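(* Let $w$ be a Veronese web of codimension $r$ on an $n$-manifold $N$. Let $\Lambda$ and $\Lambda'$ be the Liouville-Poisson structures of $T^*w(0)$ and $T^*w(\infty)$ respectively, and let $\varphi_\ell:T^*w(0)\to T^*w(\infty)$ be the vector bundle isomorphism defined by $\varphi_\ell(\beta)=\beta\circ\ell$, where $\ell:w(\infty)\to w(0)$ is the canonical isomorphism attached to $w$. Let $\Lambda_1$ be the pull-back of $\Lambda'$ by $\varphi_\ell$ (regarded as a diffeomorphism). Then $(\Lambda,\Lambda_1)$ is a Kronecker bihamiltonian structure on $M=T^*w(0)$ with $r$ factors, whose soul $\mathcal D$ is given by the fibres of the canonical fibration $T^*w(0)\to N$; therefore the quotient manifold $M/\mathcal D$ equals $N$. Moreover $w$ is the Veronese web induced by $(\Lambda,\Lambda_1)$ on $N$.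
   Context: $\mathbb K=\mathbb R$ or $\mathbb C$; all structures are real $C^\infty$ or complex holomorphic. Veronese web of codimension $r\ge1$ on $N$: a family $\{w(t)\mid t\in\mathbb K\}$ of involutive distributions of codimension $r$ such that near every point there is a curve $\gamma(t)$ of $r$-forms with $w(t)=\mathrm{Ker}\,\gamma(t)$ and, at each point $q$, a basis $\{e_{ij}\}$, $1\le i\le n_j$, $1\le j\le r$, of $T^*_qN$ with $\gamma(t)(q)=\gamma_1(t)\wedge\dots\wedge\gamma_r(t)$, $\gamma_j(t)=\sum_{i=1}^{n_j}t^{i-1}e_{ij}$. Writing $\gamma(t)=\sum_{i=0}^{n-r}t^i\gamma_i$, one sets $w(\infty)=\mathrm{Ker}\,\gamma_{n-r}$, an involutive distribution of codimension $r$ depending only on $w$. There is a unique vector bundle morphism $\ell:w(\infty)\to TN$ such that $\alpha\circ\ell=-t\,\alpha_{|w(\infty)}$ for every $t\in\mathbb K$ and every covector $\alpha$ annihilating $w(t)$; it satisfies $(\ell+tI)w(\infty)=w(t)$, and in particular it is an isomorphism from $w(\infty)$ onto $w(0)$ (the canonical isomorphism). Liouville-Poisson structure: for a foliation $\mathcal F$ of codimension $s$ on a $k$-manifold $P$, let $T^*\mathcal F$ be the total space of the dual bundle of $\mathcal F\subset TP$, $\pi:T^*\mathcal F\to P$ the projection and $\mathcal F'=\pi_*^{-1}(\mathcal F)$. On leaves of $\mathcal F'$ let $\rho(\beta)(X)=\beta(\pi_*X)$ and $\tilde\omega=-d\rho$, which is symplectic on leaves; the Liouville-Poisson structure is the dual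 Poisson structure with image $\mathcal F'$. In coordinates $(\tilde x_1,\dots,\tilde x_k,\tilde y_1,\dots,\tilde y_{k-s})$ associated to coordinates $\tilde x$ on $P$ with $\mathcal F=\{d\tilde x_{k-s+1}=\dots=d\tilde x_k=0\}$ it equals $\sum_{j=1}^{k-s}\frac{\partial}{\partial\tilde x_j}\wedge\frac{\partial}{\partial\tilde y_j}$. Kronecker elementary pair in dimension $2m-1$: for a vector space $E$ with basis $\{e_1,\dots,e_{2m}\}$ and pairwise distinct nonzero scalars $b_1,\dots,b_m$, it is the pair of images in $E/\mathbb K(\sum_je_{2j})$ of the bivectors $\sum_je_{2j-1}\wedge e_{2j}$ and $\sum_jb_j^{-1}e_{2j-1}\wedge e_{2j}$; up to isomorphism it depends only on $m$. A bihamiltonian structure is a pair of Poisson structures $\Lambda,\Lambda_1$ such that $\Lambda+\Lambda_1$ is Poisson; it is Kronecker with $r$ factors if at each point the pair of bivectors is isomorphic to a product of $r$ Kronecker elementary pairs. Its soul is the foliation $\mathcal D=\bigcap_{t\in\mathbb K}\mathrm{Im}(\Lambda+t\Lambda_1)$, where $\mathrm{Im}\,\Lambda=\Lambda(T^*M,\cdot)$, and the induced Veronese web on the quotient $\pi:M\to M/\mathcal D$ is $t\mapsto\pi_*(\mathrm{Im}(\Lambda+t\Lambda_1))$. *)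

theory Defs
  imports "HOL-Analysis.Analysis" "HOL-Library.Function_Algebras"
begin

section \<open>The ground field and linear algebra in function spaces\<close>

text \<open>
  A finite-dimensional commutative real normed division algebra with multiplicative norm is the
  field of real or of complex numbers, so a type variable of the following class ranges over
  exactly these two fields.
\<close>

class ground_field = real_normed_field + euclidean_space

instance real :: ground_field ..
instance complex :: ground_field ..

text \<open>
  Tangent vectors, covectors and coordinate tuples are all functions with values in the ground
  field, with pointwise vector space operations.
\<close>

definition fscale :: "'k::field \<Rightarrow> ('a \<Rightarrow> 'k) \<Rightarrow> 'a \<Rightarrow> 'k"
  where "fscale c v = (\<lambda>x. c * v x)"

global_interpretation fv: vector_space "fscale :: 'k::field \<Rightarrow> ('a \<Rightarrow> 'k) \<Rightarrow> 'a \<Rightarrow> 'k"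
  by unfold_locales (auto simp: fscale_def fun_eq_iff algebra_simps)

definition linear_on :: "('a \<Rightarrow> 'k) set \<Rightarrow> ('k \<Rightarrow> 'b \<Rightarrow> 'b) \<Rightarrow> (('a \<Rightarrow> 'k::field) \<Rightarrow> 'b::plus) \<Rightarrow> bool"
  where "linear_on W sc f \<longleftrightarrow>
    (\<forall>u\<in>W. \<forall>v\<in>W. f (u + v) = f u + f v) \<and> (\<forall>c. \<forall>u\<in>W. f (fscale c u) = sc c (f u))"

text \<open>
  Functionals on a subspace are extended by 0, so that equal functionals are equal functions.
\<close>

definition restr :: "('a \<Rightarrow> 'k) set \<Rightarrow> (('a \<Rightarrow> 'k) \<Rightarrow> 'b) \<Rightarrow> ('a \<Rightarrow> 'k::field) \<Rightarrow> 'b::zero"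
  where "restr W f = (\<lambda>v. if v \<in> W then f v else 0)"

definition dual :: "('a \<Rightarrow> 'k) set \<Rightarrow> (('a \<Rightarrow> 'k::field) \<Rightarrow> 'k) set"
  where "dual W = {\<alpha>. linear_on W (*) \<alpha> \<and> (\<forall>v. v \<notin> W \<longrightarrow> \<alpha> v = 0)}"

text \<open>Bivectors on a finite-dimensional space \<open>V\<close> are alternating bilinear forms on its dual.\<close>

type_synonym ('a, 'k) bivector = "(('a \<Rightarrow> 'k) \<Rightarrow> 'k) \<Rightarrow> (('a \<Rightarrow> 'k) \<Rightarrow> 'k) \<Rightarrow> 'k"

definition bivector_on :: "('a \<Rightarrow> 'k) set \<Rightarrow> ('a, 'k::field) bivector \<Rightarrow> bool"
  where "bivector_on V B \<longleftrightarrow>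
    (\<forall>\<alpha>\<in>dual V. linear_on (dual V) (*) (B \<alpha>)) \<and>
    (\<forall>\<beta>\<in>dual V. linear_on (dual V) (*) (\<lambda>\<alpha>. B \<alpha> \<beta>)) \<and>
    (\<forall>\<alpha>\<in>dual V. B \<alpha> \<alpha> = 0) \<and>
    (\<forall>\<alpha> \<beta>. \<alpha> \<notin> dual V \<or> \<beta> \<notin> dual V \<longrightarrow> B \<alpha> \<beta> = 0)"

text \<open>
  \<open>sharp_rel V B \<alpha> v\<close> says that \<open>v\<close> is the vector \<open>B(\<alpha>, _)\<close>, an element of the
  bidual of \<open>V\<close>.
\<close>

definition sharp_rel ::
    "('a \<Rightarrow> 'k) set \<Rightarrow> ('a, 'k::field) bivector \<Rightarrow> (('a \<Rightarrow> 'k) \<Rightarrow> 'k) \<Rightarrow> ('a \<Rightarrow> 'k) \<Rightarrow> bool"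
  where "sharp_rel V B \<alpha> v \<longleftrightarrow> v \<in> V \<and> (\<forall>\<beta>\<in>dual V. \<beta> v = B \<alpha> \<beta>)"

definition bivector_image :: "('a \<Rightarrow> 'k) set \<Rightarrow> ('a, 'k::field) bivector \<Rightarrow> ('a \<Rightarrow> 'k) set"
  where "bivector_image V B = {v. \<exists>\<alpha>\<in>dual V. sharp_rel V B \<alpha> v}"

definition wedge :: "nat \<Rightarrow> (nat \<Rightarrow> 'v \<Rightarrow> 'k::field) \<Rightarrow> (nat \<Rightarrow> 'v) \<Rightarrow> 'k"
  where "wedge r \<alpha> v =
    (\<Sum>\<sigma> | \<sigma> permutes {..<r}. of_int (sign \<sigma>) * (\<Prod>j<r. \<alpha> j (v (\<sigma> j))))"

text \<open>Interior-product kernel of an \<open>r\<close>-form on \<open>V\<close>, for \<open>r\<close> at least 1.\<close>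

definition form_kernel :: "nat \<Rightarrow> 'v set \<Rightarrow> ((nat \<Rightarrow> 'v) \<Rightarrow> 'k::zero) \<Rightarrow> 'v set"
  where "form_kernel r V \<omega> =
    {u\<in>V. \<forall>v. (\<forall>i<r. v i \<in> V) \<and> v 0 = u \<longrightarrow> \<omega> v = 0}"


subsection \<open>Kronecker pairs\<close>

definition coord_space :: "nat \<Rightarrow> (nat \<Rightarrow> 'k::zero) set"
  where "coord_space n = {x. \<forall>i\<ge>n. x i = 0}"

definition unit_vec :: "nat \<Rightarrow> nat \<Rightarrow> 'k::zero_neq_one"
  where "unit_vec i = (\<lambda>j. if j = i then 1 else 0)"

text \<open>
  \<open>(V, B, B1)\<close> is isomorphic to the elementary Kronecker pair of dimension \<open>2m - 1\<close>.  The
  basis of \<open>E\<close> is indexed from 0, so \<open>e(2j-1), e(2j)\<close> with \<open>1 \<le> j \<le> m\<close> become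
  \<open>unit_vec (2j), unit_vec (2j+1)\<close> with \<open>j < m\<close>.  The map \<open>Q\<close> is the composite of the
  projection of \<open>E\<close> onto its quotient by the line spanned by the sum of the \<open>e(2j)\<close> with
  an isomorphism from that quotient to \<open>V\<close>; \<open>B\<close> and \<open>B1\<close> are the images under \<open>Q\<close>.
\<close>

definition kronecker_elementary ::
    "nat \<Rightarrow> ('a \<Rightarrow> 'k) set \<Rightarrow> ('a, 'k::field) bivector \<Rightarrow> ('a, 'k) bivector \<Rightarrow> bool"
  where "kronecker_elementary m V B B1 \<longleftrightarrow> m \<ge> 1 \<and>
    bivector_on V B \<and> bivector_on V B1 \<and>
    (\<exists>(b :: nat \<Rightarrow> 'k) (Q :: (nat \<Rightarrow> 'k) \<Rightarrow> 'a \<Rightarrow> 'k).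
       inj_on b {..<m} \<and> (\<forall>j<m. b j \<noteq> 0) \<and>
       linear_on (coord_space (2 * m)) fscale Q \<and>
       Q ` coord_space (2 * m) = V \<and>
       {x \<in> coord_space (2 * m). Q x = 0} = fv.span {\<Sum>j<m. unit_vec (2 * j + 1)} \<and>
       (\<forall>\<alpha>\<in>dual V. \<forall>\<beta>\<in>dual V.
          B \<alpha> \<beta> = (\<Sum>j<m.
            \<alpha> (Q (unit_vec (2 * j))) * \<beta> (Q (unit_vec (2 * j + 1)))
            - \<alpha> (Q (unit_vec (2 * j + 1))) * \<beta> (Q (unit_vec (2 * j)))) \<and>
          B1 \<alpha> \<beta> = (\<Sum>j<m. inverse (b j) *
            (\<alpha> (Q (unit_vec (2 * j))) * \<beta> (Q (unit_vec (2 * j + 1)))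
            - \<alpha> (Q (unit_vec (2 * j + 1))) * \<beta> (Q (unit_vec (2 * j)))))))"

text \<open>The product of pairs is expressed as an internal direct sum of \<open>T\<close>.\<close>

definition kronecker_product ::
    "nat \<Rightarrow> ('a \<Rightarrow> 'k) set \<Rightarrow> ('a, 'k::field) bivector \<Rightarrow> ('a, 'k) bivector \<Rightarrow> bool"
  where "kronecker_product r T B B1 \<longleftrightarrow>
    (\<exists>m V C C1.
       (\<forall>j<r. fv.subspace (V j) \<and> V j \<subseteq> T \<and> kronecker_elementary (m j) (V j) (C j) (C1 j)) \<and>
       (\<forall>v\<in>T. \<exists>!x. (\<forall>j<r. x j \<in> V j) \<and> (\<forall>j\<ge>r. x j = 0) \<and> v = (\<Sum>j<r. x j)) \<and>
       (\<forall>\<alpha>\<in>dual T. \<forall>\<beta>\<in>dual T.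
          B \<alpha> \<beta> = (\<Sum>j<r. C j (restr (V j) \<alpha>) (restr (V j) \<beta>)) \<and>
          B1 \<alpha> \<beta> = (\<Sum>j<r. C1 j (restr (V j) \<alpha>) (restr (V j) \<beta>))))"


section \<open>Manifolds over the ground field\<close>

text \<open>
  Coordinates are functions on \<open>nat\<close>; on \<open>coord_space n\<close> the product topology is the usual
  topology of affine \<open>n\<close>-space.  Since derivatives are taken over the ground field,
  \<open>smooth_coord\<close> means infinitely differentiable over the reals, and holomorphic over the
  complex numbers.  Only relatively open subsets \<open>V\<close> of \<open>coord_space n\<close> are used.
\<close>

definition pderivative :: "nat \<Rightarrow> ((nat \<Rightarrow> 'k::real_normed_field) \<Rightarrow> 'k) \<Rightarrow> (nat \<Rightarrow> 'k) \<Rightarrow> 'k"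
  where "pderivative i f x = deriv (\<lambda>t. f (x(i := t))) (x i)"

primrec Ck_coord ::
    "nat \<Rightarrow> nat \<Rightarrow> (nat \<Rightarrow> 'k) set \<Rightarrow> ((nat \<Rightarrow> 'k::real_normed_field) \<Rightarrow> 'k) \<Rightarrow> bool"
  where
    "Ck_coord n 0 V f \<longleftrightarrow> continuous_on V f"
  | "Ck_coord n (Suc k) V f \<longleftrightarrow> continuous_on V f \<and>
       (\<forall>i<n. (\<forall>x\<in>V. (\<lambda>t. f (x(i := t))) field_differentiable at (x i)) \<and>
              Ck_coord n k V (pderivative i f))"

definition smooth_coord ::
    "nat \<Rightarrow> (nat \<Rightarrow> 'k) set \<Rightarrow> ((nat \<Rightarrow> 'k::real_normed_field) \<Rightarrow> 'k) \<Rightarrow> bool"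
  where "smooth_coord n V f \<longleftrightarrow> (\<forall>k. Ck_coord n k V f)"

record ('p, 'k) mfd =
  mdim :: nat
  atlas :: "('p set \<times> ('p \<Rightarrow> nat \<Rightarrow> 'k)) set"

definition points :: "('p, 'k) mfd \<Rightarrow> 'p set"
  where "points M = \<Union> (fst ` atlas M)"

definition mtop :: "('p, 'k::ground_field) mfd \<Rightarrow> 'p topology"
  where "mtop M = topology (\<lambda>W. W \<subseteq> points M \<and>
    (\<forall>(U, \<phi>)\<in>atlas M. openin (top_of_set (coord_space (mdim M))) (\<phi> ` (W \<inter> U))))"

definition manifold :: "('p, 'k::ground_field) mfd \<Rightarrow> bool"
  where "manifold M \<longleftrightarrow>
    (\<forall>(U, \<phi>)\<in>atlas M. inj_on \<phi> U \<and>
       openin (top_of_set (coord_space (mdim M))) (\<phi> ` U)) \<and>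
    (\<forall>(U, \<phi>)\<in>atlas M. \<forall>(V, \<psi>)\<in>atlas M.
       openin (top_of_set (coord_space (mdim M))) (\<phi> ` (U \<inter> V)) \<and>
       (\<forall>i<mdim M. smooth_coord (mdim M) (\<phi> ` (U \<inter> V)) (\<lambda>x. \<psi> (inv_into U \<phi> x) i))) \<and>
    Hausdorff_space (mtop M) \<and> second_countable (mtop M)"

definition smooth_fun :: "('p, 'k::ground_field) mfd \<Rightarrow> 'p set \<Rightarrow> ('p \<Rightarrow> 'k) \<Rightarrow> bool"
  where "smooth_fun M W f \<longleftrightarrow> openin (mtop M) W \<and>
    (\<forall>(U, \<phi>)\<in>atlas M. smooth_coord (mdim M) (\<phi> ` (W \<inter> U)) (f \<circ> inv_into U \<phi>))"

definition smooth_near :: "('p, 'k::ground_field) mfd \<Rightarrow> 'p \<Rightarrow> ('p \<Rightarrow> 'k) \<Rightarrow> bool"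
  where "smooth_near M p f \<longleftrightarrow> (\<exists>W. p \<in> W \<and> smooth_fun M W f)"

definition smooth_map ::
    "('p, 'k::ground_field) mfd \<Rightarrow> ('q, 'k) mfd \<Rightarrow> ('p \<Rightarrow> 'q) \<Rightarrow> bool"
  where "smooth_map M M' F \<longleftrightarrow> F ` points M \<subseteq> points M' \<and>
    (\<forall>W g. smooth_fun M' W g \<longrightarrow> smooth_fun M {p \<in> points M. F p \<in> W} (g \<circ> F))"


subsection \<open>Tangent vectors, vector fields and forms\<close>

text \<open>
  Tangent vectors are directional derivative operators on the functions smooth near \<open>p\<close>; they
  are given the value 0 on all other functions.
\<close>

type_synonym ('p, 'k) tvec = "('p \<Rightarrow> 'k) \<Rightarrow> 'k"
type_synonym ('p, 'k) covec = "('p, 'k) tvec \<Rightarrow> 'k"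

definition tangent_space :: "('p, 'k::ground_field) mfd \<Rightarrow> 'p \<Rightarrow> ('p, 'k) tvec set"
  where "tangent_space M p = {v. \<exists>(U, \<phi>)\<in>atlas M. p \<in> U \<and>
    (\<exists>a. v = (\<lambda>f. if smooth_near M p f
                   then \<Sum>i<mdim M. a i * pderivative i (f \<circ> inv_into U \<phi>) (\<phi> p)
                   else 0))}"

abbreviation cotangent_space :: "('p, 'k::ground_field) mfd \<Rightarrow> 'p \<Rightarrow> ('p, 'k) covec set"
  where "cotangent_space M p \<equiv> dual (tangent_space M p)"

definition differential :: "('p, 'k::ground_field) mfd \<Rightarrow> ('p \<Rightarrow> 'k) \<Rightarrow> 'p \<Rightarrow> ('p, 'k) covec"
  where "differential M f p = restr (tangent_space M p) (\<lambda>v. v f)"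

definition push ::
    "('q, 'k::ground_field) mfd \<Rightarrow> ('p \<Rightarrow> 'q) \<Rightarrow> 'p \<Rightarrow> ('p, 'k) tvec \<Rightarrow> ('q, 'k) tvec"
  where "push M' F p v = (\<lambda>g. if smooth_near M' (F p) g then v (g \<circ> F) else 0)"

definition vector_field ::
    "('p, 'k::ground_field) mfd \<Rightarrow> 'p set \<Rightarrow> ('p \<Rightarrow> ('p, 'k) tvec) \<Rightarrow> bool"
  where "vector_field M U X \<longleftrightarrow> openin (mtop M) U \<and>
    (\<forall>p\<in>U. X p \<in> tangent_space M p) \<and>
    (\<forall>W f. W \<subseteq> U \<and> smooth_fun M W f \<longrightarrow> smooth_fun M W (\<lambda>p. X p f))"

definition lie_bracket ::
    "('p, 'k::ground_field) mfd \<Rightarrow> ('p \<Rightarrow> ('p, 'k) tvec) \<Rightarrow> ('p \<Rightarrow> ('p, 'k) tvec)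
      \<Rightarrow> 'p \<Rightarrow> ('p, 'k) tvec"
  where "lie_bracket M X Y p =
    (\<lambda>f. if smooth_near M p f then X p (\<lambda>x. Y x f) - Y p (\<lambda>x. X x f) else 0)"

definition smooth_form ::
    "('p, 'k::ground_field) mfd \<Rightarrow> nat \<Rightarrow> 'p set \<Rightarrow> ('p \<Rightarrow> (nat \<Rightarrow> ('p, 'k) tvec) \<Rightarrow> 'k) \<Rightarrow> bool"
  where "smooth_form M r U \<omega> \<longleftrightarrow> openin (mtop M) U \<and>
    (\<forall>W X. W \<subseteq> U \<and> openin (mtop M) W \<and> (\<forall>i<r. vector_field M W (X i)) \<longrightarrow>
       smooth_fun M W (\<lambda>p. \<omega> p (\<lambda>i. X i p)))"


subsection \<open>Foliations\<close>

text \<open>Foliations are identified with their tangent distributions, which are involutive.\<close>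

type_synonym ('p, 'k) distrib = "'p \<Rightarrow> ('p, 'k) tvec set"

definition distribution ::
    "('p, 'k::ground_field) mfd \<Rightarrow> nat \<Rightarrow> ('p, 'k) distrib \<Rightarrow> bool"
  where "distribution M s D \<longleftrightarrow>
    (\<forall>p\<in>points M. fv.subspace (D p) \<and> D p \<subseteq> tangent_space M p \<and> fv.dim (D p) + s = mdim M) \<and>
    (\<forall>p\<in>points M. \<exists>U X. p \<in> U \<and> (\<forall>i<mdim M - s. vector_field M U (X i)) \<and>
       openin (mtop M) U \<and> (\<forall>x\<in>U. fv.span ((\<lambda>i. X i x) ` {..<mdim M - s}) = D x))"

definition involutive :: "('p, 'k::ground_field) mfd \<Rightarrow> ('p, 'k) distrib \<Rightarrow> bool"
  where "involutive M D \<longleftrightarrow>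
    (\<forall>U X Y. vector_field M U X \<and> vector_field M U Y \<and> (\<forall>p\<in>U. X p \<in> D p \<and> Y p \<in> D p) \<longrightarrow>
       (\<forall>p\<in>U. lie_bracket M X Y p \<in> D p))"

definition foliation :: "('p, 'k::ground_field) mfd \<Rightarrow> nat \<Rightarrow> ('p, 'k) distrib \<Rightarrow> bool"
  where "foliation M s D \<longleftrightarrow> distribution M s D \<and> involutive M D"

text \<open>
  The leaf through \<open>p\<close> consists of the points that can be joined to \<open>p\<close> by a finite chain of
  curves tangent to \<open>D\<close>.  The parameter of a curve runs through a connected open subset of
  the ground field.
\<close>

definition tangent_curve ::
    "('p, 'k::ground_field) mfd \<Rightarrow> ('p, 'k) distrib \<Rightarrow> 'k set \<Rightarrow> ('k \<Rightarrow> 'p) \<Rightarrow> bool"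
  where "tangent_curve M D J c \<longleftrightarrow> open J \<and> connected J \<and>
    continuous_map (top_of_set J) (mtop M) c \<and>
    (\<forall>s\<in>J. \<exists>v\<in>D (c s). \<forall>f. smooth_near M (c s) f \<longrightarrow> ((f \<circ> c) has_field_derivative v f) (at s))"

definition leaf :: "('p, 'k::ground_field) mfd \<Rightarrow> ('p, 'k) distrib \<Rightarrow> 'p \<Rightarrow> 'p set"
  where "leaf M D p = {x. (p, x) \<in> {(y, z). \<exists>J c. tangent_curve M D J c \<and> y \<in> c ` J \<and> z \<in> c ` J}\<^sup>*}"

text \<open>
  \<open>N\<close>, with projection \<open>\<pi>\<close>, is the quotient manifold \<open>M/D\<close>: the leaves of \<open>D\<close> are the
  fibres of the surjective submersion \<open>\<pi>\<close>.
\<close>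

definition quotient_manifold ::
    "('p, 'k::ground_field) mfd \<Rightarrow> ('p, 'k) distrib \<Rightarrow> ('q, 'k) mfd \<Rightarrow> ('p \<Rightarrow> 'q) \<Rightarrow> bool"
  where "quotient_manifold M D N \<pi> \<longleftrightarrow> smooth_map M N \<pi> \<and> \<pi> ` points M = points N \<and>
    (\<forall>p\<in>points M. push N \<pi> p ` tangent_space M p = tangent_space N (\<pi> p)) \<and>
    (\<forall>p\<in>points M. leaf M D p = {x \<in> points M. \<pi> x = \<pi> p})"


section \<open>Bihamiltonian structures\<close>

type_synonym ('p, 'k) bivector_field = "'p \<Rightarrow> ('p \<Rightarrow> 'k, 'k) bivector"

definition poisson_bracket ::
    "('p, 'k::ground_field) mfd \<Rightarrow> ('p, 'k) bivector_field \<Rightarrow> ('p \<Rightarrow> 'k) \<Rightarrow> ('p \<Rightarrow> 'k) \<Rightarrow> 'p \<Rightarrow> 'k"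
  where "poisson_bracket M \<Lambda> f g p = \<Lambda> p (differential M f p) (differential M g p)"

definition poisson_structure ::
    "('p, 'k::ground_field) mfd \<Rightarrow> ('p, 'k) bivector_field \<Rightarrow> bool"
  where "poisson_structure M \<Lambda> \<longleftrightarrow> manifold M \<and>
    (\<forall>p\<in>points M. bivector_on (tangent_space M p) (\<Lambda> p)) \<and>
    (\<forall>W f g. smooth_fun M W f \<and> smooth_fun M W g \<longrightarrow> smooth_fun M W (poisson_bracket M \<Lambda> f g)) \<and>
    (\<forall>W f g h. smooth_fun M W f \<and> smooth_fun M W g \<and> smooth_fun M W h \<longrightarrow>
       (\<forall>p\<in>W. poisson_bracket M \<Lambda> (poisson_bracket M \<Lambda> f g) h p
             + poisson_bracket M \<Lambda> (poisson_bracket M \<Lambda> g h) f p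
             + poisson_bracket M \<Lambda> (poisson_bracket M \<Lambda> h f) g p = 0))"

definition pencil ::
    "('p, 'k::ground_field) bivector_field \<Rightarrow> ('p, 'k) bivector_field \<Rightarrow> 'k \<Rightarrow> ('p, 'k) bivector_field"
  where "pencil \<Lambda> \<Lambda>\<^sub>1 t = (\<lambda>p \<alpha> \<beta>. \<Lambda> p \<alpha> \<beta> + t * \<Lambda>\<^sub>1 p \<alpha> \<beta>)"

definition bihamiltonian ::
    "('p, 'k::ground_field) mfd \<Rightarrow> ('p, 'k) bivector_field \<Rightarrow> ('p, 'k) bivector_field \<Rightarrow> bool"
  where "bihamiltonian M \<Lambda> \<Lambda>\<^sub>1 \<longleftrightarrow>
    poisson_structure M \<Lambda> \<and> poisson_structure M \<Lambda>\<^sub>1 \<and> poisson_structure M (pencil \<Lambda> \<Lambda>\<^sub>1 1)"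

definition kronecker_bihamiltonian ::
    "('p, 'k::ground_field) mfd \<Rightarrow> nat \<Rightarrow> ('p, 'k) bivector_field \<Rightarrow> ('p, 'k) bivector_field \<Rightarrow> bool"
  where "kronecker_bihamiltonian M r \<Lambda> \<Lambda>\<^sub>1 \<longleftrightarrow> bihamiltonian M \<Lambda> \<Lambda>\<^sub>1 \<and>
    (\<forall>p\<in>points M. kronecker_product r (tangent_space M p) (\<Lambda> p) (\<Lambda>\<^sub>1 p))"

definition soul ::
    "('p, 'k::ground_field) mfd \<Rightarrow> ('p, 'k) bivector_field \<Rightarrow> ('p, 'k) bivector_field \<Rightarrow> ('p, 'k) distrib"
  where "soul M \<Lambda> \<Lambda>\<^sub>1 p = (\<Inter>t. bivector_image (tangent_space M p) (pencil \<Lambda> \<Lambda>\<^sub>1 t p))"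

text \<open>\<open>w\<close> is the Veronese web induced on \<open>N\<close>, seen as the quotient of \<open>M\<close> by the soul.\<close>

definition induced_web ::
    "('p, 'k::ground_field) mfd \<Rightarrow> ('p, 'k) bivector_field \<Rightarrow> ('p, 'k) bivector_field
      \<Rightarrow> ('q, 'k) mfd \<Rightarrow> ('p \<Rightarrow> 'q) \<Rightarrow> ('k \<Rightarrow> ('q, 'k) distrib) \<Rightarrow> bool"
  where "induced_web M \<Lambda> \<Lambda>\<^sub>1 N \<pi> w \<longleftrightarrow> quotient_manifold M (soul M \<Lambda> \<Lambda>\<^sub>1) N \<pi> \<and>
    (\<forall>t. \<forall>p\<in>points M.
       w t (\<pi> p) = push N \<pi> p ` bivector_image (tangent_space M p) (pencil \<Lambda> \<Lambda>\<^sub>1 t p))"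

text \<open>Pull-back of a bivector field by a diffeomorphism \<open>F\<close> from \<open>M\<close> to \<open>M'\<close>.\<close>

definition pullback_bivector ::
    "('p, 'k::ground_field) mfd \<Rightarrow> ('q, 'k) mfd \<Rightarrow> ('p \<Rightarrow> 'q) \<Rightarrow> ('q, 'k) bivector_field
      \<Rightarrow> ('p, 'k) bivector_field"
  where "pullback_bivector M M' F \<Lambda>' p \<alpha> \<beta> =
    (if \<alpha> \<in> cotangent_space M p \<and> \<beta> \<in> cotangent_space M p
     then \<Lambda>' (F p)
       (restr (tangent_space M' (F p)) (\<alpha> \<circ> inv_into (tangent_space M p) (push M' F p)))
       (restr (tangent_space M' (F p)) (\<beta> \<circ> inv_into (tangent_space M p) (push M' F p)))
     else 0)"


section \<open>The Liouville-Poisson structure\<close>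

text \<open>
  The total space of the dual bundle of a foliation \<open>F\<close> of codimension \<open>s\<close> on \<open>P\<close>.  Its
  points are the pairs of a point \<open>q\<close> and a functional on \<open>F q\<close>.  A chart of \<open>P\<close> with
  a local frame \<open>X\<close> of \<open>F\<close> gives a chart: the coordinates of \<open>q\<close> followed by the values of
  the functional on the frame.
\<close>

type_synonym ('p, 'k) cot = "'p \<times> ('p, 'k) covec"

definition leaf_cotangent ::
    "('p, 'k::ground_field) mfd \<Rightarrow> nat \<Rightarrow> ('p, 'k) distrib \<Rightarrow> (('p, 'k) cot, 'k) mfd"
  where "leaf_cotangent P s F = \<lparr>
    mdim = mdim P + (mdim P - s),
    atlas = {(D, \<Phi>). \<exists>U \<phi> V X. (U, \<phi>) \<in> atlas P \<and> V \<subseteq> U \<and> openin (mtop P) V \<and>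
      (\<forall>i<mdim P - s. vector_field P V (X i)) \<and>
      (\<forall>q\<in>V. fv.span ((\<lambda>i. X i q) ` {..<mdim P - s}) = F q) \<and>
      D = {p. fst p \<in> V \<and> snd p \<in> dual (F (fst p))} \<and>
      \<Phi> = (\<lambda>p i. if i < mdim P then \<phi> (fst p) i
                 else if i < mdim P + (mdim P - s) then snd p (X (i - mdim P) (fst p))
                 else 0)} \<rparr>"

definition lifted_foliation ::
    "('p, 'k::ground_field) mfd \<Rightarrow> nat \<Rightarrow> ('p, 'k) distrib \<Rightarrow> (('p, 'k) cot, 'k) distrib"
  where "lifted_foliation P s F p =
    {v \<in> tangent_space (leaf_cotangent P s F) p. push P fst p v \<in> F (fst p)}"

definition liouville_form ::
    "('p, 'k::ground_field) mfd \<Rightarrow> ('p, 'k) cot \<Rightarrow> (('p, 'k) cot, 'k) tvec \<Rightarrow> 'k"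
  where "liouville_form P p v = snd p (push P fst p v)"

text \<open>
  Minus the leafwise exterior derivative of the Liouville form, evaluated on two vectors at
  \<open>p\<close> by means of arbitrary local sections of the lifted foliation extending them.
\<close>

definition liouville_symplectic ::
    "('p, 'k::ground_field) mfd \<Rightarrow> nat \<Rightarrow> ('p, 'k) distrib \<Rightarrow> ('p, 'k) cot
      \<Rightarrow> (('p, 'k) cot, 'k) tvec \<Rightarrow> (('p, 'k) cot, 'k) tvec \<Rightarrow> 'k"
  where "liouville_symplectic P s F p u v = (THE c.
    \<forall>U X Y. p \<in> U \<and> X p = u \<and> Y p = v \<and>
      vector_field (leaf_cotangent P s F) U X \<and> vector_field (leaf_cotangent P s F) U Y \<and>
      (\<forall>x\<in>U. X x \<in> lifted_foliation P s F x \<and> Y x \<in> lifted_foliation P s F x) \<longrightarrow>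
      c = - (X p (\<lambda>x. liouville_form P x (Y x)) - Y p (\<lambda>x. liouville_form P x (X x))
             - liouville_form P p (lie_bracket (leaf_cotangent P s F) X Y p)))"

text \<open>
  The dual Poisson structure: its image is the lifted foliation, and the sharp map carries
  the bivector to the leafwise symplectic form.  With this sign it is the sum of the
  \<open>\<partial>/\<partial>x(j) \<and> \<partial>/\<partial>y(j)\<close> in foliated coordinates.
\<close>

definition liouville_poisson ::
    "('p, 'k::ground_field) mfd \<Rightarrow> nat \<Rightarrow> ('p, 'k) distrib \<Rightarrow> (('p, 'k) cot, 'k) bivector_field"
  where "liouville_poisson P s F p = (THE B.
    let T = tangent_space (leaf_cotangent P s F) p in
      bivector_on T B \<and> bivector_image T B = lifted_foliation P s F p \<and>
      (\<forall>\<alpha>\<in>dual T. \<forall>\<beta>\<in>dual T. \<forall>u v. sharp_rel T B \<alpha> u \<and> sharp_rel T B \<beta> v \<longrightarrow>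
         liouville_symplectic P s F p u v = B \<alpha> \<beta>))"


section \<open>Veronese webs\<close>

text \<open>
  On \<open>U\<close> the web is the kernel of the curve \<open>\<gamma>\<close> of \<open>r\<close>-forms.  The covectors of the basis
  are indexed from 0, so \<open>e i j\<close> carries the power \<open>t ^ i\<close>.
\<close>

definition web_form ::
    "('p, 'k::ground_field) mfd \<Rightarrow> nat \<Rightarrow> ('k \<Rightarrow> ('p, 'k) distrib) \<Rightarrow> 'p set
      \<Rightarrow> ('k \<Rightarrow> 'p \<Rightarrow> (nat \<Rightarrow> ('p, 'k) tvec) \<Rightarrow> 'k) \<Rightarrow> bool"
  where "web_form N r w U \<gamma> \<longleftrightarrow> openin (mtop N) U \<and>
    (\<forall>t. smooth_form N r U (\<gamma> t) \<and> (\<forall>q\<in>U. w t q = form_kernel r (tangent_space N q) (\<gamma> t q))) \<and>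
    (\<forall>q\<in>U. \<exists>(m :: nat \<Rightarrow> nat) (e :: nat \<Rightarrow> nat \<Rightarrow> ('p, 'k) covec).
       let I = {(i, j). j < r \<and> i < m j} in
         inj_on (\<lambda>(i, j). e i j) I \<and>
         fv.independent ((\<lambda>(i, j). e i j) ` I) \<and>
         fv.span ((\<lambda>(i, j). e i j) ` I) = cotangent_space N q \<and>
         (\<forall>t v. (\<forall>i<r. v i \<in> tangent_space N q) \<longrightarrow>
            \<gamma> t q v = wedge r (\<lambda>j. \<Sum>i<m j. fscale (t ^ i) (e i j)) v))"

definition veronese_web ::
    "('p, 'k::ground_field) mfd \<Rightarrow> nat \<Rightarrow> ('k \<Rightarrow> ('p, 'k) distrib) \<Rightarrow> bool"
  where "veronese_web N r w \<longleftrightarrow> r \<ge> 1 \<and>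
    (\<forall>t. foliation N r (w t)) \<and>
    (\<forall>q\<in>points N. \<exists>U \<gamma>. q \<in> U \<and> web_form N r w U \<gamma>)"

text \<open>
  The kernel of the leading coefficient \<open>c (n - r)\<close> of \<open>\<gamma>\<close>, which does not depend on the
  choice of \<open>\<gamma>\<close>.
\<close>

definition web_infinity ::
    "('p, 'k::ground_field) mfd \<Rightarrow> nat \<Rightarrow> ('k \<Rightarrow> ('p, 'k) distrib) \<Rightarrow> ('p, 'k) distrib"
  where "web_infinity N r w q = {u. \<exists>U \<gamma> c. q \<in> U \<and> web_form N r w U \<gamma> \<and>
    (\<forall>t v. (\<forall>i<r. v i \<in> tangent_space N q) \<longrightarrow>
       \<gamma> t q v = (\<Sum>i\<le>mdim N - r. t ^ i * c i v)) \<and>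
    u \<in> form_kernel r (tangent_space N q) (c (mdim N - r))}"

definition bundle_morphism_TN ::
    "('p, 'k::ground_field) mfd \<Rightarrow> ('p, 'k) distrib \<Rightarrow> ('p \<Rightarrow> ('p, 'k) tvec \<Rightarrow> ('p, 'k) tvec) \<Rightarrow> bool"
  where "bundle_morphism_TN N D L \<longleftrightarrow>
    (\<forall>q\<in>points N. linear_on (D q) fscale (L q) \<and> L q ` D q \<subseteq> tangent_space N q) \<and>
    (\<forall>q v. q \<notin> points N \<or> v \<notin> D q \<longrightarrow> L q v = 0) \<and>
    (\<forall>U X. vector_field N U X \<and> (\<forall>q\<in>U. X q \<in> D q) \<longrightarrow> vector_field N U (\<lambda>q. L q (X q)))"

definition canonical_iso ::
    "('p, 'k::ground_field) mfd \<Rightarrow> nat \<Rightarrow> ('k \<Rightarrow> ('p, 'k) distrib)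
      \<Rightarrow> 'p \<Rightarrow> ('p, 'k) tvec \<Rightarrow> ('p, 'k) tvec"
  where "canonical_iso N r w = (THE L. bundle_morphism_TN N (web_infinity N r w) L \<and>
    (\<forall>q\<in>points N. \<forall>t. \<forall>\<alpha>\<in>cotangent_space N q. (\<forall>v\<in>w t q. \<alpha> v = 0) \<longrightarrow>
       (\<forall>v\<in>web_infinity N r w q. \<alpha> (L q v) = - t * \<alpha> v)))"

definition dual_iso ::
    "('p, 'k::ground_field) mfd \<Rightarrow> nat \<Rightarrow> ('k \<Rightarrow> ('p, 'k) distrib) \<Rightarrow> ('p, 'k) cot \<Rightarrow> ('p, 'k) cot"
  where "dual_iso N r w p =
    (fst p, restr (web_infinity N r w (fst p)) (snd p \<circ> canonical_iso N r w (fst p)))"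

end

theory Submission
  imports Defs "HOL-Computational_Algebra.Polynomial"
begin

text \<open>
Locally \<open>w(\<infinity>)\<close> has a frame \<open>X\<^sub>a\<close>, and \<open>X\<^sub>a(t) = (\<ell> + tI) X\<^sub>a\<close> frames \<open>w(t)\<close>. An involutive frame determines a
Poisson bivector on the total space of the dual bundle, by means of the brackets of fibre coordinates
and functions on the base. For \<open>\<Lambda> + t\<Lambda>\<^sub>1\<close> this is the bivector of the frame \<open>X\<^sub>a(t)\<close>: the involutivity of
all \<open>w(t)\<close> makes its structure functions affine in \<open>t\<close>. Hence \<open>\<Lambda> + t\<Lambda>\<^sub>1\<close> is Poisson and its image is the
preimage of \<open>w(t)\<close>, which yields the soul and the web. At a point, a shift of the horizontal basis
removes the purely vertical terms of both bivectors, and Lagrange interpolation turns what is left into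
Kronecker elementary pairs.
\<close>

section \<open>Calculus on coordinate spaces\<close>

text \<open>In general no coordinates are foliated for all w(t) at once, so the coordinate formula
  for Liouville-Poisson structures cannot treat the pencil. Both structures are computed in frames
  that need not commute, at the price of vertical terms built from the structure functions. If X_a =
  ell(Y_a), with Y_a a frame of w(\<infinity>), the fibre coordinates on T*w(0) given by the X_a are
  the pull-backs of those on T*w(\<infinity>) given by the Y_a; so the dual isomorphism is the
  identity in adapted charts, and pulling back merely replaces X by Y. The structure functions are
  affine for this reason: [X_a(t), X_b(t)] = A + tB + t^2 C lies in w(t) for every t. At t = 0, A is
  a combination of the X_c; removing the same combination of the X_c(t) and dividing by t leaves a
  linear pencil that lies in w(t) for nonzero t, hence for all t, and is therefore a combination of
  the X_c(t) with coefficients free of t. The isomorphism is handled as the relation "x + tu lies in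
  w(t) for all t", which means x = ell(u) and mentions w alone. Its smoothness comes from the
  annihilators of w(1), ..., w(n), because these n subspaces intersect in 0.\<close>

abbreviation open_coord :: "nat => (nat => 'k::real_normed_field) set => bool"
 where "open_coord n V \<equiv> openin (top_of_set (coord_space n)) V"

definition cube :: "nat => (nat => 'k::real_normed_field) => real => (nat => 'k) set"
 where "cube n x e = {y \<in> coord_space n. ALL i<n. dist (y i) (x i) < e}"

lemma cube_mono: "d \<le> e ==> cube n x d \<subseteq> cube n x e"
 by (auto simp: cube_def)

lemma open_coord_subset_cube:
 assumes V: "open_coord n V" and x: "x \<in> V"
 shows "EX e>0. cube n x e \<subseteq> V"
proof -
 have *: "x \<in> coord_space n"
  using openin_imp_subset[OF V] x by blast
 obtain T where T: "open T" "V = coord_space n \<inter> T"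
  using V unfolding openin_open by blast
 have "openin (product_topology (%i. euclidean) UNIV) T"
  using T(1) by (simp add: open_fun_def)
 hence "EX X. x \<in> (\<Pi>\<^sub>E i\<in>UNIV. X i) \<and> (ALL i. openin euclidean (X i)) \<and>
   finite {i. X i \<noteq> topspace euclidean} \<and> (\<Pi>\<^sub>E i\<in>UNIV. X i) \<subseteq> T"
  by (rule product_topology_open_contains_basis) (use x T(2) in blast)
 then obtain X where X: "x \<in> (\<Pi>\<^sub>E i\<in>UNIV. X i)" "ALL i. openin euclidean (X i)" "(\<Pi>\<^sub>E i\<in>UNIV. X i) \<subseteq> T"
  by (elim exE conjE) (rule that)
 have "EX d>0. ball (x i) d \<subseteq> X i" for i
 proof -
  have "x i \<in> X i" using X(1) by (simp add: PiE_iff)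
  moreover have "open (X i)" using X(2) by simp
  ultimately show ?thesis by (simp add: open_contains_ball)
 qed
 then obtain d where d: "!!i. d i > 0" "!!i. ball (x i) (d i) \<subseteq> X i"
  by metis
 \<comment> \<open>From index \<open>n\<close> on, both points have the coordinate 0, so only
   \<open>n\<close> of the radii count. The 1 keeps the minimum defined for
   \<open>n = 0\<close>.\<close>
 define e where "e = Min (insert 1 (d ` {..<n}))"
 have e: "e > 0" "!!i. i < n ==> e \<le> d i"
  using d(1) by (auto simp: e_def)
 have "cube n x e \<subseteq> V"
 proof
  fix y assume y: "y \<in> cube n x e"
  have "y i \<in> X i" for i
  proof (cases "i < n")
   case True
   hence "dist (x i) (y i) < d i"
    using y e(2)[of i] by (auto simp: cube_def dist_commute)
   thus ?thesis using d(2)[of i] by auto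
  next
   case False
   hence "y i = x i" using y * by (auto simp: cube_def coord_space_def)
   thus ?thesis using d(1)[of i] d(2)[of i] by auto
  qed
  hence "y \<in> T" using X(3) by (auto simp: PiE_iff)
  thus "y \<in> V" using y T(2) by (simp add: cube_def)
 qed
 with e(1) show ?thesis by blast
qed

lemma open_coord_subset: "open_coord n V ==> V \<subseteq> coord_space n"
 by (rule openin_imp_subset)

lemma open_coordD:
 assumes "open_coord n V" "x \<in> V"
 shows "x \<in> coord_space n" "EX e>0. cube n x e \<subseteq> V"
 using open_coord_subset[OF assms(1)] assms(2) open_coord_subset_cube[OF assms] by blast+

lemma coord_space_upd: "x \<in> coord_space n ==> i < n ==> x(i := t) \<in> coord_space n"
 by (auto simp: coord_space_def)

lemma eventually_upd_in:
 assumes "open_coord n V" "x \<in> V" "i < n"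
 shows "\<forall>\<^sub>F t in nhds (x i). x(i := t) \<in> V"
proof -
 obtain e where e: "e > 0" "cube n x e \<subseteq> V" and x: "x \<in> coord_space n"
  using open_coordD[OF assms(1,2)] by blast
 have "\<forall>\<^sub>F t in nhds (x i). dist t (x i) < e"
  unfolding eventually_nhds_metric using e(1) by blast
 thus ?thesis
 proof eventually_elim
  case (elim t)
  hence "x(i := t) \<in> cube n x e"
   using e(1) coord_space_upd[OF x assms(3)] by (auto simp: cube_def)
  thus ?case using e(2) by blast
 qed
qed

lemma continuous_on_cube:
 assumes "open_coord n V" "continuous_on V f" "x \<in> V" "e > 0"
 shows "EX d>0. cube n x d \<subseteq> V \<and> (ALL y:cube n x d. dist (f y) (f x) < e)"
proof -
 have "openin (top_of_set V) (V \<inter> f -` ball (f x) e)"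
  by (rule continuous_openin_preimage_gen[OF assms(2) open_ball])
 hence "open_coord n (V \<inter> f -` ball (f x) e)"
  using assms(1) by (rule openin_trans)
 moreover have "x \<in> V \<inter> f -` ball (f x) e" using assms by auto
 ultimately obtain d where "d > 0" "cube n x d \<subseteq> V \<inter> f -` ball (f x) e"
  by (blast dest: open_coordD(2))
 thus ?thesis by (intro exI[of _ d]) (auto simp: subset_iff dist_commute)
qed

section \<open>Approximation by partial derivatives and the chain rule\<close>

lemma has_pderivative:
 assumes "Ck_coord n (Suc k) V f" "x \<in> V" "i < n"
 shows "((%t. f (x(i := t))) has_field_derivative pderivative i f x) (at (x i))"
 using assms unfolding pderivative_def by (auto intro: DERIV_deriv_iff_field_differentiable[THEN iffD2])

text \<open>The mean value inequality for \<open>g t - c * t\<close>. It uses only the real segment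
  from \<open>a\<close> to \<open>b\<close>, so it serves both ground fields.\<close>

lemma increment_approx:
 fixes g :: "'k::real_normed_field => 'k"
 assumes "!!t. t \<in> closed_segment a b ==> (g has_field_derivative g' t) (at t)"
  and "!!t. t \<in> closed_segment a b ==> norm (g' t - c) \<le> e"
 shows "norm (g b - g a - c * (b - a)) \<le> e * norm (b - a)"
proof -
 have "norm ((g b - c * b) - (g a - c * a)) \<le> e * norm (b - a)"
 proof (rule differentiable_bound[where S = "closed_segment a b" and f' = "%t h. (g' t - c) * h"])
  fix t assume t: "t \<in> closed_segment a b"
  have "((%t. g t - c * t) has_field_derivative (g' t - c)) (at t)"
   by (rule derivative_eq_intros assms(1)[OF t] refl)+ simp
  thus "((%t. g t - c * t) has_derivative (%h. (g' t - c) * h)) (at t within closed_segment a b)"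
   by (meson has_derivative_at_withinI has_field_derivative_def)
  show "onorm (%h. (g' t - c) * h) \<le> e"
   by (rule onorm_le) (simp add: assms(2)[OF t] mult_right_mono norm_mult)
 qed auto
 thus ?thesis by (simp add: algebra_simps)
qed

text \<open>Continuous partial derivatives yield a total differential: one coordinate is changed at
  a time, and each change is controlled by \<open>increment_approx\<close>.\<close>

lemma differential_estimate:
 fixes f :: "(nat => 'k::real_normed_field) => 'k"
 assumes V: "open_coord n V" and f: "Ck_coord n (Suc 0) V f" and x: "x \<in> V" and "e > 0"
 shows "EX d>0. cube n x d \<subseteq> V \<and> (ALL y:cube n x d.
  norm (f y - f x - (\<Sum>i<n. pderivative i f x * (y i - x i))) \<le> e * (\<Sum>i<n. norm (y i - x i)))"
proof -
 have "EX d>0. cube n x d \<subseteq> V \<and> (ALL y:cube n x d. dist (pderivative i f y) (pderivative i f x) < e)"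
  if "i < n" for i
  using f that by (intro continuous_on_cube[OF V _ x \<open>e > 0\<close>]) simp
 then obtain D where D: "!!i. i < n ==> D i > 0"
  "!!i y. i < n ==> y \<in> cube n x (D i) ==> dist (pderivative i f y) (pderivative i f x) < e"
  by metis
 obtain d0 where d0: "d0 > 0" "cube n x d0 \<subseteq> V"
  using open_coordD(2)[OF V x] by blast
 define d where "d = Min (insert d0 (D ` {..<n}))"
 have d: "d > 0" "d \<le> d0" "!!i. i < n ==> d \<le> D i"
  using D(1) d0 by (auto simp: d_def)
 have cV: "cube n x d \<subseteq> V" using d(2) d0(2) cube_mono by blast
 have est: "norm (pderivative i f y - pderivative i f x) \<le> e" if "i < n" "y \<in> cube n x d" for i y
  using D(2)[OF that(1), of y] d(3)[OF that(1)] that(2) cube_mono[of d "D i" n x]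
  by (auto simp: dist_norm)
 have xC: "x \<in> coord_space n" using open_coordD[OF V x] by blast
 have "norm (f y - f x - (\<Sum>i<n. pderivative i f x * (y i - x i))) \<le> e * (\<Sum>i<n. norm (y i - x i))"
  if y: "y \<in> cube n x d" for y
 proof -
  \<comment> \<open>A path of corners from \<open>z 0 = x\<close> to \<open>z n = y\<close>; passing
    from \<open>z m\<close> to \<open>z (Suc m)\<close> moves coordinate \<open>m\<close> alone and
    stays in the cube.\<close>
  define z where "z m = (%i. if i < m then y i else x i)" for m
  have z: "(z m)(m := t) \<in> cube n x d" if "m < n" "t \<in> closed_segment (x m) (y m)" for m t
  proof -
   have "dist t (x m) \<le> dist (y m) (x m)"
    using that(2) by (simp add: dist_norm segment_bound)
   also have "\<dots> < d" using y that(1) by (auto simp: cube_def)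
   finally show ?thesis
    using y xC that(1) d(1) by (auto simp: cube_def z_def coord_space_def)
  qed
  have "norm (f (z m) - f x - (\<Sum>i<m. pderivative i f x * (y i - x i))) \<le> e * (\<Sum>i<m. norm (y i - x i))"
   if "m \<le> n" for m using that
  proof (induction m)
   case 0
   have "z 0 = x" by (auto simp: z_def)
   thus ?case by simp
  next
   case (Suc m)
   have [simp]: "(z m)(m := y m) = z (Suc m)" "(z m)(m := x m) = z m"
    by (auto simp: z_def fun_eq_iff)
   have "norm (f ((z m)(m := y m)) - f ((z m)(m := x m)) - pderivative m f x * (y m - x m))
    \<le> e * norm (y m - x m)"
   proof (rule increment_approx[where g' = "%t. pderivative m f ((z m)(m := t))"])
    fix t assume t: "t \<in> closed_segment (x m) (y m)"
    have "(z m)(m := t) \<in> V" using z[OF _ t] Suc.prems cV by auto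
    thus "((%t. f ((z m)(m := t))) has_field_derivative pderivative m f ((z m)(m := t))) (at t)"
     using has_pderivative[OF f, of "(z m)(m := t)" m] Suc.prems by simp
    show "norm (pderivative m f ((z m)(m := t)) - pderivative m f x) \<le> e"
     using est z[OF _ t] Suc.prems by auto
   qed
   moreover have "norm (f (z m) - f x - (\<Sum>i<m. pderivative i f x * (y i - x i)))
    \<le> e * (\<Sum>i<m. norm (y i - x i))"
    using Suc by simp
   ultimately have "norm ((f (z (Suc m)) - f (z m) - pderivative m f x * (y m - x m))
     + (f (z m) - f x - (\<Sum>i<m. pderivative i f x * (y i - x i))))
     \<le> e * norm (y m - x m) + e * (\<Sum>i<m. norm (y i - x i))"
    by (intro norm_triangle_mono) auto
   thus ?case by (simp add: algebra_simps)
  qed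
  from this[of n] have "norm (f (z n) - f x - (\<Sum>i<n. pderivative i f x * (y i - x i))) \<le> e * (\<Sum>i<n. norm (y i - x i))"
   by simp
  moreover have "z n = y"
   using y xC by (auto simp: z_def fun_eq_iff cube_def coord_space_def)
  ultimately show ?thesis by simp
 qed
 thus ?thesis using d(1) cV by blast
qed

text \<open>Composition of functions of several coordinates is reduced to this case, by restricting
  the inner map to a coordinate line; curves tangent to a distribution are another instance.\<close>

lemma chain_rule_curve:
 fixes f :: "(nat => 'k::real_normed_field) => 'k"
 assumes V: "open_coord n V" and f: "Ck_coord n (Suc 0) V f" and x: "c s \<in> V"
  and c: "\<forall>\<^sub>F t in nhds s. c t \<in> coord_space n"
  and dc: "!!i. i < n ==> ((%t. c t i) has_field_derivative c' i) (at s)"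
 shows "((%t. f (c t)) has_field_derivative (\<Sum>i<n. pderivative i f (c s) * c' i)) (at s)"
proof -
 define R where "R y = f y - f (c s) - (\<Sum>i<n. pderivative i f (c s) * (y i - c s i))" for y
 \<comment> \<open>\<open>K\<close> exceeds the limit of the sum of the difference quotients, so it
   bounds that sum near \<open>s\<close>, and a relative error \<open>e / K\<close> in
   \<open>f\<close> becomes an error below \<open>e\<close>. The added 1 makes the bound strict and
   \<open>K\<close> positive.\<close>
 define K where "K = (\<Sum>i<n. norm (c' i)) + 1"
 have K: "K > 0" unfolding K_def by (simp add: add_nonneg_pos sum_nonneg)
 have q: "((%t. (c t i - c s i) / (t - s)) \<longlongrightarrow> c' i) (at s)" if "i < n" for i
  using dc[OF that] by (simp add: has_field_derivative_iff)
 have "((%t. \<Sum>i<n. norm ((c t i - c s i) / (t - s))) \<longlongrightarrow> (\<Sum>i<n. norm (c' i))) (at s)"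
  by (intro tendsto_sum tendsto_norm q) auto
 hence bd: "\<forall>\<^sub>F t in at s. (\<Sum>i<n. norm ((c t i - c s i) / (t - s))) < K"
  by (rule order_tendstoD) (simp add: K_def)
 have near: "\<forall>\<^sub>F t in at s. c t \<in> cube n (c s) d" if "d > 0" for d
 proof -
  have "\<forall>\<^sub>F t in at s. ALL i:{..<n}. dist (c t i) (c s i) < d"
  proof (subst eventually_ball_finite_distrib)
   show "ALL y:{..<n}. \<forall>\<^sub>F t in at s. dist (c t y) (c s y) < d"
   proof
    fix i assume "i \<in> {..<n}"
    hence "isCont (%t. c t i) s" using dc DERIV_isCont by blast
    thus "\<forall>\<^sub>F t in at s. dist (c t i) (c s i) < d"
     using that by (metis isCont_def tendstoD)
   qed
  qed auto
  moreover have "\<forall>\<^sub>F t in at s. c t \<in> coord_space n"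
   using c eventually_nhds_conv_at by blast
  ultimately show ?thesis
   by eventually_elim (auto simp: cube_def)
 qed
 have "((%t. R (c t) / (t - s)) \<longlongrightarrow> 0) (at s)"
 proof (rule tendstoI)
  fix e :: real assume e: "e > 0"
  obtain d where d: "d > 0" "ALL y:cube n (c s) d. norm (R y) \<le> e / K * (\<Sum>i<n. norm (y i - c s i))"
   using differential_estimate[OF V f x, of "e / K"] e K unfolding R_def by auto
  from near[OF d(1)] bd show "\<forall>\<^sub>F t in at s. dist (R (c t) / (t - s)) 0 < e"
   unfolding eventually_at_filter
  proof eventually_elim
   case (elim t)
   show ?case
   proof (intro impI)
    assume ts: "t \<noteq> s"
    have "norm (R (c t)) \<le> e / K * (\<Sum>i<n. norm (c t i - c s i))"
     using d(2) elim(1) ts by simp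
    hence "norm (R (c t) / (t - s)) \<le> e / K * (\<Sum>i<n. norm (c t i - c s i)) / norm (t - s)"
     unfolding norm_divide by (rule divide_right_mono) simp
    also have "\<dots> = e / K * (\<Sum>i<n. norm ((c t i - c s i) / (t - s)))"
     by (simp add: norm_divide mult.commute flip: sum_divide_distrib)
    also have "\<dots> < e / K * K"
     using elim ts e K by (intro mult_strict_left_mono) auto
    finally show "dist (R (c t) / (t - s)) 0 < e" using K by simp
   qed
  qed
 qed
 moreover have "((%t. \<Sum>i<n. pderivative i f (c s) * ((c t i - c s i) / (t - s)))
   \<longlongrightarrow> (\<Sum>i<n. pderivative i f (c s) * c' i)) (at s)"
  by (intro tendsto_intros q) auto
 ultimately have "((%t. R (c t) / (t - s) + (\<Sum>i<n. pderivative i f (c s) * ((c t i - c s i) / (t - s))))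
   \<longlongrightarrow> 0 + (\<Sum>i<n. pderivative i f (c s) * c' i)) (at s)"
  by (rule tendsto_add)
 moreover have "R (c t) / (t - s) + (\<Sum>i<n. pderivative i f (c s) * ((c t i - c s i) / (t - s)))
   = (f (c t) - f (c s)) / (t - s)" for t
  by (simp add: R_def flip: sum_divide_distrib add_divide_distrib)
 ultimately show ?thesis
  by (simp add: has_field_derivative_iff)
qed

subsection \<open>Classes of differentiable functions\<close>

lemma pderivative_cong:
 assumes "open_coord n V" "x \<in> V" "i < n" "!!y. y \<in> V ==> f y = g y"
 shows "pderivative i f x = pderivative i g x"
 unfolding pderivative_def
 by (rule deriv_cong_ev) (use eventually_upd_in[OF assms(1-3)] assms(4) in \<open>auto elim: eventually_mono\<close>)

lemma Ck_coord_continuous: "Ck_coord n k V f ==> continuous_on V f"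
 by (cases k) auto

lemma Ck_coord_Suc_intro:
 assumes "continuous_on V f"
  and d: "!!i x. i < n ==> x \<in> V ==> (%t. f (x(i := t))) field_differentiable at (x i)"
  and "!!i. i < n ==> Ck_coord n k V (pderivative i f)"
 shows "Ck_coord n (Suc k) V f"
 unfolding Ck_coord.simps
proof (intro conjI allI impI ballI)
 show "(%t. f (x(i := t))) field_differentiable at (x i)" if "i < n" "x \<in> V" for i x
  using that by (rule d)
qed (use assms(1,3) in auto)

lemma Ck_coord_cong:
 assumes V: "open_coord n V" and "!!y. y \<in> V ==> f y = g y" and "Ck_coord n k V f"
 shows "Ck_coord n k V g"
 using assms(2,3)
proof (induction k arbitrary: f g)
 case 0
 thus ?case by (auto cong: continuous_on_cong)
next
 case (Suc k)
 have fd: "(%t. g (x(i := t))) field_differentiable at (x i)"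
  if x: "x \<in> V" "i < n" for x i
 proof -
  have ev: "\<forall>\<^sub>F t in nhds (x i). f (x(i := t)) = g (x(i := t))"
   using eventually_upd_in[OF V x] by (rule eventually_mono) (rule Suc.prems(1))
  have "((%t. g (x(i := t))) has_field_derivative pderivative i f x) (at (x i))"
   using has_pderivative[OF Suc.prems(2) x] by (rule iffD1[OF DERIV_cong_ev[OF refl ev refl]])
  thus ?thesis unfolding field_differentiable_def by (rule exI)
 qed
 have "Ck_coord n k V (pderivative i g)" if "i < n" for i
  using Suc.IH[of "pderivative i f" "pderivative i g"] pderivative_cong[OF V _ that Suc.prems(1)]
   Suc.prems(2) that by simp
 moreover have "continuous_on V g \<longleftrightarrow> continuous_on V f"
  by (rule continuous_on_cong) (simp_all add: Suc.prems(1))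
 hence "continuous_on V g" using Ck_coord_continuous[OF Suc.prems(2)] by (rule iffD2)
 moreover note \<open>continuous_on V g\<close>
 ultimately show ?case
 proof (intro Ck_coord_Suc_intro)
  show "(%t. g (x(i := t))) field_differentiable at (x i)" if "i < n" "x \<in> V" for i x
   using that(2,1) by (rule fd)
 qed
qed

lemma Ck_coord_mono: "Ck_coord n k V f ==> W \<subseteq> V ==> Ck_coord n k W f"
 by (induction k arbitrary: f) (auto intro: continuous_on_subset)

lemma Ck_coord_SucD: "Ck_coord n (Suc k) V f ==> Ck_coord n k V f"
 by (induction k arbitrary: f) auto

lemma Ck_coord_le: "j \<le> k ==> Ck_coord n k V f ==> Ck_coord n j V f"
 by (induction k rule: nat_induct_at_least) (blast dest: Ck_coord_SucD)+

lemma Ck_coord_SucI: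
 assumes V: "open_coord n V" and "continuous_on V f"
  and d: "!!i x. i < n ==> x \<in> V ==> ((%t. f (x(i := t))) has_field_derivative f' i x) (at (x i))"
  and "!!i. i < n ==> Ck_coord n k V (f' i)"
 shows "Ck_coord n (Suc k) V f"
proof -
 have "pderivative i f x = f' i x" if "i < n" "x \<in> V" for i x
  unfolding pderivative_def using d[OF that] by (rule DERIV_imp_deriv)
 hence "Ck_coord n k V (pderivative i f)" if "i < n" for i
  using that by (intro Ck_coord_cong[OF V _ assms(4)[OF that]]) simp
 with assms(2) show ?thesis
 proof (intro Ck_coord_Suc_intro)
  show "(%t. f (x(i := t))) field_differentiable at (x i)" if "i < n" "x \<in> V" for i x
   using d[OF that] unfolding field_differentiable_def by (rule exI)
 qed
qed

lemma pderivative_eqI: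
 "((%t. f (x(i := t))) has_field_derivative D) (at (x i)) ==> pderivative i f x = D"
 unfolding pderivative_def by (rule DERIV_imp_deriv)

lemma Ck_coord_const: "open_coord n V ==> Ck_coord n k V (%x. c)"
proof (induction k arbitrary: c)
 case (Suc k)
 show ?case by (rule Ck_coord_SucI[where f' = "%_ _. 0", OF Suc.prems]) (use Suc in auto)
qed auto

lemma Ck_coord_proj:
 assumes V: "open_coord n V" 
 shows "Ck_coord n k V (%x. x j)"
proof (cases k)
 case (Suc l)
 show ?thesis unfolding Suc
  by (rule Ck_coord_SucI[where f' = "%i _. if i = j then 1 else 0", OF V])
   (auto intro: continuous_on_subset[OF continuous_on_product_coordinates] Ck_coord_const[OF V])
qed (auto intro: continuous_on_subset[OF continuous_on_product_coordinates])

lemma Ck_coord_add: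
 assumes V: "open_coord n V" 
 shows "Ck_coord n k V f ==> Ck_coord n k V g ==> Ck_coord n k V (%x. f x + g x)"
proof (induction k arbitrary: f g)
 case (Suc k)
 show ?case
 proof (rule Ck_coord_SucI[where f' = "%i x. pderivative i f x + pderivative i g x", OF V])
  show "continuous_on V (%x. f x + g x)" using Suc.prems by (auto intro!: continuous_intros)
  show "((%t. f (x(i := t)) + g (x(i := t))) has_field_derivative
    pderivative i f x + pderivative i g x) (at (x i))" if "i < n" "x \<in> V" for i x
   by (intro DERIV_add has_pderivative[OF Suc.prems(1)] has_pderivative[OF Suc.prems(2)] that)
  show "Ck_coord n k V (%x. pderivative i f x + pderivative i g x)" if "i < n" for i
   using Suc.prems that by (intro Suc.IH) auto
 qed
qed (auto intro!: continuous_intros)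

lemma Ck_coord_mult:
 assumes V: "open_coord n V" 
 shows "Ck_coord n k V f ==> Ck_coord n k V g ==> Ck_coord n k V (%x. f x * g x)"
proof (induction k arbitrary: f g)
 case (Suc k)
 show ?case
 proof (rule Ck_coord_SucI[where f' = "%i x. f x * pderivative i g x + pderivative i f x * g x", OF V])
  show "continuous_on V (%x. f x * g x)" using Suc.prems by (auto intro!: continuous_intros)
  show "((%t. f (x(i := t)) * g (x(i := t))) has_field_derivative
    f x * pderivative i g x + pderivative i f x * g x) (at (x i))" if "i < n" "x \<in> V" for i x
   using DERIV_mult'[OF has_pderivative[OF Suc.prems(1) that(2,1)] has_pderivative[OF Suc.prems(2) that(2,1)]]
   by (simp only: fun_upd_triv)
  show "Ck_coord n k V (%x. f x * pderivative i g x + pderivative i f x * g x)" if "i < n" for i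
   using Suc.prems Suc.prems[THEN Ck_coord_SucD] that by (intro Suc.IH Ck_coord_add[OF V]) auto
 qed
qed (auto intro!: continuous_intros)

lemma Ck_coord_sum:
 assumes V: "open_coord n V" 
 shows "(!!j. j \<in> S ==> Ck_coord n k V (f j)) ==> Ck_coord n k V (%x. \<Sum>j\<in>S. f j x)"
 by (induction S rule: infinite_finite_induct) (auto intro!: Ck_coord_add[OF V] Ck_coord_const[OF V])

lemma Ck_coord_uminus:
 assumes V: "open_coord n V" and f: "Ck_coord n k V f"
 shows "Ck_coord n k V (%x. - f x)"
 using Ck_coord_mult[OF V Ck_coord_const[OF V, of k "-1"] f] by simp

lemma Ck_coord_inverse:
 assumes V: "open_coord n V" and nz: "!!x. x \<in> V ==> f x \<noteq> 0"
 shows "Ck_coord n k V f ==> Ck_coord n k V (%x. inverse (f x))"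
proof (induction k)
 case (Suc k)
 show ?case
 proof (rule Ck_coord_SucI[where f' = "%i x. - (inverse (f x) * pderivative i f x * inverse (f x))", OF V])
  show "continuous_on V (%x. inverse (f x))" using Suc.prems nz by (auto intro!: continuous_intros)
  show "((%t. inverse (f (x(i := t)))) has_field_derivative
    - (inverse (f x) * pderivative i f x * inverse (f x))) (at (x i))" if "i < n" "x \<in> V" for i x
  proof -
   have "f (x(i := x i)) \<noteq> 0" using nz[OF that(2)] by simp
   from DERIV_inverse'[OF has_pderivative[OF Suc.prems(1) that(2,1)] this] show ?thesis
    by (simp only: fun_upd_triv)
  qed
  show "Ck_coord n k V (%x. - (inverse (f x) * pderivative i f x * inverse (f x)))" if "i < n" for i
   using Suc.prems Ck_coord_SucD[OF Suc.prems] that Suc.IH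
   by (intro Ck_coord_uminus[OF V] Ck_coord_mult[OF V]) auto
 qed
qed (use nz in \<open>auto intro!: continuous_intros\<close>)

lemma continuous_on_coords:
 fixes g :: "'a::topological_space => nat => 'k::real_normed_field"
 assumes "!!x. x \<in> V ==> g x \<in> coord_space m" "!!j. j < m ==> continuous_on V (%x. g x j)"
 shows "continuous_on V g"
proof (rule continuous_on_coordinatewise_then_product)
 fix j
 show "continuous_on V (%x. g x j)"
 proof (cases "j < m")
  case False
  hence "g x j = 0" if "x \<in> V" for x using assms(1)[OF that] by (auto simp: coord_space_def)
  hence "continuous_on V (%x. g x j) \<longleftrightarrow> continuous_on V (%x. 0::'k)"
   by (intro continuous_on_cong) auto
  thus ?thesis by simp
 qed (use assms in auto)
qed

lemma has_field_derivative_comp: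
 assumes V: "open_coord n V" and W: "open_coord m W" and f: "Ck_coord m (Suc 0) W f"
  and gW: "!!x. x \<in> V ==> g x \<in> W" and g: "!!j. j < m ==> Ck_coord n (Suc 0) V (%x. g x j)"
  and x: "x \<in> V" "i < n"
 shows "((%t. f (g (x(i := t)))) has_field_derivative
  (\<Sum>j<m. pderivative j f (g x) * pderivative i (%x. g x j) x)) (at (x i))"
proof -
 have "\<forall>\<^sub>F t in nhds (x i). g (x(i := t)) \<in> coord_space m"
  using eventually_upd_in[OF V x] by (rule eventually_mono) (meson gW W open_coordD(1))
 thus ?thesis
  using chain_rule_curve[OF W f, of "%t. g (x(i := t))" "x i" "%j. pderivative i (%x. g x j) x"]
   gW[OF x(1)] has_pderivative[OF g x] by simp
qed

text \<open>Induction on \<open>k\<close>: a partial derivative of the composition is a sum of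
  products of a partial derivative of \<open>f\<close> taken at \<open>g x\<close>, to which the
  induction hypothesis applies, and a partial derivative of a component of \<open>g\<close>.\<close>

lemma Ck_coord_comp:
 assumes V: "open_coord n V" and W: "open_coord m W" and gW: "!!x. x \<in> V ==> g x \<in> W"
 shows "Ck_coord m k W f ==> (!!j. j < m ==> Ck_coord n k V (%x. g x j))
  ==> Ck_coord n k V (%x. f (g x))"
proof (induction k arbitrary: f)
 case 0
 have "continuous_on V g"
  using 0 gW W by (intro continuous_on_coords[of _ _ m]) (auto dest: open_coordD(1))
 thus ?case
  using 0 gW continuous_on_compose2[of W f V g] by auto
next
 case (Suc k)
 have g: "Ck_coord n k V (%x. g x j)" if "j < m" for j
  using Suc.prems(2)[OF that] by (rule Ck_coord_SucD)
 have f1: "Ck_coord m (Suc 0) W f"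
  using Ck_coord_le[OF _ Suc.prems(1), of "Suc 0"] by simp
 have g1: "Ck_coord n (Suc 0) V (%x. g x j)" if "j < m" for j
  using Ck_coord_le[OF _ Suc.prems(2)[OF that], of "Suc 0"] by simp
 show ?case
 proof (rule Ck_coord_SucI[OF V, where
    f' = "%i x. \<Sum>j<m. pderivative j f (g x) * pderivative i (%x. g x j) x"])
  show "continuous_on V (%x. f (g x))"
   using Suc.IH[OF Ck_coord_SucD[OF Suc.prems(1)]] g Ck_coord_continuous by blast
  fix i x assume i: "i < n" and x: "x \<in> V"
  show "((%t. f (g (x(i := t)))) has_field_derivative
    (\<Sum>j<m. pderivative j f (g x) * pderivative i (%x. g x j) x)) (at (x i))"
  proof (rule has_field_derivative_comp[where f = f and g = g, OF V W f1 _ _ x i])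
   show "g x \<in> W" if "x \<in> V" for x using that by (rule gW)
   show "Ck_coord n (Suc 0) V (%x. g x j)" if "j < m" for j using that by (rule g1)
  qed
 next
  fix i assume i: "i < n"
  show "Ck_coord n k V (%x. \<Sum>j<m. pderivative j f (g x) * pderivative i (%x. g x j) x)"
  proof (rule Ck_coord_sum[OF V], rule Ck_coord_mult[OF V])
   fix j assume "j \<in> {..<m}"
   hence j: "j < m" by simp
   show "Ck_coord n k V (%x. pderivative j f (g x))"
   proof (rule Suc.IH[where f = "pderivative j f"])
    show "Ck_coord m k W (pderivative j f)" using Suc.prems(1) j by simp
    show "Ck_coord n k V (%x. g x l)" if "l < m" for l using that by (rule g)
   qed
   have "Ck_coord n (Suc k) V (%x. g x j)" using j by (rule Suc.prems(2))
   thus "Ck_coord n k V (pderivative i (%x. g x j))" using i by simp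
  qed
 qed
qed

lemma Ck_coord_Union:
 assumes "!!x. x \<in> V ==> EX W. x \<in> W \<and> open_coord n W \<and> W \<subseteq> V \<and> Ck_coord n k W f"
 shows "Ck_coord n k V f"
 using assms
proof (induction k arbitrary: f)
 case 0
 have "continuous (at x within V) f" if x: "x \<in> V" for x
 proof -
  obtain W where W: "x \<in> W" "open_coord n W" "W \<subseteq> V" "continuous_on W f" using 0[OF x] by auto
  obtain T where T: "open T" "W = coord_space n \<inter> T"
   using W(2) unfolding openin_open by blast
  have "V \<subseteq> coord_space n"
  proof
   fix y assume "y \<in> V"
   thus "y \<in> coord_space n" using 0 open_coordD(1) by blast
  qed
  hence "at x within V = at x within W"
   using W(1,3) T by (intro at_within_nhd[of x T]) auto
  thus ?thesis using W by (simp add: continuous_on_eq_continuous_within)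
 qed
 thus ?case by (simp add: continuous_on_eq_continuous_within)
next
 case (Suc k)
 have *: "EX W. x \<in> W \<and> open_coord n W \<and> W \<subseteq> V \<and> Ck_coord n (Suc k) W f" if "x \<in> V" for x
  by (rule Suc.prems[OF that])
 have "Ck_coord n k V (pderivative i f)" if i: "i < n" for i
 proof (rule Suc.IH)
  fix x assume x: "x \<in> V"
  obtain W where W: "x \<in> W" "open_coord n W" "W \<subseteq> V" "Ck_coord n (Suc k) W f"
   using *[OF x] by (elim exE conjE) (rule that)
  from W(4) have "Ck_coord n k W (pderivative i f)" using i by simp
  with W(1-3) show "EX W. x \<in> W \<and> open_coord n W \<and> W \<subseteq> V \<and> Ck_coord n k W (pderivative i f)"
   by (intro exI conjI)
 qed
 moreover have "Ck_coord n k V f"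
 proof (rule Suc.IH)
  fix x assume x: "x \<in> V"
  obtain W where W: "x \<in> W" "open_coord n W" "W \<subseteq> V" "Ck_coord n (Suc k) W f"
   using *[OF x] by (elim exE conjE) (rule that)
  from W(1-3) Ck_coord_SucD[OF W(4)]
  show "EX W. x \<in> W \<and> open_coord n W \<and> W \<subseteq> V \<and> Ck_coord n k W f"
   by (intro exI conjI)
 qed
 hence "continuous_on V f" by (rule Ck_coord_continuous)
 ultimately show ?case
 proof (intro Ck_coord_Suc_intro)
  fix i x assume i: "i < n" and x: "x \<in> V"
  obtain W where W: "x \<in> W" "Ck_coord n (Suc k) W f"
   using *[OF x] by (elim exE conjE) (rule that)
  from has_pderivative[OF W(2,1) i] show "(%t. f (x(i := t))) field_differentiable at (x i)"
   unfolding field_differentiable_def by (rule exI)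
 qed
qed


text \<open>The second difference, with one increment \<open>h\<close> in both directions, is
  estimated by a mean value inequality in direction \<open>j\<close> nested in one in direction
  \<open>i\<close>; continuity of the mixed derivative supplies the error bound.\<close>

lemma mixed_increment:
 fixes f :: "(nat => 'k::real_normed_field) => 'k"
 assumes V: "open_coord n V" and f: "Ck_coord n 2 V f" and x: "x \<in> V"
  and ij: "i < n" "j < n" "i \<noteq> j" and "e > 0"
 shows "EX d>0. ALL h. norm h < d -->
  norm (f (x(i := x i + h, j := x j + h)) - f (x(i := x i + h)) - f (x(j := x j + h)) + f x
   - pderivative j (pderivative i f) x * h * h) \<le> e * norm h * norm h"
proof -
 let ?fi = "pderivative i f" let ?fji = "pderivative j (pderivative i f)"
 have f2: "Ck_coord n (Suc (Suc 0)) V f" using f by (simp add: numeral_2_eq_2)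
 have fi: "Ck_coord n (Suc 0) V ?fi" and fji: "continuous_on V ?fji"
  using f2 ij by simp_all
 obtain d where d: "d > 0" "cube n x d \<subseteq> V" "ALL y:cube n x d. dist (?fji y) (?fji x) < e"
  using continuous_on_cube[OF V fji x \<open>e > 0\<close>] by blast
 have xC: "x \<in> coord_space n" using open_coordD[OF V x] by blast
 have inc: "x(i := x i + a, j := x j + b) \<in> cube n x d" if "norm a < d" "norm b < d" for a b
  using that xC ij d(1) by (auto simp: cube_def coord_space_def dist_norm)
 have "norm (f (x(i := x i + h, j := x j + h)) - f (x(i := x i + h)) - f (x(j := x j + h)) + f x
   - ?fji x * h * h) \<le> e * norm h * norm h" if h: "norm h < d" for h
 proof -
  define g where "g s = f (x(i := s, j := x j + h)) - f (x(i := s, j := x j))" for s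
  define g' where "g' s = ?fi (x(i := s, j := x j + h)) - ?fi (x(i := s, j := x j))" for s
  have seg: "norm (t - a) < d" if "t \<in> closed_segment a (a + h)" for t a
   using segment_bound(1)[OF that] h by (simp add: norm_minus_commute)
  have in_i: "x(i := s, j := x j + b) \<in> cube n x d"
   if "s \<in> closed_segment (x i) (x i + h)" "norm b < d" for s b
   using inc[OF seg[OF that(1)] that(2)] by simp
  have "norm (g (x i + h) - g (x i) - (?fji x * h) * ((x i + h) - x i)) \<le> (e * norm h) * norm ((x i + h) - x i)"
  proof (rule increment_approx[where g' = g'])
   fix s assume s: "s \<in> closed_segment (x i) (x i + h)"
   have D: "((%t. f (x(i := t, j := x j + b))) has_field_derivative ?fi (x(i := s, j := x j + b))) (at s)"
    if b: "norm b < d" for b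
   proof -
    have "x(i := s, j := x j + b) \<in> V" using in_i[OF s b] d(2) by blast
    from has_pderivative[OF f2 this ij(1)] show ?thesis
     using ij(3) by (simp add: fun_upd_twist)
   qed
   from DERIV_diff[OF D[OF h] D[of 0]] d(1)
   show "(g has_field_derivative g' s) (at s)"
    by (simp add: g_def[abs_def] g'_def)
   have "norm (?fi (x(i := s, j := x j + h)) - ?fi (x(i := s, j := x j)) - ?fji x * ((x j + h) - x j))
     \<le> e * norm ((x j + h) - x j)"
   proof (rule increment_approx[where g' = "%t. ?fji (x(i := s, j := t))"])
    fix t assume t: "t \<in> closed_segment (x j) (x j + h)"
    have c: "x(i := s, j := t) \<in> cube n x d"
     using in_i[OF s seg[OF t]] by simp
    hence "x(i := s, j := t) \<in> V" using d(2) by blast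
    from has_pderivative[OF fi this ij(2)]
    show "((%t. ?fi (x(i := s, j := t))) has_field_derivative ?fji (x(i := s, j := t))) (at t)"
     by simp
    show "norm (?fji (x(i := s, j := t)) - ?fji x) \<le> e"
     using d(3) c by (auto simp: dist_norm intro: less_imp_le)
   qed
   thus "norm (g' s - ?fji x * h) \<le> e * norm h"
    by (simp add: g'_def)
  qed
  moreover have "x(i := x i, j := x j + h) = x(j := x j + h)"
   "x(i := x i + h, j := x j) = x(i := x i + h)" "x(i := x i, j := x j) = x"
   using ij(3) by auto
  ultimately show ?thesis by (simp add: g_def algebra_simps)
 qed
 thus ?thesis using d(1) by blast
qed

text \<open>The second difference is symmetric in \<open>i\<close> and \<open>j\<close>. Divided by
  \<open>h * h\<close> it approximates both mixed derivatives with arbitrarily small error.\<close>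

lemma pderivative_commute:
 fixes f :: "(nat => 'k::real_normed_field) => 'k"
 assumes V: "open_coord n V" and f: "Ck_coord n 2 V f" and x: "x \<in> V"
  and ij: "i < n" "j < n"
 shows "pderivative i (pderivative j f) x = pderivative j (pderivative i f) x"
proof (cases "i = j")
 case False
 let ?a = "pderivative i (pderivative j f) x" let ?b = "pderivative j (pderivative i f) x"
 have "norm (?a - ?b) \<le> 2 * e" if e: "e > 0" for e
 proof -
  obtain d1 where d1: "d1 > 0" "!!h. norm h < d1 ==>
   norm (f (x(i := x i + h, j := x j + h)) - f (x(i := x i + h)) - f (x(j := x j + h)) + f x
   - ?b * h * h) \<le> e * norm h * norm h"
   using mixed_increment[OF V f x ij False e] by blast
  obtain d2 where d2: "d2 > 0" "!!h. norm h < d2 ==>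
   norm (f (x(j := x j + h, i := x i + h)) - f (x(j := x j + h)) - f (x(i := x i + h)) + f x
   - ?a * h * h) \<le> e * norm h * norm h"
   using mixed_increment[OF V f x ij(2,1) _ e] False by metis
  define h :: 'k where "h = of_real (min d1 d2 / 2)"
  have h: "norm h < d1" "norm h < d2" "h \<noteq> 0" using d1(1) d2(1) by (auto simp: h_def)
  let ?D = "f (x(i := x i + h, j := x j + h)) - f (x(i := x i + h)) - f (x(j := x j + h)) + f x"
  have "norm (?D - ?a * h * h) \<le> e * norm h * norm h"
   using d2(2)[OF h(2)] False by (simp add: fun_upd_twist algebra_simps)
  with d1(2)[OF h(1)]
  have "norm ((?D - ?b * h * h) - (?D - ?a * h * h)) \<le> e * norm h * norm h + e * norm h * norm h"
   using norm_triangle_ineq4[of "?D - ?b * h * h" "?D - ?a * h * h"] by linarith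
  also have "(?D - ?b * h * h) - (?D - ?a * h * h) = (?a - ?b) * (h * h)"
   by (simp add: algebra_simps)
  finally have "norm (?a - ?b) * (norm h * norm h) \<le> 2 * e * (norm h * norm h)"
   by (simp add: norm_mult)
  thus ?thesis using h(3) by (simp add: mult_le_cancel_right)
 qed
 hence "norm (?a - ?b) \<le> 0 + e" if "e > 0" for e
  using that by (metis add_0 half_gt_zero field_sum_of_halves mult_2)
 hence "norm (?a - ?b) \<le> 0" by (rule field_le_epsilon)
 thus ?thesis by simp
qed simp

subsection \<open>Smooth functions of coordinates\<close>

lemma smooth_coord_cong:
 "open_coord n V ==> (!!y. y \<in> V ==> f y = g y) ==> smooth_coord n V f ==> smooth_coord n V g"
 unfolding smooth_coord_def using Ck_coord_cong by blast

lemma smooth_coord_subset: "smooth_coord n V f ==> W \<subseteq> V ==> smooth_coord n W f"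
 unfolding smooth_coord_def using Ck_coord_mono by blast

lemma smooth_coord_const: "open_coord n V ==> smooth_coord n V (%x. c)"
 unfolding smooth_coord_def by (simp add: Ck_coord_const)

lemma smooth_coord_proj: "open_coord n V ==> smooth_coord n V (%x. x j)"
 unfolding smooth_coord_def by (simp add: Ck_coord_proj)

lemma smooth_coord_add:
 "open_coord n V ==> smooth_coord n V f ==> smooth_coord n V g ==> smooth_coord n V (%x. f x + g x)"
 unfolding smooth_coord_def by (simp add: Ck_coord_add)

lemma smooth_coord_mult:
 "open_coord n V ==> smooth_coord n V f ==> smooth_coord n V g ==> smooth_coord n V (%x. f x * g x)"
 unfolding smooth_coord_def by (simp add: Ck_coord_mult)

lemma smooth_coord_sum:
 "open_coord n V ==> (!!j. j \<in> S ==> smooth_coord n V (f j)) ==>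
  smooth_coord n V (%x. \<Sum>j\<in>S. f j x)"
 unfolding smooth_coord_def by (simp add: Ck_coord_sum)

lemma smooth_coord_inverse:
 "open_coord n V ==> (!!x. x \<in> V ==> f x \<noteq> 0) ==> smooth_coord n V f
  ==> smooth_coord n V (%x. inverse (f x))"
 unfolding smooth_coord_def by (simp add: Ck_coord_inverse)

lemma smooth_coord_comp:
 assumes "open_coord n V" "open_coord m W" "!!x. x \<in> V ==> g x \<in> W"
  "smooth_coord m W f" "!!j. j < m ==> smooth_coord n V (%x. g x j)"
 shows "smooth_coord n V (%x. f (g x))"
 using assms(4,5) Ck_coord_comp[where f = f and g = g, OF assms(1,2,3)]
 by (simp add: smooth_coord_def)

lemma smooth_coord_pderivative: "smooth_coord n V f ==> i < n ==> smooth_coord n V (pderivative i f)"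
 unfolding smooth_coord_def by (metis Ck_coord.simps(2))

lemma smooth_coord_Union:
 assumes "!!x. x \<in> V ==> EX W. x \<in> W \<and> open_coord n W \<and> W \<subseteq> V \<and> smooth_coord n W f"
 shows "smooth_coord n V f"
 unfolding smooth_coord_def
proof
 fix k show "Ck_coord n k V f"
 proof (rule Ck_coord_Union)
  fix x assume x: "x \<in> V"
  obtain W where "x \<in> W" "open_coord n W" "W \<subseteq> V" "smooth_coord n W f"
   using assms[OF x] by (elim exE conjE) (rule that)
  thus "EX W. x \<in> W \<and> open_coord n W \<and> W \<subseteq> V \<and> Ck_coord n k W f"
   unfolding smooth_coord_def by blast
 qed
qed

lemma smooth_coord_continuous: "smooth_coord n V f ==> continuous_on V f"
 unfolding smooth_coord_def using Ck_coord_continuous by blast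

section \<open>Manifolds\<close>

lemma sum_fun_apply: "(\<Sum>i\<in>S. f i) x = (\<Sum>i\<in>S. f i x :: 'a::comm_monoid_add)"
 by (induction S rule: infinite_finite_induct) auto

lemma fscale_apply [simp]: "fscale c v x = c * v x"
 by (simp add: fscale_def)

text \<open>\<open>mtop\<close> is introduced through \<open>topology\<close>, so membership can be
  unfolded only once the defining condition is known to be a topology. Injectivity of the charts
  makes images commute with intersections.\<close>

lemma openin_mtop_inj:
 assumes inj: "!!U \<phi>. (U, \<phi>) \<in> atlas M ==> inj_on \<phi> U"
 shows "openin (mtop M) W \<longleftrightarrow>
  W \<subseteq> points M \<and> (ALL (U, \<phi>):atlas M. open_coord (mdim M) (\<phi> ` (W \<inter> U)))"
proof -
 have "istopology (%W. W \<subseteq> points M \<and> (ALL (U, \<phi>):atlas M. open_coord (mdim M) (\<phi> ` (W \<inter> U))))"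
  unfolding istopology_def
 proof (intro conjI allI impI)
  fix S T
  assume S: "S \<subseteq> points M \<and> (ALL (U, \<phi>):atlas M. open_coord (mdim M) (\<phi> ` (S \<inter> U)))"
   and T: "T \<subseteq> points M \<and> (ALL (U, \<phi>):atlas M. open_coord (mdim M) (\<phi> ` (T \<inter> U)))"
  show "S \<inter> T \<subseteq> points M" using S by auto
  show "ALL (U, \<phi>):atlas M. open_coord (mdim M) (\<phi> ` (S \<inter> T \<inter> U))"
  proof (clarify)
   fix U \<phi> assume U: "(U, \<phi>) \<in> atlas M"
   have "\<phi> ` (S \<inter> T \<inter> U) = \<phi> ` (S \<inter> U) \<inter> \<phi> ` (T \<inter> U)"
    using inj_onD[OF inj[OF U]] by blast
   thus "open_coord (mdim M) (\<phi> ` (S \<inter> T \<inter> U))"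
    using S T U by auto
  qed
 next
  fix K
  assume K: "ALL S:K. S \<subseteq> points M \<and> (ALL (U, \<phi>):atlas M. open_coord (mdim M) (\<phi> ` (S \<inter> U)))"
  show "\<Union>K \<subseteq> points M" using K by auto
  show "ALL (U, \<phi>):atlas M. open_coord (mdim M) (\<phi> ` (\<Union>K \<inter> U))"
  proof (clarify)
   fix U \<phi> assume U: "(U, \<phi>) \<in> atlas M"
   have "\<phi> ` (\<Union>K \<inter> U) = (\<Union>S\<in>K. \<phi> ` (S \<inter> U))" by auto
   moreover have "open_coord (mdim M) (\<phi> ` (S \<inter> U))" if "S \<in> K" for S using K U that by auto
   ultimately show "open_coord (mdim M) (\<phi> ` (\<Union>K \<inter> U))"
    by (simp only:) (rule openin_Union, blast)
  qed
 qed
 thus ?thesis unfolding mtop_def by (simp add: topology_inverse')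
qed

text \<open>The chart conditions of \<open>manifold\<close>. Splitting them off lets calculus on the
  total space begin before its Hausdorff and countability properties are established.\<close>

definition smooth_atlas :: "('p, 'k::ground_field) mfd => bool"
 where "smooth_atlas M \<longleftrightarrow>
  (ALL (U, \<phi>):atlas M. inj_on \<phi> U \<and> open_coord (mdim M) (\<phi> ` U)) \<and>
  (ALL (U, \<phi>):atlas M. ALL (V, \<psi>):atlas M. open_coord (mdim M) (\<phi> ` (U \<inter> V)) \<and>
    (ALL i<mdim M. smooth_coord (mdim M) (\<phi> ` (U \<inter> V)) (%x. \<psi> (inv_into U \<phi> x) i)))"

lemma manifold_iff:
 "manifold M \<longleftrightarrow> smooth_atlas M \<and> Hausdorff_space (mtop M) \<and> second_countable (mtop M)"
 unfolding manifold_def smooth_atlas_def by simp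

locale mfold =
 fixes M :: "('p, 'k::ground_field) mfd"
 assumes smooth_atlas: "smooth_atlas M"
begin

abbreviation "TS \<equiv> tangent_space M"
abbreviation "smooth \<equiv> smooth_near M"
abbreviation "br \<equiv> poisson_bracket M"
abbreviation "opn \<equiv> openin (mtop M)"
abbreviation near :: "'p => 'p filter" where "near p \<equiv> nhdsin (mtop M) p"

lemma chart_inj: "(U, \<phi>) \<in> atlas M ==> inj_on \<phi> U"
 using smooth_atlas unfolding smooth_atlas_def by auto

lemma chart_image_open: "(U, \<phi>) \<in> atlas M ==> open_coord (mdim M) (\<phi> ` U)"
 using smooth_atlas unfolding smooth_atlas_def by auto

lemma overlap_open:
 "(U, \<phi>) \<in> atlas M ==> (V, \<psi>) \<in> atlas M ==> open_coord (mdim M) (\<phi> ` (U \<inter> V))"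
 using smooth_atlas unfolding smooth_atlas_def by fast

lemma transition_smooth:
 "(U, \<phi>) \<in> atlas M ==> (V, \<psi>) \<in> atlas M ==> i < mdim M ==>
  smooth_coord (mdim M) (\<phi> ` (U \<inter> V)) (%x. \<psi> (inv_into U \<phi> x) i)"
 using smooth_atlas unfolding smooth_atlas_def by fast

lemma chart_coord: "(U, \<phi>) \<in> atlas M ==> p \<in> U ==> \<phi> p \<in> coord_space (mdim M)"
 using open_coord_subset[OF chart_image_open] by blast

lemma chart_inv: "(U, \<phi>) \<in> atlas M ==> p \<in> U ==> inv_into U \<phi> (\<phi> p) = p"
 by (rule inv_into_f_f[OF chart_inj])

lemma openin_mtop:
 "opn W \<longleftrightarrow>
  W \<subseteq> points M \<and> (ALL (U, \<phi>):atlas M. open_coord (mdim M) (\<phi> ` (W \<inter> U)))"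
 by (rule openin_mtop_inj) (rule chart_inj)

lemma chart_subset: "(U, \<phi>) \<in> atlas M ==> U \<subseteq> points M"
 unfolding points_def by force

lemma ex_chart: "p \<in> points M ==> EX U \<phi>. (U, \<phi>) \<in> atlas M \<and> p \<in> U"
 unfolding points_def by force

lemma chart_open: assumes "(U, \<phi>) \<in> atlas M" shows "opn U"
 unfolding openin_mtop
proof (intro conjI)
 show "ALL (V, \<psi>):atlas M. open_coord (mdim M) (\<psi> ` (U \<inter> V))"
  using overlap_open[OF _ assms] by (auto simp: Int_commute)
qed (rule chart_subset[OF assms])

lemma openin_points: "opn (points M)"
proof -
 have "opn (\<Union> (fst ` atlas M))"
  using chart_open by (intro openin_Union) auto
 thus ?thesis by (simp add: points_def)
qed

lemma topspace_mtop: "topspace (mtop M) = points M"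
proof
 show "topspace (mtop M) \<subseteq> points M"
  using openin_topspace[of "mtop M"] unfolding openin_mtop by blast
 show "points M \<subseteq> topspace (mtop M)" using openin_points by (rule openin_subset)
qed

lemma openin_sub_points: "opn W ==> W \<subseteq> points M"
 using openin_subset topspace_mtop by metis

text \<open>One chart is enough because the transition maps are continuous.\<close>

lemma openin_chart:
 assumes U: "(U, \<phi>) \<in> atlas M" and W: "W \<subseteq> U"
 shows "opn W \<longleftrightarrow> open_coord (mdim M) (\<phi> ` W)"
proof
 assume "opn W"
 hence "open_coord (mdim M) (\<phi> ` (W \<inter> U))" using U unfolding openin_mtop by auto
 thus "open_coord (mdim M) (\<phi> ` W)" using W by (simp add: Int_absorb2)
next
 assume o: "open_coord (mdim M) (\<phi> ` W)"
 show "opn W"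
  unfolding openin_mtop
 proof (intro conjI, goal_cases)
  case 1 show ?case using W chart_subset[OF U] by auto
 next
  case 2 show ?case
  proof clarify
   fix V \<psi> assume V: "(V, \<psi>) \<in> atlas M"
   let ?S = "\<psi> ` (V \<inter> U)" let ?g = "%y. \<phi> (inv_into V \<psi> y)"
   have g: "continuous_on ?S ?g"
   proof (rule continuous_on_coords)
    show "?g y \<in> coord_space (mdim M)" if "y \<in> ?S" for y
     using that chart_coord[OF U] chart_inv[OF V] by auto
    show "continuous_on ?S (%y. ?g y i)" if "i < mdim M" for i
     using transition_smooth[OF V U that] by (rule smooth_coord_continuous)
   qed
   have "openin (top_of_set ?S) (?S \<inter> ?g -` (\<phi> ` W))"
   proof (rule continuous_openin_preimage[OF g _ o])
    show "?g \<in> ?S \<rightarrow> coord_space (mdim M)"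
     using chart_coord[OF U] chart_inv[OF V] by auto
   qed
   hence "open_coord (mdim M) (?S \<inter> ?g -` (\<phi> ` W))"
    using openin_trans overlap_open[OF V U] by blast
   moreover have "?S \<inter> ?g -` (\<phi> ` W) = \<psi> ` (W \<inter> V)"
   proof (intro equalityI subsetI)
    fix y assume y: "y \<in> ?S \<inter> ?g -` (\<phi> ` W)"
    then obtain p where p: "p \<in> V" "p \<in> U" "y = \<psi> p" by blast
    hence "\<phi> p \<in> \<phi> ` W" using y chart_inv[OF V p(1)] by simp
    hence "p \<in> W" using p(2) W inj_onD[OF chart_inj[OF U]] by blast
    thus "y \<in> \<psi> ` (W \<inter> V)" using p by blast
   next
    fix y assume "y \<in> \<psi> ` (W \<inter> V)"
    then obtain p where p: "p \<in> V" "p \<in> W" "y = \<psi> p" by blast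
    thus "y \<in> ?S \<inter> ?g -` (\<phi> ` W)" using W chart_inv[OF V p(1)] by auto
   qed
   ultimately show "open_coord (mdim M) (\<psi> ` (W \<inter> V))" by simp
  qed
 qed
qed

lemma eventually_near:
 "p \<in> points M ==> eventually P (near p) \<longleftrightarrow> (EX S. opn S \<and> p \<in> S \<and> (ALL x:S. P x))"
 by (simp add: eventually_nhdsin topspace_mtop)

lemma eventually_nearI:
 "opn S ==> p \<in> S ==> (!!x. x \<in> S ==> P x) ==> eventually P (near p)"
 by (auto simp: eventually_nhdsin)

lemma eventually_nearE:
 assumes "eventually P (near p)" "p \<in> points M"
 obtains S where "opn S" "p \<in> S" "!!x. x \<in> S ==> P x"
 using assms eventually_near by auto

lemma eventually_near_self: "eventually P (near p) ==> p \<in> points M ==> P p"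
 by (auto simp: eventually_near)

lemma eventually_in_open: "opn S ==> p \<in> S ==> eventually (%x. x \<in> S) (near p)"
 by (rule eventually_nearI)

lemma near_chart:
 assumes "eventually P (near p)" "(U, \<phi>) \<in> atlas M" "p \<in> U"
 obtains W where "opn W" "p \<in> W" "W \<subseteq> U" "open_coord (mdim M) (\<phi> ` W)"
  "!!x. x \<in> W ==> P x"
proof -
 obtain S where S: "opn S" "p \<in> S" "!!x. x \<in> S ==> P x"
  using eventually_nearE[OF assms(1)] chart_subset[OF assms(2)] assms(3) by blast
 have "opn (S \<inter> U)" using S(1) chart_open[OF assms(2)] by (rule openin_Int)
 moreover from this have "open_coord (mdim M) (\<phi> ` (S \<inter> U))"
  using openin_chart[OF assms(2), of "S \<inter> U"] by simp
 ultimately show thesis using S assms(3) by (intro that[of "S \<inter> U"]) auto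
qed

subsection \<open>Smooth functions\<close>

text \<open>Composition with the transition maps carries smoothness from one chart to all the
  others.\<close>

lemma smooth_fun_chartI:
 assumes U: "(U, \<phi>) \<in> atlas M" and W: "W \<subseteq> U" "opn W"
  and f: "smooth_coord (mdim M) (\<phi> ` W) (f \<circ> inv_into U \<phi>)"
 shows "smooth_fun M W f"
 unfolding smooth_fun_def
proof (intro conjI)
 show "ALL (V, \<psi>):atlas M. smooth_coord (mdim M) (\<psi> ` (W \<inter> V)) (f \<circ> inv_into V \<psi>)"
 proof clarify
  fix V \<psi> assume V: "(V, \<psi>) \<in> atlas M"
  let ?g = "%y. \<phi> (inv_into V \<psi> y)" let ?S = "\<psi> ` (W \<inter> V)"
  have S: "open_coord (mdim M) ?S"
   using W(2) V unfolding openin_mtop by auto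
  have "smooth_coord (mdim M) ?S (%y. (f \<circ> inv_into U \<phi>) (?g y))"
  proof (rule smooth_coord_comp[where f = "f \<circ> inv_into U \<phi>" and g = ?g, OF S])
   show "open_coord (mdim M) (\<phi> ` W)" using openin_chart[OF U W(1)] W(2) by simp
   show "?g y \<in> \<phi> ` W" if "y \<in> ?S" for y
    using that chart_inv[OF V] by auto
   show "smooth_coord (mdim M) ?S (%y. ?g y i)" if "i < mdim M" for i
    using transition_smooth[OF V U that] by (rule smooth_coord_subset) (use W(1) in auto)
  qed (rule f)
  thus "smooth_coord (mdim M) ?S (f \<circ> inv_into V \<psi>)"
  proof (rule smooth_coord_cong[OF S, rotated])
   fix y assume "y \<in> ?S"
   then obtain p where p: "p \<in> W" "p \<in> V" "y = \<psi> p" by blast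
   thus "(f \<circ> inv_into U \<phi>) (?g y) = (f \<circ> inv_into V \<psi>) y"
    using W(1) chart_inv[OF V p(2)] chart_inv[OF U, of p] by auto
  qed
 qed
qed (rule W(2))

lemma smooth_near_iff:
 assumes U: "(U, \<phi>) \<in> atlas M" and p: "p \<in> U"
 shows "smooth p f \<longleftrightarrow> (EX W. opn W \<and> p \<in> W \<and> W \<subseteq> U \<and>
  open_coord (mdim M) (\<phi> ` W) \<and> smooth_coord (mdim M) (\<phi> ` W) (f \<circ> inv_into U \<phi>))"
proof
 assume "smooth p f"
 then obtain W where W: "p \<in> W" "smooth_fun M W f" unfolding smooth_near_def by blast
 have o: "opn (W \<inter> U)"
  using W(2) chart_open[OF U] unfolding smooth_fun_def by (intro openin_Int) auto
 have "smooth_coord (mdim M) (\<phi> ` (W \<inter> U)) (f \<circ> inv_into U \<phi>)"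
  using W(2) U unfolding smooth_fun_def by auto
 moreover have "open_coord (mdim M) (\<phi> ` (W \<inter> U))"
  using o openin_chart[OF U, of "W \<inter> U"] by simp
 ultimately show "EX W. opn W \<and> p \<in> W \<and> W \<subseteq> U \<and>
  open_coord (mdim M) (\<phi> ` W) \<and> smooth_coord (mdim M) (\<phi> ` W) (f \<circ> inv_into U \<phi>)"
  using o W(1) p by (intro exI[of _ "W \<inter> U"]) simp
next
 assume "EX W. opn W \<and> p \<in> W \<and> W \<subseteq> U \<and>
  open_coord (mdim M) (\<phi> ` W) \<and> smooth_coord (mdim M) (\<phi> ` W) (f \<circ> inv_into U \<phi>)"
 then obtain W where W: "opn W" "p \<in> W" "W \<subseteq> U"
  "smooth_coord (mdim M) (\<phi> ` W) (f \<circ> inv_into U \<phi>)" by blast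
 from smooth_fun_chartI[OF U W(3,1,4)] W(2) show "smooth p f"
  unfolding smooth_near_def by blast
qed

lemma smooth_near_chartE:
 assumes "smooth p f" "(U, \<phi>) \<in> atlas M" "p \<in> U"
 obtains W where "opn W" "p \<in> W" "W \<subseteq> U" "open_coord (mdim M) (\<phi> ` W)"
  "smooth_coord (mdim M) (\<phi> ` W) (f \<circ> inv_into U \<phi>)"
 using assms smooth_near_iff by metis

lemma smooth_near_points: "smooth p f ==> p \<in> points M"
 unfolding smooth_near_def smooth_fun_def using openin_sub_points by blast

lemma smooth_fun_near: "smooth_fun M W f ==> p \<in> W ==> smooth p f"
 unfolding smooth_near_def by blast

lemma smooth_fun_open: "smooth_fun M W f ==> opn W"
 unfolding smooth_fun_def by blast

lemma smooth_funI:
 assumes W: "opn W" and f: "!!p. p \<in> W ==> smooth p f"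
 shows "smooth_fun M W f"
 unfolding smooth_fun_def
proof (intro conjI)
 show "ALL (U, \<phi>):atlas M. smooth_coord (mdim M) (\<phi> ` (W \<inter> U)) (f \<circ> inv_into U \<phi>)"
 proof clarify
  fix U \<phi> assume U: "(U, \<phi>) \<in> atlas M"
  show "smooth_coord (mdim M) (\<phi> ` (W \<inter> U)) (f \<circ> inv_into U \<phi>)"
  proof (rule smooth_coord_Union)
   fix y assume "y \<in> \<phi> ` (W \<inter> U)"
   then obtain p where p: "p \<in> W" "p \<in> U" "y = \<phi> p" by blast
   obtain S where S: "opn S" "p \<in> S" "S \<subseteq> U" "open_coord (mdim M) (\<phi> ` S)"
    "smooth_coord (mdim M) (\<phi> ` S) (f \<circ> inv_into U \<phi>)"
    using smooth_near_chartE[OF f[OF p(1)] U p(2)] by metis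
   have "opn (S \<inter> W)" using S(1) W by (rule openin_Int)
   hence "open_coord (mdim M) (\<phi> ` (S \<inter> W))"
    using openin_chart[OF U, of "S \<inter> W"] S(3) by auto
   moreover have "smooth_coord (mdim M) (\<phi> ` (S \<inter> W)) (f \<circ> inv_into U \<phi>)"
    using S(5) by (rule smooth_coord_subset) auto
   moreover have "y \<in> \<phi> ` (S \<inter> W)" "\<phi> ` (S \<inter> W) \<subseteq> \<phi> ` (W \<inter> U)"
    using S p by auto
   ultimately show "EX T. y \<in> T \<and> open_coord (mdim M) T \<and> T \<subseteq> \<phi> ` (W \<inter> U) \<and>
     smooth_coord (mdim M) T (f \<circ> inv_into U \<phi>)" by (intro exI conjI)
  qed
 qed
qed (rule W)

lemma smooth_near_cong:
 assumes f: "smooth p f" and e: "eventually (%x. f x = g x) (near p)"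
 shows "smooth p g"
proof -
 have p: "p \<in> points M" using smooth_near_points[OF f] .
 then obtain U \<phi> where U: "(U, \<phi>) \<in> atlas M" "p \<in> U" using ex_chart by blast
 obtain W where W: "opn W" "p \<in> W" "W \<subseteq> U"
  "smooth_coord (mdim M) (\<phi> ` W) (f \<circ> inv_into U \<phi>)"
  using smooth_near_chartE[OF f U] by metis
 obtain S where S: "opn S" "p \<in> S" "!!x. x \<in> S ==> f x = g x"
  using eventually_nearE[OF e p] by metis
 have o: "opn (W \<inter> S)" using W(1) S(1) by (rule openin_Int)
 hence oc: "open_coord (mdim M) (\<phi> ` (W \<inter> S))"
  using openin_chart[OF U(1), of "W \<inter> S"] W(3) by auto
 have "smooth_coord (mdim M) (\<phi> ` (W \<inter> S)) (f \<circ> inv_into U \<phi>)"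
  using W(4) by (rule smooth_coord_subset) auto
 hence "smooth_coord (mdim M) (\<phi> ` (W \<inter> S)) (g \<circ> inv_into U \<phi>)"
 proof (rule smooth_coord_cong[OF oc, rotated])
  fix y assume "y \<in> \<phi> ` (W \<inter> S)"
  then obtain x where x: "x \<in> W" "x \<in> S" "y = \<phi> x" by blast
  hence "x \<in> U" using W(3) by blast
  thus "(f \<circ> inv_into U \<phi>) y = (g \<circ> inv_into U \<phi>) y"
   using x S(3) chart_inv[OF U(1)] by simp
 qed
 thus ?thesis
  unfolding smooth_near_iff[OF U] using o oc W S by (intro exI[of _ "W \<inter> S"]) auto
qed

lemma smooth_near_eventually:
 assumes f: "smooth p f" shows "eventually (%x. smooth x f) (near p)"
proof -
 obtain W where "p \<in> W" "smooth_fun M W f" using f unfolding smooth_near_def by blast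
 thus ?thesis
  by (intro eventually_nearI[of W]) (auto intro: smooth_fun_near smooth_fun_open)
qed

text \<open>A common neighbourhood on which all \<open>g j\<close> are smooth and their joint values
  stay in \<open>V\<close>. It serves both the composition of smooth functions and the chain rule
  for tangent vectors. Padding by 0 makes the \<open>m\<close> values a point of
  \<open>coord_space m\<close>.\<close>

lemma comp_chart:
 assumes U: "(U, \<phi>) \<in> atlas M" "p \<in> U"
  and g: "ALL j<m. smooth p (g j)"
  and V: "open_coord m V" "(%j. if j < m then g j p else 0) \<in> V"
 shows "EX W. opn W \<and> p \<in> W \<and> W \<subseteq> U \<and> open_coord (mdim M) (\<phi> ` W) \<and>
  (ALL j<m. smooth_coord (mdim M) (\<phi> ` W) (g j \<circ> inv_into U \<phi>)) \<and>
  (ALL y:\<phi> ` W. (%j. if j < m then g j (inv_into U \<phi> y) else 0) \<in> V)"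
proof -
 have "EX W. opn W \<and> p \<in> W \<and> W \<subseteq> U \<and>
  open_coord (mdim M) (\<phi> ` W) \<and> smooth_coord (mdim M) (\<phi> ` W) (g j \<circ> inv_into U \<phi>)" if "j < m" for j
  using g[rule_format, OF that] smooth_near_iff[OF U] by blast
 then obtain W where W: "!!j. j < m ==> opn (W j)" "!!j. j < m ==> p \<in> W j"
  "!!j. j < m ==> smooth_coord (mdim M) (\<phi> ` W j) (g j \<circ> inv_into U \<phi>)" by metis
 define S where "S = U \<inter> (\<Inter>j\<in>{..<m}. W j)"
 have S: "opn S" "p \<in> S" "S \<subseteq> U" "!!j. j < m ==> S \<subseteq> W j"
 proof -
  have "opn (\<Inter> (insert U (W ` {..<m})))"
   using W(1) chart_open[OF U(1)] by (intro openin_Inter) auto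
  thus "opn S" by (simp add: S_def)
 qed (use W(2) U(2) in \<open>auto simp: S_def\<close>)
 have oS: "open_coord (mdim M) (\<phi> ` S)" using openin_chart[OF U(1) S(3)] S(1) by simp
 have gS: "smooth_coord (mdim M) (\<phi> ` S) (g j \<circ> inv_into U \<phi>)" if "j < m" for j
  using W(3)[OF that] by (rule smooth_coord_subset) (use S(4)[OF that] in auto)
 let ?H = "%y j. if j < m then g j (inv_into U \<phi> y) else 0"
 have H: "continuous_on (\<phi> ` S) ?H"
 proof (rule continuous_on_coords)
  show "?H y \<in> coord_space m" for y by (simp add: coord_space_def)
  show "continuous_on (\<phi> ` S) (%y. ?H y j)" if "j < m" for j
   using smooth_coord_continuous[OF gS[OF that]] that by (simp add: o_def)
 qed
 have "openin (top_of_set (\<phi> ` S)) (\<phi> ` S \<inter> ?H -` V)"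
  by (rule continuous_openin_preimage[OF H _ V(1)]) (simp add: coord_space_def)
 hence oc: "open_coord (mdim M) (\<phi> ` S \<inter> ?H -` V)" using oS by (rule openin_trans)
 define W' where "W' = {x \<in> S. ?H (\<phi> x) \<in> V}"
 have im: "\<phi> ` W' = \<phi> ` S \<inter> ?H -` V" by (auto simp: W'_def)
 have W'U: "W' \<subseteq> U" "W' \<subseteq> S" using S(3) by (auto simp: W'_def)
 show ?thesis
 proof (intro exI conjI allI impI ballI)
  show "opn W'" using openin_chart[OF U(1) W'U(1)] oc im by simp
  show "p \<in> W'" using S(2) V(2) chart_inv[OF U] by (simp add: W'_def cong: if_cong)
  show "open_coord (mdim M) (\<phi> ` W')" using oc im by simp
  show "smooth_coord (mdim M) (\<phi> ` W') (g j \<circ> inv_into U \<phi>)" if "j < m" for j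
   using gS[OF that] by (rule smooth_coord_subset) (use W'U in auto)
  show "?H y \<in> V" if "y \<in> \<phi> ` W'" for y using that im by blast
 qed (rule W'U)
qed

text \<open>The source of the closure rules: constants are the case \<open>m = 0\<close>, inverses
  \<open>m = 1\<close>, sums and products \<open>m = 2\<close>.\<close>

lemma smooth_near_comp:
 assumes p: "p \<in> points M" and g: "ALL j<m. smooth p (g j)"
  and V: "open_coord m V" "(%j. if j < m then g j p else 0) \<in> V" and G: "smooth_coord m V G"
 shows "smooth p (%x. G (%j. if j < m then g j x else 0))"
proof -
 obtain U \<phi> where U: "(U, \<phi>) \<in> atlas M" "p \<in> U" using ex_chart[OF p] by blast
 obtain W where W: "opn W" "p \<in> W" "W \<subseteq> U" "open_coord (mdim M) (\<phi> ` W)"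
  "ALL j<m. smooth_coord (mdim M) (\<phi> ` W) (g j \<circ> inv_into U \<phi>)"
  "ALL y:\<phi> ` W. (%j. if j < m then g j (inv_into U \<phi> y) else 0) \<in> V"
  using comp_chart[where g = g, OF U g V] by (elim exE conjE) (rule that)
 let ?H = "%y j. if j < m then g j (inv_into U \<phi> y) else 0"
 have "smooth_coord (mdim M) (\<phi> ` W) (%y. G (?H y))"
 proof (rule smooth_coord_comp[where f = G and g = ?H, OF W(4) V(1) _ G])
  show "?H y \<in> V" if "y \<in> \<phi> ` W" for y using W(6) that by (rule bspec)
  show "smooth_coord (mdim M) (\<phi> ` W) (%y. ?H y j)" if "j < m" for j
   using W(5)[rule_format, OF that] that by (simp add: o_def)
 qed
 thus ?thesis
  unfolding smooth_near_iff[OF U] using W(1-4) by (intro exI[of _ W]) (simp add: o_def)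
qed

lemma smooth_near_const: "p \<in> points M ==> smooth p (%x. c)"
 using smooth_near_comp[of p 0 "%_ _. 0" "coord_space 0" "%_. c"]
 by (simp add: smooth_coord_const coord_space_def)

lemma smooth_near_add:
 assumes "smooth p f" "smooth p g" shows "smooth p (%x. f x + g x)"
proof -
 have "smooth p (%x. (%y. y 0 + y 1) (%j::nat. if j < 2 then (if j = 0 then f else g) x else 0))"
  by (rule smooth_near_comp[where V = "coord_space 2" and m = 2 and G = "%y. y 0 + y 1"
     and g = "%j. if j = 0 then f else g"])
   (use assms smooth_near_points[OF assms(1)] in
    \<open>auto simp: coord_space_def intro!: smooth_coord_add smooth_coord_proj\<close>)
 thus ?thesis by simp
qed

lemma smooth_near_mult:
 assumes "smooth p f" "smooth p g" shows "smooth p (%x. f x * g x)"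
proof -
 have "smooth p (%x. (%y. y 0 * y 1) (%j::nat. if j < 2 then (if j = 0 then f else g) x else 0))"
  by (rule smooth_near_comp[where V = "coord_space 2" and m = 2 and G = "%y. y 0 * y 1"
     and g = "%j. if j = 0 then f else g"])
   (use assms smooth_near_points[OF assms(1)] in
    \<open>auto simp: coord_space_def intro!: smooth_coord_mult smooth_coord_proj\<close>)
 thus ?thesis by simp
qed

lemma smooth_near_uminus:
 assumes "smooth p f" shows "smooth p (%x. - f x)"
 using smooth_near_mult[OF smooth_near_const[of p "-1"] assms] smooth_near_points[OF assms] by simp

lemma smooth_near_diff:
 assumes "smooth p f" "smooth p g" shows "smooth p (%x. f x - g x)"
 using smooth_near_add[OF assms(1) smooth_near_uminus[OF assms(2)]] by simp

lemma smooth_near_sum: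
 assumes "p \<in> points M" "!!i. i \<in> S ==> smooth p (f i)"
 shows "smooth p (%x. \<Sum>i\<in>S. f i x)"
 using assms(2)
 by (induction S rule: infinite_finite_induct)
  (auto intro: smooth_near_const[OF assms(1)] smooth_near_add)

lemma smooth_near_inverse:
 assumes f: "smooth p f" and nz: "f p \<noteq> 0" shows "smooth p (%x. inverse (f x))"
proof -
 let ?V = "{x \<in> coord_space 1. x 0 \<noteq> 0} :: (nat => 'k) set"
 have "open ((%x::nat => 'k. x 0) -` (- {0}))"
  by (intro open_vimage) auto
 moreover have "?V = coord_space 1 \<inter> (%x. x 0) -` (- {0})" by auto
 ultimately have V: "open_coord 1 ?V" unfolding openin_open by blast
 have "smooth p (%x. (%y. inverse (y 0)) (%j::nat. if j < 1 then f x else 0))"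
 proof (rule smooth_near_comp[where V = ?V and m = 1 and G = "%y. inverse (y 0)" and g = "%_. f", OF _ _ V])
  show "smooth_coord 1 ?V (%y. inverse (y 0))"
   by (intro smooth_coord_inverse V smooth_coord_proj) simp
 qed (use f nz smooth_near_points[OF f] in \<open>auto simp: coord_space_def\<close>)
 thus ?thesis by simp
qed

lemma smooth_near_chart_coord:
 assumes U: "(U, \<phi>) \<in> atlas M" "p \<in> U" and "i < mdim M"
 shows "smooth p (%x. \<phi> x i)"
proof -
 have "smooth_coord (mdim M) (\<phi> ` U) (%y. y i)"
  by (rule smooth_coord_proj[OF chart_image_open[OF U(1)]])
 hence "smooth_coord (mdim M) (\<phi> ` U) ((%x. \<phi> x i) \<circ> inv_into U \<phi>)"
  by (rule smooth_coord_cong[OF chart_image_open[OF U(1)], rotated]) (simp add: f_inv_into_f)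
 thus ?thesis
  unfolding smooth_near_iff[OF U]
  using chart_open[OF U(1)] chart_image_open[OF U(1)] U(2) by (intro exI[of _ U]) simp
qed

lemma chart_preimage_open:
 assumes U: "(U, \<phi>) \<in> atlas M" and A: "open A"
 shows "opn {x \<in> U. \<phi> x \<in> A}"
proof -
 have "\<phi> ` {x \<in> U. \<phi> x \<in> A} = \<phi> ` U \<inter> A" by auto
 moreover have "open_coord (mdim M) (\<phi> ` U \<inter> A)"
 proof -
  obtain T where "open T" "\<phi> ` U = coord_space (mdim M) \<inter> T"
   using chart_image_open[OF U] unfolding openin_open by blast
  hence "\<phi> ` U \<inter> A = coord_space (mdim M) \<inter> (T \<inter> A)" "open (T \<inter> A)" using A by auto
  thus ?thesis unfolding openin_open by blast
 qed
 ultimately show ?thesis using openin_chart[OF U, of "{x \<in> U. \<phi> x \<in> A}"] by auto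
qed

text \<open>A countable base of the space of functions on \<open>nat\<close>, pulled back along
  countably many charts that cover \<open>M\<close>, is a base of \<open>mtop M\<close>.\<close>

lemma second_countable_mtop:
 assumes C: "countable C" "C \<subseteq> atlas M" and cover: "points M \<subseteq> \<Union> (fst ` C)"
 shows "second_countable (mtop M)"
proof -
 obtain B :: "(nat => 'k) set set" where B: "countable B" "topological_basis B"
  using ex_countable_basis by blast
 define E where "E = (%((U, \<phi>), A). {x \<in> U. \<phi> x \<in> A}) ` (C \<times> B)"
 have "countable E" unfolding E_def using C(1) B(1) by simp
 moreover have "opn V" if V: "V \<in> E" for V
 proof -
  obtain U \<phi> A where "(U, \<phi>) \<in> C" "A \<in> B" "V = {x \<in> U. \<phi> x \<in> A}"
   using V unfolding E_def by auto
  thus ?thesis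
   using chart_preimage_open C(2) topological_basis_open[OF B(2)] by blast
 qed
 moreover have "EX V:E. x \<in> V \<and> V \<subseteq> W" if W: "opn W" and x: "x \<in> W" for W x
 proof -
  obtain U \<phi> where U: "(U, \<phi>) \<in> C" "x \<in> U"
   using cover openin_sub_points[OF W] x by fastforce
  have UM: "(U, \<phi>) \<in> atlas M" using U(1) C(2) by blast
  have "open_coord (mdim M) (\<phi> ` (W \<inter> U))"
   using W UM unfolding openin_mtop by auto
  then obtain T where T: "open T" "\<phi> ` (W \<inter> U) = coord_space (mdim M) \<inter> T"
   unfolding openin_open by blast
  have "\<phi> x \<in> T" using T(2) x U(2) by blast
  then obtain A where A: "A \<in> B" "\<phi> x \<in> A" "A \<subseteq> T"
   using topological_basisE[OF B(2) T(1)] by blast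
  have "{y \<in> U. \<phi> y \<in> A} \<subseteq> W"
  proof clarify
   fix y assume y: "y \<in> U" "\<phi> y \<in> A"
   hence "\<phi> y \<in> \<phi> ` (W \<inter> U)" using T(2) A(3) chart_coord[OF UM] by blast
   thus "y \<in> W" using inj_onD[OF chart_inj[OF UM]] y(1) by blast
  qed
  moreover have "{y \<in> U. \<phi> y \<in> A} \<in> E" unfolding E_def using U(1) A(1) by force
  moreover have "x \<in> {y \<in> U. \<phi> y \<in> A}" using U(2) A(2) by simp
  ultimately show ?thesis by (intro bexI[of _ "{y \<in> U. \<phi> y \<in> A}"] conjI)
 qed
 ultimately show ?thesis
  unfolding second_countable_def
 proof (intro exI[of _ E] conjI ballI allI impI)
  fix W x assume "opn W \<and> x \<in> W"
  hence "opn W" "x \<in> W" by simp_all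
  thus "EX V:E. x \<in> V \<and> V \<subseteq> W"
   by (rule \<open>!!x W. opn W ==> x \<in> W ==> EX V:E. x \<in> V \<and> V \<subseteq> W\<close>)
 qed
qed

end

section \<open>Tangent vectors and vector fields\<close>

text \<open>The value 0 on functions not smooth near \<open>p\<close> follows the convention of
  \<open>tangent_space\<close>, so that tangent vectors can be added and compared as plain
  functions.\<close>

definition coord_vec ::
  "('p, 'k::ground_field) mfd => 'p set => ('p => nat => 'k) => nat => 'p => ('p, 'k) tvec"
 where "coord_vec M U \<phi> i p =
  (%f. if smooth_near M p f then pderivative i (f \<circ> inv_into U \<phi>) (\<phi> p) else 0)"

declare Ck_coord.simps [simp del]

context mfold
begin

lemma tangent_space_coord_vec:
 "v \<in> TS p \<longleftrightarrow> (EX U \<phi> a. (U, \<phi>) \<in> atlas M \<and> p \<in> U \<and>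
  v = (\<Sum>i<mdim M. fscale (a i) (coord_vec M U \<phi> i p)))"
proof -
 have *: "(%f. if smooth p f
   then \<Sum>i<mdim M. a i * pderivative i (f \<circ> inv_into U \<phi>) (\<phi> p) else 0)
  = (\<Sum>i<mdim M. fscale (a i) (coord_vec M U \<phi> i p))" for U \<phi> a
  by (auto simp: fun_eq_iff sum_fun_apply coord_vec_def)
 show ?thesis unfolding tangent_space_def * by auto
qed

lemma coord_vec_tangent:
 assumes "(U, \<phi>) \<in> atlas M" "p \<in> U" "i < mdim M"
 shows "coord_vec M U \<phi> i p \<in> TS p"
proof -
 have "coord_vec M U \<phi> i p = (\<Sum>j<mdim M. fscale (if j = i then 1 else 0) (coord_vec M U \<phi> j p))"
 proof
  fix f
  have "(\<Sum>j<mdim M. (if j = i then 1 else 0) * coord_vec M U \<phi> j p f)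
    = (\<Sum>j<mdim M. if j = i then coord_vec M U \<phi> j p f else 0)"
   by (intro sum.cong) auto
  thus "coord_vec M U \<phi> i p f
    = (\<Sum>j<mdim M. fscale (if j = i then 1 else 0) (coord_vec M U \<phi> j p)) f"
   using assms(3) by (simp add: sum_fun_apply)
 qed
 thus ?thesis unfolding tangent_space_coord_vec using assms by (intro exI conjI)
qed

lemma coord_vec_cong:
 assumes U: "(U, \<phi>) \<in> atlas M" "p \<in> U" "i < mdim M" and e: "eventually (%x. f x = g x) (near p)"
 shows "coord_vec M U \<phi> i p f = coord_vec M U \<phi> i p g"
proof -
 have "smooth p f \<longleftrightarrow> smooth p g"
 proof
  show "smooth p g" if "smooth p f" using that e by (rule smooth_near_cong)
  have e': "eventually (%x. g x = f x) (near p)" using e by (rule eventually_mono) (rule sym)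
  show "smooth p f" if "smooth p g" using that e' by (rule smooth_near_cong)
 qed
 moreover obtain W where W: "opn W" "p \<in> W" "W \<subseteq> U" "open_coord (mdim M) (\<phi> ` W)"
  "!!x. x \<in> W ==> f x = g x"
  using near_chart[OF e U(1,2)] by metis
 have "pderivative i (f \<circ> inv_into U \<phi>) (\<phi> p) = pderivative i (g \<circ> inv_into U \<phi>) (\<phi> p)"
 proof (rule pderivative_cong[OF W(4) _ U(3)])
  show "\<phi> p \<in> \<phi> ` W" using W(2) by blast
  show "(f \<circ> inv_into U \<phi>) y = (g \<circ> inv_into U \<phi>) y" if "y \<in> \<phi> ` W" for y
   using that W(3,5) chart_inv[OF U(1)] by (auto simp: subset_iff)
 qed
 ultimately show ?thesis by (simp add: coord_vec_def)
qed

lemma tangent_cong: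
 assumes v: "v \<in> TS p" and e: "eventually (%x. f x = g x) (near p)"
 shows "v f = v g"
proof -
 obtain U \<phi> a where U: "(U, \<phi>) \<in> atlas M" "p \<in> U"
  and v: "v = (\<Sum>i<mdim M. fscale (a i) (coord_vec M U \<phi> i p))"
  using v unfolding tangent_space_coord_vec by blast
 show ?thesis
  unfolding v sum_fun_apply fscale_apply
  by (intro sum.cong refl arg_cong2[where f = "(*)"] coord_vec_cong[OF U _ e]) simp
qed

lemma tangent_nonsmooth: "v \<in> TS p ==> \<not> smooth p f ==> v f = 0"
 unfolding tangent_space_coord_vec by (auto simp: sum_fun_apply coord_vec_def)

text \<open>The counterpart of \<open>smooth_near_comp\<close> for derivatives: additivity, the
  Leibniz rule, the vanishing on constants and the change of chart are instances of it.\<close>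

lemma tangent_comp:
 assumes v: "v \<in> TS p" and p: "p \<in> points M" and g: "ALL j<m. smooth p (g j)"
  and V: "open_coord m V" "(%j. if j < m then g j p else 0) \<in> V" and G: "smooth_coord m V G"
 shows "v (%x. G (%j. if j < m then g j x else 0))
  = (\<Sum>j<m. pderivative j G (%j. if j < m then g j p else 0) * v (g j))"
proof -
 obtain U \<phi> a where U: "(U, \<phi>) \<in> atlas M" "p \<in> U"
  and v: "v = (\<Sum>i<mdim M. fscale (a i) (coord_vec M U \<phi> i p))"
  using v unfolding tangent_space_coord_vec by blast
 obtain W where W: "opn W" "p \<in> W" "W \<subseteq> U" "open_coord (mdim M) (\<phi> ` W)"
  "ALL j<m. smooth_coord (mdim M) (\<phi> ` W) (g j \<circ> inv_into U \<phi>)"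
  "ALL y:\<phi> ` W. (%j. if j < m then g j (inv_into U \<phi> y) else 0) \<in> V"
  using comp_chart[where g = g, OF U g V] by (elim exE conjE) (rule that)
 let ?F = "%x. G (%j. if j < m then g j x else 0)"
 let ?H = "%y j. if j < m then g j (inv_into U \<phi> y) else 0"
 have sF: "smooth p ?F" by (rule smooth_near_comp[OF p g V G])
 have Hp: "?H (\<phi> p) = (%j. if j < m then g j p else 0)"
  using chart_inv[OF U] by (simp cong: if_cong)
 have "coord_vec M U \<phi> i p ?F = (\<Sum>j<m. pderivative j G (%j. if j < m then g j p else 0)
   * coord_vec M U \<phi> i p (g j))" if i: "i < mdim M" for i
 proof -
  have "((%t. G (?H ((\<phi> p)(i := t)))) has_field_derivative
   (\<Sum>j<m. pderivative j G (?H (\<phi> p)) * pderivative i (%y. ?H y j) (\<phi> p))) (at (\<phi> p i))"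
  proof (rule has_field_derivative_comp[where f = G and g = ?H, OF W(4) V(1) _ _ _ _ i])
   show "Ck_coord m (Suc 0) V G" using G unfolding smooth_coord_def by blast
   show "?H y \<in> V" if "y \<in> \<phi> ` W" for y using W(6) that by (rule bspec)
   show "Ck_coord (mdim M) (Suc 0) (\<phi> ` W) (%y. ?H y j)" if "j < m" for j
    using W(5)[rule_format, OF that] that unfolding smooth_coord_def by (simp add: o_def)
   show "\<phi> p \<in> \<phi> ` W" using W(2) by blast
  qed
  hence "pderivative i (%y. G (?H y)) (\<phi> p)
   = (\<Sum>j<m. pderivative j G (?H (\<phi> p)) * pderivative i (%y. ?H y j) (\<phi> p))"
   by (rule pderivative_eqI)
  also have "\<dots> = (\<Sum>j<m. pderivative j G (%j. if j < m then g j p else 0)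
   * coord_vec M U \<phi> i p (g j))"
   unfolding Hp using g by (intro sum.cong) (auto simp: coord_vec_def o_def)
  finally show ?thesis using sF by (simp add: coord_vec_def o_def)
 qed
 hence "v ?F = (\<Sum>i<mdim M. \<Sum>j<m. a i *
   (pderivative j G (%j. if j < m then g j p else 0) * coord_vec M U \<phi> i p (g j)))"
  unfolding v by (simp add: sum_fun_apply sum_distrib_left)
 also have "\<dots> = (\<Sum>j<m. \<Sum>i<mdim M. a i *
   (pderivative j G (%j. if j < m then g j p else 0) * coord_vec M U \<phi> i p (g j)))"
  by (rule sum.swap)
 finally show ?thesis
  unfolding v by (simp add: sum_fun_apply sum_distrib_left mult_ac)
qed

text \<open>A tangent vector comes with some chart of its own. Near \<open>p\<close>,
  \<open>f\<close> is the function \<open>f \<circ> inv_into U \<phi>\<close> of the coordinates of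
  the given chart, so \<open>tangent_comp\<close> expands the vector in this chart instead.\<close>

lemma tangent_chart:
 assumes v: "v \<in> TS p" and U: "(U, \<phi>) \<in> atlas M" "p \<in> U"
 shows "v f = (\<Sum>j<mdim M. v (%x. \<phi> x j) * coord_vec M U \<phi> j p f)"
proof (cases "smooth p f")
 case False
 thus ?thesis using tangent_nonsmooth[OF v] by (simp add: coord_vec_def)
next
 case True
 have p: "p \<in> points M" by (rule smooth_near_points[OF True])
 obtain W where W: "opn W" "p \<in> W" "W \<subseteq> U" "open_coord (mdim M) (\<phi> ` W)"
  "smooth_coord (mdim M) (\<phi> ` W) (f \<circ> inv_into U \<phi>)"
  using smooth_near_chartE[OF True U] by metis
 let ?g = "%j x. \<phi> x j" let ?G = "f \<circ> inv_into U \<phi>"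
 have c: "(%j. if j < mdim M then \<phi> x j else 0) = \<phi> x" if "x \<in> U" for x
  using chart_coord[OF U(1) that] by (auto simp: coord_space_def)
 have "v f = v (%x. ?G (%j. if j < mdim M then ?g j x else 0))"
 proof (rule tangent_cong[OF v], rule eventually_nearI[OF W(1,2)])
  fix x assume "x \<in> W"
  hence x: "x \<in> U" using W(3) by blast
  show "f x = ?G (%j. if j < mdim M then ?g j x else 0)"
   unfolding c[OF x] using chart_inv[OF U(1) x] by simp
 qed
 also have "\<dots> = (\<Sum>j<mdim M. pderivative j ?G (%j. if j < mdim M then ?g j p else 0) * v (?g j))"
 proof (rule tangent_comp[where g = ?g and G = ?G, OF v p _ W(4) _ W(5)])
  show "ALL j<mdim M. smooth p (?g j)"
   using smooth_near_chart_coord[OF U] by blast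
  show "(%j. if j < mdim M then ?g j p else 0) \<in> \<phi> ` W" unfolding c[OF U(2)] using W(2) by blast
 qed
 also have "\<dots> = (\<Sum>j<mdim M. v (%x. \<phi> x j) * coord_vec M U \<phi> j p f)"
  unfolding c[OF U(2)] using True by (simp add: coord_vec_def mult.commute)
 finally show ?thesis .
qed

lemma tangent_expand:
 assumes "v \<in> TS p" "(U, \<phi>) \<in> atlas M" "p \<in> U"
 shows "v = (\<Sum>j<mdim M. fscale (v (%x. \<phi> x j)) (coord_vec M U \<phi> j p))"
 unfolding fun_eq_iff sum_fun_apply fscale_apply by (intro allI tangent_chart[OF assms])

lemma tangent_spaceI:
 assumes "(U, \<phi>) \<in> atlas M" "p \<in> U"
 shows "(\<Sum>j<mdim M. fscale (a j) (coord_vec M U \<phi> j p)) \<in> TS p"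
 unfolding tangent_space_coord_vec using assms by blast

lemma coord_vec_coord:
 assumes U: "(U, \<phi>) \<in> atlas M" "p \<in> U" and i: "i < mdim M" and j: "j < mdim M"
 shows "coord_vec M U \<phi> i p (%x. \<phi> x j) = (if i = j then 1 else 0)"
proof -
 have o: "open_coord (mdim M) (\<phi> ` U)" by (rule chart_image_open[OF U(1)])
 have "pderivative i ((%x. \<phi> x j) \<circ> inv_into U \<phi>) (\<phi> p) = pderivative i (%y. y j) (\<phi> p)"
  by (rule pderivative_cong[OF o _ i]) (use U(2) in \<open>auto simp: f_inv_into_f\<close>)
 also have "\<dots> = (if i = j then 1 else 0)"
  by (rule pderivative_eqI) auto
 finally show ?thesis
  using smooth_near_chart_coord[OF U j] by (simp add: coord_vec_def)
qed

lemma coord_vec_sum_coord: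
 assumes U: "(U, \<phi>) \<in> atlas M" "p \<in> U" and j: "j < mdim M"
 shows "(\<Sum>i<mdim M. fscale (a i) (coord_vec M U \<phi> i p)) (%x. \<phi> x j) = a j"
proof -
 have "(\<Sum>i<mdim M. fscale (a i) (coord_vec M U \<phi> i p)) (%x. \<phi> x j)
   = (\<Sum>i<mdim M. if i = j then a i else 0)"
  unfolding sum_fun_apply using coord_vec_coord[OF U _ j] by (intro sum.cong) auto
 thus ?thesis using j by simp
qed

lemma tangent_eqI:
 assumes "u \<in> TS p" "v \<in> TS p" "(U, \<phi>) \<in> atlas M" "p \<in> U"
  "!!i. i < mdim M ==> u (%x. \<phi> x i) = v (%x. \<phi> x i)"
 shows "u = v"
proof -
 have "(\<Sum>j<mdim M. fscale (u (%x. \<phi> x j)) (coord_vec M U \<phi> j p))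
   = (\<Sum>j<mdim M. fscale (v (%x. \<phi> x j)) (coord_vec M U \<phi> j p))"
  using assms(5) by (intro sum.cong refl arg_cong2[where f = fscale]) simp
 thus ?thesis
  unfolding tangent_expand[OF assms(1,3,4), symmetric] tangent_expand[OF assms(2,3,4), symmetric] .
qed

lemma tangent_add: 
 assumes "u \<in> TS p" "v \<in> TS p" shows "u + v \<in> TS p"
proof -
 obtain U \<phi> where U: "(U, \<phi>) \<in> atlas M" "p \<in> U"
  using assms(1) unfolding tangent_space_coord_vec by blast
 have "u + v = (\<Sum>j<mdim M. fscale (u (%x. \<phi> x j) + v (%x. \<phi> x j)) (coord_vec M U \<phi> j p))"
  unfolding fun_eq_iff sum_fun_apply fscale_apply plus_fun_apply distrib_right sum.distrib
  by (intro allI arg_cong2[where f = "(+)"] tangent_chart assms U)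
 thus ?thesis using tangent_spaceI[OF U] by simp
qed

lemma tangent_scale: 
 assumes "u \<in> TS p" shows "fscale c u \<in> TS p"
proof -
 obtain U \<phi> where U: "(U, \<phi>) \<in> atlas M" "p \<in> U"
  using assms(1) unfolding tangent_space_coord_vec by blast
 have "fscale c u = (\<Sum>j<mdim M. fscale (c * u (%x. \<phi> x j)) (coord_vec M U \<phi> j p))"
  unfolding fun_eq_iff sum_fun_apply fscale_apply mult.assoc sum_distrib_left[symmetric]
  by (intro allI arg_cong2[where f = "(*)"] refl tangent_chart assms U)
 thus ?thesis using tangent_spaceI[OF U] by simp
qed

lemma tangent_zero: assumes "p \<in> points M" shows "0 \<in> TS p"
proof -
 obtain U \<phi> where U: "(U, \<phi>) \<in> atlas M" "p \<in> U" using ex_chart[OF assms] by blast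
 show ?thesis using tangent_spaceI[OF U, of "%_. 0"] by simp
qed

lemma tangent_subspace: "p \<in> points M ==> fv.subspace (TS p)"
 by (simp add: fv.subspace_def tangent_zero tangent_add tangent_scale)

lemma tangent_point: "v \<in> TS p ==> p \<in> points M"
 unfolding tangent_space_coord_vec using chart_subset by blast

lemma tangent_const:
 assumes v: "v \<in> TS p" shows "v (%x. c) = 0"
proof -
 have p: "p \<in> points M" by (rule tangent_point[OF v])
 have "v (%x. (%_. c) (%j::nat. if j < 0 then (%_. 0) x else 0))
  = (\<Sum>j<(0::nat). pderivative j (%_. c) (%j::nat. if j < 0 then (%_. 0) p else 0) * v (%_. 0))"
  by (rule tangent_comp[where g = "%_ _. 0" and V = "coord_space 0", OF v p])
   (auto simp: coord_space_def smooth_coord_const)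
 thus ?thesis by simp
qed

lemma tangent_plus:
 assumes v: "v \<in> TS p" and f: "smooth p f" "smooth p g"
 shows "v (%x. f x + g x) = v f + v g"
proof -
 have p: "p \<in> points M" by (rule tangent_point[OF v])
 let ?g = "%j. if j = 0 then f else g" let ?G = "%y::nat => 'k. y 0 + y 1"
 have d: "pderivative 0 ?G y = 1" "pderivative 1 ?G y = 1" for y
  by (rule pderivative_eqI, auto intro!: derivative_eq_intros)+
 have "v (%x. ?G (%j::nat. if j < 2 then ?g j x else 0))
  = (\<Sum>j<(2::nat). pderivative j ?G (%j::nat. if j < 2 then ?g j p else 0) * v (?g j))"
  by (rule tangent_comp[where g = ?g and G = ?G and V = "coord_space 2", OF v p])
   (use f in \<open>auto simp: coord_space_def intro!: smooth_coord_add smooth_coord_proj\<close>)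
 thus ?thesis using d by (simp add: numeral_2_eq_2)
qed

lemma tangent_mult:
 assumes v: "v \<in> TS p" and f: "smooth p f" "smooth p g"
 shows "v (%x. f x * g x) = v f * g p + f p * v g"
proof -
 have p: "p \<in> points M" by (rule tangent_point[OF v])
 let ?g = "%j. if j = 0 then f else g" let ?G = "%y::nat => 'k. y 0 * y 1"
 have d: "pderivative 0 ?G y = y 1" "pderivative 1 ?G y = y 0" for y
  by (rule pderivative_eqI, auto intro!: derivative_eq_intros)+
 have "v (%x. ?G (%j::nat. if j < 2 then ?g j x else 0))
  = (\<Sum>j<(2::nat). pderivative j ?G (%j::nat. if j < 2 then ?g j p else 0) * v (?g j))"
  by (rule tangent_comp[where g = ?g and G = ?G and V = "coord_space 2", OF v p])
   (use f in \<open>auto simp: coord_space_def intro!: smooth_coord_mult smooth_coord_proj\<close>)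
 thus ?thesis using d by (simp add: numeral_2_eq_2 mult.commute)
qed

lemma tangent_cmult:
 assumes "v \<in> TS p" "smooth p f" shows "v (%x. c * f x) = c * v f"
 using tangent_mult[OF assms(1) smooth_near_const[OF tangent_point[OF assms(1)]] assms(2)]
  tangent_const[OF assms(1)] by simp

lemma tangent_minus:
 assumes "v \<in> TS p" "smooth p f" shows "v (%x. - f x) = - v f"
 using tangent_cmult[OF assms, of "-1"] by simp

lemma tangent_diff:
 assumes "v \<in> TS p" "smooth p f" "smooth p g"
 shows "v (%x. f x - g x) = v f - v g"
 using tangent_plus[OF assms(1,2) smooth_near_uminus[OF assms(3)]] tangent_minus[OF assms(1,3)] by simp

lemma tangent_sum:
 assumes v: "v \<in> TS p"
 shows "(!!i. i \<in> S ==> smooth p (f i)) ==> v (%x. \<Sum>i\<in>S. f i x) = (\<Sum>i\<in>S. v (f i))"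
proof (induction S rule: infinite_finite_induct)
 case (insert i S)
 have "v (%x. f i x + (\<Sum>i\<in>S. f i x)) = v (f i) + v (%x. \<Sum>i\<in>S. f i x)"
  using insert.prems by (intro tangent_plus[OF v] smooth_near_sum tangent_point[OF v]) auto
 thus ?case using insert by simp
qed (simp_all add: tangent_const[OF v])

subsection \<open>Vector fields\<close>

lemma vector_field_open: "vector_field M U X ==> opn U"
 unfolding vector_field_def by blast

lemma vector_field_tangent: "vector_field M U X ==> p \<in> U ==> X p \<in> TS p"
 unfolding vector_field_def by blast

lemma vector_field_smooth:
 assumes X: "vector_field M U X" and p: "p \<in> U" and f: "smooth p f"
 shows "smooth p (%x. X x f)"
proof -
 obtain W where W: "p \<in> W" "smooth_fun M W f" using f unfolding smooth_near_def by blast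
 have o: "opn (W \<inter> U)"
  using smooth_fun_open[OF W(2)] vector_field_open[OF X] by (rule openin_Int)
 have "smooth_fun M (W \<inter> U) f"
  using o by (rule smooth_funI) (use smooth_fun_near[OF W(2)] in blast)
 hence "smooth_fun M (W \<inter> U) (%x. X x f)"
  using X unfolding vector_field_def by simp
 thus ?thesis by (rule smooth_fun_near) (use W(1) p in blast)
qed

lemma smooth_near_coord_vec:
 assumes U: "(U, \<phi>) \<in> atlas M" "p \<in> U" and f: "smooth p f" and i: "i < mdim M"
 shows "smooth p (%x. coord_vec M U \<phi> i x f)"
proof -
 obtain W where W: "opn W" "p \<in> W" "W \<subseteq> U" "open_coord (mdim M) (\<phi> ` W)"
  "smooth_coord (mdim M) (\<phi> ` W) (f \<circ> inv_into U \<phi>)"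
  using smooth_near_chartE[OF f U] by metis
 have sf: "smooth x f" if "x \<in> W" for x
  using smooth_fun_chartI[OF U(1) W(3,1,5)] that by (rule smooth_fun_near)
 have "smooth_coord (mdim M) (\<phi> ` W) (pderivative i (f \<circ> inv_into U \<phi>))"
  using W(5) i by (rule smooth_coord_pderivative)
 hence "smooth_coord (mdim M) (\<phi> ` W) ((%x. coord_vec M U \<phi> i x f) \<circ> inv_into U \<phi>)"
 proof (rule smooth_coord_cong[OF W(4), rotated])
  fix y assume "y \<in> \<phi> ` W"
  then obtain x where x: "x \<in> W" "y = \<phi> x" by blast
  hence "inv_into U \<phi> y = x" using W(3) chart_inv[OF U(1)] by auto
  thus "pderivative i (f \<circ> inv_into U \<phi>) y = ((%x. coord_vec M U \<phi> i x f) \<circ> inv_into U \<phi>) y"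
   using x sf by (simp add: coord_vec_def)
 qed
 thus ?thesis unfolding smooth_near_iff[OF U] using W(1-4) by blast
qed

text \<open>By \<open>tangent_chart\<close>, the derivative of any function is a combination of
  derivatives of coordinates with smooth coefficients. So smoothness needs a check only on the
  coordinates of one chart around each point.\<close>

lemma vector_fieldI:
 assumes U: "opn U" and X: "!!p. p \<in> U ==> X p \<in> TS p"
  and s: "!!p. p \<in> U ==> EX V \<psi>. (V, \<psi>) \<in> atlas M \<and> p \<in> V \<and>
   (ALL i<mdim M. smooth p (%x. X x (%y. \<psi> y i)))"
 shows "vector_field M U X"
 unfolding vector_field_def
proof (intro conjI ballI allI impI)
 fix W f assume Wf: "W \<subseteq> U \<and> smooth_fun M W f"
 show "smooth_fun M W (%p. X p f)"
 proof (rule smooth_funI)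
  show W: "opn W" using Wf smooth_fun_open by blast
  fix p assume p: "p \<in> W"
  hence f: "smooth p f" using Wf smooth_fun_near by blast
  have pU: "p \<in> U" using p Wf by blast
  obtain V \<psi> where V: "(V, \<psi>) \<in> atlas M" "p \<in> V"
   "ALL i<mdim M. smooth p (%x. X x (%y. \<psi> y i))" using s[OF pU] by blast
  have "smooth p (%x. \<Sum>j<mdim M. X x (%y. \<psi> y j) * coord_vec M V \<psi> j x f)"
   using V(3) smooth_near_coord_vec[OF V(1,2) f]
   by (intro smooth_near_sum smooth_near_mult smooth_near_points[OF f]) auto
  thus "smooth p (%x. X x f)"
  proof (rule smooth_near_cong)
   have "opn (U \<inter> V)" using U chart_open[OF V(1)] by (rule openin_Int)
   thus "eventually (%x. (\<Sum>j<mdim M. X x (%y. \<psi> y j) * coord_vec M V \<psi> j x f) = X x f) (near p)"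
    by (rule eventually_nearI) (use pU V(1,2) tangent_chart[OF X V(1)] in auto)
  qed
 qed
qed (use U X in auto)

lemma vector_field_coord_vec:
 assumes U: "(U, \<phi>) \<in> atlas M" and i: "i < mdim M"
 shows "vector_field M U (coord_vec M U \<phi> i)"
proof (rule vector_fieldI[OF chart_open[OF U]])
 show "coord_vec M U \<phi> i p \<in> TS p" if "p \<in> U" for p
  using coord_vec_tangent[OF U that i] .
 show "EX V \<psi>. (V, \<psi>) \<in> atlas M \<and> p \<in> V \<and>
   (ALL j<mdim M. smooth p (%x. coord_vec M U \<phi> i x (%y. \<psi> y j)))" if "p \<in> U" for p
  using U that smooth_near_coord_vec[OF U that smooth_near_chart_coord[OF U that] i] by blast
qed

lemma vector_field_subset:
 assumes "vector_field M U X" "opn W" "W \<subseteq> U" shows "vector_field M W X"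
 using assms unfolding vector_field_def by (meson order_trans subsetD)

lemma vector_field_lincomb:
 assumes U: "opn U" and X: "!!i. i \<in> S ==> vector_field M U (X i)"
  and f: "!!i p. i \<in> S ==> p \<in> U ==> smooth p (f i)"
 shows "vector_field M U (%p. \<Sum>i\<in>S. fscale (f i p) (X i p))"
proof (rule vector_fieldI[OF U])
 fix p assume p: "p \<in> U"
 have pM: "p \<in> points M" using openin_sub_points[OF U] p by blast
 show "(\<Sum>i\<in>S. fscale (f i p) (X i p)) \<in> TS p"
  by (intro fv.subspace_sum tangent_subspace[OF pM] tangent_scale vector_field_tangent[OF X p])
 obtain V \<psi> where V: "(V, \<psi>) \<in> atlas M" "p \<in> V" using ex_chart[OF pM] by blast
 have "smooth p (%x. (\<Sum>i\<in>S. fscale (f i x) (X i x)) (%y. \<psi> y j))" if "j < mdim M" for j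
  unfolding sum_fun_apply fscale_apply
  by (intro smooth_near_sum pM smooth_near_mult f p
    vector_field_smooth[OF X p smooth_near_chart_coord[OF V that]])
 thus "EX V \<psi>. (V, \<psi>) \<in> atlas M \<and> p \<in> V \<and>
   (ALL j<mdim M. smooth p (%x. (\<Sum>i\<in>S. fscale (f i x) (X i x)) (%y. \<psi> y j)))"
  using V by blast
qed

lemma vector_field_add:
 assumes X: "vector_field M U X" and Y: "vector_field M U Y"
 shows "vector_field M U (%p. X p + Y p)"
proof (rule vector_fieldI[OF vector_field_open[OF X]])
 fix p assume p: "p \<in> U"
 show "X p + Y p \<in> TS p"
  by (intro tangent_add vector_field_tangent[OF X p] vector_field_tangent[OF Y p])
 then obtain V \<psi> where V: "(V, \<psi>) \<in> atlas M" "p \<in> V" using ex_chart[OF tangent_point] by blast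
 have "smooth p (%x. (X x + Y x) (%y. \<psi> y j))" if "j < mdim M" for j
  unfolding plus_fun_apply
  by (intro smooth_near_add vector_field_smooth[OF X p] vector_field_smooth[OF Y p]
    smooth_near_chart_coord[OF V that])
 thus "EX V \<psi>. (V, \<psi>) \<in> atlas M \<and> p \<in> V \<and>
   (ALL j<mdim M. smooth p (%x. (X x + Y x) (%y. \<psi> y j)))"
  using V by blast
qed

subsection \<open>Lie brackets\<close>

lemma coord_vec_commute:
 assumes U: "(U, \<phi>) \<in> atlas M" "p \<in> U" and f: "smooth p f"
  and i: "i < mdim M" and j: "j < mdim M"
 shows "coord_vec M U \<phi> i p (%x. coord_vec M U \<phi> j x f)
  = coord_vec M U \<phi> j p (%x. coord_vec M U \<phi> i x f)"
proof -
 obtain W where W: "opn W" "p \<in> W" "W \<subseteq> U" "open_coord (mdim M) (\<phi> ` W)"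
  "smooth_coord (mdim M) (\<phi> ` W) (f \<circ> inv_into U \<phi>)"
  using smooth_near_chartE[OF f U] by metis
 have sf: "smooth x f" if "x \<in> W" for x
  using smooth_fun_chartI[OF U(1) W(3,1,5)] that by (rule smooth_fun_near)
 have pW: "\<phi> p \<in> \<phi> ` W" using W(2) by blast
 have *: "coord_vec M U \<phi> k p (%x. coord_vec M U \<phi> l x f)
   = pderivative k (pderivative l (f \<circ> inv_into U \<phi>)) (\<phi> p)"
  if k: "k < mdim M" and l: "l < mdim M" for k l
 proof -
  have "pderivative k ((%x. coord_vec M U \<phi> l x f) \<circ> inv_into U \<phi>) (\<phi> p)
    = pderivative k (pderivative l (f \<circ> inv_into U \<phi>)) (\<phi> p)"
  proof (rule pderivative_cong[OF W(4) pW k])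
   fix y assume "y \<in> \<phi> ` W"
   then obtain x where x: "x \<in> W" "y = \<phi> x" by blast
   hence "inv_into U \<phi> y = x" using W(3) chart_inv[OF U(1)] by auto
   thus "((%x. coord_vec M U \<phi> l x f) \<circ> inv_into U \<phi>) y = pderivative l (f \<circ> inv_into U \<phi>) y"
    using x sf by (simp add: coord_vec_def)
  qed
  thus ?thesis using smooth_near_coord_vec[OF U f l]
   by (simp add: coord_vec_def[of M U \<phi> k])
 qed
 have "Ck_coord (mdim M) 2 (\<phi> ` W) (f \<circ> inv_into U \<phi>)"
  using W(5) unfolding smooth_coord_def by blast
 from pderivative_commute[OF W(4) this pW i j] show ?thesis
  by (simp only: *[OF i j] *[OF j i])
qed

lemma vector_field_iterated:
 assumes X: "vector_field M U X" and Y: "vector_field M U Y" and p: "p \<in> U"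
  and V: "(V, \<psi>) \<in> atlas M" "p \<in> V" and f: "smooth p f"
 shows "X p (%x. Y x f) = (\<Sum>i<mdim M. X p (%x. Y x (%y. \<psi> y i)) * coord_vec M V \<psi> i p f)
  + (\<Sum>i<mdim M. \<Sum>j<mdim M. Y p (%y. \<psi> y i) * X p (%y. \<psi> y j)
    * coord_vec M V \<psi> j p (%x. coord_vec M V \<psi> i x f))"
proof -
 let ?y = "%i y. \<psi> y i" let ?d = "%i x. coord_vec M V \<psi> i x f"
 have Xp: "X p \<in> TS p" by (rule vector_field_tangent[OF X p])
 have o: "opn (U \<inter> V)"
  using vector_field_open[OF X] chart_open[OF V(1)] by (rule openin_Int)
 have sY: "smooth p (%x. Y x (?y i))" if "i < mdim M" for i
  by (rule vector_field_smooth[OF Y p smooth_near_chart_coord[OF V that]])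
 have sd: "smooth p (?d i)" if "i < mdim M" for i
  by (rule smooth_near_coord_vec[OF V f that])
 have "X p (%x. Y x f) = X p (%x. \<Sum>i<mdim M. Y x (?y i) * ?d i x)"
  by (rule tangent_cong[OF Xp], rule eventually_nearI[OF o])
   (use p V tangent_chart[OF vector_field_tangent[OF Y]] in auto)
 also have "\<dots> = (\<Sum>i<mdim M. X p (%x. Y x (?y i) * ?d i x))"
  using sY sd by (intro tangent_sum[OF Xp] smooth_near_mult) auto
 also have "\<dots> = (\<Sum>i<mdim M. X p (%x. Y x (?y i)) * ?d i p + Y p (?y i) * X p (?d i))"
  using sY sd by (intro sum.cong tangent_mult[OF Xp]) auto
 also have "\<dots> = (\<Sum>i<mdim M. X p (%x. Y x (?y i)) * ?d i p) +
   (\<Sum>i<mdim M. Y p (?y i) * (\<Sum>j<mdim M. X p (?y j) * coord_vec M V \<psi> j p (?d i)))"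
  unfolding sum.distrib
  by (intro arg_cong2[where f = "(+)"] sum.cong arg_cong2[where f = "(*)"] refl tangent_chart[OF Xp V])
 finally show ?thesis by (simp add: sum_distrib_left mult.assoc)
qed

text \<open>The second-order terms of the two iterated derivatives agree by
  \<open>coord_vec_commute\<close>, so only first-order terms remain; this is why the bracket is a
  tangent vector.\<close>

lemma lie_bracket_expand:
 assumes X: "vector_field M U X" and Y: "vector_field M U Y" and p: "p \<in> U"
  and V: "(V, \<psi>) \<in> atlas M" "p \<in> V"
 shows "lie_bracket M X Y p = (\<Sum>i<mdim M.
  fscale (X p (%x. Y x (%y. \<psi> y i)) - Y p (%x. X x (%y. \<psi> y i))) (coord_vec M V \<psi> i p))"
proof
 fix f
 let ?d = "%i x. coord_vec M V \<psi> i x f"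
 show "lie_bracket M X Y p f = (\<Sum>i<mdim M. fscale (X p (%x. Y x (%y. \<psi> y i))
   - Y p (%x. X x (%y. \<psi> y i))) (coord_vec M V \<psi> i p)) f"
 proof (cases "smooth p f")
  case True
  have "(\<Sum>i<mdim M. \<Sum>j<mdim M. Y p (%y. \<psi> y i) * X p (%y. \<psi> y j) * coord_vec M V \<psi> j p (?d i))
   = (\<Sum>j<mdim M. \<Sum>i<mdim M. Y p (%y. \<psi> y i) * X p (%y. \<psi> y j) * coord_vec M V \<psi> j p (?d i))"
   by (rule sum.swap)
  also have "\<dots> = (\<Sum>j<mdim M. \<Sum>i<mdim M. X p (%y. \<psi> y j) * Y p (%y. \<psi> y i) * coord_vec M V \<psi> i p (?d j))"
   using coord_vec_commute[OF V True] by (intro sum.cong) (auto simp: mult_ac)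
  finally have "X p (%x. Y x f) - Y p (%x. X x f) = (\<Sum>i<mdim M.
    X p (%x. Y x (%y. \<psi> y i)) * ?d i p) - (\<Sum>i<mdim M. Y p (%x. X x (%y. \<psi> y i)) * ?d i p)"
   unfolding vector_field_iterated[OF X Y p V True] vector_field_iterated[OF Y X p V True]
   by (simp add: mult_ac)
  thus ?thesis
   using True by (simp add: lie_bracket_def sum_fun_apply sum_subtractf left_diff_distrib)
 next
  case False
  thus ?thesis by (simp add: lie_bracket_def sum_fun_apply coord_vec_def)
 qed
qed

lemma lie_bracket_tangent:
 assumes X: "vector_field M U X" and Y: "vector_field M U Y" and p: "p \<in> U"
 shows "lie_bracket M X Y p \<in> TS p"
proof -
 obtain V \<psi> where V: "(V, \<psi>) \<in> atlas M" "p \<in> V"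
  using ex_chart[OF tangent_point[OF vector_field_tangent[OF X p]]] by blast
 show ?thesis unfolding lie_bracket_expand[OF X Y p V] by (rule tangent_spaceI[OF V])
qed

lemma lie_bracket_apply:
 "smooth p f ==> lie_bracket M X Y p f = X p (%x. Y x f) - Y p (%x. X x f)"
 by (simp add: lie_bracket_def)

lemma vector_field_lie_bracket:
 assumes X: "vector_field M U X" and Y: "vector_field M U Y"
 shows "vector_field M U (lie_bracket M X Y)"
proof (rule vector_fieldI[OF vector_field_open[OF X]])
 fix p assume p: "p \<in> U"
 show *: "lie_bracket M X Y p \<in> TS p" by (rule lie_bracket_tangent[OF X Y p])
 obtain V \<psi> where V: "(V, \<psi>) \<in> atlas M" "p \<in> V"
  using ex_chart[OF tangent_point[OF *]] by blast
 have "smooth p (%x. lie_bracket M X Y x (%y. \<psi> y i))" if i: "i < mdim M" for i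
 proof -
  have s: "smooth p (%y. \<psi> y i)" by (rule smooth_near_chart_coord[OF V i])
  have "smooth p (%x. X x (%z. Y z (%y. \<psi> y i)) - Y x (%z. X z (%y. \<psi> y i)))"
   by (intro smooth_near_diff vector_field_smooth[OF X p] vector_field_smooth[OF Y p] s)
  thus ?thesis
   by (rule smooth_near_cong)
    (use smooth_near_eventually[OF s] in \<open>rule eventually_mono, simp add: lie_bracket_apply\<close>)
 qed
 thus "EX V \<psi>. (V, \<psi>) \<in> atlas M \<and> p \<in> V \<and>
   (ALL i<mdim M. smooth p (%x. lie_bracket M X Y x (%y. \<psi> y i)))"
  using V by blast
qed

lemma lie_bracket_swap: "p \<in> points M ==> lie_bracket M X Y p = - lie_bracket M Y X p"
 by (auto simp: lie_bracket_def fun_eq_iff)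

subsection \<open>Smooth left inverses\<close>

text \<open>Elimination with smooth coefficients, by induction on the number of vectors
  \<open>Z i\<close>, whose components are indexed by \<open>a\<close>; a pivot that is nonzero at
  \<open>q\<close> stays nonzero nearby. Rectangular systems are wanted: frames have
  \<open>k\<close> vectors in \<open>n\<close> coordinates, and the smoothness of \<open>ell\<close>
  leads to \<open>n * n\<close> equations in \<open>n\<close> unknowns.\<close>

lemma smooth_left_inverse:
 fixes k :: nat and Z :: "nat => 's => 'p => 'k"
 assumes q: "q \<in> points M" and S: "finite S"
  and Z: "!!i a. i < k ==> a \<in> S ==> smooth q (Z i a)"
  and ind: "!!c. (!!a. a \<in> S ==> (\<Sum>i<k. c i * Z i a q) = 0) ==> ALL i<k. c i = (0::'k)"
 shows "EX B. (ALL l<k. ALL a:S. smooth q (B l a)) \<and>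
  eventually (%x. ALL l<k. ALL i<k. (\<Sum>a\<in>S. B l a x * Z i a x) = (if l = i then 1 else 0)) (near q)"
 using Z ind
proof (induction k)
 case 0
 thus ?case by simp
next
 case (Suc k)
 have ind': "ALL i<k. c i = 0" if c: "!!a. a \<in> S ==> (\<Sum>i<k. c i * Z i a q) = 0" for c :: "nat => 'k"
 proof -
  have "(\<Sum>i<Suc k. (if i < k then c i else 0) * Z i a q) = 0" if "a \<in> S" for a
   using c[OF that] by simp
  from Suc.prems(2)[of "%i. if i < k then c i else 0", OF this] show ?thesis
   by (metis less_Suc_eq)
 qed
 obtain B where B: "ALL l<k. ALL a:S. smooth q (B l a)"
  "eventually (%x. ALL l<k. ALL i<k. (\<Sum>a\<in>S. B l a x * Z i a x) = (if l = i then 1 else 0)) (near q)"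
  using Suc.IH[OF Suc.prems(1) ind'] by auto
 \<comment> \<open>\<open>u\<close> is \<open>Z k\<close> without its components along the earlier
   vectors. By independence at \<open>q\<close> some entry of it is nonzero there, and this entry
   becomes the pivot \<open>a0\<close>.\<close>
 define u where "u a x = Z k a x - (\<Sum>l<k. (\<Sum>b\<in>S. B l b x * Z k b x) * Z l a x)" for a x
 have su: "smooth q (u a)" if "a \<in> S" for a
  unfolding u_def using B(1) Suc.prems(1) that
  by (intro smooth_near_diff smooth_near_sum q smooth_near_mult) auto
 have "EX a:S. u a q \<noteq> 0"
 proof (rule ccontr)
  assume "\<not> ?thesis"
  hence u0: "u a q = 0" if "a \<in> S" for a using that by blast
  let ?c = "%i. if i = k then 1 else - (\<Sum>b\<in>S. B i b q * Z k b q)"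
  have "(\<Sum>i<Suc k. ?c i * Z i a q) = 0" if "a \<in> S" for a
   using u0[OF that] by (simp add: u_def sum_negf)
  from Suc.prems(2)[of ?c, OF this] show False by (auto dest: spec[of _ k])
 qed
 then obtain a0 where a0: "a0 \<in> S" "u a0 q \<noteq> 0" by blast
 \<comment> \<open>Removing the components along the earlier vectors, reading entry
   \<open>a0\<close> and dividing by the pivot gives a functional that kills \<open>Z i\<close> for
   \<open>i < k\<close> and is 1 on \<open>Z k\<close>. In \<open>B'\<close> it also corrects the
   earlier functionals, so that they vanish on \<open>Z k\<close>.\<close>
 define E where "E b x = ((if b = a0 then 1 else 0) - (\<Sum>l<k. Z l a0 x * B l b x)) * inverse (u a0 x)" for b x
 define B' where "B' l b x = (if l = k then E b x else B l b x - (\<Sum>c\<in>S. B l c x * Z k c x) * E b x)" for l b x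
 have sE: "smooth q (E b)" if "b \<in> S" for b
  unfolding E_def using B(1) Suc.prems(1) that a0 su
  by (intro smooth_near_mult smooth_near_inverse smooth_near_diff smooth_near_sum q smooth_near_const) auto
 have "smooth q (B' l b)" if "l < Suc k" "b \<in> S" for l b
 proof (cases "l = k")
  case True thus ?thesis using sE[OF that(2)] by (simp add: B'_def[abs_def])
 next
  case False
  hence "l < k" using that by simp
  hence "smooth q (%x. B l b x - (\<Sum>c\<in>S. B l c x * Z k c x) * E b x)"
   using B(1) Suc.prems(1) that sE by (intro smooth_near_diff smooth_near_mult smooth_near_sum q) auto
  thus ?thesis using False by (simp add: B'_def[abs_def])
 qed
 moreover have "eventually (%x. u a0 x \<noteq> 0) (near q)"
 proof -
  obtain U \<phi> where U: "(U, \<phi>) \<in> atlas M" "q \<in> U" using ex_chart[OF q] by blast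
  obtain W where W: "opn W" "q \<in> W" "W \<subseteq> U" "open_coord (mdim M) (\<phi> ` W)"
   "smooth_coord (mdim M) (\<phi> ` W) (u a0 \<circ> inv_into U \<phi>)"
   using smooth_near_chartE[OF su[OF a0(1)] U] by metis
  have "openin (top_of_set (\<phi> ` W)) (\<phi> ` W \<inter> (u a0 \<circ> inv_into U \<phi>) -` (- {0}))"
   using smooth_coord_continuous[OF W(5)] by (rule continuous_openin_preimage_gen) auto
  hence o: "open_coord (mdim M) (\<phi> ` W \<inter> (u a0 \<circ> inv_into U \<phi>) -` (- {0}))"
   using W(4) by (rule openin_trans)
  have inv: "inv_into U \<phi> (\<phi> x) = x" if "x \<in> W" for x
   using chart_inv[OF U(1)] that W(3) by blast
  have im: "\<phi> ` {x \<in> W. u a0 x \<noteq> 0} = \<phi> ` W \<inter> (u a0 \<circ> inv_into U \<phi>) -` (- {0})"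
   using inv by auto
  show ?thesis
  proof (rule eventually_nearI)
   show "opn {x \<in> W. u a0 x \<noteq> 0}"
    using openin_chart[OF U(1), of "{x \<in> W. u a0 x \<noteq> 0}"] o W(3) im by auto
  qed (use W(2) a0(2) in auto)
 qed
 with B(2) have "eventually (%x. ALL l<Suc k. ALL i<Suc k. (\<Sum>a\<in>S. B' l a x * Z i a x) = (if l = i then 1 else 0)) (near q)"
 proof eventually_elim
  case (elim x)
  have BZ: "(\<Sum>a\<in>S. B l a x * Z i a x) = (if l = i then 1 else 0)" if "l < k" "i < k" for l i
   using elim(1) that by blast
  have E: "(\<Sum>b\<in>S. E b x * Z i b x) = (Z i a0 x - (\<Sum>l<k. Z l a0 x * (\<Sum>b\<in>S. B l b x * Z i b x))) * inverse (u a0 x)"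
   for i
  proof -
   have "(\<Sum>b\<in>S. E b x * Z i b x) = (\<Sum>b\<in>S. ((if b = a0 then Z i b x else 0)
     - (\<Sum>l<k. Z l a0 x * (B l b x * Z i b x))) * inverse (u a0 x))"
    unfolding E_def by (intro sum.cong refl) (auto simp: algebra_simps sum_distrib_left sum_distrib_right)
   also have "\<dots> = ((\<Sum>b\<in>S. if b = a0 then Z i b x else 0)
     - (\<Sum>b\<in>S. \<Sum>l<k. Z l a0 x * (B l b x * Z i b x))) * inverse (u a0 x)"
    by (simp only: sum_distrib_right[symmetric] sum_subtractf)
   also have "(\<Sum>b\<in>S. if b = a0 then Z i b x else 0) = Z i a0 x"
    using S a0(1) by simp
   also have "(\<Sum>b\<in>S. \<Sum>l<k. Z l a0 x * (B l b x * Z i b x))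
     = (\<Sum>l<k. Z l a0 x * (\<Sum>b\<in>S. B l b x * Z i b x))"
    by (subst sum.swap) (simp add: sum_distrib_left)
   finally show ?thesis .
  qed
  have Ei: "(\<Sum>b\<in>S. E b x * Z i b x) = 0" if "i < k" for i
  proof -
   have "(\<Sum>l<k. Z l a0 x * (\<Sum>b\<in>S. B l b x * Z i b x)) = (\<Sum>l<k. if l = i then Z l a0 x else 0)"
    using BZ that by (intro sum.cong) auto
   thus ?thesis unfolding E using that by simp
  qed
  have Ek: "(\<Sum>b\<in>S. E b x * Z k b x) = 1"
   unfolding E using elim(2) by (simp add: u_def mult.commute)
  have B'k: "(\<Sum>a\<in>S. B' k a x * Z i a x) = (if k = i then 1 else 0)" if "i < Suc k" for i
   using Ei Ek that by (auto simp: B'_def less_Suc_eq)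
  have B'l: "(\<Sum>a\<in>S. B' l a x * Z i a x) = (if l = i then 1 else 0)" if "i < Suc k" "l < k" for i l
  proof -
   have "(\<Sum>a\<in>S. B' l a x * Z i a x) = (\<Sum>a\<in>S. B l a x * Z i a x)
     - (\<Sum>c\<in>S. B l c x * Z k c x) * (\<Sum>a\<in>S. E a x * Z i a x)"
    using that by (simp add: B'_def left_diff_distrib sum_subtractf sum_distrib_left mult.assoc)
   thus ?thesis
    using that BZ Ei Ek by (cases "i = k") auto
  qed
  show ?case using B'k B'l by (auto simp: less_Suc_eq)
 qed
 ultimately show ?case by blast
qed

end

section \<open>Linear algebra in function spaces\<close>

lemma span_image_lessThan:
 fixes X :: "nat => 'a => 'k::field"
 shows "fv.span (X ` {..<k}) = range (%c. \<Sum>i<k. fscale (c i) (X i))"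
proof (intro equalityI fv.span_minimal)
 show "X ` {..<k} \<subseteq> range (%c. \<Sum>i<k. fscale (c i) (X i))"
 proof clarify
  fix i assume "i < k"
  hence "X i = (\<Sum>j<k. fscale (if j = i then 1 else 0) (X j))"
   by (simp add: if_distrib[of "%c. fscale c _"] cong: if_cong)
  thus "X i \<in> range (%c. \<Sum>i<k. fscale (c i) (X i))" by (intro range_eqI)
 qed
 show "fv.subspace (range (%c. \<Sum>i<k. fscale (c i) (X i)))"
 proof (rule fv.subspaceI)
  have "0 = (\<Sum>i<k. fscale 0 (X i))" by simp
  thus "0 \<in> range (%c. \<Sum>i<k. fscale (c i) (X i))" by (intro range_eqI)
  fix x y assume "x \<in> range (%c. \<Sum>i<k. fscale (c i) (X i))" "y \<in> range (%c. \<Sum>i<k. fscale (c i) (X i))"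
  then obtain c d where "x = (\<Sum>i<k. fscale (c i) (X i))" "y = (\<Sum>i<k. fscale (d i) (X i))" by blast
  hence "x + y = (\<Sum>i<k. fscale (c i + d i) (X i))"
   by (simp add: fv.scale_left_distrib sum.distrib)
  thus "x + y \<in> range (%c. \<Sum>i<k. fscale (c i) (X i))" by (intro range_eqI)
 next
  fix a x assume "x \<in> range (%c. \<Sum>i<k. fscale (c i) (X i))"
  then obtain c where "x = (\<Sum>i<k. fscale (c i) (X i))" by blast
  hence "fscale a x = (\<Sum>i<k. fscale (a * c i) (X i))"
   by (simp add: fv.scale_sum_right)
  thus "fscale a x \<in> range (%c. \<Sum>i<k. fscale (c i) (X i))" by (intro range_eqI)
 qed
 show "range (%c. \<Sum>i<k. fscale (c i) (X i)) \<subseteq> fv.span (X ` {..<k})"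
 proof clarify
  fix c :: "nat => 'k"
  show "(\<Sum>i<k. fscale (c i) (X i)) \<in> fv.span (X ` {..<k})"
   by (intro fv.span_sum fv.span_scale fv.span_base imageI)
 qed
qed

lemma independent_image_coeffs:
 fixes f :: "'i => 'a => 'k::field"
 assumes I: "finite I" and f: "inj_on f I" and ind: "fv.independent (f ` I)"
  and c: "(\<Sum>i\<in>I. fscale (c i) (f i)) = 0" and i: "i \<in> I"
 shows "c i = 0"
proof -
 have "(\<Sum>v\<in>f ` I. fscale (c (inv_into I f v)) v) = 0"
  using c by (simp add: sum.reindex[OF f] inv_into_f_f[OF f])
 from fv.independentD[OF ind _ order_refl this, of "f i"] show ?thesis
  using I i by (simp add: inv_into_f_f[OF f])
qed


text \<open>A basis chosen inside the image already has \<open>k\<close> elements. So it is the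
  whole image, and \<open>X\<close> is injective, which turns independence of the set into
  independence of the family.\<close>

lemma spanning_independent:
 fixes X :: "nat => 'a => 'k::field"
 assumes dim: "fv.dim (fv.span (X ` {..<k})) = k" and c: "(\<Sum>i<k. fscale (c i) (X i)) = 0" and i: "i < k"
 shows "c i = 0"
proof -
 obtain b where b: "b \<subseteq> X ` {..<k}" "fv.independent b" "X ` {..<k} \<subseteq> fv.span b"
  using fv.maximal_independent_subset by blast
 have "fv.span b = fv.span (X ` {..<k})"
  using b by (metis fv.span_mono fv.span_span subset_antisym)
 from fv.dim_eq_card[OF this b(2)] have kb: "card b = k" using dim by (simp add: fv.dim_span)
 have "card b \<le> card (X ` {..<k})" using b(1) by (intro card_mono) auto
 moreover have "card (X ` {..<k}) \<le> k" using card_image_le[of "{..<k}" X] by simp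
 ultimately have ck: "card (X ` {..<k}) = k" using kb by simp
 hence inj: "inj_on X {..<k}" by (intro eq_card_imp_inj_on) simp_all
 have "b = X ` {..<k}" using b(1) kb ck by (intro card_subset_eq) simp_all
 hence ind: "fv.independent (X ` {..<k})" using b(2) by simp
 show ?thesis using independent_image_coeffs[OF _ inj ind c] i by simp
qed

lemma linear_on_add: "linear_on W sc f ==> u \<in> W ==> v \<in> W ==> f (u + v) = f u + f v"
 unfolding linear_on_def by blast

lemma linear_on_scale: "linear_on W sc f ==> u \<in> W ==> f (fscale c u) = sc c (f u)"
 unfolding linear_on_def by blast

lemma linear_on_sum:
 fixes f :: "('a => 'k::field) => 'k"
 assumes f: "linear_on W (*) f" and W: "fv.subspace W" and x: "!!i. i \<in> S ==> x i \<in> W"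
 shows "f (\<Sum>i\<in>S. fscale (c i) (x i)) = (\<Sum>i\<in>S. c i * f (x i))"
 using x
proof (induction S rule: infinite_finite_induct)
 case (insert i S)
 have "fscale (c i) (x i) \<in> W" "(\<Sum>i\<in>S. fscale (c i) (x i)) \<in> W"
  using insert.prems by (auto intro!: fv.subspace_scale[OF W] fv.subspace_sum[OF W])
 moreover have "f (\<Sum>i\<in>S. fscale (c i) (x i)) = (\<Sum>i\<in>S. c i * f (x i))"
  by (rule insert.IH) (use insert.prems in blast)
 ultimately have "f (\<Sum>i\<in>insert i S. fscale (c i) (x i)) = (\<Sum>i\<in>insert i S. c i * f (x i))"
  using insert.prems insert.hyps linear_on_add[OF f] linear_on_scale[OF f] by simp
 thus ?case .
next
 case empty
 have "f (fscale 0 0) = 0 * f 0" using fv.subspace_0[OF W] by (rule linear_on_scale[OF f])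
 hence "f (\<Sum>i\<in>{}. fscale (c i) (x i)) = (\<Sum>i\<in>{}. c i * f (x i))" by simp
 thus ?case .
next
 case (infinite S)
 have "f (fscale 0 0) = 0 * f 0" using fv.subspace_0[OF W] by (rule linear_on_scale[OF f])
 hence "f (\<Sum>i\<in>S. fscale (c i) (x i)) = (\<Sum>i\<in>S. c i * f (x i))" using infinite by simp
 thus ?case .
qed

lemma linear_on_zero: "linear_on W (*) f ==> fv.subspace W ==> f 0 = (0::'k::field)"
 using linear_on_sum[of W f "{}"] by simp

lemma dual_linear: "\<alpha> \<in> dual W ==> linear_on W (*) \<alpha>"
 unfolding dual_def by blast

lemma dual_outside: "\<alpha> \<in> dual W ==> v \<notin> W ==> \<alpha> v = 0"
 unfolding dual_def by blast

lemma dualI: "linear_on W (*) \<alpha> ==> (!!v. v \<notin> W ==> \<alpha> v = 0) ==> \<alpha> \<in> dual W"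
 unfolding dual_def by blast

lemma dual_restr: "linear_on W (*) \<alpha> ==> fv.subspace W ==> restr W \<alpha> \<in> dual W"
 by (rule dualI) (auto simp: restr_def linear_on_def fv.subspace_add fv.subspace_scale)

lemma dual_zero: "0 \<in> dual W"
 by (rule dualI) (auto simp: linear_on_def)

section \<open>The total space of the dual of a distribution\<close>

interpretation fvk: vector_space_pair fscale "(*) :: 'k::field => 'k => 'k"
 by unfold_locales (simp_all add: algebra_simps)

text \<open>Independence of the family forces \<open>f\<close> to be injective, so the prescribed
  values are consistent; they extend linearly to the whole function space, and the extension is cut
  down to \<open>T\<close>.\<close>

lemma ex_dual:
 fixes f :: "'i => 'a => 'k::field"
 assumes I: "finite I" and T: "fv.subspace T" and f: "!!i. i \<in> I ==> f i \<in> T"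
  and ind: "!!c. (\<Sum>i\<in>I. fscale (c i) (f i)) = 0 ==> ALL i:I. c i = 0"
 shows "EX \<alpha>:dual T. ALL i:I. \<alpha> (f i) = y i"
proof -
 have inj: "inj_on f I"
 proof (rule inj_onI, rule ccontr)
  fix i j assume ij: "i \<in> I" "j \<in> I" "f i = f j" "i \<noteq> j"
  have "(\<Sum>h\<in>I. fscale ((if h = i then 1 else 0) - (if h = j then 1 else 0)) (f h))
   = (\<Sum>h\<in>I. if h = i then f h else 0) - (\<Sum>h\<in>I. if h = j then f h else 0)"
   unfolding sum_subtractf[symmetric] by (rule sum.cong) (auto simp: fv.scale_left_diff_distrib)
  also have "\<dots> = 0" using I ij by simp
  finally show False using ind ij by force
 qed
 have "fv.independent (f ` I)"
 proof (rule fv.independent_if_scalars_zero)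
  fix g x assume "(\<Sum>x\<in>f ` I. fscale (g x) x) = 0" "x \<in> f ` I"
  thus "g x = 0" using ind[of "%i. g (f i)"] by (auto simp: sum.reindex[OF inj])
 qed (use I in simp)
 from fvk.linear_independent_extend[OF this, of "%x. y (inv_into I f x)"]
 obtain g where g: "Vector_Spaces.linear fscale (*) g" "ALL x:f ` I. g x = y (inv_into I f x)" by blast
 have "linear_on T (*) g"
  using g(1) unfolding linear_on_def by (auto simp: fvk.linear_add fvk.linear_scale)
 from dual_restr[OF this T] show ?thesis
  using g(2) f by (intro bexI[of _ "restr T g"]) (auto simp: restr_def inv_into_f_f[OF inj])
qed

section \<open>Charts of the total space built from local frames\<close>

definition local_frame ::
  "('p, 'k::ground_field) mfd => nat => ('p, 'k) distrib => 'p set => (nat => 'p => ('p, 'k) tvec) => bool"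
 where "local_frame N s F V X \<longleftrightarrow> openin (mtop N) V \<and>
  (ALL i<mdim N - s. vector_field N V (X i)) \<and>
  (ALL q:V. fv.span ((%i. X i q) ` {..<mdim N - s}) = F q)"

definition cot_dom :: "('p, 'k::ground_field) distrib => 'p set => ('p, 'k) cot set"
 where "cot_dom F V = {p. fst p \<in> V \<and> snd p \<in> dual (F (fst p))}"

definition cot_map ::
  "nat => nat => ('p => nat => 'k) => (nat => 'p => ('p, 'k::ground_field) tvec) => ('p, 'k) cot => nat => 'k"
 where "cot_map n k \<phi> X = (%p i. if i < n then \<phi> (fst p) i
  else if i < n + k then snd p (X (i - n) (fst p)) else 0)"

lemma cot_map_base: "i < n ==> cot_map n k \<phi> X p i = \<phi> (fst p) i"
 by (simp add: cot_map_def)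

lemma cot_map_fibre: "i < k ==> cot_map n k \<phi> X p (n + i) = snd p (X i (fst p))"
 by (simp add: cot_map_def)

lemma leaf_cotangent_dim: "mdim (leaf_cotangent N s F) = mdim N + (mdim N - s)"
 by (simp add: leaf_cotangent_def)

lemma leaf_cotangent_atlas:
 "(D, \<Phi>) \<in> atlas (leaf_cotangent N s F) \<longleftrightarrow> (EX U \<phi> V X. (U, \<phi>) \<in> atlas N \<and> V \<subseteq> U \<and>
  local_frame N s F V X \<and> D = cot_dom F V \<and> \<Phi> = cot_map (mdim N) (mdim N - s) \<phi> X)"
 unfolding leaf_cotangent_def local_frame_def cot_dom_def cot_map_def by auto

text \<open>The bundle projection in coordinates, padded by 0 so that its values lie in
  \<open>coord_space n\<close>.\<close>

definition trunc :: "nat => (nat => 'k::zero) => nat => 'k"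
 where "trunc n z = (%i. if i < n then z i else 0)"

lemma trunc_coord_space: "trunc n z \<in> coord_space n"
 by (simp add: trunc_def coord_space_def)

lemma trunc_preimage_open:
 fixes W :: "(nat => 'k::real_normed_field) set"
 assumes "open_coord n W"
 shows "open_coord (n + k) {z \<in> coord_space (n + k). trunc n z \<in> W}"
proof -
 have c: "continuous_on (coord_space (n + k)) (trunc n :: (nat => 'k) => nat => 'k)"
 proof (rule continuous_on_coords[where g = "trunc n" and m = n])
  show "trunc n z \<in> coord_space n" for z by (rule trunc_coord_space)
  show "continuous_on (coord_space (n + k)) (%z. trunc n z i)" if "i < n" for i
   using that by (simp add: trunc_def) (rule continuous_on_subset[OF continuous_on_product_coordinates], simp)
 qed
 have "openin (top_of_set (coord_space (n + k))) (coord_space (n + k) \<inter> trunc n -` W)"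
  by (rule continuous_openin_preimage[OF c _ assms]) (simp add: trunc_coord_space)
 moreover have "coord_space (n + k) \<inter> trunc n -` W = {z \<in> coord_space (n + k). trunc n z \<in> W}" by auto
 ultimately show ?thesis by simp
qed

locale cotangent = N: mfold N for N :: "('p, 'k::ground_field) mfd" +
 fixes s :: nat and F :: "('p, 'k) distrib"
 assumes dist: "distribution N s F"
begin

abbreviation "n \<equiv> mdim N"
abbreviation "k \<equiv> mdim N - s"
abbreviation "M \<equiv> leaf_cotangent N s F"
abbreviation "cm \<equiv> cot_map n k"
abbreviation "lifted \<equiv> lifted_foliation N s F"

lemma mdim_M [simp]: "mdim M = n + k"
 by (rule leaf_cotangent_dim)

lemma F_subspace: "q \<in> points N ==> fv.subspace (F q)"
 and F_tangent: "q \<in> points N ==> F q \<subseteq> N.TS q"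
 and F_dim: "q \<in> points N ==> fv.dim (F q) + s = n"
 using dist unfolding distribution_def by blast+

lemma local_frame_open: "local_frame N s F V X ==> N.opn V"
 unfolding local_frame_def by blast

lemma local_frame_vf: "local_frame N s F V X ==> i < k ==> vector_field N V (X i)"
 unfolding local_frame_def by blast

lemma local_frame_points: "local_frame N s F V X ==> q \<in> V ==> q \<in> points N"
 using N.openin_sub_points[OF local_frame_open] by blast

lemma local_frame_range:
 "local_frame N s F V X ==> q \<in> V ==> F q = range (%c. \<Sum>i<k. fscale (c i) (X i q))"
 unfolding local_frame_def using span_image_lessThan[of "%i. X i q" k] by simp

lemma local_frame_in:
 assumes X: "local_frame N s F V X" and q: "q \<in> V" and i: "i < k"
 shows "X i q \<in> F q"
proof -
 have "fv.span ((%i. X i q) ` {..<k}) = F q" using X q unfolding local_frame_def by blast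
 moreover have "X i q \<in> fv.span ((%i. X i q) ` {..<k})"
  using i by (intro fv.span_base) simp
 ultimately show ?thesis by simp
qed

lemma local_frame_independent:
 assumes X: "local_frame N s F V X" and q: "q \<in> V" and c: "(\<Sum>i<k. fscale (c i) (X i q)) = 0" and i: "i < k"
 shows "c i = 0"
proof (rule spanning_independent[where X = "%i. X i q" and k = k and c = c, OF _ c i])
 have "fv.span ((%i. X i q) ` {..<k}) = F q" using X q unfolding local_frame_def by blast
 thus "fv.dim (fv.span ((%i. X i q) ` {..<k})) = k"
  using F_dim[OF local_frame_points[OF X q]] by simp
qed

lemma local_frame_subset:
 "local_frame N s F V X ==> N.opn W ==> W \<subseteq> V ==> local_frame N s F W X"
 unfolding local_frame_def by (auto intro: N.vector_field_subset)

lemma ex_local_frame: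
 assumes q: "q \<in> points N"
 shows "EX U \<phi> V X. (U, \<phi>) \<in> atlas N \<and> V \<subseteq> U \<and> q \<in> V \<and> local_frame N s F V X"
proof -
 obtain V X where V: "q \<in> V" "ALL i<n - s. vector_field N V (X i)" "N.opn V"
  "ALL x:V. fv.span ((%i. X i x) ` {..<n - s}) = F x"
  using dist q unfolding distribution_def by blast
 obtain U \<phi> where U: "(U, \<phi>) \<in> atlas N" "q \<in> U" using N.ex_chart[OF q] by blast
 have "local_frame N s F V X" unfolding local_frame_def using V by blast
 hence "local_frame N s F (V \<inter> U) X"
  using openin_Int[OF V(3) N.chart_open[OF U(1)]] local_frame_subset by blast
 thus ?thesis using U V(1) by (intro exI[of _ U] exI[of _ \<phi>] exI[of _ "V \<inter> U"] exI[of _ X]) auto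
qed

text \<open>\<open>smooth_left_inverse\<close> for the matrix of coordinates of the frame: one
  smooth matrix \<open>B\<close> recovers the coefficients of all combinations of the frame, at all
  points near \<open>q\<close>.\<close>

lemma frame_coefficients:
 fixes m :: nat
 assumes U: "(U, \<phi>) \<in> atlas N" "q \<in> U"
  and X: "ALL i<m. vector_field N V (X i)" and q: "q \<in> V"
  and ind: "ALL c. (\<Sum>i<m. fscale (c i) (X i q)) = 0 --> (ALL i<m. c i = (0::'k))"
 shows "EX B. (ALL l<m. ALL a<n. N.smooth q (B l a)) \<and>
  eventually (%x. ALL l<m. ALL c. (\<Sum>a<n. B l a x * (\<Sum>i<m. fscale (c i) (X i x)) (%y. \<phi> y a)) = c l) (N.near q)"
proof -
 have qN: "q \<in> points N" using N.chart_subset[OF U(1)] U(2) by blast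
 have "EX B. (ALL l<m. ALL a:{..<n}. N.smooth q (B l a)) \<and>
  eventually (%x. ALL l<m. ALL i<m. (\<Sum>a\<in>{..<n}. B l a x * X i x (%y. \<phi> y a)) = (if l = i then 1 else 0)) (N.near q)"
 proof (rule N.smooth_left_inverse[where Z = "%i a x. X i x (%y. \<phi> y a)", OF qN])
  show "N.smooth q (%x. X i x (%y. \<phi> y a))" if "i < m" "a \<in> {..<n}" for i a
   using that X by (intro N.vector_field_smooth[OF _ q N.smooth_near_chart_coord[OF U]]) auto
  fix c assume c: "!!a. a \<in> {..<n} ==> (\<Sum>i<m. c i * X i q (%y. \<phi> y a)) = 0"
  have "(\<Sum>i<m. fscale (c i) (X i q)) = 0"
  proof (rule N.tangent_eqI[OF _ N.tangent_zero[OF qN] U])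
   show "(\<Sum>i<m. fscale (c i) (X i q)) \<in> N.TS q"
    using X by (intro fv.subspace_sum[OF N.tangent_subspace[OF qN]] N.tangent_scale N.vector_field_tangent[OF _ q]) simp
   show "(\<Sum>i<m. fscale (c i) (X i q)) (%x. \<phi> x a) = 0 (%x. \<phi> x a)" if "a < n" for a
    using c[of a] that by (simp add: sum_fun_apply)
  qed
  thus "ALL i<m. c i = 0" using ind by blast
 qed simp
 then obtain B where B: "ALL l<m. ALL a:{..<n}. N.smooth q (B l a)"
  "eventually (%x. ALL l<m. ALL i<m. (\<Sum>a\<in>{..<n}. B l a x * X i x (%y. \<phi> y a)) = (if l = i then 1 else 0)) (N.near q)"
  by blast
 have "eventually (%x. ALL l<m. ALL c. (\<Sum>a<n. B l a x * (\<Sum>i<m. fscale (c i) (X i x)) (%y. \<phi> y a)) = c l) (N.near q)"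
  using B(2)
 proof eventually_elim
  case (elim x)
  show ?case
  proof (intro allI impI)
   fix l c assume l: "l < m"
   have "(\<Sum>a<n. B l a x * (\<Sum>i<m. fscale (c i) (X i x)) (%y. \<phi> y a))
    = (\<Sum>i<m. c i * (\<Sum>a<n. B l a x * X i x (%y. \<phi> y a)))"
    by (simp add: sum_fun_apply sum_distrib_left mult_ac) (rule sum.swap)
   also have "\<dots> = (\<Sum>i<m. if i = l then c i else 0)"
    using elim l by (intro sum.cong) auto
   finally show "(\<Sum>a<n. B l a x * (\<Sum>i<m. fscale (c i) (X i x)) (%y. \<phi> y a)) = c l"
    using l by simp
  qed
 qed
 thus ?thesis using B(1) by auto
qed

text \<open>The coefficients are given only pointwise; near \<open>q\<close> they equal the smooth
  matrix of \<open>frame_coefficients\<close> applied to the coordinates of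
  \<open>Y\<close>.\<close>

lemma smooth_frame_coefficients:
 fixes m :: nat
 assumes X: "ALL i<m. vector_field N V (X i)" and q: "q \<in> V"
  and ind: "ALL c. (\<Sum>i<m. fscale (c i) (X i q)) = 0 --> (ALL i<m. c i = (0::'k))"
  and Y: "vector_field N V Y" and c: "ALL x:V. Y x = (\<Sum>i<m. fscale (c i x) (X i x))"
  and l: "l < m"
 shows "N.smooth q (c l)"
proof -
 have qN: "q \<in> points N" using N.openin_sub_points[OF N.vector_field_open[OF Y]] q by blast
 obtain U \<phi> where U: "(U, \<phi>) \<in> atlas N" "q \<in> U" using N.ex_chart[OF qN] by blast
 obtain B where B: "ALL l<m. ALL a<n. N.smooth q (B l a)"
  "eventually (%x. ALL l<m. ALL c. (\<Sum>a<n. B l a x * (\<Sum>i<m. fscale (c i) (X i x)) (%y. \<phi> y a)) = c l) (N.near q)"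
  using frame_coefficients[where X = X and m = m, OF U X q ind] by (elim exE conjE) (rule that)
 have "N.smooth q (%x. \<Sum>a<n. B l a x * Y x (%y. \<phi> y a))"
  using B(1) l by (intro N.smooth_near_sum qN N.smooth_near_mult N.vector_field_smooth[OF Y q]
    N.smooth_near_chart_coord[OF U]) auto
 thus ?thesis
 proof (rule N.smooth_near_cong)
  have "eventually (%x. x \<in> V) (N.near q)"
   using N.eventually_in_open[OF N.vector_field_open[OF Y] q] .
  with B(2) show "eventually (%x. (\<Sum>a<n. B l a x * Y x (%y. \<phi> y a)) = c l x) (N.near q)"
  proof eventually_elim
   case (elim x)
   have "(\<Sum>a<n. B l a x * (\<Sum>i<m. fscale (c i x) (X i x)) (%y. \<phi> y a)) = c l x"
    using elim(1) l by (metis (no_types))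
   thus ?case unfolding bspec[OF c elim(2)] .
  qed
 qed
qed

subsection \<open>The manifold structure\<close>

lemma dual_frame_eqI:
 assumes X: "local_frame N s F V X" and q: "q \<in> V"
  and \<alpha>: "\<alpha> \<in> dual (F q)" "\<beta> \<in> dual (F q)" and e: "!!i. i < k ==> \<alpha> (X i q) = \<beta> (X i q)"
 shows "\<alpha> = \<beta>"
proof
 fix v
 show "\<alpha> v = \<beta> v"
 proof (cases "v \<in> F q")
  case True
  then obtain c where v: "v = (\<Sum>i<k. fscale (c i) (X i q))"
   using local_frame_range[OF X q] by blast
  show ?thesis
   unfolding v
   using linear_on_sum[OF dual_linear[OF \<alpha>(1)] F_subspace[OF local_frame_points[OF X q]], of "{..<k}" "%i. X i q" c]
    linear_on_sum[OF dual_linear[OF \<alpha>(2)] F_subspace[OF local_frame_points[OF X q]], of "{..<k}" "%i. X i q" c]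
    e local_frame_in[OF X q] by simp
 qed (use \<alpha> in \<open>simp add: dual_outside\<close>)
qed

lemma dual_frame_ex:
 assumes X: "local_frame N s F V X" and q: "q \<in> V"
 shows "EX \<alpha>:dual (F q). ALL i<k. \<alpha> (X i q) = y i"
 using ex_dual[of "{..<k}" "F q" "%i. X i q" y] F_subspace[OF local_frame_points[OF X q]]
  local_frame_in[OF X q] local_frame_independent[OF X q] by auto

lemma cot_map_inj:
 assumes U: "(U, \<phi>) \<in> atlas N" "V \<subseteq> U" and X: "local_frame N s F V X"
 shows "inj_on (cm \<phi> X) (cot_dom F V)"
proof (rule inj_onI)
 fix p p' assume p: "p \<in> cot_dom F V" "p' \<in> cot_dom F V" and e: "cm \<phi> X p = cm \<phi> X p'"
 have pV: "fst p \<in> V" "fst p' \<in> V" "snd p \<in> dual (F (fst p))" "snd p' \<in> dual (F (fst p'))"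
  using p unfolding cot_dom_def by auto
 have "\<phi> (fst p) i = \<phi> (fst p') i" for i
 proof (cases "i < n")
  case True thus ?thesis using fun_cong[OF e, of i] by (simp add: cot_map_def)
 next
  case False
  have "\<phi> (fst p) \<in> coord_space n" "\<phi> (fst p') \<in> coord_space n"
   using N.chart_coord[OF U(1)] pV(1,2) U(2) by blast+
  thus ?thesis using False by (simp add: coord_space_def)
 qed
 hence "\<phi> (fst p) = \<phi> (fst p')" by (rule ext)
 hence f: "fst p = fst p'" using inj_onD[OF N.chart_inj[OF U(1)]] pV U(2) by blast
 have "snd p = snd p'"
 proof (rule dual_frame_eqI[OF X pV(1,3)])
  show "snd p' \<in> dual (F (fst p))" using pV(4) f by simp
  show "snd p (X i (fst p)) = snd p' (X i (fst p))" if "i < k" for i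
   using fun_cong[OF e, of "n + i"] that f by (simp only: cot_map_fibre)
 qed
 thus "p = p'" using f by (simp add: prod_eq_iff)
qed

lemma cot_map_trunc:
 assumes U: "(U, \<phi>) \<in> atlas N" "V \<subseteq> U" and p: "p \<in> cot_dom F V"
 shows "trunc n (cm \<phi> X p) = \<phi> (fst p)" "cm \<phi> X p \<in> coord_space (n + k)"
proof -
 have "fst p \<in> U" using p U(2) unfolding cot_dom_def by auto
 hence "\<phi> (fst p) \<in> coord_space n" by (rule N.chart_coord[OF U(1)])
 thus "trunc n (cm \<phi> X p) = \<phi> (fst p)"
  by (auto simp: trunc_def cot_map_def coord_space_def)
qed (simp add: cot_map_def coord_space_def)

text \<open>All values of the fibre coordinates occur, because a covector may be prescribed freely
  on the independent frame.\<close>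

lemma cot_map_image:
 assumes U: "(U, \<phi>) \<in> atlas N" "V \<subseteq> U" and X: "local_frame N s F V X" and W: "W \<subseteq> V"
 shows "cm \<phi> X ` cot_dom F W = {z \<in> coord_space (n + k). trunc n z \<in> \<phi> ` W}"
proof (intro equalityI subsetI)
 fix z assume "z \<in> cm \<phi> X ` cot_dom F W"
 then obtain p where p: "p \<in> cot_dom F W" "z = cm \<phi> X p" by blast
 hence "p \<in> cot_dom F V" "fst p \<in> W" using W unfolding cot_dom_def by auto
 thus "z \<in> {z \<in> coord_space (n + k). trunc n z \<in> \<phi> ` W}"
  using cot_map_trunc[OF U] p(2) by auto
next
 fix z assume "z \<in> {z \<in> coord_space (n + k). trunc n z \<in> \<phi> ` W}"
 then obtain q where z: "z \<in> coord_space (n + k)" and q: "q \<in> W" "trunc n z = \<phi> q" by blast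
 obtain \<alpha> where \<alpha>: "\<alpha> \<in> dual (F q)" "ALL i<k. \<alpha> (X i q) = z (n + i)"
  using dual_frame_ex[OF X, of q "%i. z (n + i)"] q(1) W by blast
 have "cm \<phi> X (q, \<alpha>) i = z i" for i
 proof -
  consider "i < n" | "n \<le> i" "i < n + k" | "n + k \<le> i" by linarith
  thus ?thesis
  proof cases
   case 1 thus ?thesis using fun_cong[OF q(2), of i] by (simp add: cot_map_def trunc_def)
  next
   case 2
   hence "i - n < k" by linarith
   thus ?thesis using \<alpha>(2) 2 by (simp add: cot_map_def)
  next
   case 3 thus ?thesis using z by (simp add: cot_map_def coord_space_def)
  qed
 qed
 hence "z = cm \<phi> X (q, \<alpha>)" by auto
 moreover have "(q, \<alpha>) \<in> cot_dom F W" using q(1) \<alpha>(1) by (simp add: cot_dom_def)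
 ultimately show "z \<in> cm \<phi> X ` cot_dom F W" by blast
qed

lemma cot_map_image_open:
 assumes "(U, \<phi>) \<in> atlas N" "V \<subseteq> U" "local_frame N s F V X" "W \<subseteq> V" "N.opn W"
 shows "open_coord (n + k) (cm \<phi> X ` cot_dom F W)"
 unfolding cot_map_image[OF assms(1-4)]
 using N.openin_chart[OF assms(1), of W] assms by (intro trunc_preimage_open) auto

lemma cot_dom_Int: "cot_dom F V \<inter> cot_dom F V' = cot_dom F (V \<inter> V')"
 by (auto simp: cot_dom_def)

lemma cot_map_inv:
 assumes U: "(U, \<phi>) \<in> atlas N" "V \<subseteq> U" and X: "local_frame N s F V X"
  and z: "z \<in> cm \<phi> X ` cot_dom F V"
 shows "inv_into (cot_dom F V) (cm \<phi> X) z \<in> cot_dom F V"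
  "fst (inv_into (cot_dom F V) (cm \<phi> X) z) = inv_into U \<phi> (trunc n z)"
  "!!i. i < k ==> snd (inv_into (cot_dom F V) (cm \<phi> X) z)
   (X i (fst (inv_into (cot_dom F V) (cm \<phi> X) z))) = z (n + i)"
proof -
 let ?p = "inv_into (cot_dom F V) (cm \<phi> X) z"
 show p: "?p \<in> cot_dom F V" using z by (rule inv_into_into)
 have zp: "cm \<phi> X ?p = z" using z by (rule f_inv_into_f)
 have "fst ?p \<in> U" using p U(2) unfolding cot_dom_def by auto
 thus "fst ?p = inv_into U \<phi> (trunc n z)"
  using cot_map_trunc(1)[OF U p, of X] zp N.chart_inv[OF U(1)] by simp
 show "snd ?p (X i (fst ?p)) = z (n + i)" if "i < k" for i
  using fun_cong[OF zp, of "n + i"] that by (simp only: cot_map_fibre)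
qed

lemma smooth_coord_lift:
 assumes U: "(U, \<phi>) \<in> atlas N" and W: "W \<subseteq> U" "open_coord n (\<phi> ` W)"
  and g: "smooth_coord n (\<phi> ` W) (g \<circ> inv_into U \<phi>)"
 shows "smooth_coord (n + k) {z \<in> coord_space (n + k). trunc n z \<in> \<phi> ` W} (%z. g (inv_into U \<phi> (trunc n z)))"
proof -
 let ?S = "{z \<in> coord_space (n + k). trunc n z \<in> \<phi> ` W}"
 have S: "open_coord (n + k) ?S" using W(2) by (rule trunc_preimage_open)
 have "smooth_coord (n + k) ?S (%z. (g \<circ> inv_into U \<phi>) (trunc n z))"
 proof (rule smooth_coord_comp[where f = "g \<circ> inv_into U \<phi>" and g = "trunc n", OF S W(2) _ g])
  show "smooth_coord (n + k) ?S (%z. trunc n z j)" if "j < n" for j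
   using smooth_coord_proj[OF S, of j] that by (simp add: trunc_def)
 qed simp
 thus ?thesis by simp
qed

lemma frame_change:
 assumes X: "local_frame N s F V X" and X': "local_frame N s F V' X'"
  and q: "q \<in> V" "q \<in> V'" and j: "j < k"
 shows "EX g. (ALL l<k. N.smooth q (g l)) \<and> (ALL x:V \<inter> V'. X' j x = (\<Sum>l<k. fscale (g l x) (X l x)))"
proof -
 let ?W = "V \<inter> V'"
 have W: "N.opn ?W" using local_frame_open[OF X] local_frame_open[OF X'] by (rule openin_Int)
 have XW: "local_frame N s F ?W X" using local_frame_subset[OF X W] by blast
 have X'W: "local_frame N s F ?W X'" using local_frame_subset[OF X' W] by blast
 have "EX c. X' j x = (\<Sum>l<k. fscale (c l) (X l x))" if "x \<in> ?W" for x
  using local_frame_range[OF XW that] local_frame_in[OF X'W that j] by blast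
 then obtain c where c: "!!x. x \<in> ?W ==> X' j x = (\<Sum>l<k. fscale (c x l) (X l x))" by metis
 have "N.smooth q (%x. c x l)" if "l < k" for l
 proof (rule smooth_frame_coefficients[where c = "%l x. c x l" and m = k and X = X and V = ?W and Y = "X' j"])
  show "ALL c. (\<Sum>i<k. fscale (c i) (X i q)) = 0 --> (ALL i<k. c i = 0)"
   using local_frame_independent[OF X q(1)] by blast
  show "ALL i<k. vector_field N ?W (X i)" using local_frame_vf[OF XW] by blast
  show "ALL x:?W. X' j x = (\<Sum>i<k. fscale (c x i) (X i x))" using c by blast
 qed (use q that local_frame_vf[OF X'W j] in simp_all)
 thus ?thesis using c by (intro exI[of _ "%l x. c x l"]) simp
qed

text \<open>Base coordinates change as on \<open>N\<close>. Fibre coordinates change linearly, by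
  the coefficients of one frame in the other, which are smooth by
  \<open>frame_change\<close>.\<close>

lemma cot_transition_smooth:
 assumes U: "(U, \<phi>) \<in> atlas N" "V \<subseteq> U" and X: "local_frame N s F V X"
  and U': "(U', \<phi>') \<in> atlas N" "V' \<subseteq> U'" and X': "local_frame N s F V' X'" and i: "i < n + k"
 shows "smooth_coord (n + k) (cm \<phi> X ` (cot_dom F V \<inter> cot_dom F V'))
  (%z. cm \<phi>' X' (inv_into (cot_dom F V) (cm \<phi> X) z) i)"
proof (rule smooth_coord_Union)
 let ?inv = "inv_into (cot_dom F V) (cm \<phi> X)"
 fix z assume z: "z \<in> cm \<phi> X ` (cot_dom F V \<inter> cot_dom F V')"
 have VV: "N.opn (V \<inter> V')"
  using local_frame_open[OF X] local_frame_open[OF X'] by (rule openin_Int)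
 have im: "cm \<phi> X ` cot_dom F W = {z \<in> coord_space (n + k). trunc n z \<in> \<phi> ` W}" if "W \<subseteq> V" for W
  using cot_map_image[OF U X that] .
 obtain q where q: "q \<in> V" "q \<in> V'" "trunc n z = \<phi> q" "z \<in> coord_space (n + k)"
  using z unfolding cot_dom_Int using im[of "V \<inter> V'"] by auto
 have qU: "q \<in> U" using q(1) U(2) by blast
 have *: "EX W. N.opn W \<and> q \<in> W \<and> W \<subseteq> V \<inter> V' \<and>
   smooth_coord (n + k) (cm \<phi> X ` cot_dom F W) (%z. g (inv_into U \<phi> (trunc n z)))"
  if g: "N.smooth q g" for g
 proof -
  obtain W where W: "N.opn W" "q \<in> W" "W \<subseteq> U" "open_coord n (\<phi> ` W)"
   "smooth_coord n (\<phi> ` W) (g \<circ> inv_into U \<phi>)"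
   using N.smooth_near_chartE[OF g U(1) qU] by metis
  let ?W = "W \<inter> (V \<inter> V')"
  have o: "N.opn ?W" using W(1) VV by (rule openin_Int)
  have "open_coord n (\<phi> ` ?W)" using N.openin_chart[OF U(1), of ?W] o W(3) by auto
  moreover have "smooth_coord n (\<phi> ` ?W) (g \<circ> inv_into U \<phi>)"
   using W(5) by (rule smooth_coord_subset) auto
  ultimately have "smooth_coord (n + k) (cm \<phi> X ` cot_dom F ?W) (%z. g (inv_into U \<phi> (trunc n z)))"
   using smooth_coord_lift[OF U(1) _ _, of ?W g] W(3) unfolding im[OF le_infI2[OF inf_le1]] by auto
  thus ?thesis using o W(2) q by (intro exI[of _ ?W]) auto
 qed
 have "EX W. N.opn W \<and> q \<in> W \<and> W \<subseteq> V \<inter> V' \<and> smooth_coord (n + k) (cm \<phi> X ` cot_dom F W)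
   (%z. cm \<phi>' X' (?inv z) i)"
 proof (cases "i < n")
  case True
  have "N.smooth q (%x. \<phi>' x i)"
   using N.smooth_near_chart_coord[OF U'(1) _ True] q(2) U'(2) by blast
  from *[OF this] obtain W where W: "N.opn W" "q \<in> W" "W \<subseteq> V \<inter> V'"
   "smooth_coord (n + k) (cm \<phi> X ` cot_dom F W) (%z. \<phi>' (inv_into U \<phi> (trunc n z)) i)"
   by (elim exE conjE) (rule that)
  have o: "open_coord (n + k) (cm \<phi> X ` cot_dom F W)"
   using cot_map_image_open[OF U X _ W(1)] W(3) by blast
  from W(4) have "smooth_coord (n + k) (cm \<phi> X ` cot_dom F W) (%z. cm \<phi>' X' (?inv z) i)"
  proof (rule smooth_coord_cong[OF o, rotated])
   fix y assume "y \<in> cm \<phi> X ` cot_dom F W"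
   hence y: "y \<in> cm \<phi> X ` cot_dom F V" using W(3) by (auto simp: cot_dom_def)
   show "\<phi>' (inv_into U \<phi> (trunc n y)) i = cm \<phi>' X' (?inv y) i"
    using cot_map_inv(2)[OF U X y] True by (simp add: cot_map_def)
  qed
  thus ?thesis using W(1-3) by blast
 next
  case False
  define j where "j = i - n"
  have j: "j < k" "i = n + j" using False i by (auto simp: j_def)
  obtain g where g: "ALL l<k. N.smooth q (g l)"
   "ALL x:V \<inter> V'. X' j x = (\<Sum>l<k. fscale (g l x) (X l x))"
   using frame_change[OF X X' q(1,2) j(1)] by blast
  have "ALL l<k. EX W. N.opn W \<and> q \<in> W \<and> W \<subseteq> V \<inter> V' \<and>
   smooth_coord (n + k) (cm \<phi> X ` cot_dom F W) (%z. g l (inv_into U \<phi> (trunc n z)))"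
   using * g(1) by blast
  then obtain W where W: "!!l. l < k ==> N.opn (W l)" "!!l. l < k ==> q \<in> W l"
   "!!l. l < k ==> smooth_coord (n + k) (cm \<phi> X ` cot_dom F (W l)) (%z. g l (inv_into U \<phi> (trunc n z)))"
   by metis
  define S where "S = (V \<inter> V') \<inter> (\<Inter>l\<in>{..<k}. W l)"
  have S: "N.opn S" "q \<in> S" "S \<subseteq> V \<inter> V'" "!!l. l < k ==> S \<subseteq> W l"
  proof -
   have "N.opn (\<Inter> (insert (V \<inter> V') (W ` {..<k})))"
    using W(1) VV by (intro openin_Inter) auto
   thus "N.opn S" by (simp add: S_def)
  qed (use W(2) q in \<open>auto simp: S_def\<close>)
  let ?S = "cm \<phi> X ` cot_dom F S"
  have o: "open_coord (n + k) ?S" using cot_map_image_open[OF U X _ S(1)] S(3) by blast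
  have "smooth_coord (n + k) ?S (%z. g l (inv_into U \<phi> (trunc n z)))" if "l < k" for l
   using W(3)[OF that] by (rule smooth_coord_subset) (use S(4)[OF that] in \<open>auto simp: cot_dom_def\<close>)
  hence "smooth_coord (n + k) ?S (%z. \<Sum>l<k. g l (inv_into U \<phi> (trunc n z)) * z (n + l))"
   by (intro smooth_coord_sum[OF o] smooth_coord_mult[OF o] smooth_coord_proj[OF o]) auto
  hence "smooth_coord (n + k) ?S (%z. cm \<phi>' X' (?inv z) i)"
  proof (rule smooth_coord_cong[OF o, rotated])
   fix y assume "y \<in> ?S"
   then obtain p where p: "p \<in> cot_dom F S" "y = cm \<phi> X p" by blast
   have pV: "p \<in> cot_dom F V" using p(1) S(3) by (auto simp: cot_dom_def)
   hence y: "y \<in> cm \<phi> X ` cot_dom F V" using p(2) by blast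
   have inv: "?inv y = p" using inv_into_f_f[OF cot_map_inj[OF U X] pV] p(2) by simp
   have x: "fst p \<in> V \<inter> V'" "snd p \<in> dual (F (fst p))" using p(1) S(3) by (auto simp: cot_dom_def)
   have "cm \<phi>' X' p i = snd p (\<Sum>l<k. fscale (g l (fst p)) (X l (fst p)))"
    using g(2) x(1) unfolding j(2) cot_map_fibre[OF j(1)] by simp
   also have "\<dots> = (\<Sum>l<k. g l (fst p) * snd p (X l (fst p)))"
    using x local_frame_in[OF X] local_frame_points[OF X]
    by (intro linear_on_sum[OF dual_linear[OF x(2)] F_subspace]) auto
   also have "\<dots> = (\<Sum>l<k. g l (inv_into U \<phi> (trunc n y)) * y (n + l))"
    using cot_map_inv(2,3)[OF U X y] unfolding inv by simp
   finally show "(\<Sum>l<k. g l (inv_into U \<phi> (trunc n y)) * y (n + l)) = cm \<phi>' X' (?inv y) i"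
    unfolding inv by simp
  qed
  thus ?thesis using S(1-3) by blast
 qed
 then obtain W where W: "N.opn W" "q \<in> W" "W \<subseteq> V \<inter> V'"
  "smooth_coord (n + k) (cm \<phi> X ` cot_dom F W) (%z. cm \<phi>' X' (?inv z) i)"
  by (elim exE conjE) (rule that)
 have "open_coord (n + k) (cm \<phi> X ` cot_dom F W)"
  using cot_map_image_open[OF U X _ W(1)] W(3) by blast
 moreover have "z \<in> cm \<phi> X ` cot_dom F W"
  using im[of W] W(2,3) q(3,4) by auto
 moreover have "cm \<phi> X ` cot_dom F W \<subseteq> cm \<phi> X ` (cot_dom F V \<inter> cot_dom F V')"
  using W(3) by (auto simp: cot_dom_def)
 ultimately show "EX S. z \<in> S \<and> open_coord (n + k) S \<and> S \<subseteq> cm \<phi> X ` (cot_dom F V \<inter> cot_dom F V') \<and>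
   smooth_coord (n + k) S (%z. cm \<phi>' X' (?inv z) i)"
  using W(4) by (intro exI conjI)
qed

lemma smooth_atlas_M: "smooth_atlas M"
 unfolding smooth_atlas_def
proof (intro conjI)
 show "ALL (D, \<Phi>):atlas M. inj_on \<Phi> D \<and> open_coord (mdim M) (\<Phi> ` D)"
 proof clarify
  fix D \<Phi> assume "(D, \<Phi>) \<in> atlas M"
  then obtain U \<phi> V X where U: "(U, \<phi>) \<in> atlas N" "V \<subseteq> U" and X: "local_frame N s F V X"
   and D: "D = cot_dom F V" "\<Phi> = cm \<phi> X"
   unfolding leaf_cotangent_atlas by blast
  show "inj_on \<Phi> D \<and> open_coord (mdim M) (\<Phi> ` D)"
   unfolding D mdim_M using cot_map_inj[OF U X] cot_map_image_open[OF U X _ local_frame_open[OF X]] by blast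
 qed
 show "ALL (D, \<Phi>):atlas M. ALL (E, \<Psi>):atlas M. open_coord (mdim M) (\<Phi> ` (D \<inter> E)) \<and>
  (ALL i<mdim M. smooth_coord (mdim M) (\<Phi> ` (D \<inter> E)) (%x. \<Psi> (inv_into D \<Phi> x) i))"
 proof (clarify, intro conjI allI impI)
  fix D \<Phi> E \<Psi> assume "(D, \<Phi>) \<in> atlas M" "(E, \<Psi>) \<in> atlas M"
  then obtain U \<phi> V X U' \<phi>' V' X' where U: "(U, \<phi>) \<in> atlas N" "V \<subseteq> U" and X: "local_frame N s F V X"
   and D: "D = cot_dom F V" "\<Phi> = cm \<phi> X"
   and U': "(U', \<phi>') \<in> atlas N" "V' \<subseteq> U'" and X': "local_frame N s F V' X'"
   and E: "E = cot_dom F V'" "\<Psi> = cm \<phi>' X'"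
   unfolding leaf_cotangent_atlas by blast
  have "N.opn (V \<inter> V')"
   using local_frame_open[OF X] local_frame_open[OF X'] by (rule openin_Int)
  thus "open_coord (mdim M) (\<Phi> ` (D \<inter> E))"
   unfolding D E mdim_M cot_dom_Int using cot_map_image_open[OF U X, of "V \<inter> V'"] by blast
  show "smooth_coord (mdim M) (\<Phi> ` (D \<inter> E)) (%x. \<Psi> (inv_into D \<Phi> x) i)" if "i < mdim M" for i
   unfolding D E mdim_M using that cot_transition_smooth[OF U X U' X'] by simp
 qed
qed

end

sublocale cotangent \<subseteq> M: mfold "leaf_cotangent N s F"
 by unfold_locales (rule smooth_atlas_M)

context cotangent
begin

lemma points_M: "points M = {p. fst p \<in> points N \<and> snd p \<in> dual (F (fst p))}"
proof (intro equalityI subsetI)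
 fix p assume "p \<in> points M"
 then obtain D \<Phi> where "(D, \<Phi>) \<in> atlas M" "p \<in> D" using M.ex_chart by blast
 thus "p \<in> {p. fst p \<in> points N \<and> snd p \<in> dual (F (fst p))}"
  unfolding leaf_cotangent_atlas using local_frame_points by (auto simp: cot_dom_def)
next
 fix p assume p: "p \<in> {p. fst p \<in> points N \<and> snd p \<in> dual (F (fst p))}"
 then obtain U \<phi> V X where "(U, \<phi>) \<in> atlas N" "V \<subseteq> U" "fst p \<in> V" "local_frame N s F V X"
  using ex_local_frame by blast
 hence "(cot_dom F V, cm \<phi> X) \<in> atlas M" "p \<in> cot_dom F V"
  using p unfolding leaf_cotangent_atlas by (auto simp: cot_dom_def)
 thus "p \<in> points M" using M.chart_subset by blast
qed

lemma cot_chart: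
 "(U, \<phi>) \<in> atlas N ==> V \<subseteq> U ==> local_frame N s F V X ==>
  (cot_dom F V, cm \<phi> X) \<in> atlas M"
 unfolding leaf_cotangent_atlas by blast

lemma fst_preimage_open:
 assumes W: "N.opn W"
 shows "M.opn {p \<in> points M. fst p \<in> W}"
 unfolding M.openin_mtop
proof (intro conjI)
 show "ALL (D, \<Phi>):atlas M. open_coord (mdim M) (\<Phi> ` ({p \<in> points M. fst p \<in> W} \<inter> D))"
 proof clarify
  fix D \<Phi> assume D: "(D, \<Phi>) \<in> atlas M"
  then obtain U \<phi> V X where U: "(U, \<phi>) \<in> atlas N" "V \<subseteq> U" and X: "local_frame N s F V X"
   and DV: "D = cot_dom F V" "\<Phi> = cm \<phi> X"
   unfolding leaf_cotangent_atlas by blast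
  have "{p \<in> points M. fst p \<in> W} \<inter> D = cot_dom F (W \<inter> V)"
   using M.chart_subset[OF D] unfolding DV by (auto simp: cot_dom_def)
  thus "open_coord (mdim M) (\<Phi> ` ({p \<in> points M. fst p \<in> W} \<inter> D))"
   using cot_map_image_open[OF U X, of "W \<inter> V"] openin_Int[OF W local_frame_open[OF X]]
   by (simp add: DV)
 qed
qed blast

text \<open>Points over distinct base points are separated on \<open>N\<close>, points of one fibre
  inside a common chart. For countability, the Lindelof property of \<open>N\<close> selects
  countably many frame domains that cover \<open>N\<close>.\<close>

lemma manifold_M:
 assumes N: "manifold N" shows "manifold M"
 unfolding manifold_iff
proof (intro conjI smooth_atlas_M)
 show "Hausdorff_space (mtop M)"
  unfolding Hausdorff_space_def
 proof (intro allI impI)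
  fix p p' assume pp: "p \<in> topspace (mtop M) \<and> p' \<in> topspace (mtop M) \<and> p \<noteq> p'"
  hence p: "p \<in> points M" "p' \<in> points M" by (simp_all add: M.topspace_mtop)
  hence pN: "fst p \<in> points N" "fst p' \<in> points N" by (auto simp: points_M)
  show "EX S T. M.opn S \<and> M.opn T \<and> p \<in> S \<and> p' \<in> T \<and> disjnt S T"
  proof (cases "fst p = fst p'")
   case False
   then obtain S T where ST: "N.opn S" "N.opn T" "fst p \<in> S" "fst p' \<in> T" "disjnt S T"
    using N pN unfolding manifold_iff Hausdorff_space_def N.topspace_mtop by metis
   have "disjnt {p \<in> points M. fst p \<in> S} {p \<in> points M. fst p \<in> T}"
    using ST(5) by (auto simp: disjnt_iff)
   thus ?thesis
    using fst_preimage_open[OF ST(1)] fst_preimage_open[OF ST(2)] ST(3,4) p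
    by (intro exI[of _ "{p \<in> points M. fst p \<in> S}"] exI[of _ "{p \<in> points M. fst p \<in> T}"]) simp
  next
   case True
   obtain U \<phi> V X where U: "(U, \<phi>) \<in> atlas N" "V \<subseteq> U" "fst p \<in> V" and X: "local_frame N s F V X"
    using ex_local_frame[OF pN(1)] by blast
   have c: "(cot_dom F V, cm \<phi> X) \<in> atlas M" by (rule cot_chart[OF U(1,2) X])
   have pD: "p \<in> cot_dom F V" "p' \<in> cot_dom F V"
    using p U(3) True unfolding points_M cot_dom_def by auto
   have "cm \<phi> X p \<noteq> cm \<phi> X p'"
    using inj_onD[OF cot_map_inj[OF U(1,2) X] _ pD] pp by blast
   from hausdorff[OF this] obtain A B where AB: "open A" "open B" "cm \<phi> X p \<in> A" "cm \<phi> X p' \<in> B" "A \<inter> B = {}"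
    by (elim exE conjE) (rule that)
   let ?S = "{x \<in> cot_dom F V. cm \<phi> X x \<in> A}" let ?T = "{x \<in> cot_dom F V. cm \<phi> X x \<in> B}"
   have "disjnt ?S ?T" using AB(5) by (auto simp: disjnt_iff)
   thus ?thesis
    using M.chart_preimage_open[OF c AB(1)] M.chart_preimage_open[OF c AB(2)] AB(3,4) pD
    by (intro exI[of _ ?S] exI[of _ ?T]) simp
  qed
 qed
 show "second_countable (mtop M)"
 proof -
  have L: "Lindelof_space (mtop N)"
   using N unfolding manifold_iff by (intro second_countable_imp_Lindelof_space) simp
  define \<U> where "\<U> = {V. EX U \<phi> X. (U, \<phi>) \<in> atlas N \<and> V \<subseteq> U \<and> local_frame N s F V X}"
  have o: "N.opn V" if "V \<in> \<U>" for V
   using that local_frame_open unfolding \<U>_def by blast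
  have "\<Union>\<U> = points N"
  proof (intro equalityI subsetI)
   fix q assume "q \<in> \<Union>\<U>"
   then obtain V where "V \<in> \<U>" "q \<in> V" by blast
   thus "q \<in> points N" using N.openin_sub_points[OF o] by blast
  next
   fix q assume "q \<in> points N"
   from ex_local_frame[OF this] obtain U \<phi> V X where
    "(U, \<phi>) \<in> atlas N" "V \<subseteq> U" "q \<in> V" "local_frame N s F V X"
    by (elim exE conjE) (rule that)
   thus "q \<in> \<Union>\<U>" unfolding \<U>_def by blast
  qed
  hence "EX \<V>. countable \<V> \<and> \<V> \<subseteq> \<U> \<and> \<Union>\<V> = points N"
   using L o unfolding Lindelof_space_def N.topspace_mtop by simp
  then obtain \<V> where V: "countable \<V>" "\<V> \<subseteq> \<U>" "\<Union>\<V> = points N"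
   by (elim exE conjE) (rule that)
  have "EX \<Phi>. (cot_dom F V, \<Phi>) \<in> atlas M" if "V \<in> \<V>" for V
   using that V(2) cot_chart unfolding \<U>_def by blast
  then obtain \<Phi> where \<Phi>: "!!V. V \<in> \<V> ==> (cot_dom F V, \<Phi> V) \<in> atlas M" by metis
  show ?thesis
  proof (rule M.second_countable_mtop)
   show "countable ((%V. (cot_dom F V, \<Phi> V)) ` \<V>)" using V(1) by simp
   show "(%V. (cot_dom F V, \<Phi> V)) ` \<V> \<subseteq> atlas M" using \<Phi> by blast
   show "points M \<subseteq> \<Union> (fst ` (%V. (cot_dom F V, \<Phi> V)) ` \<V>)"
   proof
    fix p assume p: "p \<in> points M"
    hence "fst p \<in> \<Union>\<V>" using V(3) by (simp add: points_M)
    then obtain V where "V \<in> \<V>" "fst p \<in> V" by blast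
    moreover have "p \<in> cot_dom F V" using p \<open>fst p \<in> V\<close> by (simp add: points_M cot_dom_def)
    ultimately show "p \<in> \<Union> (fst ` (%V. (cot_dom F V, \<Phi> V)) ` \<V>)" by auto
   qed
  qed
 qed
qed

subsection \<open>The projection\<close>

lemma cot_dom_open:
 assumes "(U, \<phi>) \<in> atlas N" "V \<subseteq> U" "local_frame N s F V X" "W \<subseteq> V" "N.opn W"
 shows "M.opn (cot_dom F W)"
proof -
 have "cot_dom F W \<subseteq> cot_dom F V" using assms(4) by (auto simp: cot_dom_def)
 thus ?thesis
  using M.openin_chart[OF cot_chart[OF assms(1-3)], of "cot_dom F W"] cot_map_image_open[OF assms] by simp
qed

lemma smooth_near_fst:
 assumes p: "p \<in> points M" and g: "N.smooth (fst p) g"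
 shows "M.smooth p (%x. g (fst x))"
proof -
 have "fst p \<in> points N" using p by (simp add: points_M)
 from ex_local_frame[OF this] obtain U \<phi> V X where U: "(U, \<phi>) \<in> atlas N" "V \<subseteq> U"
  and q: "fst p \<in> V" and X: "local_frame N s F V X"
  by (elim exE conjE) (rule that)
 have qU: "fst p \<in> U" using q U(2) by blast
 have pD: "p \<in> cot_dom F V" using p q by (simp add: points_M cot_dom_def)
 obtain W where W: "N.opn W" "fst p \<in> W" "W \<subseteq> U" "open_coord n (\<phi> ` W)"
  "smooth_coord n (\<phi> ` W) (g \<circ> inv_into U \<phi>)"
  using N.smooth_near_chartE[OF g U(1) qU] by metis
 let ?W = "W \<inter> V"
 have o: "N.opn ?W" using W(1) local_frame_open[OF X] by (rule openin_Int)
 have WU: "?W \<subseteq> U" using W(3) by blast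
 have WV: "?W \<subseteq> V" by blast
 have oc: "open_coord n (\<phi> ` ?W)" using N.openin_chart[OF U(1) WU] o by simp
 have gs: "smooth_coord n (\<phi> ` ?W) (g \<circ> inv_into U \<phi>)"
  using W(5) by (rule smooth_coord_subset) auto
 have oM: "open_coord (n + k) (cm \<phi> X ` cot_dom F ?W)"
  by (rule cot_map_image_open[OF U X WV o])
 have "smooth_coord (n + k) (cm \<phi> X ` cot_dom F ?W) (%z. g (inv_into U \<phi> (trunc n z)))"
  unfolding cot_map_image[OF U X WV] by (rule smooth_coord_lift[OF U(1) WU oc gs])
 hence "smooth_coord (n + k) (cm \<phi> X ` cot_dom F ?W)
   ((%x. g (fst x)) \<circ> inv_into (cot_dom F V) (cm \<phi> X))"
 proof (rule smooth_coord_cong[OF oM, rotated])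
  fix z assume "z \<in> cm \<phi> X ` cot_dom F ?W"
  hence "z \<in> cm \<phi> X ` cot_dom F V" by (auto simp: cot_dom_def)
  from cot_map_inv(2)[OF U X this]
  show "g (inv_into U \<phi> (trunc n z)) = ((%x. g (fst x)) \<circ> inv_into (cot_dom F V) (cm \<phi> X)) z"
   by simp
 qed
 moreover have "p \<in> cot_dom F ?W" "cot_dom F ?W \<subseteq> cot_dom F V"
  using pD W(2) by (auto simp: cot_dom_def)
 ultimately show ?thesis
  unfolding M.smooth_near_iff[OF cot_chart[OF U X] pD]
  using cot_dom_open[OF U X WV o] oM by (intro exI[of _ "cot_dom F ?W"]) simp
qed

lemma smooth_map_fst: "smooth_map M N fst"
 unfolding smooth_map_def
proof (intro conjI allI impI)
 show "fst ` points M \<subseteq> points N" by (auto simp: points_M)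
 fix W g assume g: "smooth_fun N W g"
 show "smooth_fun M {p \<in> points M. fst p \<in> W} (g \<circ> fst)"
 proof (rule M.smooth_funI[OF fst_preimage_open[OF N.smooth_fun_open[OF g]]])
  fix p assume "p \<in> {p \<in> points M. fst p \<in> W}"
  hence "M.smooth p (%x. g (fst x))"
   using N.smooth_fun_near[OF g] by (intro smooth_near_fst) auto
  thus "M.smooth p (g \<circ> fst)" by (simp add: o_def)
 qed
qed

lemma push_fst_apply:
 "N.smooth (fst p) g ==> push N fst p v g = v (%x. g (fst x))"
 by (simp add: push_def o_def)

lemma push_add: "push N' G p (u + v) = push N' G p u + push N' G p v"
 by (simp add: push_def fun_eq_iff)

lemma push_scale: "push N' G p (fscale c v) = fscale c (push N' G p v)"
 by (simp add: push_def fun_eq_iff)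

lemma push_zero: "push N' G p 0 = 0"
 by (simp add: push_def fun_eq_iff)

lemma push_sum: "push N' G p (\<Sum>i\<in>S. v i) = (\<Sum>i\<in>S. push N' G p (v i))"
 by (simp add: push_def fun_eq_iff sum_fun_apply)

lemma push_expand:
 assumes v: "v \<in> M.TS p" and U: "(U, \<phi>) \<in> atlas N" "fst p \<in> U"
 shows "push N fst p v = (\<Sum>j<n. fscale (v (%x. \<phi> (fst x) j)) (coord_vec N U \<phi> j (fst p)))"
proof
 fix g
 have p: "p \<in> points M" by (rule M.tangent_point[OF v])
 show "push N fst p v g = (\<Sum>j<n. fscale (v (%x. \<phi> (fst x) j)) (coord_vec N U \<phi> j (fst p))) g"
 proof (cases "N.smooth (fst p) g")
  case False
  thus ?thesis by (simp add: push_def sum_fun_apply coord_vec_def)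
 next
  case True
  obtain W where W: "N.opn W" "fst p \<in> W" "W \<subseteq> U" "open_coord n (\<phi> ` W)"
   "smooth_coord n (\<phi> ` W) (g \<circ> inv_into U \<phi>)"
   using N.smooth_near_chartE[OF True U] by metis
  let ?g = "%j x. \<phi> (fst x) j" let ?G = "g \<circ> inv_into U \<phi>"
  have c: "(%j. if j < n then \<phi> x j else 0) = \<phi> x" if "x \<in> U" for x
   using N.chart_coord[OF U(1) that] by (auto simp: coord_space_def)
  have "v (%x. g (fst x)) = v (%x. ?G (%j. if j < n then ?g j x else 0))"
  proof (rule M.tangent_cong[OF v], rule M.eventually_nearI[OF fst_preimage_open[OF W(1)]])
   show "p \<in> {p \<in> points M. fst p \<in> W}" using p W(2) by simp
   fix x assume "x \<in> {p \<in> points M. fst p \<in> W}"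
   hence x: "fst x \<in> U" using W(3) by blast
   show "g (fst x) = ?G (%j. if j < n then ?g j x else 0)"
    unfolding c[OF x] using N.chart_inv[OF U(1) x] by simp
  qed
  also have "\<dots> = (\<Sum>j<n. pderivative j ?G (%j. if j < n then ?g j p else 0) * v (?g j))"
  proof (rule M.tangent_comp[where g = ?g and G = ?G, OF v p _ W(4) _ W(5)])
   show "ALL j<n. M.smooth p (?g j)"
    using smooth_near_fst[OF p N.smooth_near_chart_coord[OF U]] by blast
   show "(%j. if j < n then ?g j p else 0) \<in> \<phi> ` W" unfolding c[OF U(2)] using W(2) by blast
  qed
  also have "\<dots> = (\<Sum>j<n. v (?g j) * coord_vec N U \<phi> j (fst p) g)"
   unfolding c[OF U(2)] using True by (simp add: coord_vec_def mult.commute)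
  finally show ?thesis using True by (simp add: push_fst_apply sum_fun_apply)
 qed
qed

lemma push_tangent:
 assumes v: "v \<in> M.TS p" shows "push N fst p v \<in> N.TS (fst p)"
proof -
 have "fst p \<in> points N" using M.tangent_point[OF v] by (simp add: points_M)
 then obtain U \<phi> where U: "(U, \<phi>) \<in> atlas N" "fst p \<in> U" using N.ex_chart by blast
 show ?thesis unfolding push_expand[OF v U] by (rule N.tangent_spaceI[OF U])
qed

end

subsection \<open>Horizontal and vertical vectors in a chart\<close>

locale cot_frame = cotangent N s F for N :: "('p, 'k::ground_field) mfd" and s F +
 fixes U \<phi> V X
 assumes U: "(U, \<phi>) \<in> atlas N" "V \<subseteq> U" and X: "local_frame N s F V X"
begin

abbreviation "D \<equiv> cot_dom F V"
abbreviation "\<Phi> \<equiv> cm \<phi> X"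

definition y :: "nat => ('p, 'k) cot => 'k" where "y i p = snd p (X i (fst p))"
definition dy :: "nat => ('p, 'k) cot => (('p, 'k) cot, 'k) tvec" where "dy i p = coord_vec M D \<Phi> (n + i) p"
text \<open>The lift that keeps every fibre coordinate \<open>y j\<close> constant, as
  \<open>hlift_y\<close> confirms. It is the horizontal lift of a flat connection and depends on the
  chart and on the frame.\<close>

definition hlift :: "('p, 'k) cot => ('p, 'k) tvec => (('p, 'k) cot, 'k) tvec"
 where "hlift p w = (\<Sum>a<n. fscale (w (%x. \<phi> x a)) (coord_vec M D \<Phi> a p))"

lemma chart: "(D, \<Phi>) \<in> atlas M" by (rule cot_chart[OF U X])

lemma D_base: assumes "p \<in> D" shows "fst p \<in> V" "fst p \<in> U" "fst p \<in> points N" "p \<in> points M"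
 using assms U(2) local_frame_points[OF X] M.chart_subset[OF chart] by (auto simp: cot_dom_def)

lemma D_open: "M.opn D" by (rule M.chart_open[OF chart])

lemma coord_base: "a < n ==> (%x. \<Phi> x a) = (%x. \<phi> (fst x) a)"
 by (rule ext) (rule cot_map_base)

lemma coord_fibre: "i < k ==> (%x. \<Phi> x (n + i)) = y i"
 by (rule ext) (simp only: cot_map_fibre y_def)

lemma smooth_y: "p \<in> D ==> i < k ==> M.smooth p (y i)"
 using M.smooth_near_chart_coord[OF chart, of p "n + i"] by (simp only: coord_fibre) simp

lemma smooth_base: "p \<in> D ==> a < n ==> M.smooth p (%x. \<phi> (fst x) a)"
 using smooth_near_fst N.smooth_near_chart_coord[OF U(1)] D_base by blast

lemma tangent_eqI_split:
 assumes u: "u \<in> M.TS p" and v: "v \<in> M.TS p" and p: "p \<in> D"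
  and b: "!!a. a < n ==> u (%x. \<phi> (fst x) a) = v (%x. \<phi> (fst x) a)"
  and f: "!!i. i < k ==> u (y i) = v (y i)"
 shows "u = v"
proof (rule M.tangent_eqI[OF u v chart p])
 fix i assume i: "i < mdim M"
 show "u (%x. \<Phi> x i) = v (%x. \<Phi> x i)"
 proof (cases "i < n")
  case True thus ?thesis using b by (simp only: coord_base)
 next
  case False
  hence "i - n < k" "i = n + (i - n)" using i by auto
  thus ?thesis using f coord_fibre[of "i - n"] by metis
 qed
qed

lemma dy_tangent: "p \<in> D ==> i < k ==> dy i p \<in> M.TS p"
 unfolding dy_def by (rule M.coord_vec_tangent[OF chart]) simp_all

lemma hlift_tangent: "p \<in> D ==> hlift p w \<in> M.TS p"
 unfolding hlift_def
 by (intro fv.subspace_sum[OF M.tangent_subspace[OF D_base(4)]] M.tangent_scale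
   M.coord_vec_tangent[OF chart]) auto

lemma dy_y: assumes "p \<in> D" "i < k" "j < k" shows "dy i p (y j) = (if i = j then 1 else 0)"
 using M.coord_vec_coord[OF chart assms(1), of "n + i" "n + j"] assms(2,3)
 unfolding dy_def by (simp add: coord_fibre)

lemma dy_base: assumes "p \<in> D" "i < k" "a < n" shows "dy i p (%x. \<phi> (fst x) a) = 0"
 using M.coord_vec_coord[OF chart assms(1), of "n + i" a] assms(2,3)
 unfolding dy_def by (simp add: coord_base)

lemma hlift_y: assumes "p \<in> D" "j < k" shows "hlift p w (y j) = 0"
proof -
 have "coord_vec M D \<Phi> a p (y j) = 0" if "a < n" for a
  using M.coord_vec_coord[OF chart assms(1), of a "n + j"] assms(2) that
  by (simp add: coord_fibre)
 thus ?thesis by (simp add: hlift_def sum_fun_apply)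
qed

lemma hlift_base: assumes "p \<in> D" "b < n" shows "hlift p w (%x. \<phi> (fst x) b) = w (%x. \<phi> x b)"
proof -
 have "coord_vec M D \<Phi> a p (%x. \<phi> (fst x) b) = (if a = b then 1 else 0)" if "a < n" for a
  using M.coord_vec_coord[OF chart assms(1), of a b] assms(2) that
  by (simp add: coord_base)
 hence "hlift p w (%x. \<phi> (fst x) b) = (\<Sum>a<n. if a = b then w (%x. \<phi> x a) else 0)"
  unfolding hlift_def sum_fun_apply by (intro sum.cong) auto
 thus ?thesis using assms(2) by simp
qed

lemma push_hlift:
 assumes p: "p \<in> D" and w: "w \<in> N.TS (fst p)"
 shows "push N fst p (hlift p w) = w"
proof -
 have "push N fst p (hlift p w) = (\<Sum>j<n. fscale (w (%x. \<phi> x j)) (coord_vec N U \<phi> j (fst p)))"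
  unfolding push_expand[OF hlift_tangent[OF p] U(1) D_base(2)[OF p]]
  using hlift_base[OF p] by (intro sum.cong) auto
 thus ?thesis using N.tangent_expand[OF w U(1) D_base(2)[OF p]] by simp
qed

lemma push_dy:
 assumes p: "p \<in> D" and i: "i < k" shows "push N fst p (dy i p) = 0"
 unfolding push_expand[OF dy_tangent[OF p i] U(1) D_base(2)[OF p]]
 using dy_base[OF p i] by simp

lemma hlift_fst:
 assumes p: "p \<in> D" and w: "w \<in> N.TS (fst p)" and g: "N.smooth (fst p) g"
 shows "hlift p w (%x. g (fst x)) = w g"
 using push_fst_apply[OF g, of "hlift p w"] push_hlift[OF p w] by simp

lemma dy_fst:
 assumes p: "p \<in> D" and i: "i < k" and g: "N.smooth (fst p) g"
 shows "dy i p (%x. g (fst x)) = 0"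
 using push_fst_apply[OF g, of "dy i p"] push_dy[OF p i] by simp

lemma hlift_add: "hlift p (u + w) = hlift p u + hlift p w"
 by (simp add: hlift_def fv.scale_left_distrib sum.distrib)

lemma hlift_scale: "hlift p (fscale c w) = fscale c (hlift p w)"
 by (simp add: hlift_def fv.scale_sum_right)

lemma hlift_sum: "hlift p (\<Sum>i\<in>S. fscale (c i) (w i)) = (\<Sum>i\<in>S. fscale (c i) (hlift p (w i)))"
 by (rule ext)
  (simp add: hlift_def sum_fun_apply sum_distrib_left sum_distrib_right mult.assoc, rule sum.swap)

lemma tangent_split:
 assumes v: "v \<in> M.TS p" and p: "p \<in> D"
 shows "v = hlift p (push N fst p v) + (\<Sum>i<k. fscale (v (y i)) (dy i p))"
proof (rule tangent_eqI_split[OF v _ p])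
 have dys: "(\<Sum>i<k. fscale (v (y i)) (dy i p)) \<in> M.TS p"
  by (intro fv.subspace_sum[OF M.tangent_subspace[OF D_base(4)[OF p]]] M.tangent_scale dy_tangent[OF p]) auto
 thus "hlift p (push N fst p v) + (\<Sum>i<k. fscale (v (y i)) (dy i p)) \<in> M.TS p"
  by (intro M.tangent_add hlift_tangent[OF p])
 fix a assume a: "a < n"
 have "N.smooth (fst p) (%x. \<phi> x a)" by (rule N.smooth_near_chart_coord[OF U(1) D_base(2)[OF p] a])
 thus "v (%x. \<phi> (fst x) a) = (hlift p (push N fst p v) + (\<Sum>i<k. fscale (v (y i)) (dy i p))) (%x. \<phi> (fst x) a)"
  using dy_base[OF p _ a] hlift_base[OF p a] by (simp add: sum_fun_apply push_fst_apply)
next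
 fix j assume j: "j < k"
 have "(\<Sum>i<k. fscale (v (y i)) (dy i p)) (y j) = (\<Sum>i<k. if i = j then v (y i) else 0)"
  unfolding sum_fun_apply using dy_y[OF p _ j] by (intro sum.cong) auto
 thus "v (y j) = (hlift p (push N fst p v) + (\<Sum>i<k. fscale (v (y i)) (dy i p))) (y j)"
  using hlift_y[OF p j] j by simp
qed

lemma vector_field_dy: "i < k ==> vector_field M D (dy i)"
 unfolding dy_def[abs_def] by (rule M.vector_field_coord_vec[OF chart]) simp

lemma vector_field_hlift:
 assumes Z: "vector_field N V Z" shows "vector_field M D (%p. hlift p (Z (fst p)))"
 unfolding hlift_def
proof (rule M.vector_field_lincomb[OF D_open])
 show "vector_field M D (coord_vec M D \<Phi> a)" if "a \<in> {..<n}" for a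
  using that by (intro M.vector_field_coord_vec[OF chart]) simp
 show "M.smooth p (%x. Z (fst x) (%y. \<phi> y a))" if "a \<in> {..<n}" "p \<in> D" for a p
  using that smooth_near_fst[OF D_base(4) N.vector_field_smooth[OF Z D_base(1)
   N.smooth_near_chart_coord[OF U(1) D_base(2)]]] by simp
qed

end

section \<open>Poisson structures\<close>

lemma dual_subspace: "fv.subspace (dual W)"
 by (rule fv.subspaceI) (auto simp: dual_zero dual_def linear_on_def algebra_simps)

lemma bivector_linear_left:
 "bivector_on T B ==> \<beta> \<in> dual T ==> linear_on (dual T) (*) (%\<alpha>. B \<alpha> \<beta>)"
 unfolding bivector_on_def by blast

lemma bivector_linear_right:
 "bivector_on T B ==> \<alpha> \<in> dual T ==> linear_on (dual T) (*) (B \<alpha>)"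
 unfolding bivector_on_def by blast

lemma bivector_alternating: "bivector_on T B ==> \<alpha> \<in> dual T ==> B \<alpha> \<alpha> = 0"
 unfolding bivector_on_def by blast

lemma bivector_outside: "bivector_on T B ==> \<alpha> \<notin> dual T \<or> \<beta> \<notin> dual T ==> B \<alpha> \<beta> = 0"
 unfolding bivector_on_def by blast

lemma bivector_antisym:
 assumes B: "bivector_on T B" and a: "\<alpha> \<in> dual T" and b: "\<beta> \<in> dual T"
 shows "B \<alpha> \<beta> = - B \<beta> \<alpha>"
proof -
 have ab: "\<alpha> + \<beta> \<in> dual T" by (rule fv.subspace_add[OF dual_subspace a b])
 have "0 = B (\<alpha> + \<beta>) (\<alpha> + \<beta>)" using bivector_alternating[OF B ab] by simp
 also have "\<dots> = B (\<alpha> + \<beta>) \<alpha> + B (\<alpha> + \<beta>) \<beta>"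
  by (rule linear_on_add[OF bivector_linear_right[OF B ab] a b])
 also have "\<dots> = (B \<alpha> \<alpha> + B \<beta> \<alpha>) + (B \<alpha> \<beta> + B \<beta> \<beta>)"
  using linear_on_add[OF bivector_linear_left[OF B a] a b]
   linear_on_add[OF bivector_linear_left[OF B b] a b] by simp
 finally show ?thesis
  using bivector_alternating[OF B a] bivector_alternating[OF B b] by (simp add: eq_neg_iff_add_eq_0 add.commute)
qed

section \<open>Differentials, Hamiltonian vector fields and the Jacobi identity\<close>

context mfold
begin

lemma differential_dual: "p \<in> points M ==> differential M f p \<in> dual (TS p)"
 unfolding differential_def by (rule dual_restr[OF _ tangent_subspace]) (simp_all add: linear_on_def)

lemma differential_apply: "v \<in> TS p ==> differential M f p v = v f"
 by (simp add: differential_def restr_def)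

lemma differential_outside: "v \<notin> TS p ==> differential M f p v = 0"
 by (simp add: differential_def restr_def)

lemma differential_expand:
 assumes U: "(U, \<phi>) \<in> atlas M" "p \<in> U"
 shows "differential M f p = (\<Sum>j<mdim M. fscale (coord_vec M U \<phi> j p f) (differential M (%x. \<phi> x j) p))"
proof
 fix v
 show "differential M f p v = (\<Sum>j<mdim M. fscale (coord_vec M U \<phi> j p f) (differential M (%x. \<phi> x j) p)) v"
 proof (cases "v \<in> TS p")
  case True
  show ?thesis
   using tangent_chart[OF True U, of f]
   by (simp only: differential_apply[OF True] sum_fun_apply fscale_apply mult.commute)
 qed (simp add: differential_outside sum_fun_apply)
qed

lemma differential_cong:
 assumes "eventually (%x. f x = g x) (near p)"
 shows "differential M f p = differential M g p"
proof
 fix v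
 show "differential M f p v = differential M g p v"
  using tangent_cong[OF _ assms, of v] by (cases "v \<in> TS p") (simp_all add: differential_def restr_def)
qed

lemma poisson_bracket_cong:
 assumes "eventually (%x. f x = f' x) (near p)" "eventually (%x. g x = g' x) (near p)"
 shows "br \<Lambda> f g p = br \<Lambda> f' g' p"
 unfolding poisson_bracket_def differential_cong[OF assms(1)] differential_cong[OF assms(2)] ..

text \<open>The bracket is cut off to 0 on functions not smooth near \<open>p\<close>, which makes
  the Hamiltonian an element of \<open>TS p\<close> and gives access to the derivation
  rules.\<close>

definition hamiltonian ::
  "('p, 'k) bivector_field => ('p => 'k) => 'p => ('p, 'k) tvec"
 where "hamiltonian \<Lambda> f p = (%g. if smooth p g then br \<Lambda> f g p else 0)"

lemma hamiltonian_apply: "smooth p g ==> hamiltonian \<Lambda> f p g = br \<Lambda> f g p"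
 by (simp add: hamiltonian_def)

lemma hamiltonian_tangent:
 assumes B: "bivector_on (TS p) (\<Lambda> p)" and p: "p \<in> points M"
 shows "hamiltonian \<Lambda> f p \<in> TS p"
proof -
 obtain U \<phi> where U: "(U, \<phi>) \<in> atlas M" "p \<in> U" using ex_chart[OF p] by blast
 let ?x = "%j x. \<phi> x j"
 have lin: "linear_on (dual (TS p)) (*) (\<Lambda> p (differential M f p))"
  using B differential_dual[OF p] by (rule bivector_linear_right)
 have "hamiltonian \<Lambda> f p = (\<Sum>j<mdim M. fscale (br \<Lambda> f (?x j) p) (coord_vec M U \<phi> j p))"
 proof
  fix g
  show "hamiltonian \<Lambda> f p g = (\<Sum>j<mdim M. fscale (br \<Lambda> f (?x j) p) (coord_vec M U \<phi> j p)) g"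
  proof (cases "smooth p g")
   case True
   have "br \<Lambda> f g p = \<Lambda> p (differential M f p)
     (\<Sum>j<mdim M. fscale (coord_vec M U \<phi> j p g) (differential M (?x j) p))"
    unfolding poisson_bracket_def differential_expand[OF U, of g] ..
   also have "\<dots> = (\<Sum>j<mdim M. coord_vec M U \<phi> j p g * \<Lambda> p (differential M f p) (differential M (?x j) p))"
    by (rule linear_on_sum[OF lin dual_subspace]) (rule differential_dual[OF p])
   finally show ?thesis
    using True by (simp add: hamiltonian_def sum_fun_apply poisson_bracket_def mult.commute)
  qed (simp add: hamiltonian_def sum_fun_apply coord_vec_def)
 qed
 thus ?thesis using tangent_spaceI[OF U] by simp
qed

lemma bracket_antisym:
 assumes "bivector_on (TS p) (\<Lambda> p)" "p \<in> points M"
 shows "br \<Lambda> f g p = - br \<Lambda> g f p"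
 unfolding poisson_bracket_def
 by (rule bivector_antisym[where B = "\<Lambda> p", OF assms(1)
    differential_dual[OF assms(2)] differential_dual[OF assms(2)]])

definition jacobiator ::
  "('p, 'k) bivector_field => ('p => 'k) => ('p => 'k) => ('p => 'k) => 'p => 'k"
 where "jacobiator \<Lambda> f g h p =
  br \<Lambda> (br \<Lambda> f g) h p
  + br \<Lambda> (br \<Lambda> g h) f p
  + br \<Lambda> (br \<Lambda> h f) g p"

lemma jacobiator_cycle: "jacobiator \<Lambda> f g h p = jacobiator \<Lambda> g h f p"
 by (simp add: jacobiator_def)

context
 fixes \<Lambda> :: "('p, 'k) bivector_field"
 assumes bv: "!!p. p \<in> points M ==> bivector_on (TS p) (\<Lambda> p)"
  and sm: "!!p f g. smooth p f ==> smooth p g ==>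
   smooth p (br \<Lambda> f g)"
begin

lemma hamiltonian_vector_field:
 assumes W: "opn W" and f: "!!p. p \<in> W ==> smooth p f"
 shows "vector_field M W (hamiltonian \<Lambda> f)"
proof (rule vector_fieldI[OF W])
 fix p assume p: "p \<in> W"
 have pM: "p \<in> points M" using openin_sub_points[OF W] p by blast
 show "hamiltonian \<Lambda> f p \<in> TS p" by (rule hamiltonian_tangent[where \<Lambda> = \<Lambda>, OF bv[OF pM] pM])
 obtain V \<psi> where V: "(V, \<psi>) \<in> atlas M" "p \<in> V" using ex_chart[OF pM] by blast
 have "smooth p (%x. hamiltonian \<Lambda> f x (%y. \<psi> y i))" if i: "i < mdim M" for i
 proof -
  have s: "smooth p (%y. \<psi> y i)" by (rule smooth_near_chart_coord[OF V i])
  from sm[OF f[OF p] s] show ?thesis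
   by (rule smooth_near_cong)
    (use smooth_near_eventually[OF s] in \<open>rule eventually_mono, simp add: hamiltonian_apply\<close>)
 qed
 thus "EX V \<psi>. (V, \<psi>) \<in> atlas M \<and> p \<in> V \<and>
   (ALL i<mdim M. smooth p (%x. hamiltonian \<Lambda> f x (%y. \<psi> y i)))"
  using V by blast
qed

text \<open>The Jacobiator is a derivation in its last argument, since it is the difference of
 \<open>X\<^bsub>{f,g}\<^esub>\<close> and \<open>[X\<^sub>f, X\<^sub>g]\<close>; hence it can be tested on coordinates.\<close>

lemma jacobiator_coordinates:
 assumes f: "smooth p f" and g: "smooth p g" and U: "(U, \<phi>) \<in> atlas M" "p \<in> U"
  and J: "!!i. i < mdim M ==> jacobiator \<Lambda> f g (%x. \<phi> x i) p = 0" and h: "smooth p h"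
 shows "jacobiator \<Lambda> f g h p = 0"
proof -
 have p: "p \<in> points M" by (rule smooth_near_points[OF f])
 have "eventually (%x. smooth x f \<and> smooth x g) (near p)"
  using smooth_near_eventually[OF f] smooth_near_eventually[OF g] by (rule eventually_conj)
 hence "EX W. opn W \<and> p \<in> W \<and> (ALL x:W. smooth x f \<and> smooth x g)"
  by (simp only: eventually_near[OF p])
 then obtain W where W: "opn W" "p \<in> W" "ALL x:W. smooth x f \<and> smooth x g"
  by (elim exE conjE) (rule that)
 have Xf: "vector_field M W (hamiltonian \<Lambda> f)" and Xg: "vector_field M W (hamiltonian \<Lambda> g)"
  using W(3) by (intro hamiltonian_vector_field[OF W(1)]; blast)+
 define w where "w = hamiltonian \<Lambda> (br \<Lambda> f g) p
  + fscale (-1) (lie_bracket M (hamiltonian \<Lambda> f) (hamiltonian \<Lambda> g) p)"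
 have w: "w \<in> TS p"
  unfolding w_def by (intro tangent_add tangent_scale hamiltonian_tangent[where \<Lambda> = \<Lambda>, OF bv[OF p] p]
    lie_bracket_tangent[OF Xf Xg W(2)])
 have wJ: "w h = jacobiator \<Lambda> f g h p" if h: "smooth p h" for h
 proof -
  have H: "eventually (%x. hamiltonian \<Lambda> f' x h = br \<Lambda> f' h x) (near p)" for f'
   using smooth_near_eventually[OF h] by (rule eventually_mono) (rule hamiltonian_apply)
  have 1: "br \<Lambda> (br \<Lambda> g h) f p = - hamiltonian \<Lambda> f p (%x. hamiltonian \<Lambda> g x h)"
  proof -
   have "hamiltonian \<Lambda> f p (%x. hamiltonian \<Lambda> g x h) = hamiltonian \<Lambda> f p (br \<Lambda> g h)"
    by (rule tangent_cong[OF vector_field_tangent[OF Xf W(2)] H])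
   thus ?thesis
    unfolding hamiltonian_apply[OF sm[OF g h]]
    using bracket_antisym[where \<Lambda> = \<Lambda> and f = "br \<Lambda> g h" and g = f, OF bv[OF p] p]
    by simp
  qed
  have 2: "br \<Lambda> (br \<Lambda> h f) g p = hamiltonian \<Lambda> g p (%x. hamiltonian \<Lambda> f x h)"
  proof -
   have "hamiltonian \<Lambda> g p (%x. hamiltonian \<Lambda> f x h) = hamiltonian \<Lambda> g p (br \<Lambda> f h)"
    by (rule tangent_cong[OF vector_field_tangent[OF Xg W(2)] H])
   also have "\<dots> = - hamiltonian \<Lambda> g p (%x. - br \<Lambda> f h x)"
    using tangent_minus[OF vector_field_tangent[OF Xg W(2)] sm[OF f h]] by simp
   also have "hamiltonian \<Lambda> g p (%x. - br \<Lambda> f h x) = hamiltonian \<Lambda> g p (br \<Lambda> h f)"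
   proof (rule tangent_cong[OF vector_field_tangent[OF Xg W(2)]])
    show "eventually (%x. - br \<Lambda> f h x = br \<Lambda> h f x) (near p)"
    proof (rule eventually_nearI[OF openin_points p])
     show "- br \<Lambda> f h x = br \<Lambda> h f x" if "x \<in> points M" for x
      using bracket_antisym[where \<Lambda> = \<Lambda> and f = f and g = h, OF bv[OF that] that] by simp
    qed
   qed
   finally show ?thesis
    unfolding hamiltonian_apply[OF sm[OF h f]]
    using bracket_antisym[where \<Lambda> = \<Lambda> and f = "br \<Lambda> h f" and g = g, OF bv[OF p] p]
    by simp
  qed
  show ?thesis
   unfolding jacobiator_def 1 2 w_def
   by (simp add: lie_bracket_apply[OF h] hamiltonian_apply[OF h])
 qed
 have "w = 0"
  by (rule tangent_eqI[OF w tangent_zero[OF p] U]) (simp add: wJ smooth_near_chart_coord[OF U] J)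
 thus ?thesis using wJ[OF h] by simp
qed

text \<open>Cyclic symmetry brings each argument in turn to the last place, where
  \<open>jacobiator_coordinates\<close> passes from coordinates to an arbitrary smooth
  function.\<close>

lemma jacobi_identity:
 assumes U: "(U, \<phi>) \<in> atlas M" "p \<in> U"
  and J: "!!i j l. i < mdim M ==> j < mdim M ==> l < mdim M ==>
   jacobiator \<Lambda> (%x. \<phi> x i) (%x. \<phi> x j) (%x. \<phi> x l) p = 0"
  and f: "smooth p f" "smooth p g" "smooth p h"
 shows "jacobiator \<Lambda> f g h p = 0"
proof -
 let ?x = "%i x. \<phi> x i"
 have s: "smooth p (?x i)" if "i < mdim M" for i by (rule smooth_near_chart_coord[OF U that])
 have 1: "jacobiator \<Lambda> (?x i) (?x j) f p = 0" if "i < mdim M" "j < mdim M" "smooth p f" for i j f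
  by (rule jacobiator_coordinates[OF s[OF that(1)] s[OF that(2)] U J[OF that(1,2)] that(3)])
 have 2: "jacobiator \<Lambda> (?x i) f g p = 0" if i: "i < mdim M" and f: "smooth p f" and g: "smooth p g" for i f g
 proof (rule jacobiator_coordinates[OF s[OF i] f U _ g])
  fix j assume j: "j < mdim M"
  show "jacobiator \<Lambda> (?x i) f (?x j) p = 0"
   using 1[OF j i f] by (simp only: jacobiator_cycle[of \<Lambda> "?x j"])
 qed
 show ?thesis
 proof (rule jacobiator_coordinates[OF f(1,2) U _ f(3)])
  fix i assume i: "i < mdim M"
  show "jacobiator \<Lambda> f g (?x i) p = 0"
   using 2[OF i f(1,2)] by (simp only: jacobiator_cycle[of \<Lambda> "?x i"])
 qed
qed

end

lemma poisson_structureI: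
 assumes M: "manifold M"
  and bv: "!!p. p \<in> points M ==> bivector_on (TS p) (\<Lambda> p)"
  and sm: "!!p f g. smooth p f ==> smooth p g ==>
   smooth p (br \<Lambda> f g)"
  and J: "!!p. p \<in> points M ==> EX U \<phi>. (U, \<phi>) \<in> atlas M \<and> p \<in> U \<and>
   (ALL i<mdim M. ALL j<mdim M. ALL l<mdim M. jacobiator \<Lambda> (%x. \<phi> x i) (%x. \<phi> x j) (%x. \<phi> x l) p = 0)"
 shows "poisson_structure M \<Lambda>"
 unfolding poisson_structure_def
proof (intro conjI allI impI ballI M bv)
 fix W f g assume "smooth_fun M W f \<and> smooth_fun M W g"
 thus "smooth_fun M W (br \<Lambda> f g)"
  by (intro smooth_funI sm) (auto intro: smooth_fun_open smooth_fun_near)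
next
 fix W f g h p assume s: "smooth_fun M W f \<and> smooth_fun M W g \<and> smooth_fun M W h" and p: "p \<in> W"
 have f: "smooth p f" "smooth p g" "smooth p h"
  using s smooth_fun_near[OF _ p] by blast+
 obtain U \<phi> where U: "(U, \<phi>) \<in> atlas M" "p \<in> U"
  "ALL i<mdim M. ALL j<mdim M. ALL l<mdim M. jacobiator \<Lambda> (%x. \<phi> x i) (%x. \<phi> x j) (%x. \<phi> x l) p = 0"
  using J[OF smooth_near_points[OF f(1)]] by (elim exE conjE) (rule that)
 have "jacobiator \<Lambda> f g h p = 0"
 proof (rule jacobi_identity[where \<Lambda> = \<Lambda>, OF _ _ U(1,2) _ f])
  show "bivector_on (TS x) (\<Lambda> x)" if "x \<in> points M" for x using that by (rule bv)
  show "smooth x (br \<Lambda> a b)" if "smooth x a" "smooth x b" for x a b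
   using that by (rule sm)
  show "jacobiator \<Lambda> (%x. \<phi> x i) (%x. \<phi> x j) (%x. \<phi> x l) p = 0"
   if "i < mdim M" "j < mdim M" "l < mdim M" for i j l
   using U(3) that by blast
 qed
 thus "br \<Lambda> (br \<Lambda> f g) h p
   + br \<Lambda> (br \<Lambda> g h) f p
   + br \<Lambda> (br \<Lambda> h f) g p = 0"
  by (simp add: jacobiator_def)
qed

text \<open>Each double bracket expands into four threefold derivatives, and the twelve terms cancel
  in pairs.\<close>

lemma lie_bracket_jacobi:
 assumes A: "vector_field M V A" and B: "vector_field M V B" and C: "vector_field M V C" and p: "p \<in> V"
 shows "lie_bracket M (lie_bracket M A B) C p + lie_bracket M (lie_bracket M B C) A p
  + lie_bracket M (lie_bracket M C A) B p = 0"
proof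
 fix f
 show "(lie_bracket M (lie_bracket M A B) C p + lie_bracket M (lie_bracket M B C) A p
  + lie_bracket M (lie_bracket M C A) B p) f = 0 f"
 proof (cases "smooth p f")
  case False
  thus ?thesis by (simp add: lie_bracket_def)
 next
  case f: True
  have *: "lie_bracket M (lie_bracket M A B) C p f =
    A p (%x. B x (%z. C z f)) - B p (%x. A x (%z. C z f)) - C p (%x. A x (%z. B z f)) + C p (%x. B x (%z. A z f))"
   if A: "vector_field M V A" and B: "vector_field M V B" and C: "vector_field M V C" for A B C
  proof -
   have s: "smooth p (%x. X x (%z. Y z f))" if "vector_field M V X" "vector_field M V Y" for X Y
    by (rule vector_field_smooth[OF that(1) p vector_field_smooth[OF that(2) p f]])
   have "C p (%x. lie_bracket M A B x f) = C p (%x. A x (%z. B z f) - B x (%z. A z f))"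
    by (rule tangent_cong[OF vector_field_tangent[OF C p]])
     (use smooth_near_eventually[OF f] in \<open>rule eventually_mono, simp add: lie_bracket_apply\<close>)
   also have "\<dots> = C p (%x. A x (%z. B z f)) - C p (%x. B x (%z. A z f))"
    by (rule tangent_diff[OF vector_field_tangent[OF C p] s[OF A B] s[OF B A]])
   finally show ?thesis
    by (simp add: lie_bracket_apply[OF f] lie_bracket_apply[OF vector_field_smooth[OF C p f]])
  qed
  show ?thesis
   unfolding plus_fun_apply *[OF A B C] *[OF B C A] *[OF C A B] by simp
 qed
qed

lemma tangent_separate:
 assumes u: "u \<in> TS p" and v: "v \<in> TS p"
  and e: "!!\<beta>. \<beta> \<in> dual (TS p) ==> \<beta> u = \<beta> v"
 shows "u = v"
proof
 fix f show "u f = v f"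
  using e[OF differential_dual[OF tangent_point[OF u]]] by (simp add: differential_apply u v)
qed

end

section \<open>The bivector attached to a frame of an involutive distribution\<close>

context cot_frame
begin

text \<open>\<open>Z\<close> need not frame \<open>F\<close>. The bundle and its coordinates
  \<open>y\<close> belong to the frame \<open>X\<close>, while \<open>Z\<close> may frame any
  distribution of the same rank that is closed under brackets, such as the one spanned by X + tY;
  \<open>c\<close> are the structure functions of \<open>Z\<close>.\<close>

definition frame_data ::
  "(nat => 'p => ('p, 'k) tvec) => (nat => nat => nat => 'p => 'k) => bool"
 where "frame_data Z c \<longleftrightarrow> (ALL i<k. vector_field N V (Z i)) \<and>
  (ALL q:V. ALL a. (\<Sum>i<k. fscale (a i) (Z i q)) = 0 --> (ALL i<k. a i = 0)) \<and>
  (ALL q:V. ALL i<k. ALL j<k. ALL l<k. N.smooth q (c i j l)) \<and>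
  (ALL q:V. ALL i<k. ALL j<k. lie_bracket N (Z i) (Z j) q = (\<Sum>l<k. fscale (c i j l q) (Z l q)))"

text \<open>The fibrewise linear function that stands for the bracket of \<open>Z i\<close> and
  \<open>Z j\<close>. By \<open>bracket_fibre_fibre\<close> its negative is the Poisson bracket of
  \<open>y i\<close> and \<open>y j\<close>.\<close>

definition C :: "(nat => nat => nat => 'p => 'k) => nat => nat => ('p, 'k) cot => 'k"
 where "C c i j p = (\<Sum>l<k. c i j l (fst p) * y l p)"

text \<open>In classical notation this is the sum over j of hlift(Z_j) \<and> d/dy_j, minus the sum
  over i < j of C_ij d/dy_i \<and> d/dy_j. It is the bivector with {g, y_j} = Z_j g, {y_i, y_j} = -
  C_ij and {g, h} = 0 for functions g, h on the base; for commuting \<open>Z\<close> the second sum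
  vanishes.\<close>

definition PB ::
  "(nat => 'p => ('p, 'k) tvec) => (nat => nat => nat => 'p => 'k) => (('p, 'k) cot, 'k) bivector_field"
 where "PB Z c p \<alpha> \<beta> = (if \<alpha> \<in> dual (M.TS p) \<and> \<beta> \<in> dual (M.TS p)
  then (\<Sum>j<k. (\<alpha> (hlift p (Z j (fst p))) - (\<Sum>i<k. C c i j p * \<alpha> (dy i p))) * \<beta> (dy j p))
   - (\<Sum>i<k. \<alpha> (dy i p) * \<beta> (hlift p (Z i (fst p))))
  else 0)"

definition sharp ::
  "(nat => 'p => ('p, 'k) tvec) => (nat => nat => nat => 'p => 'k) => ('p, 'k) cot
   => ((('p, 'k) cot, 'k) tvec => 'k) => (('p, 'k) cot, 'k) tvec"
 where "sharp Z c p \<alpha> =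
  (\<Sum>j<k. fscale (\<alpha> (hlift p (Z j (fst p))) - (\<Sum>i<k. C c i j p * \<alpha> (dy i p))) (dy j p))
  + (\<Sum>i<k. fscale (- \<alpha> (dy i p)) (hlift p (Z i (fst p))))"

lemma sharp_tangent: assumes p: "p \<in> D" shows "sharp Z c p \<alpha> \<in> M.TS p"
proof -
 have T: "fv.subspace (M.TS p)" by (rule M.tangent_subspace[OF D_base(4)[OF p]])
 have "(\<Sum>j<k. fscale (a j) (dy j p)) \<in> M.TS p" for a
  by (rule fv.subspace_sum[OF T], rule fv.subspace_scale[OF T], rule dy_tangent[OF p]) simp
 moreover have "(\<Sum>i<k. fscale (a i) (hlift p (Z i (fst p)))) \<in> M.TS p" for a
  by (rule fv.subspace_sum[OF T], rule fv.subspace_scale[OF T], rule hlift_tangent[OF p])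
 ultimately show ?thesis unfolding sharp_def by (intro fv.subspace_add[OF T])
qed

lemma dual_lincomb_dy:
 assumes p: "p \<in> D" and \<beta>: "\<beta> \<in> dual (M.TS p)"
 shows "\<beta> (\<Sum>j<k. fscale (a j) (dy j p)) = (\<Sum>j<k. a j * \<beta> (dy j p))"
 by (rule linear_on_sum[OF dual_linear[OF \<beta>] M.tangent_subspace[OF D_base(4)[OF p]]])
  (simp add: dy_tangent[OF p])

lemma dual_lincomb_hlift:
 assumes p: "p \<in> D" and \<beta>: "\<beta> \<in> dual (M.TS p)"
 shows "\<beta> (\<Sum>j<k. fscale (a j) (hlift p (Z j (fst p)))) = (\<Sum>j<k. a j * \<beta> (hlift p (Z j (fst p))))"
 by (rule linear_on_sum[OF dual_linear[OF \<beta>] M.tangent_subspace[OF D_base(4)[OF p]]])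
  (simp add: hlift_tangent[OF p])

lemma sharp_PB:
 assumes p: "p \<in> D" and a: "\<alpha> \<in> dual (M.TS p)" and b: "\<beta> \<in> dual (M.TS p)"
 shows "\<beta> (sharp Z c p \<alpha>) = PB Z c p \<alpha> \<beta>"
proof -
 have T: "fv.subspace (M.TS p)" by (rule M.tangent_subspace[OF D_base(4)[OF p]])
 have 1: "(\<Sum>j<k. fscale (a j) (dy j p)) \<in> M.TS p" for a
  by (rule fv.subspace_sum[OF T], rule fv.subspace_scale[OF T], rule dy_tangent[OF p]) simp
 have 2: "(\<Sum>i<k. fscale (a i) (hlift p (Z i (fst p)))) \<in> M.TS p" for a
  by (rule fv.subspace_sum[OF T], rule fv.subspace_scale[OF T], rule hlift_tangent[OF p])
 show ?thesis
  unfolding sharp_def linear_on_add[OF dual_linear[OF b] 1 2] dual_lincomb_dy[OF p b]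
   dual_lincomb_hlift[where Z = Z, OF p b]
  using a b by (simp add: PB_def sum_negf)
qed

lemma sharp_rel_PB:
 assumes p: "p \<in> D" and a: "\<alpha> \<in> dual (M.TS p)"
 shows "sharp_rel (M.TS p) (PB Z c p) \<alpha> u \<longleftrightarrow> u = sharp Z c p \<alpha>"
proof
 assume u: "sharp_rel (M.TS p) (PB Z c p) \<alpha> u"
 show "u = sharp Z c p \<alpha>"
 proof (rule M.tangent_separate[OF _ sharp_tangent[OF p]])
  show "u \<in> M.TS p" using u unfolding sharp_rel_def by blast
  show "\<beta> u = \<beta> (sharp Z c p \<alpha>)" if "\<beta> \<in> dual (M.TS p)" for \<beta>
   using u that sharp_PB[OF p a that] unfolding sharp_rel_def by simp
 qed
qed (use sharp_tangent[OF p] sharp_PB[OF p a] in \<open>simp add: sharp_rel_def\<close>)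

lemma frame_data_vf: "frame_data Z c ==> i < k ==> vector_field N V (Z i)"
 unfolding frame_data_def by blast

lemma frame_data_ind:
 "frame_data Z c ==> q \<in> V ==> (\<Sum>i<k. fscale (a i) (Z i q)) = 0 ==> i < k ==> a i = 0"
 unfolding frame_data_def by blast

lemma frame_data_smooth:
 "frame_data Z c ==> q \<in> V ==> i < k ==> j < k ==> l < k ==> N.smooth q (c i j l)"
 unfolding frame_data_def by blast

lemma frame_data_bracket:
 "frame_data Z c ==> q \<in> V ==> i < k ==> j < k ==>
  lie_bracket N (Z i) (Z j) q = (\<Sum>l<k. fscale (c i j l q) (Z l q))"
 unfolding frame_data_def by blast

lemma frame_data_coeff_eq:
 assumes Z: "frame_data Z c" and q: "q \<in> V" and e: "(\<Sum>i<k. fscale (a i) (Z i q)) = (\<Sum>i<k. fscale (b i) (Z i q))"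
  and i: "i < k"
 shows "a i = b i"
proof -
 have "(\<Sum>i<k. fscale (a i - b i) (Z i q)) = 0"
  using e by (simp add: fv.scale_left_diff_distrib sum_subtractf)
 from frame_data_ind[OF Z q this i] show ?thesis by simp
qed

lemma frame_data_antisym:
 assumes Z: "frame_data Z c" and q: "q \<in> V" and ij: "i < k" "j < k" "l < k"
 shows "c i j l q = - c j i l q"
proof (rule frame_data_coeff_eq[OF Z q _ ij(3), of "%l. c i j l q" "%l. - c j i l q"])
 have "lie_bracket N (Z i) (Z j) q = - lie_bracket N (Z j) (Z i) q"
  by (rule N.lie_bracket_swap[OF local_frame_points[OF X q]])
 thus "(\<Sum>l<k. fscale (c i j l q) (Z l q)) = (\<Sum>l<k. fscale (- c j i l q) (Z l q))"
  unfolding frame_data_bracket[OF Z q ij(1,2)] frame_data_bracket[OF Z q ij(2,1)]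
  by (simp add: fv.scale_minus_left sum_negf)
qed

lemma C_antisym:
 assumes Z: "frame_data Z c" and p: "p \<in> D" and ij: "i < k" "j < k"
 shows "C c i j p = - C c j i p"
proof -
 have "(\<Sum>l<k. c i j l (fst p) * y l p) = (\<Sum>l<k. - (c j i l (fst p) * y l p))"
  using frame_data_antisym[OF Z D_base(1)[OF p] ij] by (intro sum.cong) auto
 thus ?thesis by (simp add: C_def sum_negf)
qed

lemma C_alternating:
 assumes Z: "frame_data Z c" and p: "p \<in> D"
 shows "(\<Sum>j<k. (\<Sum>i<k. C c i j p * a i) * a j) = 0"
proof -
 let ?S = "\<Sum>j<k. \<Sum>i<k. C c i j p * a i * a j"
 have "?S = (\<Sum>i<k. \<Sum>j<k. C c i j p * a i * a j)" by (rule sum.swap)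
 also have "\<dots> = (\<Sum>i<k. \<Sum>j<k. - (C c j i p * a j * a i))"
 proof (intro sum.cong refl)
  fix i j assume "i \<in> {..<k}" "j \<in> {..<k}"
  hence "C c i j p = - C c j i p" by (intro C_antisym[OF Z p]) auto
  thus "C c i j p * a i * a j = - (C c j i p * a j * a i)" by simp
 qed
 also have "\<dots> = - ?S" by (simp add: sum_negf)
 finally have "?S = 0" by simp
 thus ?thesis by (simp add: sum_distrib_right)
qed

lemma PB_bivector:
 assumes Z: "frame_data Z c" and p: "p \<in> D"
 shows "bivector_on (M.TS p) (PB Z c p)"
 unfolding bivector_on_def linear_on_def
proof (intro conjI ballI allI impI)
 show "PB Z c p \<alpha> \<alpha> = 0" if "\<alpha> \<in> dual (M.TS p)" for \<alpha>
  using that C_alternating[OF Z p, of "%i. \<alpha> (dy i p)"]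
  by (simp add: PB_def left_diff_distrib right_diff_distrib sum_subtractf mult.commute)
 show "PB Z c p \<alpha> \<beta> = 0" if "\<alpha> \<notin> dual (M.TS p) \<or> \<beta> \<notin> dual (M.TS p)" for \<alpha> \<beta>
  using that by (auto simp: PB_def)
qed (simp_all add: PB_def fv.subspace_add[OF dual_subspace] fv.subspace_scale[OF dual_subspace]
  algebra_simps sum.distrib sum_subtractf sum_distrib_left sum_distrib_right)

subsection \<open>Brackets of coordinate functions\<close>

lemma bracket_PB:
 assumes \<Lambda>: "\<Lambda> p = PB Z c p" and p: "p \<in> D"
 shows "M.br \<Lambda> f g p =
  (\<Sum>j<k. (hlift p (Z j (fst p)) f - (\<Sum>i<k. C c i j p * dy i p f)) * dy j p g)
  - (\<Sum>i<k. dy i p f * hlift p (Z i (fst p)) g)"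
 using M.differential_dual[OF D_base(4)[OF p]]
 by (simp add: poisson_bracket_def \<Lambda> PB_def M.differential_apply dy_tangent[OF p] hlift_tangent[OF p])

lemma smooth_C:
 assumes Z: "frame_data Z c" and p: "p \<in> D" and ij: "i < k" "j < k"
 shows "M.smooth p (C c i j)"
 unfolding C_def[abs_def]
proof (rule M.smooth_near_sum[OF D_base(4)[OF p]])
 show "M.smooth p (%x. c i j l (fst x) * y l x)" if "l \<in> {..<k}" for l
  using that by (intro M.smooth_near_mult smooth_y[OF p]
    smooth_near_fst[OF D_base(4)[OF p] frame_data_smooth[OF Z D_base(1)[OF p] ij]]) auto
qed

lemma bracket_PB_smooth:
 assumes Z: "frame_data Z c" and \<Lambda>: "!!x. x \<in> D ==> \<Lambda> x = PB Z c x" and p: "p \<in> D"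
  and f: "M.smooth p f" and g: "M.smooth p g"
 shows "M.smooth p (M.br \<Lambda> f g)"
proof -
 have pM: "p \<in> points M" by (rule D_base(4)[OF p])
 have h: "M.smooth p (%x. hlift x (Z i (fst x)) f)" if "i < k" "M.smooth p f" for i f
  by (rule M.vector_field_smooth[OF vector_field_hlift[OF frame_data_vf[OF Z that(1)]] p that(2)])
 have d: "M.smooth p (%x. dy i x f)" if "i < k" "M.smooth p f" for i f
  by (rule M.vector_field_smooth[OF vector_field_dy[OF that(1)] p that(2)])
 have "M.smooth p (%x. (\<Sum>j<k. (hlift x (Z j (fst x)) f - (\<Sum>i<k. C c i j x * dy i x f)) * dy j x g)
  - (\<Sum>i<k. dy i x f * hlift x (Z i (fst x)) g))"
 proof (intro M.smooth_near_diff M.smooth_near_sum pM)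
  fix j assume "j \<in> {..<k}"
  hence j: "j < k" by simp
  have "M.smooth p (%x. \<Sum>i<k. C c i j x * dy i x f)"
  proof (rule M.smooth_near_sum[OF pM])
   show "M.smooth p (%x. C c i j x * dy i x f)" if "i \<in> {..<k}" for i
    using that by (intro M.smooth_near_mult smooth_C[OF Z p _ j] d f) auto
  qed
  thus "M.smooth p (%x. (hlift x (Z j (fst x)) f - (\<Sum>i<k. C c i j x * dy i x f)) * dy j x g)"
   by (intro M.smooth_near_mult M.smooth_near_diff h[OF j f] d[OF j g])
  show "M.smooth p (%x. dy j x f * hlift x (Z j (fst x)) g)"
   by (intro M.smooth_near_mult h[OF j g] d[OF j f])
 qed
 thus ?thesis
 proof (rule M.smooth_near_cong)
  show "eventually (%x. (\<Sum>j<k. (hlift x (Z j (fst x)) f - (\<Sum>i<k. C c i j x * dy i x f)) * dy j x g)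
   - (\<Sum>i<k. dy i x f * hlift x (Z i (fst x)) g) = M.br \<Lambda> f g x) (M.near p)"
  proof (rule M.eventually_nearI[OF D_open p])
   fix x assume x: "x \<in> D"
   show "(\<Sum>j<k. (hlift x (Z j (fst x)) f - (\<Sum>i<k. C c i j x * dy i x f)) * dy j x g)
    - (\<Sum>i<k. dy i x f * hlift x (Z i (fst x)) g) = M.br \<Lambda> f g x"
    by (rule bracket_PB[where \<Lambda> = \<Lambda>, OF \<Lambda>[OF x] x, symmetric])
  qed
 qed
qed

lemma Z_tangent: "frame_data Z c ==> q \<in> V ==> i < k ==> Z i q \<in> N.TS q"
 using N.vector_field_tangent[OF frame_data_vf] by blast

lemma hlift_Z_fst:
 assumes "frame_data Z c" "p \<in> D" "i < k" "N.smooth (fst p) g"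
 shows "hlift p (Z i (fst p)) (%x. g (fst x)) = Z i (fst p) g"
 using hlift_fst[OF assms(2) Z_tangent[OF assms(1) D_base(1)[OF assms(2)] assms(3)] assms(4)] .

lemma bracket_base_base:
 assumes Z: "frame_data Z c" and \<Lambda>: "\<Lambda> p = PB Z c p" and p: "p \<in> D"
  and g: "N.smooth (fst p) g" "N.smooth (fst p) h"
 shows "M.br \<Lambda> (%x. g (fst x)) (%x. h (fst x)) p = 0"
 unfolding bracket_PB[where \<Lambda> = \<Lambda>, OF \<Lambda> p] using dy_fst[OF p _ g(1)] dy_fst[OF p _ g(2)] by simp

lemma bracket_base_fibre:
 assumes Z: "frame_data Z c" and \<Lambda>: "\<Lambda> p = PB Z c p" and p: "p \<in> D"
  and g: "N.smooth (fst p) g" and j: "j < k"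
 shows "M.br \<Lambda> (%x. g (fst x)) (y j) p = Z j (fst p) g"
  "M.br \<Lambda> (y j) (%x. g (fst x)) p = - Z j (fst p) g"
proof -
 have 1: "(\<Sum>i'<k. C c i' i p * dy i' p (%x. g (fst x))) = 0" for i
  using dy_fst[OF p _ g] by (intro sum.neutral) auto
 have "(\<Sum>i<k. (hlift p (Z i (fst p)) (%x. g (fst x)) - 0) * dy i p (y j)) = (\<Sum>i<k. if i = j then Z i (fst p) g else 0)"
  using hlift_Z_fst[OF Z p _ g] dy_y[OF p _ j] by (intro sum.cong) auto
 thus "M.br \<Lambda> (%x. g (fst x)) (y j) p = Z j (fst p) g"
  unfolding bracket_PB[where \<Lambda> = \<Lambda>, OF \<Lambda> p] 1 using dy_fst[OF p _ g] j by simp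
 have "(\<Sum>i<k. dy i p (y j) * hlift p (Z i (fst p)) (%x. g (fst x))) = (\<Sum>i<k. if i = j then Z i (fst p) g else 0)"
  using hlift_Z_fst[OF Z p _ g] dy_y[OF p _ j] by (intro sum.cong) auto
 thus "M.br \<Lambda> (y j) (%x. g (fst x)) p = - Z j (fst p) g"
  unfolding bracket_PB[where \<Lambda> = \<Lambda>, OF \<Lambda> p] using dy_fst[OF p _ g] j by simp
qed

lemma bracket_fibre_fibre:
 assumes Z: "frame_data Z c" and \<Lambda>: "\<Lambda> p = PB Z c p" and p: "p \<in> D"
  and i: "i < k" and j: "j < k"
 shows "M.br \<Lambda> (y i) (y j) p = - C c i j p"
proof -
 have 1: "(\<Sum>i'<k. C c i' j' p * dy i' p (y i)) = C c i j' p" for j'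
 proof -
  have "(\<Sum>i'<k. C c i' j' p * dy i' p (y i)) = (\<Sum>i'<k. if i' = i then C c i' j' p else 0)"
   using dy_y[OF p _ i] by (intro sum.cong) auto
  thus ?thesis using i by simp
 qed
 have "(\<Sum>j'<k. - C c i j' p * dy j' p (y j)) = (\<Sum>j'<k. if j' = j then - C c i j' p else 0)"
  using dy_y[OF p _ j] by (intro sum.cong) auto
 thus ?thesis
  unfolding bracket_PB[where \<Lambda> = \<Lambda>, OF \<Lambda> p] 1 using hlift_y[OF p i] hlift_y[OF p j] j by simp
qed

lemma bracket_C:
 assumes Z: "frame_data Z c" and \<Lambda>: "\<Lambda> p = PB Z c p" and p: "p \<in> D"
  and i: "i < k" and j: "j < k" 
 shows "M.br \<Lambda> (C c i j) h p =
  (\<Sum>l<k. c i j l (fst p) * M.br \<Lambda> (y l) h p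
   + M.br \<Lambda> (%x. c i j l (fst x)) h p * y l p)"
proof -
 have pM: "p \<in> points M" by (rule D_base(4)[OF p])
 have bv: "bivector_on (M.TS p) (\<Lambda> p)" unfolding \<Lambda> by (rule PB_bivector[OF Z p])
 have as: "M.br \<Lambda> f h p = - M.hamiltonian \<Lambda> h p f" if "M.smooth p f" for f
  using M.bracket_antisym[where \<Lambda> = \<Lambda> and f = f and g = h, OF bv pM] M.hamiltonian_apply[OF that, of \<Lambda> h] by simp
 have v: "M.hamiltonian \<Lambda> h p \<in> M.TS p"
  by (rule M.hamiltonian_tangent[where \<Lambda> = \<Lambda>, OF bv pM])
 have sc: "M.smooth p (%x. c i j l (fst x))" if "l < k" for l
  by (rule smooth_near_fst[OF pM frame_data_smooth[OF Z D_base(1)[OF p] i j that]])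
 have sy: "M.smooth p (y l)" if "l < k" for l by (rule smooth_y[OF p that])
 have "M.br \<Lambda> (C c i j) h p = - M.hamiltonian \<Lambda> h p (%x. \<Sum>l<k. c i j l (fst x) * y l x)"
  using as[OF smooth_C[OF Z p i j]] by (simp add: C_def[abs_def])
 also have "M.hamiltonian \<Lambda> h p (%x. \<Sum>l<k. c i j l (fst x) * y l x)
   = (\<Sum>l<k. M.hamiltonian \<Lambda> h p (%x. c i j l (fst x) * y l x))"
  by (rule M.tangent_sum[OF v]) (simp add: M.smooth_near_mult sc sy)
 also have "\<dots> = (\<Sum>l<k. M.hamiltonian \<Lambda> h p (%x. c i j l (fst x)) * y l p
   + c i j l (fst p) * M.hamiltonian \<Lambda> h p (y l))"
  by (intro sum.cong refl M.tangent_mult[OF v]) (simp_all add: sc sy)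
 finally show ?thesis
  by (simp add: as sc sy sum_negf[symmetric] algebra_simps)
qed

text \<open>The coefficient along \<open>Z h\<close> of the double bracket [[Z_i, Z_j], Z_m]. The
  two terms come from the rule [f Z_l, Z_m] = f [Z_l, Z_m] - (Z_m f) Z_l.\<close>

definition K :: "(nat => 'p => ('p, 'k) tvec) => (nat => nat => nat => 'p => 'k) => nat => nat => nat => nat => 'p => 'k"
 where "K Z c i j m h q = (\<Sum>l<k. c i j l q * c l m h q) - Z m q (c i j h)"

lemma lie_bracket_twice:
 assumes Z: "frame_data Z c" and q: "q \<in> V" and ijm: "i < k" "j < k" "m < k"
 shows "lie_bracket N (lie_bracket N (Z i) (Z j)) (Z m) q = (\<Sum>h<k. fscale (K Z c i j m h q) (Z h q))"
proof
 fix g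
 have Vo: "N.opn V" by (rule local_frame_open[OF X])
 have vf: "vector_field N V (Z i)" if "i < k" for i by (rule frame_data_vf[OF Z that])
 have vij: "vector_field N V (lie_bracket N (Z i) (Z j))"
  by (rule N.vector_field_lie_bracket[OF vf[OF ijm(1)] vf[OF ijm(2)]])
 show "lie_bracket N (lie_bracket N (Z i) (Z j)) (Z m) q g = (\<Sum>h<k. fscale (K Z c i j m h q) (Z h q)) g"
 proof (cases "N.smooth q g")
  case False
  thus ?thesis
   using N.tangent_nonsmooth[OF Z_tangent[OF Z q]]
   by (simp add: lie_bracket_def sum_fun_apply)
 next
  case g: True
  have sZ: "N.smooth q (%x. Z i x g)" if "i < k" for i by (rule N.vector_field_smooth[OF vf[OF that] q g])
  have sc: "N.smooth q (c i j l)" if "l < k" for l by (rule frame_data_smooth[OF Z q ijm(1,2) that])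
  have Zm: "Z m q \<in> N.TS q" by (rule Z_tangent[OF Z q ijm(3)])
  have "Z m q (%x. lie_bracket N (Z i) (Z j) x g) = Z m q (%x. \<Sum>l<k. c i j l x * Z l x g)"
  proof (rule N.tangent_cong[OF Zm], rule N.eventually_nearI[OF Vo q])
   fix x assume x: "x \<in> V"
   show "lie_bracket N (Z i) (Z j) x g = (\<Sum>l<k. c i j l x * Z l x g)"
    unfolding frame_data_bracket[OF Z x ijm(1,2)] by (simp add: sum_fun_apply)
  qed
  also have "\<dots> = (\<Sum>l<k. Z m q (%x. c i j l x * Z l x g))"
   by (rule N.tangent_sum[OF Zm]) (simp add: N.smooth_near_mult sc sZ)
  also have "\<dots> = (\<Sum>l<k. Z m q (c i j l) * Z l q g + c i j l q * Z m q (%x. Z l x g))"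
   by (intro sum.cong refl N.tangent_mult[OF Zm]) (simp_all add: sc sZ)
  finally have 1: "Z m q (%x. lie_bracket N (Z i) (Z j) x g)
   = (\<Sum>l<k. Z m q (c i j l) * Z l q g + c i j l q * Z m q (%x. Z l x g))" .
  have 2: "lie_bracket N (Z i) (Z j) q (%x. Z m x g) = (\<Sum>l<k. c i j l q * Z l q (%x. Z m x g))"
   unfolding frame_data_bracket[OF Z q ijm(1,2)] by (simp add: sum_fun_apply)
  have 3: "Z l q (%x. Z m x g) - Z m q (%x. Z l x g) = (\<Sum>h<k. c l m h q * Z h q g)" if "l < k" for l
  proof -
   have "lie_bracket N (Z l) (Z m) q g = (\<Sum>h<k. c l m h q * Z h q g)"
    unfolding frame_data_bracket[OF Z q that ijm(3)] by (simp add: sum_fun_apply)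
   thus ?thesis by (simp add: N.lie_bracket_apply[OF g])
  qed
  have "lie_bracket N (lie_bracket N (Z i) (Z j)) (Z m) q g
    = (\<Sum>l<k. c i j l q * (Z l q (%x. Z m x g) - Z m q (%x. Z l x g))) - (\<Sum>l<k. Z m q (c i j l) * Z l q g)"
   unfolding N.lie_bracket_apply[OF g] 1 2
   by (simp add: sum_subtractf[symmetric] algebra_simps)
  also have "(\<Sum>l<k. c i j l q * (Z l q (%x. Z m x g) - Z m q (%x. Z l x g)))
    = (\<Sum>l<k. \<Sum>h<k. c i j l q * (c l m h q * Z h q g))"
   using 3 by (simp add: sum_distrib_left)
  also have "\<dots> = (\<Sum>h<k. \<Sum>l<k. c i j l q * (c l m h q * Z h q g))" by (rule sum.swap)
  finally show ?thesis
   by (simp add: sum_fun_apply K_def left_diff_distrib sum_subtractf sum_distrib_right mult.assoc)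
 qed
qed

text \<open>The Jacobi identity for vector fields on \<open>N\<close>, read coefficient by
  coefficient in the independent frame \<open>Z\<close>.\<close>

lemma K_cyclic:
 assumes Z: "frame_data Z c" and q: "q \<in> V" and ijm: "i < k" "j < k" "m < k" "h < k"
 shows "K Z c i j m h q + K Z c j m i h q + K Z c m i j h q = 0"
proof (rule frame_data_ind[OF Z q _ ijm(4), of "%h. K Z c i j m h q + K Z c j m i h q + K Z c m i j h q"])
 have vf: "vector_field N V (Z i)" if "i < k" for i by (rule frame_data_vf[OF Z that])
 show "(\<Sum>h<k. fscale (K Z c i j m h q + K Z c j m i h q + K Z c m i j h q) (Z h q)) = 0"
  using N.lie_bracket_jacobi[OF vf[OF ijm(1)] vf[OF ijm(2)] vf[OF ijm(3)] q]
  unfolding lie_bracket_twice[OF Z q ijm(1,2,3)] lie_bracket_twice[OF Z q ijm(2,3,1)]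
   lie_bracket_twice[OF Z q ijm(3,1,2)]
  by (simp add: fv.scale_left_distrib sum.distrib)
qed

end

section \<open>The Jacobi identity on base and fibre coordinates\<close>

context cot_frame
begin

context
 fixes Z c and \<Lambda> :: "(('p, 'k) cot, 'k) bivector_field"
 assumes Z: "frame_data Z c" and \<Lambda>: "!!x. x \<in> D ==> \<Lambda> x = PB Z c x"
begin

lemma near_D: "p \<in> D ==> (!!x. x \<in> D ==> f x = g x) ==> eventually (%x. f x = g x) (M.near p)"
 by (rule M.eventually_nearI[OF D_open])

lemma bracket_left_near:
 assumes p: "p \<in> D" and e: "!!x. x \<in> D ==> f x = f' x"
 shows "M.br \<Lambda> f g p = M.br \<Lambda> f' g p"
 by (rule M.poisson_bracket_cong[OF near_D[OF p e]]) simp_all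

lemma bv_D: "x \<in> D ==> bivector_on (M.TS x) (\<Lambda> x)"
 using PB_bivector[OF Z] \<Lambda> by simp

lemma bracket_zero_left: "p \<in> D ==> M.br \<Lambda> (%x. 0) g p = 0"
 unfolding bracket_PB[where \<Lambda> = \<Lambda>, OF \<Lambda>]
 by (simp add: M.tangent_const[OF hlift_tangent] M.tangent_const[OF dy_tangent])

lemma smooth_base_fst: "p \<in> D ==> a < n ==> N.smooth (fst p) (%q. \<phi> q a)"
 by (rule N.smooth_near_chart_coord[OF U(1) D_base(2)])

lemma smooth_Z_coord: "x \<in> D ==> i < k ==> a < n ==> N.smooth (fst x) (%q. Z i q (%q. \<phi> q a))"
 by (rule N.vector_field_smooth[OF frame_data_vf[OF Z] D_base(1) smooth_base_fst])

abbreviation (input) "xb a \<equiv> %x. \<phi> (fst x) a"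

text \<open>The letters b and f in these names count base and fibre coordinates. Two base functions
  commute on all of \<open>D\<close> and not only at \<open>p\<close>, so the outer bracket is taken
  with the zero function.\<close>

lemma jacobi_bbb:
 assumes p: "p \<in> D" and a: "a < n" "b < n"
 shows "M.br \<Lambda> (M.br \<Lambda> (xb a) (xb b)) g p = 0"
proof -
 have "M.br \<Lambda> (M.br \<Lambda> (xb a) (xb b)) g p = M.br \<Lambda> (%x. 0) g p"
 proof (rule bracket_left_near[OF p])
  fix x assume x: "x \<in> D"
  show "M.br \<Lambda> (xb a) (xb b) x = 0"
   by (rule bracket_base_base[where \<Lambda> = \<Lambda>, OF Z \<Lambda>[OF x] x smooth_base_fst[OF x a(1)] smooth_base_fst[OF x a(2)]])
 qed
 thus ?thesis using bracket_zero_left[OF p] by simp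
qed

lemma inner_bf:
 assumes p: "p \<in> D" and a: "a < n" and i: "i < k"
 shows "M.br \<Lambda> (M.br \<Lambda> (xb a) (y i)) g p =
   M.br \<Lambda> (%x. Z i (fst x) (%q. \<phi> q a)) g p"
  "M.br \<Lambda> (M.br \<Lambda> (y i) (xb a)) g p =
   M.br \<Lambda> (%x. (- Z i (fst x) (%q. \<phi> q a))) g p"
proof -
 show "M.br \<Lambda> (M.br \<Lambda> (xb a) (y i)) g p =
   M.br \<Lambda> (%x. Z i (fst x) (%q. \<phi> q a)) g p"
  by (rule bracket_left_near[OF p])
   (rule bracket_base_fibre(1)[where \<Lambda> = \<Lambda>, OF Z \<Lambda> _ smooth_base_fst[OF _ a] i])
 show "M.br \<Lambda> (M.br \<Lambda> (y i) (xb a)) g p =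
   M.br \<Lambda> (%x. (- Z i (fst x) (%q. \<phi> q a))) g p"
  by (rule bracket_left_near[OF p])
   (rule bracket_base_fibre(2)[where \<Lambda> = \<Lambda>, OF Z \<Lambda> _ smooth_base_fst[OF _ a] i])
qed

lemma bracket_minus_left:
 assumes p: "p \<in> D" and f: "M.smooth p f"
 shows "M.br \<Lambda> (%x. - f x) g p = - M.br \<Lambda> f g p"
proof -
 have pM: "p \<in> points M" by (rule D_base(4)[OF p])
 have v: "M.hamiltonian \<Lambda> g p \<in> M.TS p"
  by (rule M.hamiltonian_tangent[where \<Lambda> = \<Lambda>, OF bv_D[OF p] pM])
 have as: "M.br \<Lambda> f g p = - M.hamiltonian \<Lambda> g p f" if "M.smooth p f" for f
  using M.bracket_antisym[where \<Lambda> = \<Lambda> and f = f and g = g, OF bv_D[OF p] pM] M.hamiltonian_apply[OF that, of \<Lambda> g] by simp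
 show ?thesis
  unfolding as[OF f] as[OF M.smooth_near_uminus[OF f]] M.tangent_minus[OF v f] ..
qed

text \<open>The bracket of a base coordinate with a fibre coordinate is again a function on the
  base, so all three terms vanish.\<close>

lemma jacobi_bbf:
 assumes p: "p \<in> D" and a: "a < n" "b < n" and i: "i < k"
 shows "M.jacobiator \<Lambda> (xb a) (xb b) (y i) p = 0"
proof -
 have s: "N.smooth (fst p) (%q. Z i q (%q. \<phi> q a))" if "a < n" for a
  by (rule smooth_Z_coord[OF p i that])
 have 1: "M.br \<Lambda> (%x. Z i (fst x) (%q. \<phi> q a)) (xb b) p = 0" if "a < n" "b < n" for a b
  by (rule bracket_base_base[where \<Lambda> = \<Lambda>, OF Z \<Lambda>[OF p] p s[OF that(1)] smooth_base_fst[OF p that(2)]])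
 have 2: "M.br \<Lambda> (%x. - Z i (fst x) (%q. \<phi> q a)) (xb b) p = 0" if "a < n" "b < n" for a b
  unfolding bracket_minus_left[OF p smooth_near_fst[OF D_base(4)[OF p] s[OF that(1)]]] 1[OF that] by simp
 show ?thesis
  unfolding M.jacobiator_def jacobi_bbb[OF p a] inner_bf(1)[OF p a(2) i] inner_bf(2)[OF p a(1) i]
   1[OF a(2,1)] 2[OF a] by simp
qed

lemma inner_ff:
 assumes p: "p \<in> D" and ij: "i < k" "j < k"
 shows "M.br \<Lambda> (M.br \<Lambda> (y i) (y j)) g p =
  - (\<Sum>l<k. c i j l (fst p) * M.br \<Lambda> (y l) g p
   + M.br \<Lambda> (%x. c i j l (fst x)) g p * y l p)"
proof -
 have "M.br \<Lambda> (M.br \<Lambda> (y i) (y j)) g p = M.br \<Lambda> (%x. - C c i j x) g p"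
  by (rule bracket_left_near[OF p]) (rule bracket_fibre_fibre[where \<Lambda> = \<Lambda>, OF Z \<Lambda> _ ij])
 also have "\<dots> = - M.br \<Lambda> (C c i j) g p"
  by (rule bracket_minus_left[OF p smooth_C[OF Z p ij]])
 finally show ?thesis unfolding bracket_C[where \<Lambda> = \<Lambda>, OF Z \<Lambda>[OF p] p ij] .
qed

text \<open>The identity amounts to the structure equation of the frame, [Z_i, Z_j] = sum of c_ijl
  Z_l, applied to the base coordinate.\<close>

lemma jacobi_bff:
 assumes p: "p \<in> D" and a: "a < n" and ij: "i < k" "j < k"
 shows "M.jacobiator \<Lambda> (xb a) (y i) (y j) p = 0"
proof -
 let ?x = "%q. \<phi> q a"
 have q: "fst p \<in> V" by (rule D_base(1)[OF p])
 have sx: "N.smooth (fst p) ?x" by (rule smooth_base_fst[OF p a])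
 have s: "N.smooth (fst p) (%q. Z i q ?x)" if "i < k" for i
  by (rule smooth_Z_coord[OF p that a])
 have sc: "N.smooth (fst p) (c i j l)" if "l < k" for l
  by (rule frame_data_smooth[OF Z q ij that])
 have 1: "M.br \<Lambda> (%x. Z i (fst x) ?x) (y j) p = Z j (fst p) (%q. Z i q ?x)" if "i < k" "j < k" for i j
  by (rule bracket_base_fibre(1)[where \<Lambda> = \<Lambda>, OF Z \<Lambda>[OF p] p s[OF that(1)] that(2)])
 have 2: "M.br \<Lambda> (%x. - Z j (fst x) ?x) (y i) p = - Z i (fst p) (%q. Z j q ?x)"
  unfolding bracket_minus_left[OF p smooth_near_fst[OF D_base(4)[OF p] s[OF ij(2)]]] 1[OF ij(2,1)] ..
 have 3: "M.br \<Lambda> (y l) (xb a) p = - Z l (fst p) ?x" if "l < k" for l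
  by (rule bracket_base_fibre(2)[where \<Lambda> = \<Lambda>, OF Z \<Lambda>[OF p] p sx that])
 have 4: "M.br \<Lambda> (%x. c i j l (fst x)) (xb a) p = 0" if "l < k" for l
  by (rule bracket_base_base[where \<Lambda> = \<Lambda>, OF Z \<Lambda>[OF p] p sc[OF that] sx])
 have 5: "(\<Sum>l<k. c i j l (fst p) * M.br \<Lambda> (y l) (xb a) p
   + M.br \<Lambda> (%x. c i j l (fst x)) (xb a) p * y l p) = - (\<Sum>l<k. c i j l (fst p) * Z l (fst p) ?x)"
  using 3 4 by (simp add: sum_negf)
 have "lie_bracket N (Z i) (Z j) (fst p) ?x = (\<Sum>l<k. c i j l (fst p) * Z l (fst p) ?x)"
  unfolding frame_data_bracket[OF Z q ij] by (simp add: sum_fun_apply)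
 hence 6: "Z i (fst p) (%q. Z j q ?x) - Z j (fst p) (%q. Z i q ?x) = (\<Sum>l<k. c i j l (fst p) * Z l (fst p) ?x)"
  by (simp add: N.lie_bracket_apply[OF sx])
 show ?thesis
  unfolding M.jacobiator_def inner_bf(1)[OF p a ij(1)] inner_bf(2)[OF p a ij(2)] inner_ff[OF p ij]
   1[OF ij] 2 5 6[symmetric] by simp
qed

text \<open>The Jacobiator is linear on the fibres, and its coefficients are the cyclic sums that
  vanish by \<open>K_cyclic\<close>.\<close>

lemma jacobi_fff:
 assumes p: "p \<in> D" and ij: "i < k" "j < k" "m < k"
 shows "M.jacobiator \<Lambda> (y i) (y j) (y m) p = 0"
proof -
 have q: "fst p \<in> V" by (rule D_base(1)[OF p])
 have *: "M.br \<Lambda> (M.br \<Lambda> (y i) (y j)) (y m) p = (\<Sum>h<k. K Z c i j m h (fst p) * y h p)"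
  if ijm: "i < k" "j < k" "m < k" for i j m
 proof -
  have sc: "N.smooth (fst p) (c i j l)" if "l < k" for l
   by (rule frame_data_smooth[OF Z q ijm(1,2) that])
  have 1: "M.br \<Lambda> (%x. c i j l (fst x)) (y m) p = Z m (fst p) (c i j l)" if "l < k" for l
   by (rule bracket_base_fibre(1)[where \<Lambda> = \<Lambda>, OF Z \<Lambda>[OF p] p sc[OF that] ijm(3)])
  have 2: "M.br \<Lambda> (y l) (y m) p = - C c l m p" if "l < k" for l
   by (rule bracket_fibre_fibre[where \<Lambda> = \<Lambda>, OF Z \<Lambda>[OF p] p that ijm(3)])
  have "M.br \<Lambda> (M.br \<Lambda> (y i) (y j)) (y m) p =
    (\<Sum>l<k. c i j l (fst p) * C c l m p) - (\<Sum>l<k. Z m (fst p) (c i j l) * y l p)"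
   unfolding inner_ff[OF p ijm(1,2)] using 1 2 by (simp add: sum.distrib sum_negf sum_subtractf)
  also have "(\<Sum>l<k. c i j l (fst p) * C c l m p) = (\<Sum>l<k. \<Sum>h<k. c i j l (fst p) * (c l m h (fst p) * y h p))"
   by (simp add: C_def sum_distrib_left)
  also have "\<dots> = (\<Sum>h<k. \<Sum>l<k. c i j l (fst p) * (c l m h (fst p) * y h p))" by (rule sum.swap)
  finally show ?thesis
   by (simp add: K_def left_diff_distrib sum_subtractf sum_distrib_right mult.assoc)
 qed
 have "M.jacobiator \<Lambda> (y i) (y j) (y m) p
   = (\<Sum>h<k. (K Z c i j m h (fst p) + K Z c j m i h (fst p) + K Z c m i j h (fst p)) * y h p)"
  unfolding M.jacobiator_def *[OF ij(1,2,3)] *[OF ij(2,3,1)] *[OF ij(3,1,2)]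
  by (simp add: sum.distrib distrib_right)
 also have "\<dots> = 0"
  using K_cyclic[OF Z q ij] by (intro sum.neutral) auto
 finally show ?thesis .
qed

text \<open>Up to cyclic rotation only the number of fibre coordinates among the three matters,
  which leaves the four cases above.\<close>

lemma PB_jacobi:
 assumes p: "p \<in> D" and ijm: "i < mdim M" "j < mdim M" "m < mdim M"
 shows "M.jacobiator \<Lambda> (%x. \<Phi> x i) (%x. \<Phi> x j) (%x. \<Phi> x m) p = 0"
proof -
 define B where "B f \<longleftrightarrow> (EX a. a < n \<and> f = xb a)" for f :: "('p, 'k) cot => 'k"
 define E where "E f \<longleftrightarrow> (EX l. l < k \<and> f = y l)" for f
 have cases: "B (%x. \<Phi> x i) \<or> E (%x. \<Phi> x i)" if "i < mdim M" for i
 proof (cases "i < n")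
  case True thus ?thesis unfolding B_def using coord_base[OF True] by blast
 next
  case False
  hence "i - n < k" "i = n + (i - n)" using that by auto
  thus ?thesis unfolding E_def using coord_fibre[of "i - n"] by metis
 qed
 note cyc = M.jacobiator_cycle
 have bbb: "M.jacobiator \<Lambda> f g h p = 0" if "B f" "B g" "B h" for f g h
  using that unfolding B_def by (elim exE conjE) (simp add: M.jacobiator_def jacobi_bbb[OF p])
 have bbf: "M.jacobiator \<Lambda> f g h p = 0" if "B f" "B g" "E h" for f g h
  using that unfolding B_def E_def by (elim exE conjE) (simp add: jacobi_bbf[OF p])
 have bff: "M.jacobiator \<Lambda> f g h p = 0" if "B f" "E g" "E h" for f g h
  using that unfolding B_def E_def by (elim exE conjE) (simp add: jacobi_bff[OF p])
 have fff: "M.jacobiator \<Lambda> f g h p = 0" if "E f" "E g" "E h" for f g h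
  using that unfolding E_def by (elim exE conjE) (simp add: jacobi_fff[OF p])
 have J: "M.jacobiator \<Lambda> f g h p = 0" if f: "B f \<or> E f" and g: "B g \<or> E g" and h: "B h \<or> E h" for f g h
  using f
 proof
  assume f: "B f"
  show ?thesis using g
  proof
   assume g: "B g"
   show ?thesis using h bbb[OF f g] bbf[OF f g] by (elim disjE)
  next
   assume g: "E g"
   show ?thesis using h
   proof
    assume h: "B h"
    show ?thesis using bbf[OF h f g] unfolding cyc[of \<Lambda> h f g] .
   qed (rule bff[OF f g])
  qed
 next
  assume f: "E f"
  show ?thesis using g
  proof
   assume g: "B g"
   show ?thesis using h
   proof
    assume h: "B h"
    show ?thesis unfolding cyc[of \<Lambda> f g h] by (rule bbf[OF g h f])
   next
    assume h: "E h"
    show ?thesis unfolding cyc[of \<Lambda> f g h] by (rule bff[OF g h f])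
   qed
  next
   assume g: "E g"
   show ?thesis using h
   proof
    assume h: "B h"
    show ?thesis using bff[OF h f g] unfolding cyc[of \<Lambda> h f g] .
   qed (rule fff[OF f g])
  qed
 qed
 show ?thesis by (rule J[OF cases[OF ijm(1)] cases[OF ijm(2)] cases[OF ijm(3)]])
qed

end

subsection \<open>The image\<close>

lemma ex_covector:
 assumes Z: "frame_data Z c" and p: "p \<in> D"
 shows "EX \<alpha>:dual (M.TS p). ALL i<k. \<alpha> (hlift p (Z i (fst p))) = g i \<and> \<alpha> (dy i p) = h i"
proof -
 let ?I = "{..<k} <+> {..<k}" and ?f = "case_sum (%i. hlift p (Z i (fst p))) (%i. dy i p)"
 have s: "(\<Sum>x\<in>?I. fscale (a x) (?f x)) = (\<Sum>i<k. fscale (a (Inl i)) (hlift p (Z i (fst p)))) + (\<Sum>i<k. fscale (a (Inr i)) (dy i p))" for a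
  by (subst sum.Plus) simp_all
 have "EX \<alpha>:dual (M.TS p). ALL x:?I. \<alpha> (?f x) = case_sum g h x"
 proof (rule ex_dual[OF _ M.tangent_subspace[OF D_base(4)[OF p]]])
  show "?f x \<in> M.TS p" if "x \<in> ?I" for x
   using that hlift_tangent[OF p] dy_tangent[OF p] by auto
  fix a assume "(\<Sum>x\<in>?I. fscale (a x) (?f x)) = 0"
  hence z: "(\<Sum>i<k. fscale (a (Inl i)) (hlift p (Z i (fst p)))) + (\<Sum>i<k. fscale (a (Inr i)) (dy i p)) = 0" unfolding s .
  have "(\<Sum>i<k. fscale (a (Inl i)) (Z i (fst p))) = 0"
   using arg_cong[OF z, of "push N fst p"] push_hlift[OF p Z_tangent[OF Z D_base(1)[OF p]]]
   by (simp add: push_add push_sum push_scale push_zero push_dy[OF p])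
  from frame_data_ind[OF Z D_base(1)[OF p] this] have 1: "a (Inl i) = 0" if "i < k" for i using that .
  have "a (Inr i) = 0" if i: "i < k" for i
  proof -
   have "(\<Sum>j<k. a (Inr j) * dy j p (y i)) = (\<Sum>j<k. if j = i then a (Inr j) else 0)"
    by (rule sum.cong) (auto simp: dy_y[OF p _ i])
   thus ?thesis using fun_cong[OF z, of "y i"] i by (simp add: sum_fun_apply hlift_y[OF p i])
  qed
  thus "ALL x:?I. a x = 0" using 1 by auto
 qed simp
 then obtain \<alpha> where \<alpha>: "\<alpha> \<in> dual (M.TS p)" and e: "ALL x:?I. \<alpha> (?f x) = case_sum g h x"
  by (elim bexE) (rule that)
 have "\<alpha> (hlift p (Z i (fst p))) = g i \<and> \<alpha> (dy i p) = h i" if "i < k" for i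
  using bspec[OF e InlI, of i] bspec[OF e InrI, of i] that by simp
 thus ?thesis by (intro bexI[OF _ \<alpha>] allI impI)
qed

lemma push_sharp:
 assumes Z: "frame_data Z c" and p: "p \<in> D"
 shows "push N fst p (sharp Z c p \<alpha>) = (\<Sum>i<k. fscale (- \<alpha> (dy i p)) (Z i (fst p)))"
proof -
 have "push N fst p (sharp Z c p \<alpha>) = (\<Sum>j<k. fscale (\<alpha> (hlift p (Z j (fst p))) - (\<Sum>i<k. C c i j p * \<alpha> (dy i p))) (push N fst p (dy j p)))
  + (\<Sum>i<k. fscale (- \<alpha> (dy i p)) (push N fst p (hlift p (Z i (fst p)))))"
  unfolding sharp_def push_add push_sum push_scale ..
 also have "(\<Sum>j<k. fscale (\<alpha> (hlift p (Z j (fst p))) - (\<Sum>i<k. C c i j p * \<alpha> (dy i p))) (push N fst p (dy j p))) = 0"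
  by (rule sum.neutral) (simp add: push_dy[OF p])
 also have "(\<Sum>i<k. fscale (- \<alpha> (dy i p)) (push N fst p (hlift p (Z i (fst p)))))
   = (\<Sum>i<k. fscale (- \<alpha> (dy i p)) (Z i (fst p)))"
  by (intro sum.cong refl) (simp add: push_hlift[OF p Z_tangent[OF Z D_base(1)[OF p]]])
 finally show ?thesis by simp
qed

text \<open>The projection of the image is the span of \<open>Z\<close>, and the image contains all
  vertical vectors because the values of a covector on the lifts of \<open>Z\<close> are
  free.\<close>

lemma image_PB:
 assumes Z: "frame_data Z c" and p: "p \<in> D"
 shows "bivector_image (M.TS p) (PB Z c p) =
  {v \<in> M.TS p. push N fst p v \<in> range (%\<xi>. \<Sum>i<k. fscale (\<xi> i) (Z i (fst p)))}"
proof (intro equalityI subsetI)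
 fix v assume "v \<in> bivector_image (M.TS p) (PB Z c p)"
 then obtain \<alpha> where "\<alpha> \<in> dual (M.TS p)" "v = sharp Z c p \<alpha>"
  unfolding bivector_image_def using sharp_rel_PB[OF p] by blast
 hence "v \<in> M.TS p" "push N fst p v = (\<Sum>i<k. fscale (- \<alpha> (dy i p)) (Z i (fst p)))"
  using sharp_tangent[OF p, of Z c \<alpha>] push_sharp[OF Z p, of \<alpha>] by simp_all
 thus "v \<in> {v \<in> M.TS p. push N fst p v \<in> range (%\<xi>. \<Sum>i<k. fscale (\<xi> i) (Z i (fst p)))}"
  by (intro CollectI conjI range_eqI)
next
 fix v assume "v \<in> {v \<in> M.TS p. push N fst p v \<in> range (%\<xi>. \<Sum>i<k. fscale (\<xi> i) (Z i (fst p)))}"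
 then obtain \<xi> where v: "v \<in> M.TS p" "push N fst p v = (\<Sum>i<k. fscale (\<xi> i) (Z i (fst p)))" by blast
 \<comment> \<open>The values on the \<open>dy j p\<close> are dictated by the horizontal part of
   \<open>v\<close>; those on the lifts compensate the \<open>C\<close> terms and produce the
   vertical part.\<close>
 obtain \<alpha> where \<alpha>: "\<alpha> \<in> dual (M.TS p)"
  "ALL j<k. \<alpha> (hlift p (Z j (fst p))) = v (y j) - (\<Sum>i<k. C c i j p * \<xi> i) \<and> \<alpha> (dy j p) = - \<xi> j"
  using ex_covector[OF Z p, of "%j. v (y j) - (\<Sum>i<k. C c i j p * \<xi> i)" "%j. - \<xi> j"] by blast
 have "sharp Z c p \<alpha> = (\<Sum>j<k. fscale (v (y j)) (dy j p)) + (\<Sum>i<k. fscale (\<xi> i) (hlift p (Z i (fst p))))"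
  unfolding sharp_def using \<alpha>(2) by (intro arg_cong2[where f = "(+)"] sum.cong arg_cong2[where f = fscale] refl)
   (auto simp: sum_negf)
 also have "(\<Sum>i<k. fscale (\<xi> i) (hlift p (Z i (fst p)))) = hlift p (push N fst p v)"
  unfolding v(2) hlift_sum ..
 finally have s: "sharp Z c p \<alpha> = (\<Sum>j<k. fscale (v (y j)) (dy j p)) + hlift p (push N fst p v)" .
 have "v = sharp Z c p \<alpha>"
  unfolding s by (rule trans[OF tangent_split[OF v(1) p] add.commute])
 thus "v \<in> bivector_image (M.TS p) (PB Z c p)"
  unfolding bivector_image_def using sharp_rel_PB[OF p \<alpha>(1)] \<alpha>(1) by blast
qed

lemma ex_frame_data:
 assumes vf: "ALL i<k. vector_field N V (Z i)"
  and ind: "ALL q:V. ALL a. (\<Sum>i<k. fscale (a i) (Z i q)) = 0 --> (ALL i<k. a i = 0)"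
  and br: "ALL q:V. ALL i<k. ALL j<k. lie_bracket N (Z i) (Z j) q \<in> range (%\<xi>. \<Sum>l<k. fscale (\<xi> l) (Z l q))"
 shows "EX c. frame_data Z c"
proof -
 have ex: "EX c. lie_bracket N (Z i) (Z j) q = (\<Sum>l<k. fscale (c l) (Z l q))" if "q \<in> V" "i < k" "j < k" for q i j
  using br that by blast
 define c where "c q i j = (SOME c. lie_bracket N (Z i) (Z j) q = (\<Sum>l<k. fscale (c l) (Z l q)))" for q i j
 have c: "lie_bracket N (Z i) (Z j) q = (\<Sum>l<k. fscale (c q i j l) (Z l q))"
  if "q \<in> V" "i < k" "j < k" for q i j
  unfolding c_def using someI_ex[OF ex[OF that]] .
 have "N.smooth q (%q. c q i j l)" if q: "q \<in> V" and ijl: "i < k" "j < k" "l < k" for q i j l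
 proof (rule smooth_frame_coefficients[where c = "%l q. c q i j l" and m = k and X = Z and V = V
    and Y = "lie_bracket N (Z i) (Z j)", OF vf q _ _ _ ijl(3)])
  show "vector_field N V (lie_bracket N (Z i) (Z j))"
   using vf ijl by (intro N.vector_field_lie_bracket) auto
  show "ALL x:V. lie_bracket N (Z i) (Z j) x = (\<Sum>l<k. fscale (c x i j l) (Z l x))"
   using c ijl by blast
  show "ALL c. (\<Sum>i<k. fscale (c i) (Z i q)) = 0 --> (ALL i<k. c i = 0)" using ind q by blast
 qed
 hence "frame_data Z (%i j l q. c q i j l)"
  unfolding frame_data_def using vf ind c by blast
 thus ?thesis by blast
qed

end

section \<open>The Liouville-Poisson structure in a frame\<close>

context mfold
begin

lemma ex_sharp:
 assumes B: "bivector_on (TS p) B" and \<alpha>: "\<alpha> \<in> dual (TS p)" and p: "p \<in> points M"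
 shows "EX u. sharp_rel (TS p) B \<alpha> u"
proof -
 let ?T = "TS p"
 obtain U \<phi> where U: "(U, \<phi>) \<in> atlas M" "p \<in> U" using ex_chart[OF p] by blast
 let ?dx = "%j. differential M (%x. \<phi> x j) p" let ?d = "%j. coord_vec M U \<phi> j p"
 have d: "?d j \<in> ?T" if "j < mdim M" for j by (rule coord_vec_tangent[OF U that])
 define u where "u = (\<Sum>j<mdim M. fscale (B \<alpha> (?dx j)) (?d j))"
 have u: "u \<in> ?T" unfolding u_def by (rule tangent_spaceI[OF U])
 have "\<beta> u = B \<alpha> \<beta>" if \<beta>: "\<beta> \<in> dual ?T" for \<beta>
 proof -
  have expand: "\<beta> = (\<Sum>j<mdim M. fscale (\<beta> (?d j)) (?dx j))"
  proof
   fix v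
   show "\<beta> v = (\<Sum>j<mdim M. fscale (\<beta> (?d j)) (?dx j)) v"
   proof (cases "v \<in> ?T")
    case True
    have "\<beta> v = \<beta> (\<Sum>j<mdim M. fscale (v (%x. \<phi> x j)) (?d j))"
     using tangent_expand[OF True U] by simp
    also have "\<dots> = (\<Sum>j<mdim M. v (%x. \<phi> x j) * \<beta> (?d j))"
     by (rule linear_on_sum[OF dual_linear[OF \<beta>] tangent_subspace[OF p]]) (simp add: d)
    finally show ?thesis by (simp add: sum_fun_apply differential_apply[OF True] mult.commute)
   qed (simp add: dual_outside[OF \<beta>] differential_outside sum_fun_apply)
  qed
  have "B \<alpha> (\<Sum>j<mdim M. fscale (\<beta> (?d j)) (?dx j)) = (\<Sum>j<mdim M. \<beta> (?d j) * B \<alpha> (?dx j))"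
   by (rule linear_on_sum[OF bivector_linear_right[OF B \<alpha>] dual_subspace]) (rule differential_dual[OF p])
  moreover have "\<beta> u = (\<Sum>j<mdim M. B \<alpha> (?dx j) * \<beta> (?d j))"
   unfolding u_def by (rule linear_on_sum[OF dual_linear[OF \<beta>] tangent_subspace[OF p]]) (simp add: d)
  ultimately show ?thesis using expand by (simp add: mult.commute)
 qed
 thus ?thesis unfolding sharp_rel_def using u by blast
qed

end

context cotangent
begin

lemma eventually_fst:
 assumes P: "eventually P (N.near (fst p))" and p: "p \<in> points M"
 shows "eventually (%x. P (fst x)) (M.near p)"
proof -
 have q: "fst p \<in> points N" using p by (simp add: points_M)
 have "EX S. N.opn S \<and> fst p \<in> S \<and> (ALL x:S. P x)"
  using P by (simp only: N.eventually_near[OF q])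
 then obtain S where S: "N.opn S" "fst p \<in> S" "ALL x:S. P x"
  by (elim exE conjE) (rule that)
 show ?thesis
  by (rule M.eventually_nearI[OF fst_preimage_open[OF S(1)]]) (use S p in auto)
qed

end

section \<open>The leafwise symplectic form on sections of the lifted foliation\<close>

context cot_frame
begin

context
 fixes c
 assumes Xc: "frame_data X c"
begin

lemma X_tangent: "q \<in> V ==> i < k ==> X i q \<in> N.TS q"
 by (rule Z_tangent[OF Xc])

lemma X_lift: "q \<in> V ==> (\<Sum>i<k. fscale (\<xi> i) (X i q)) \<in> F q"
 by (simp add: local_frame_range[OF X])

lemma snd_lincomb:
 assumes p: "p \<in> D" shows "snd p (\<Sum>i<k. fscale (\<xi> i) (X i (fst p))) = (\<Sum>i<k. \<xi> i * y i p)"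
 unfolding y_def
proof (rule linear_on_sum[OF _ F_subspace[OF D_base(3)[OF p]]])
 show "linear_on (F (fst p)) (*) (snd p)" using p by (intro dual_linear) (simp add: cot_dom_def)
qed (simp add: local_frame_in[OF X D_base(1)[OF p]])

text \<open>Constant coefficients in the adapted frame extend \<open>u\<close>. At least one
  extension must exist, since otherwise the condition on the number in
  \<open>liouville_symplectic\<close> would be vacuous and \<open>THE\<close> undetermined.\<close>

lemma section_extension:
 assumes p: "p \<in> D" and u: "u \<in> lifted p"
 shows "EX S. vector_field M D S \<and> S p = u \<and> (ALL x:D. S x \<in> lifted x)"
proof -
 have uT: "u \<in> M.TS p" and "push N fst p u \<in> F (fst p)"
  using u unfolding lifted_foliation_def by auto
 then obtain \<xi> where \<xi>: "push N fst p u = (\<Sum>i<k. fscale (\<xi> i) (X i (fst p)))"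
  using local_frame_range[OF X D_base(1)[OF p]] by blast
 define S where "S x = (\<Sum>i<k. fscale (\<xi> i) (hlift x (X i (fst x)))) + (\<Sum>i<k. fscale (u (y i)) (dy i x))" for x
 have 1: "vector_field M D (%x. \<Sum>i<k. fscale (\<xi> i) (hlift x (X i (fst x))))"
 proof (rule M.vector_field_lincomb[where f = "%i x. \<xi> i", OF D_open])
  show "vector_field M D (%x. hlift x (X i (fst x)))" if "i \<in> {..<k}" for i
   using that by (intro vector_field_hlift frame_data_vf[OF Xc]) simp
  show "M.smooth x (%x. \<xi> i)" if "x \<in> D" for i x by (rule M.smooth_near_const[OF D_base(4)[OF that]])
 qed
 have 2: "vector_field M D (%x. \<Sum>i<k. fscale (u (y i)) (dy i x))"
 proof (rule M.vector_field_lincomb[where f = "%i x. u (y i)", OF D_open])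
  show "vector_field M D (dy i)" if "i \<in> {..<k}" for i using that by (intro vector_field_dy) simp
  show "M.smooth x (%x. u (y i))" if "x \<in> D" for i x by (rule M.smooth_near_const[OF D_base(4)[OF that]])
 qed
 have vf: "vector_field M D S"
  unfolding S_def[abs_def] by (rule M.vector_field_add[OF 1 2])
 have "S p = u"
  unfolding S_def hlift_sum[symmetric] \<xi>[symmetric] by (rule tangent_split[OF uT p, symmetric])
 moreover have "S x \<in> lifted x" if x: "x \<in> D" for x
 proof -
  have "push N fst x (S x) = (\<Sum>i<k. fscale (\<xi> i) (push N fst x (hlift x (X i (fst x)))))
    + (\<Sum>i<k. fscale (u (y i)) (push N fst x (dy i x)))"
   unfolding S_def push_add push_sum push_scale ..
  also have "(\<Sum>i<k. fscale (\<xi> i) (push N fst x (hlift x (X i (fst x))))) = (\<Sum>i<k. fscale (\<xi> i) (X i (fst x)))"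
   by (intro sum.cong refl) (simp add: push_hlift[OF x X_tangent[OF D_base(1)[OF x]]])
  also have "(\<Sum>i<k. fscale (u (y i)) (push N fst x (dy i x))) = 0"
   by (rule sum.neutral) (simp add: push_dy[OF x])
  finally have "push N fst x (S x) \<in> F (fst x)"
   by (simp only: add_0_right X_lift[OF D_base(1)[OF x]])
  thus ?thesis unfolding lifted_foliation_def using M.vector_field_tangent[OF vf x] by simp
 qed
 ultimately show ?thesis using vf by blast
qed

text \<open>The coefficients of the projected section are functions on the total space. They are
  smooth because the matrix of \<open>frame_coefficients\<close>, composed with \<open>fst\<close>,
  computes them.\<close>

lemma section_coefficients:
 assumes p: "p \<in> D" and S: "vector_field M W S" "p \<in> W" and l: "ALL x:W. S x \<in> lifted x"
 shows "EX \<xi>. (ALL i<k. M.smooth p (\<xi> i)) \<and>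
  eventually (%x. push N fst x (S x) = (\<Sum>i<k. fscale (\<xi> i x) (X i (fst x)))) (M.near p)"
proof -
 have q: "fst p \<in> V" "fst p \<in> U" by (rule D_base[OF p])+
 have pM: "p \<in> points M" by (rule D_base(4)[OF p])
 have vf: "ALL i<k. vector_field N V (X i)" using frame_data_vf[OF Xc] by blast
 have ind: "ALL c. (\<Sum>i<k. fscale (c i) (X i (fst p))) = 0 --> (ALL i<k. c i = 0)"
  using frame_data_ind[OF Xc q(1)] by blast
 obtain B where B: "ALL l<k. ALL a<n. N.smooth (fst p) (B l a)"
  "eventually (%x. ALL l<k. ALL c. (\<Sum>a<n. B l a x * (\<Sum>i<k. fscale (c i) (X i x)) (%y. \<phi> y a)) = c l) (N.near (fst p))"
  using frame_coefficients[where X = X and m = k, OF U(1) q(2) vf q(1) ind] by (elim exE conjE) (rule that)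
 define \<xi> where "\<xi> i x = (\<Sum>a<n. B i a (fst x) * S x (%y. \<phi> (fst y) a))" for i x
 have "M.smooth p (\<xi> i)" if "i < k" for i
  unfolding \<xi>_def[abs_def]
 proof (rule M.smooth_near_sum[OF pM])
  show "M.smooth p (%x. B i a (fst x) * S x (%y. \<phi> (fst y) a))" if "a \<in> {..<n}" for a
  proof (rule M.smooth_near_mult)
   show "M.smooth p (%x. B i a (fst x))"
    using B(1) \<open>i < k\<close> that by (intro smooth_near_fst[OF pM]) auto
   show "M.smooth p (%x. S x (%y. \<phi> (fst y) a))"
    using that by (intro M.vector_field_smooth[OF S smooth_base[OF p]]) auto
  qed
 qed
 moreover have "eventually (%x. push N fst x (S x) = (\<Sum>i<k. fscale (\<xi> i x) (X i (fst x)))) (M.near p)"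
  using eventually_fst[OF B(2) pM] M.eventually_in_open[OF D_open p]
   M.eventually_in_open[OF M.vector_field_open[OF S(1)] S(2)]
 proof eventually_elim
  case (elim x)
  have "push N fst x (S x) \<in> F (fst x)" using l elim(3) unfolding lifted_foliation_def by blast
  then obtain a where a: "push N fst x (S x) = (\<Sum>i<k. fscale (a i) (X i (fst x)))"
   using local_frame_range[OF X D_base(1)[OF elim(2)]] by blast
  have "\<xi> i x = a i" if i: "i < k" for i
  proof -
   have "\<xi> i x = (\<Sum>a<n. B i a (fst x) * push N fst x (S x) (%y. \<phi> y a))"
    unfolding \<xi>_def
    by (intro sum.cong refl) (simp add: push_fst_apply[OF N.smooth_near_chart_coord[OF U(1) D_base(2)[OF elim(2)]]])
   also have "\<dots> = a i" unfolding a using elim(1) i by blast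
   finally show ?thesis .
  qed
  thus ?case unfolding a by (intro sum.cong refl arg_cong2[where f = fscale]) simp
 qed
 ultimately show ?thesis by blast
qed

lemma section_derivative:
 assumes p: "p \<in> D" and v: "v \<in> M.TS p"
  and \<xi>': "ALL i<k. M.smooth p (\<xi>' i)"
  and f: "ALL i<k. M.smooth p (f i)"
 shows "v (%x. \<Sum>i<k. \<xi>' i x * f i x) = (\<Sum>i<k. v (\<xi>' i) * f i p + \<xi>' i p * v (f i))"
proof -
 have "v (%x. \<Sum>i<k. \<xi>' i x * f i x) = (\<Sum>i<k. v (%x. \<xi>' i x * f i x))"
  using \<xi>' f by (intro M.tangent_sum[OF v] M.smooth_near_mult) auto
 also have "\<dots> = (\<Sum>i<k. v (\<xi>' i) * f i p + \<xi>' i p * v (f i))"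
  using \<xi>' f by (intro sum.cong refl M.tangent_mult[OF v]) auto
 finally show ?thesis .
qed

lemma section_iterated:
 assumes p: "p \<in> D" and S: "vector_field M W S" "p \<in> W" and S': "vector_field M W S'"
  and \<xi>: "ALL i<k. M.smooth p (\<xi> i)"
   "eventually (%x. push N fst x (S x) = (\<Sum>i<k. fscale (\<xi> i x) (X i (fst x)))) (M.near p)"
  and \<xi>': "ALL i<k. M.smooth p (\<xi>' i)"
   "eventually (%x. push N fst x (S' x) = (\<Sum>i<k. fscale (\<xi>' i x) (X i (fst x)))) (M.near p)"
  and g: "N.smooth (fst p) g"
 shows "S p (%x. S' x (%z. g (fst z))) = (\<Sum>i<k. S p (\<xi>' i) * X i (fst p) g)
  + (\<Sum>i<k. \<Sum>j<k. \<xi> i p * \<xi>' j p * X i (fst p) (%q. X j q g))"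
proof -
 have pM: "p \<in> points M" by (rule D_base(4)[OF p])
 have v: "S p \<in> M.TS p" by (rule M.vector_field_tangent[OF S])
 have sX: "N.smooth (fst p) (%q. X i q g)" if "i < k" for i
  by (rule N.vector_field_smooth[OF frame_data_vf[OF Xc that] D_base(1)[OF p] g])
 have push: "push N fst p (S p) = (\<Sum>i<k. fscale (\<xi> i p) (X i (fst p)))"
  by (rule M.eventually_near_self[OF \<xi>(2) pM])
 have "S p (%x. S' x (%z. g (fst z))) = S p (%x. \<Sum>j<k. \<xi>' j x * X j (fst x) g)"
 proof (rule M.tangent_cong[OF v])
  show "eventually (%x. S' x (%z. g (fst z)) = (\<Sum>j<k. \<xi>' j x * X j (fst x) g)) (M.near p)"
   using \<xi>'(2) eventually_fst[OF N.smooth_near_eventually[OF g] pM]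
  proof eventually_elim
   case (elim x)
   thus ?case using push_fst_apply[OF elim(2), of "S' x"] by (simp add: sum_fun_apply)
  qed
 qed
 also have "\<dots> = (\<Sum>j<k. S p (\<xi>' j) * X j (fst p) g + \<xi>' j p * S p (%x. X j (fst x) g))"
  by (rule section_derivative[where f = "%j x. X j (fst x) g", OF p v \<xi>'(1)])
   (use smooth_near_fst[OF pM sX] in blast)
 also have "\<dots> = (\<Sum>j<k. S p (\<xi>' j) * X j (fst p) g)
   + (\<Sum>j<k. \<xi>' j p * (\<Sum>i<k. \<xi> i p * X i (fst p) (%q. X j q g)))"
 proof -
  have "S p (%x. X j (fst x) g) = (\<Sum>i<k. \<xi> i p * X i (fst p) (%q. X j q g))" if "j < k" for j
   using push_fst_apply[OF sX[OF that], of "S p"] unfolding push by (simp add: sum_fun_apply)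
  thus ?thesis by (simp add: sum.distrib)
 qed
 also have "(\<Sum>j<k. \<xi>' j p * (\<Sum>i<k. \<xi> i p * X i (fst p) (%q. X j q g)))
   = (\<Sum>j<k. \<Sum>i<k. \<xi> i p * \<xi>' j p * X i (fst p) (%q. X j q g))"
  by (simp add: sum_distrib_left mult_ac)
 also have "\<dots> = (\<Sum>i<k. \<Sum>j<k. \<xi> i p * \<xi>' j p * X i (fst p) (%q. X j q g))" by (rule sum.swap)
 finally show ?thesis .
qed

text \<open>\<open>S\<close> and \<open>S'\<close> need not be projectable, as their coefficients
  may vary along the fibres. Testing on functions from the base still gives the usual formula for
  the bracket of two combinations of the frame, with coefficients differentiated along
  \<open>S\<close> and \<open>S'\<close>.\<close>

lemma section_bracket:
 assumes p: "p \<in> D" and S: "vector_field M W S" "p \<in> W" and S': "vector_field M W S'"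
  and \<xi>: "ALL i<k. M.smooth p (\<xi> i)"
   "eventually (%x. push N fst x (S x) = (\<Sum>i<k. fscale (\<xi> i x) (X i (fst x)))) (M.near p)"
  and \<xi>': "ALL i<k. M.smooth p (\<xi>' i)"
   "eventually (%x. push N fst x (S' x) = (\<Sum>i<k. fscale (\<xi>' i x) (X i (fst x)))) (M.near p)"
 shows "push N fst p (lie_bracket M S S' p) =
  (\<Sum>l<k. fscale (S p (\<xi>' l) - S' p (\<xi> l) + (\<Sum>i<k. \<Sum>j<k. \<xi> i p * \<xi>' j p * c i j l (fst p))) (X l (fst p)))"
proof
 fix g
 let ?q = "fst p"
 have pM: "p \<in> points M" by (rule D_base(4)[OF p])
 show "push N fst p (lie_bracket M S S' p) g =
  (\<Sum>l<k. fscale (S p (\<xi>' l) - S' p (\<xi> l) + (\<Sum>i<k. \<Sum>j<k. \<xi> i p * \<xi>' j p * c i j l (fst p))) (X l (fst p))) g"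
 proof (cases "N.smooth ?q g")
  case False
  thus ?thesis
   using N.tangent_nonsmooth[OF X_tangent[OF D_base(1)[OF p]]] by (simp add: push_def sum_fun_apply)
 next
  case g: True
  have br: "X i ?q (%q. X j q g) - X j ?q (%q. X i q g) = (\<Sum>l<k. c i j l ?q * X l ?q g)" if "i < k" "j < k" for i j
  proof -
   have "lie_bracket N (X i) (X j) ?q g = (\<Sum>l<k. c i j l ?q * X l ?q g)"
    unfolding frame_data_bracket[OF Xc D_base(1)[OF p] that] by (simp add: sum_fun_apply)
   thus ?thesis by (simp add: N.lie_bracket_apply[OF g])
  qed
  have "(\<Sum>i<k. \<Sum>j<k. \<xi>' i p * \<xi> j p * X i ?q (%q. X j q g)) = (\<Sum>j<k. \<Sum>i<k. \<xi>' i p * \<xi> j p * X i ?q (%q. X j q g))"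
   by (rule sum.swap)
  hence "push N fst p (lie_bracket M S S' p) g = (\<Sum>i<k. S p (\<xi>' i) * X i ?q g) - (\<Sum>i<k. S' p (\<xi> i) * X i ?q g)
    + ((\<Sum>i<k. \<Sum>j<k. \<xi> i p * \<xi>' j p * X i ?q (%q. X j q g)) - (\<Sum>i<k. \<Sum>j<k. \<xi>' j p * \<xi> i p * X j ?q (%q. X i q g)))"
   unfolding push_fst_apply[OF g] M.lie_bracket_apply[OF smooth_near_fst[OF pM g]]
    section_iterated[OF p S S' \<xi> \<xi>' g] section_iterated[OF p S' S(2) S(1) \<xi>' \<xi> g] by simp
  also have "(\<Sum>i<k. \<Sum>j<k. \<xi> i p * \<xi>' j p * X i ?q (%q. X j q g)) - (\<Sum>i<k. \<Sum>j<k. \<xi>' j p * \<xi> i p * X j ?q (%q. X i q g))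
    = (\<Sum>i<k. \<Sum>j<k. \<xi> i p * \<xi>' j p * (X i ?q (%q. X j q g) - X j ?q (%q. X i q g)))"
   by (simp add: sum_subtractf[symmetric] algebra_simps)
  also have "\<dots> = (\<Sum>i<k. \<Sum>j<k. \<Sum>l<k. \<xi> i p * \<xi>' j p * c i j l ?q * X l ?q g)"
   using br by (simp add: sum_distrib_left mult.assoc)
  also have "\<dots> = (\<Sum>i<k. \<Sum>l<k. \<Sum>j<k. \<xi> i p * \<xi>' j p * c i j l ?q * X l ?q g)"
   by (rule sum.cong[OF refl], rule sum.swap)
  also have "\<dots> = (\<Sum>l<k. \<Sum>i<k. \<Sum>j<k. \<xi> i p * \<xi>' j p * c i j l ?q * X l ?q g)"
   by (rule sum.swap)
  finally show ?thesis
   by (simp add: sum_fun_apply distrib_right left_diff_distrib sum.distrib sum_subtractf sum_distrib_right)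
 qed
qed

text \<open>On a section with coefficients \<xi> the Liouville form is the sum of \<xi>_i y_i. The
  derivatives of the coefficients cancel against those in \<open>section_bracket\<close>, so only
  values at \<open>p\<close> remain; hence the form does not depend on the chosen
  extensions.\<close>

lemma liouville_symplectic_section:
 assumes p: "p \<in> D" and S: "vector_field M W S" "p \<in> W" and S': "vector_field M W S'"
  and l: "ALL x:W. S x \<in> lifted x" "ALL x:W. S' x \<in> lifted x"
  and u: "push N fst p (S p) = (\<Sum>i<k. fscale (\<xi>0 i) (X i (fst p)))"
  and v: "push N fst p (S' p) = (\<Sum>i<k. fscale (\<xi>0' i) (X i (fst p)))"
 shows "- (S p (%x. liouville_form N x (S' x)) - S' p (%x. liouville_form N x (S x))
   - liouville_form N p (lie_bracket M S S' p))
  = (\<Sum>i<k. \<xi>0 i * S' p (y i) - \<xi>0' i * S p (y i)) + (\<Sum>i<k. \<Sum>j<k. \<xi>0 i * \<xi>0' j * C c i j p)"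
proof -
 have pM: "p \<in> points M" by (rule D_base(4)[OF p])
 obtain \<xi> where \<xi>: "ALL i<k. M.smooth p (\<xi> i)"
  "eventually (%x. push N fst x (S x) = (\<Sum>i<k. fscale (\<xi> i x) (X i (fst x)))) (M.near p)"
  using section_coefficients[OF p S l(1)] by (elim exE conjE) (rule that)
 obtain \<xi>' where \<xi>': "ALL i<k. M.smooth p (\<xi>' i)"
  "eventually (%x. push N fst x (S' x) = (\<Sum>i<k. fscale (\<xi>' i x) (X i (fst x)))) (M.near p)"
  using section_coefficients[OF p S' S(2) l(2)] by (elim exE conjE) (rule that)
 have e: "\<xi> i p = \<xi>0 i" "\<xi>' i p = \<xi>0' i" if "i < k" for i
 proof -
  show "\<xi> i p = \<xi>0 i"
   by (rule frame_data_coeff_eq[OF Xc D_base(1)[OF p] _ that])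
    (use M.eventually_near_self[OF \<xi>(2) pM] u in simp)
  show "\<xi>' i p = \<xi>0' i"
   by (rule frame_data_coeff_eq[OF Xc D_base(1)[OF p] _ that])
    (use M.eventually_near_self[OF \<xi>'(2) pM] v in simp)
 qed
 have d: "v (%x. liouville_form N x (T x)) = (\<Sum>i<k. v (\<eta> i) * y i p + \<eta> i p * v (y i))"
  if v: "v \<in> M.TS p" and \<eta>: "ALL i<k. M.smooth p (\<eta> i)"
   "eventually (%x. push N fst x (T x) = (\<Sum>i<k. fscale (\<eta> i x) (X i (fst x)))) (M.near p)" for v T \<eta>
 proof -
  have "v (%x. liouville_form N x (T x)) = v (%x. \<Sum>i<k. \<eta> i x * y i x)"
  proof (rule M.tangent_cong[OF v])
   show "eventually (%x. liouville_form N x (T x) = (\<Sum>i<k. \<eta> i x * y i x)) (M.near p)"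
    using \<eta>(2) M.eventually_in_open[OF D_open p]
   proof eventually_elim
    case (elim x)
    thus ?case unfolding liouville_form_def elim(1) by (intro snd_lincomb)
   qed
  qed
  also have "\<dots> = (\<Sum>i<k. v (\<eta> i) * y i p + \<eta> i p * v (y i))"
   by (rule section_derivative[OF p v \<eta>(1)]) (use smooth_y[OF p] in blast)
  finally show ?thesis .
 qed
 have "liouville_form N p (lie_bracket M S S' p) = (\<Sum>l<k. (S p (\<xi>' l) - S' p (\<xi> l)
   + (\<Sum>i<k. \<Sum>j<k. \<xi> i p * \<xi>' j p * c i j l (fst p))) * y l p)"
  unfolding liouville_form_def section_bracket[OF p S S' \<xi> \<xi>'] by (rule snd_lincomb[OF p])
 also have "\<dots> = (\<Sum>l<k. S p (\<xi>' l) * y l p) - (\<Sum>l<k. S' p (\<xi> l) * y l p)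
   + (\<Sum>l<k. \<Sum>i<k. \<Sum>j<k. \<xi> i p * \<xi>' j p * (c i j l (fst p) * y l p))"
  by (simp add: distrib_right left_diff_distrib sum.distrib sum_subtractf sum_distrib_right mult.assoc)
 also have "(\<Sum>l<k. \<Sum>i<k. \<Sum>j<k. \<xi> i p * \<xi>' j p * (c i j l (fst p) * y l p))
   = (\<Sum>i<k. \<Sum>l<k. \<Sum>j<k. \<xi> i p * \<xi>' j p * (c i j l (fst p) * y l p))" by (rule sum.swap)
 also have "\<dots> = (\<Sum>i<k. \<Sum>j<k. \<Sum>l<k. \<xi> i p * \<xi>' j p * (c i j l (fst p) * y l p))"
  by (rule sum.cong[OF refl], rule sum.swap)
 also have "\<dots> = (\<Sum>i<k. \<Sum>j<k. \<xi>0 i * \<xi>0' j * C c i j p)"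
  using e by (simp add: C_def sum_distrib_left)
 finally have 1: "liouville_form N p (lie_bracket M S S' p) = (\<Sum>l<k. S p (\<xi>' l) * y l p) - (\<Sum>l<k. S' p (\<xi> l) * y l p)
  + (\<Sum>i<k. \<Sum>j<k. \<xi>0 i * \<xi>0' j * C c i j p)" .
 show ?thesis
  unfolding 1 d[OF M.vector_field_tangent[OF S] \<xi>'] d[OF M.vector_field_tangent[OF S' S(2)] \<xi>]
  using e by (simp add: sum.distrib sum_subtractf)
qed

lemma liouville_symplectic_eq:
 assumes p: "p \<in> D" and u: "u \<in> lifted p" and v: "v \<in> lifted p"
  and \<xi>: "push N fst p u = (\<Sum>i<k. fscale (\<xi> i) (X i (fst p)))"
  and \<xi>': "push N fst p v = (\<Sum>i<k. fscale (\<xi>' i) (X i (fst p)))"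
 shows "liouville_symplectic N s F p u v =
  (\<Sum>i<k. \<xi> i * v (y i) - \<xi>' i * u (y i)) + (\<Sum>i<k. \<Sum>j<k. \<xi> i * \<xi>' j * C c i j p)"
 unfolding liouville_symplectic_def
proof (rule the_equality)
 let ?r = "(\<Sum>i<k. \<xi> i * v (y i) - \<xi>' i * u (y i)) + (\<Sum>i<k. \<Sum>j<k. \<xi> i * \<xi>' j * C c i j p)"
 have *: "?r = - (S p (%x. liouville_form N x (S' x)) - S' p (%x. liouville_form N x (S x))
   - liouville_form N p (lie_bracket M S S' p))"
  if "p \<in> W" "S p = u" "S' p = v" "vector_field M W S" "vector_field M W S'"
   "ALL x:W. S x \<in> lifted x \<and> S' x \<in> lifted x" for W S S'
  using liouville_symplectic_section[OF p that(4,1,5), of \<xi> \<xi>'] that(2,3,6) \<xi> \<xi>' by simp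
 thus "ALL W S S'. p \<in> W \<and> S p = u \<and> S' p = v \<and> vector_field M W S \<and> vector_field M W S' \<and>
   (ALL x:W. S x \<in> lifted x \<and> S' x \<in> lifted x) -->
   ?r = - (S p (%x. liouville_form N x (S' x)) - S' p (%x. liouville_form N x (S x))
   - liouville_form N p (lie_bracket M S S' p))" by blast
 fix r
 assume r: "ALL W S S'. p \<in> W \<and> S p = u \<and> S' p = v \<and> vector_field M W S \<and> vector_field M W S' \<and>
   (ALL x:W. S x \<in> lifted x \<and> S' x \<in> lifted x) -->
   r = - (S p (%x. liouville_form N x (S' x)) - S' p (%x. liouville_form N x (S x))
   - liouville_form N p (lie_bracket M S S' p))"
 obtain S where S: "vector_field M D S" "S p = u" "ALL x:D. S x \<in> lifted x"
  using section_extension[OF p u] by blast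
 obtain S' where S': "vector_field M D S'" "S' p = v" "ALL x:D. S' x \<in> lifted x"
  using section_extension[OF p v] by blast
 have "r = - (S p (%x. liouville_form N x (S' x)) - S' p (%x. liouville_form N x (S x))
   - liouville_form N p (lie_bracket M S S' p))"
  using r[rule_format, of D S S'] p S S' by blast
 also have "\<dots> = ?r" using *[of D S S'] p S S' by simp
 finally show "r = ?r" .
qed

lemma sharp_y:
 assumes p: "p \<in> D" and i: "i < k"
 shows "sharp Z c' p \<alpha> (y i) = \<alpha> (hlift p (Z i (fst p))) - (\<Sum>j<k. C c' j i p * \<alpha> (dy j p))"
proof -
 have "(\<Sum>j<k. (\<alpha> (hlift p (Z j (fst p))) - (\<Sum>i<k. C c' i j p * \<alpha> (dy i p))) * dy j p (y i))
  = (\<Sum>j<k. if j = i then \<alpha> (hlift p (Z j (fst p))) - (\<Sum>i<k. C c' i j p * \<alpha> (dy i p)) else 0)"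
  using dy_y[OF p _ i] by (intro sum.cong) auto
 thus ?thesis
  unfolding sharp_def plus_fun_apply sum_fun_apply fscale_apply using hlift_y[OF p i] i by simp
qed

text \<open>Three sums with \<open>C\<close> appear. By antisymmetry the one from the sharp of
  \<beta> cancels the one in the symplectic form, and the one from the sharp of \<alpha> is the
  vertical term of \<open>PB\<close>.\<close>

lemma liouville_sharp:
 assumes p: "p \<in> D" and a: "\<alpha> \<in> dual (M.TS p)" and b: "\<beta> \<in> dual (M.TS p)"
 shows "liouville_symplectic N s F p (sharp X c p \<alpha>) (sharp X c p \<beta>) = PB X c p \<alpha> \<beta>"
proof -
 let ?a = "%i. \<alpha> (dy i p)" let ?b = "%i. \<beta> (dy i p)" let ?h = "%i. hlift p (X i (fst p))"
 have lift: "sharp X c p \<gamma> \<in> lifted p" for \<gamma>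
  unfolding lifted_foliation_def mem_Collect_eq push_sharp[OF Xc p]
  by (intro conjI sharp_tangent[OF p] X_lift[OF D_base(1)[OF p]])
 have swap: "(\<Sum>i<k. \<Sum>j<k. ?a i * (C c j i p * ?b j)) = - (\<Sum>i<k. \<Sum>j<k. ?a i * ?b j * C c i j p)"
 proof -
  have "(\<Sum>i<k. \<Sum>j<k. ?a i * (C c j i p * ?b j)) = (\<Sum>i<k. \<Sum>j<k. - (?a i * ?b j * C c i j p))"
  proof (intro sum.cong refl)
   fix i j assume "i \<in> {..<k}" "j \<in> {..<k}"
   hence "C c j i p = - C c i j p" by (intro C_antisym[OF Xc p]) auto
   thus "?a i * (C c j i p * ?b j) = - (?a i * ?b j * C c i j p)" by simp
  qed
  thus ?thesis by (simp add: sum_negf)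
 qed
 have "liouville_symplectic N s F p (sharp X c p \<alpha>) (sharp X c p \<beta>) =
  (\<Sum>i<k. - ?a i * sharp X c p \<beta> (y i) - - ?b i * sharp X c p \<alpha> (y i)) + (\<Sum>i<k. \<Sum>j<k. - ?a i * - ?b j * C c i j p)"
  by (rule liouville_symplectic_eq[OF p lift lift push_sharp[OF Xc p] push_sharp[OF Xc p]])
 also have "(\<Sum>i<k. - ?a i * sharp X c p \<beta> (y i) - - ?b i * sharp X c p \<alpha> (y i))
   = (\<Sum>i<k. - ?a i * (\<beta> (?h i) - (\<Sum>j<k. C c j i p * ?b j)) - - ?b i * (\<alpha> (?h i) - (\<Sum>j<k. C c j i p * ?a j)))"
  using sharp_y[OF p] by (intro sum.cong) auto
 also have "\<dots> = (\<Sum>i<k. (\<alpha> (?h i) - (\<Sum>j<k. C c j i p * ?a j)) * ?b i) - (\<Sum>i<k. ?a i * \<beta> (?h i))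
   + (\<Sum>i<k. \<Sum>j<k. ?a i * (C c j i p * ?b j))"
  by (simp add: sum.distrib sum_subtractf sum_negf right_diff_distrib left_diff_distrib sum_distrib_left mult.commute)
 finally show ?thesis
  unfolding swap using a b by (simp add: PB_def)
qed

text \<open>Uniqueness combines image and form. Let \<open>u\<close> be the image of \<alpha> under
  a competitor \<open>B\<close>, and \<open>v\<close> that of \<beta> under \<open>PB\<close>. As
  the two images coincide, \<open>u\<close> is also a value of \<open>PB\<close> and
  \<open>v\<close> one of \<open>B\<close>; evaluating the symplectic form on \<open>u\<close>,
  \<open>v\<close> in both ways identifies the bivectors.\<close>

theorem liouville_poisson_PB:
 assumes p: "p \<in> D"
 shows "liouville_poisson N s F p = PB X c p"
 unfolding liouville_poisson_def Let_def
proof (rule the_equality)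
 let ?T = "M.TS p"
 have pM: "p \<in> points M" by (rule D_base(4)[OF p])
 have bv: "bivector_on ?T (PB X c p)" by (rule PB_bivector[OF Xc p])
 have im: "bivector_image ?T (PB X c p) = lifted p"
  unfolding image_PB[OF Xc p] lifted_foliation_def local_frame_range[OF X D_base(1)[OF p]] ..
 have LS: "liouville_symplectic N s F p u v = PB X c p \<alpha> \<beta>"
  if "\<alpha> \<in> dual ?T" "\<beta> \<in> dual ?T" "sharp_rel ?T (PB X c p) \<alpha> u" "sharp_rel ?T (PB X c p) \<beta> v" for \<alpha> \<beta> u v
  using that liouville_sharp[OF p that(1,2)] by (simp add: sharp_rel_PB[OF p])
 thus "bivector_on ?T (PB X c p) \<and> bivector_image ?T (PB X c p) = lifted p \<and>
   (ALL \<alpha>:dual ?T. ALL \<beta>:dual ?T. ALL u v. sharp_rel ?T (PB X c p) \<alpha> u \<and> sharp_rel ?T (PB X c p) \<beta> v -->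
     liouville_symplectic N s F p u v = PB X c p \<alpha> \<beta>)"
  using bv im by blast
 fix B
 assume B: "bivector_on ?T B \<and> bivector_image ?T B = lifted p \<and>
   (ALL \<alpha>:dual ?T. ALL \<beta>:dual ?T. ALL u v. sharp_rel ?T B \<alpha> u \<and> sharp_rel ?T B \<beta> v -->
     liouville_symplectic N s F p u v = B \<alpha> \<beta>)"
 have Bb: "bivector_on ?T B" and Bi: "bivector_image ?T B = lifted p"
  and BL: "!!\<alpha> \<beta> u v. \<alpha> \<in> dual ?T ==> \<beta> \<in> dual ?T ==> sharp_rel ?T B \<alpha> u ==> sharp_rel ?T B \<beta> v ==>
   liouville_symplectic N s F p u v = B \<alpha> \<beta>" using B by auto
 show "B = PB X c p"
 proof (intro ext)
  fix \<alpha> \<beta>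
  show "B \<alpha> \<beta> = PB X c p \<alpha> \<beta>"
  proof (cases "\<alpha> \<in> dual ?T \<and> \<beta> \<in> dual ?T")
   case False
   thus ?thesis using bivector_outside[OF Bb] bivector_outside[OF bv] by auto
  next
   case True
   hence a: "\<alpha> \<in> dual ?T" and b: "\<beta> \<in> dual ?T" by auto
   obtain u where u: "sharp_rel ?T B \<alpha> u" using M.ex_sharp[OF Bb a pM] by blast
   obtain u0 where u0: "sharp_rel ?T (PB X c p) \<alpha> u0" using M.ex_sharp[OF bv a pM] by blast
   obtain v where v: "sharp_rel ?T (PB X c p) \<beta> v" using M.ex_sharp[OF bv b pM] by blast
   have "u \<in> lifted p"
    using u a unfolding Bi[symmetric] bivector_image_def by blast
   then obtain \<gamma> where \<gamma>: "\<gamma> \<in> dual ?T" "sharp_rel ?T (PB X c p) \<gamma> u"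
    unfolding im[symmetric] bivector_image_def by blast
   have "v \<in> lifted p"
    using v b unfolding im[symmetric] bivector_image_def by blast
   then obtain \<delta> where \<delta>: "\<delta> \<in> dual ?T" "sharp_rel ?T B \<delta> v"
    unfolding Bi[symmetric] bivector_image_def by blast
   have "B \<alpha> \<beta> = \<beta> u" using u b unfolding sharp_rel_def by simp
   also have "\<dots> = PB X c p \<gamma> \<beta>" using \<gamma>(2) b unfolding sharp_rel_def by simp
   also have "\<dots> = liouville_symplectic N s F p u v" using LS[OF \<gamma>(1) b \<gamma>(2) v] by simp
   also have "\<dots> = B \<alpha> \<delta>" using BL[OF a \<delta>(1) u \<delta>(2)] .
   also have "\<dots> = - B \<delta> \<alpha>" by (rule bivector_antisym[OF Bb a \<delta>(1)])
   also have "\<dots> = - \<alpha> v" using \<delta>(2) a unfolding sharp_rel_def by simp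
   also have "\<dots> = - PB X c p \<beta> \<alpha>" using v a unfolding sharp_rel_def by simp
   also have "\<dots> = PB X c p \<alpha> \<beta>" using bivector_antisym[OF bv a b] by simp
   finally show ?thesis .
  qed
 qed
qed

end

end

section \<open>Pointwise algebra of Veronese webs\<close>

lemma dim_dual_family:
 fixes f :: "'i => 'a => 'k::field"
 assumes I: "finite I" and T: "fv.subspace T" and f: "!!i. i \<in> I ==> f i \<in> T"
  and lin: "!!i. i \<in> I ==> linear_on T (*) (\<theta> i)"
  and d: "!!i j. i \<in> I ==> j \<in> I ==> \<theta> i (f j) = (if i = j then 1 else 0)"
  and e: "!!v. v \<in> T ==> v = (\<Sum>i\<in>I. fscale (\<theta> i v) (f i))"
 shows "fv.dim T = card I"
proof -
 have inj: "inj_on f I"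
  using d by (intro inj_onI) (metis zero_neq_one)
 have "fv.independent (f ` I)"
 proof (rule fv.independent_if_scalars_zero)
  show "finite (f ` I)" using I by simp
  fix g x assume s: "(\<Sum>x\<in>f ` I. fscale (g x) x) = 0" and x: "x \<in> f ` I"
  obtain i where i: "i \<in> I" "x = f i" using x by blast
  have "0 = \<theta> i (\<Sum>j\<in>I. fscale (g (f j)) (f j))"
   using s linear_on_zero[OF lin[OF i(1)] T] by (simp add: sum.reindex[OF inj])
  also have "\<dots> = (\<Sum>j\<in>I. g (f j) * \<theta> i (f j))"
   by (rule linear_on_sum[OF lin[OF i(1)] T f])
  also have "\<dots> = (\<Sum>j\<in>I. if i = j then g (f j) else 0)"
   by (intro sum.cong refl) (simp add: d i)
  finally show "g x = 0" using i I by simp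
 qed
 moreover have "T \<subseteq> fv.span (f ` I)"
 proof
  fix v assume v: "v \<in> T"
  have "(\<Sum>i\<in>I. fscale (\<theta> i v) (f i)) \<in> fv.span (f ` I)"
   by (intro fv.span_sum fv.span_scale fv.span_base imageI)
  thus "v \<in> fv.span (f ` I)" using e[OF v] by simp
 qed
 ultimately show ?thesis
  using f by (intro fv.dim_unique[of "f ` I"]) (auto simp: card_image[OF inj])
qed

lemma (in mfold) dim_tangent_space:
 assumes p: "p \<in> points M" shows "fv.dim (TS p) = mdim M"
proof -
 obtain U \<phi> where U: "(U, \<phi>) \<in> atlas M" "p \<in> U" using ex_chart[OF p] by blast
 have "fv.dim (TS p) = card {..<mdim M}"
 proof (rule dim_dual_family[where f = "%i. coord_vec M U \<phi> i p" and \<theta> = "%i v. v (%x. \<phi> x i)"])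
  show "fv.subspace (TS p)" by (rule tangent_subspace[OF p])
  show "v = (\<Sum>i<mdim M. fscale (v (%x. \<phi> x i)) (coord_vec M U \<phi> i p))" if "v \<in> TS p" for v
   by (rule tangent_expand[OF that U])
  show "coord_vec M U \<phi> i p \<in> TS p" if "i \<in> {..<mdim M}" for i
   using coord_vec_tangent[OF U] that by simp
  show "coord_vec M U \<phi> j p (%x. \<phi> x i) = (if i = j then 1 else 0)"
   if "i \<in> {..<mdim M}" "j \<in> {..<mdim M}" for i j
   using coord_vec_coord[OF U, of j i] that by auto
 qed (auto simp: linear_on_def)
 thus ?thesis by simp
qed

text \<open>With a family \<open>g\<close> dual to the \<alpha>, replacing one member of
  \<open>g\<close> by \<open>u\<close> isolates a single value of one \<alpha> on
  \<open>u\<close>.\<close>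

lemma form_kernel_wedge:
 fixes \<alpha> :: "nat => ('a => 'k::field) => 'k"
 assumes r: "r \<ge> 1" and g: "!!j. j < r ==> g j \<in> T"
  and d: "!!i j. i < r ==> j < r ==> \<alpha> i (g j) = (if i = j then 1 else 0)"
  and \<omega>: "!!v. (ALL i<r. v i \<in> T) ==> \<omega> v = wedge r \<alpha> v"
 shows "form_kernel r T \<omega> = {u \<in> T. ALL j<r. \<alpha> j u = 0}"
proof (intro equalityI subsetI CollectI conjI allI impI)
 fix u assume u: "u \<in> form_kernel r T \<omega>"
 thus uT: "u \<in> T" by (simp add: form_kernel_def)
 fix j0 assume j0: "j0 < r"
 \<comment> \<open>\<open>form_kernel\<close> keeps its vector in slot 0, so the transposition moves
   it there from slot \<open>j0\<close>. In the expansion of the wedge only the permutation \<tau>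
   gives a nonzero product.\<close>
 define \<tau> where "\<tau> = Transposition.transpose 0 j0"
 define v where "v = (%i. if i = 0 then u else g (\<tau> i))"
 have \<tau>r: "\<tau> i < r" if "i < r" for i using that j0 r unfolding \<tau>_def Transposition.transpose_def by auto
 have \<tau>\<tau>: "\<tau> (\<tau> i) = i" for i unfolding \<tau>_def by simp
 have \<tau>0: "\<tau> j = 0 \<longleftrightarrow> j = j0" for j unfolding \<tau>_def Transposition.transpose_def by auto
 have \<tau>p: "\<tau> permutes {..<r}" unfolding \<tau>_def using j0 r by (intro permutes_swap_id) auto
 have vT: "ALL i<r. v i \<in> T" unfolding v_def using uT g \<tau>r by auto
 have nz: "\<sigma> = \<tau>" if \<sigma>: "\<sigma> permutes {..<r}" and p: "(\<Prod>j<r. \<alpha> j (v (\<sigma> j))) \<noteq> 0" for \<sigma>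
 proof -
  have *: "\<tau> (\<sigma> j) = j" if j: "j < r" "\<sigma> j \<noteq> 0" for j
  proof (rule ccontr)
   assume n: "\<tau> (\<sigma> j) \<noteq> j"
   have "\<sigma> j < r" using permutes_in_image[OF \<sigma>, of j] j by simp
   hence "\<alpha> j (v (\<sigma> j)) = 0" using j n d[of j "\<tau> (\<sigma> j)"] \<tau>r by (simp add: v_def)
   thus False using p j by (auto simp: prod_zero_iff)
  qed
  have inj: "\<sigma> i = \<sigma> j ==> i = j" for i j using permutes_inj[OF \<sigma>] by (auto dest: injD)
  have "\<tau> (\<sigma> j) = j" for j
  proof (cases "j < r \<and> \<sigma> j = 0")
   case False thus ?thesis
   proof (cases "j < r")
    case j: False
    hence "\<sigma> j = j" "\<tau> j = j" using \<sigma> \<tau>p by (auto simp: permutes_def)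
    thus ?thesis by simp
   qed (use * False in blast)
  next
   case True
   define i where "i = \<tau> (\<sigma> j)"
   have i: "i < r" unfolding i_def using True r \<tau>r by simp
   show ?thesis
   proof (rule ccontr)
    assume n: "\<tau> (\<sigma> j) \<noteq> j"
    hence "\<sigma> i \<noteq> 0" using inj[of i j] True by (auto simp: i_def)
    hence "\<tau> (\<sigma> i) = \<tau> (\<sigma> j)" using *[OF i] i_def by simp
    hence "\<sigma> i = \<sigma> j" using \<tau>\<tau> by metis
    thus False using inj n i_def by auto
   qed
  qed
  thus "\<sigma> = \<tau>" using \<tau>\<tau> by (metis ext)
 qed
 have "(\<Prod>j<r. \<alpha> j (v (\<tau> j))) = (\<Prod>j<r. if j = j0 then \<alpha> j0 u else 1)"
  by (rule prod.cong[OF refl]) (auto simp: v_def \<tau>0 \<tau>\<tau> d)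
 hence pr: "(\<Prod>j<r. \<alpha> j (v (\<tau> j))) = \<alpha> j0 u" using j0 by simp
 have "wedge r \<alpha> v = of_int (sign \<tau>) * (\<Prod>j<r. \<alpha> j (v (\<tau> j)))"
 proof -
  have "wedge r \<alpha> v = (\<Sum>\<sigma> | \<sigma> permutes {..<r}.
    if \<sigma> = \<tau> then of_int (sign \<tau>) * (\<Prod>j<r. \<alpha> j (v (\<tau> j))) else 0)"
   unfolding wedge_def using nz by (intro sum.cong[OF refl]) (auto simp del: prod_zero_iff)
  thus ?thesis using \<tau>p by (simp add: finite_permutations)
 qed
 also have "wedge r \<alpha> v = 0" using u vT \<omega>[OF vT] by (auto simp: form_kernel_def v_def)
 finally show "\<alpha> j0 u = 0" unfolding pr by (auto simp: sign_def split: if_splits)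
next
 fix u assume u: "u \<in> {u \<in> T. ALL j<r. \<alpha> j u = 0}"
 have "wedge r \<alpha> v = 0" if v: "v 0 = u" for v
  unfolding wedge_def
 proof (rule sum.neutral, intro ballI)
  fix \<sigma> assume "\<sigma> \<in> {\<sigma>. \<sigma> permutes {..<r}}"
  hence "\<sigma> permutes {..<r}" by simp
  then obtain j where j: "\<sigma> j = 0" using permutes_surj by (metis surj_def)
  hence "j < r" using permutes_in_image[OF \<open>\<sigma> permutes {..<r}\<close>, of j] r by simp
  hence "(\<Prod>j<r. \<alpha> j (v (\<sigma> j))) = 0" using j v u by (auto simp: prod_zero_iff intro!: bexI[of _ j])
  thus "of_int (sign \<sigma>) * (\<Prod>j<r. \<alpha> j (v (\<sigma> j))) = 0" by simp
 qed
 thus "u \<in> form_kernel r T \<omega>" using u \<omega> by (auto simp: form_kernel_def)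
qed

text \<open>The coefficient is taken at prescribed degree bounds rather than at actual degrees,
  because the leading coefficients below vanish on some vectors.\<close>

lemma coeff_prod_sum:
 fixes p :: "'i => 'k::comm_ring_1 poly"
 assumes A: "finite A" and d: "!!j. j \<in> A ==> degree (p j) \<le> d j"
 shows "degree (prod p A) \<le> sum d A \<and> coeff (prod p A) (sum d A) = (\<Prod>j\<in>A. coeff (p j) (d j))"
 using A d
proof (induction A rule: finite_induct)
 case (insert x A)
 have a: "degree (p x) \<le> d x" and b: "degree (prod p A) \<le> sum d A"
  and c: "coeff (prod p A) (sum d A) = (\<Prod>j\<in>A. coeff (p j) (d j))"
  using insert by auto
 have "coeff (p x * prod p A) (d x + sum d A)
  = (\<Sum>i\<le>d x + sum d A. if i = d x then coeff (p x) (d x) * coeff (prod p A) (sum d A) else 0)"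
  unfolding coeff_mult
 proof (rule sum.cong[OF refl])
  fix i assume "i \<in> {..d x + sum d A}"
  show "coeff (p x) i * coeff (prod p A) (d x + sum d A - i) =
   (if i = d x then coeff (p x) (d x) * coeff (prod p A) (sum d A) else 0)"
  proof (cases i "d x" rule: linorder_cases)
   case less
   hence "coeff (prod p A) (d x + sum d A - i) = 0" by (intro coeff_eq_0) (use b in linarith)
   thus ?thesis using less by simp
  next
   case greater
   hence "coeff (p x) i = 0" by (intro coeff_eq_0) (use a in linarith)
   thus ?thesis using greater by simp
  qed simp
 qed
 thus ?case using insert(1,2) a b c degree_mult_le[of "p x" "prod p A"] by simp
qed simp

lemma polyfun_zero_off_zero:
 fixes c :: "nat => 'k::ground_field"
 assumes "!!t. t \<noteq> 0 ==> (\<Sum>i\<le>m. c i * t ^ i) = 0" and "i \<le> m"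
 shows "c i = 0"
proof (rule ccontr)
 assume "c i \<noteq> 0"
 hence "finite {t. (\<Sum>i\<le>m. c i * t ^ i) = 0}" using assms(2) polyfun_finite_roots[of c m] by blast
 moreover have "UNIV - {0} \<subseteq> {t. (\<Sum>i\<le>m. c i * t ^ i) = 0}" using assms(1) by blast
 ultimately have "finite (UNIV - {0::'k})" by (rule rev_finite_subset)
 thus False using infinite_UNIV_char_0[where 'a = 'k] by simp
qed

text \<open>Comparison of coefficients. It turns "x + tu lies in w(t)" into equations linking
  neighbouring components of x and u; nonzero \<open>t\<close> suffice because the field is
  infinite.\<close>

lemma polyfun_shift_zero:
 fixes a b :: "nat => 'k::ground_field"
 assumes m: "1 \<le> m" and z: "!!t. t \<noteq> 0 ==> (\<Sum>i<m. t ^ i * (a i + t * b i)) = 0"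
 shows "a 0 = 0" "b (m - 1) = 0" "!!i. 1 \<le> i ==> i < m ==> a i + b (i - 1) = 0"
proof -
 define c where "c i = (if i < m then a i else 0) + (if 1 \<le> i then b (i - 1) else 0)" for i
 have "(\<Sum>i\<le>m. c i * t ^ i) = 0" if "t \<noteq> 0" for t
 proof -
  have "(\<Sum>i\<le>m. c i * t ^ i) = (\<Sum>i\<le>m. (if i < m then a i else 0) * t ^ i)
    + (\<Sum>i\<le>m. (if 1 \<le> i then b (i - 1) else 0) * t ^ i)"
   by (simp add: c_def ring_distribs sum.distrib)
  also have "(\<Sum>i\<le>m. (if i < m then a i else 0) * t ^ i) = (\<Sum>i<m. a i * t ^ i)"
   using m by (simp add: lessThan_Suc_atMost[symmetric])
  also have "(\<Sum>i\<le>m. (if 1 \<le> i then b (i - 1) else 0) * t ^ i) = (\<Sum>i<m. b i * t ^ Suc i)"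
   unfolding lessThan_Suc_atMost[symmetric] sum.lessThan_Suc_shift by simp
  also have "(\<Sum>i<m. a i * t ^ i) + (\<Sum>i<m. b i * t ^ Suc i) = (\<Sum>i<m. t ^ i * (a i + t * b i))"
   by (simp add: sum.distrib[symmetric] algebra_simps)
  finally show ?thesis using z[OF that] by simp
 qed
 from polyfun_zero_off_zero[OF this] have c: "c i = 0" if "i \<le> m" for i using that by blast
 show "a 0 = 0" using c[of 0] m by (simp add: c_def)
 show "b (m - 1) = 0" using c[of m] m by (simp add: c_def)
 show "a i + b (i - 1) = 0" if "1 \<le> i" "i < m" for i using c[of i] that by (simp add: c_def)
qed

text \<open>The tangent space at one point, with the covector basis \<open>e\<close> from the
  definition of a web, cut into \<open>r\<close> blocks of lengths \<open>m j\<close>, and the dual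
  basis \<open>f\<close>.\<close>

locale web_point =
 fixes T :: "('a => 'k::ground_field) set" and r :: nat and m :: "nat => nat"
  and e :: "nat => nat => ('a => 'k) => 'k" and f :: "nat => nat => 'a => 'k"
 assumes T: "fv.subspace T"
  and e_dual: "j < r ==> i < m j ==> e i j \<in> dual T"
  and f_T: "j < r ==> i < m j ==> f i j \<in> T"
  and e_f: "j < r ==> i < m j ==> l < r ==> h < m l ==> e i j (f h l) = (if i = h \<and> j = l then 1 else 0)"
  and expand: "v \<in> T ==> v = (\<Sum>j<r. \<Sum>i<m j. fscale (e i j v) (f i j))"
  and m_pos: "j < r ==> 1 \<le> m j"
begin

definition W :: "'k => ('a => 'k) set" where "W t = {v \<in> T. ALL j<r. (\<Sum>i<m j. t ^ i * e i j v) = 0}"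

text \<open>This says x = ell(u): for a covector \<alpha> annihilating w(t), the condition
  \<alpha>(ell(u)) = - t \<alpha>(u) means that ell(u) + tu is killed by \<alpha>. As a relation it
  treats \<open>ell\<close> and its inverse alike, and its domain and range can be determined
  afterwards.\<close>

definition R :: "('a => 'k) => ('a => 'k) => bool"
 where "R x u \<longleftrightarrow> x \<in> T \<and> u \<in> T \<and> (ALL t. x + fscale t u \<in> W t)"

definition vec :: "(nat => nat => 'k) => 'a => 'k"
 where "vec a = (\<Sum>j<r. \<Sum>i<m j. fscale (a i j) (f i j))"

lemma e_linear: "j < r ==> i < m j ==> linear_on T (*) (e i j)"
 by (rule dual_linear[OF e_dual])

lemma e_add: "j < r ==> i < m j ==> u \<in> T ==> v \<in> T ==> e i j (u + v) = e i j u + e i j v"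
 by (rule linear_on_add[OF e_linear])

lemma e_scale: "j < r ==> i < m j ==> u \<in> T ==> e i j (fscale c u) = c * e i j u"
 by (rule linear_on_scale[OF e_linear])

lemma T_add: "u \<in> T ==> v \<in> T ==> u + v \<in> T" by (rule fv.subspace_add[OF T])
lemma T_scale: "u \<in> T ==> fscale c u \<in> T" by (rule fv.subspace_scale[OF T])

lemma vec_T: "vec a \<in> T"
 unfolding vec_def by (intro fv.subspace_sum[OF T] T_scale f_T) auto

lemma dual_vec:
 assumes \<alpha>: "linear_on T (*) \<alpha>" shows "\<alpha> (vec a) = (\<Sum>j<r. \<Sum>i<m j. a i j * \<alpha> (f i j))"
proof -
 have "\<alpha> (vec a) = \<alpha> (\<Sum>j<r. fscale 1 (\<Sum>i<m j. fscale (a i j) (f i j)))"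
  unfolding vec_def by simp
 also have "\<dots> = (\<Sum>j<r. 1 * \<alpha> (\<Sum>i<m j. fscale (a i j) (f i j)))"
  by (rule linear_on_sum[OF \<alpha> T]) (auto intro!: fv.subspace_sum[OF T] T_scale f_T)
 also have "\<dots> = (\<Sum>j<r. \<Sum>i<m j. a i j * \<alpha> (f i j))"
  by (simp, rule sum.cong[OF refl], rule linear_on_sum[OF \<alpha> T]) (auto intro: f_T)
 finally show ?thesis .
qed

lemma e_vec: assumes "j < r" "i < m j" shows "e i j (vec a) = a i j"
proof -
 have "e i j (vec a) = (\<Sum>l<r. \<Sum>h<m l. a h l * e i j (f h l))"
  by (rule dual_vec[OF e_linear[OF assms]])
 also have "\<dots> = (\<Sum>l<r. if l = j then (\<Sum>h<m j. if i = h then a h j else 0) else 0)"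
  using assms by (intro sum.cong[OF refl]) (auto simp: e_f if_distrib[where f = "(*) c" for c] cong: if_cong intro!: sum.neutral)
 finally show ?thesis using assms by simp
qed

lemma eqI:
 assumes "u \<in> T" "v \<in> T" "!!i j. j < r ==> i < m j ==> e i j u = e i j v" shows "u = v"
 using expand[OF assms(1)] expand[OF assms(2)] assms(3) by simp

lemma W_T: "W t \<subseteq> T" by (auto simp: W_def)

lemma W_subspace: "fv.subspace (W t)"
 unfolding fv.subspace_def
proof (intro conjI ballI allI)
 show "0 \<in> W t" using fv.subspace_0[OF T] linear_on_zero[OF e_linear T] by (auto simp: W_def)
 show "u + v \<in> W t" if "u \<in> W t" "v \<in> W t" for u v
  using that T_add by (auto simp: W_def e_add ring_distribs sum.distrib)
 show "fscale c u \<in> W t" if u: "u \<in> W t" for c u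
 proof -
  have "(\<Sum>i<m j. t ^ i * e i j (fscale c u)) = c * (\<Sum>i<m j. t ^ i * e i j u)" if "j < r" for j
   using subsetD[OF W_T u] that by (simp add: e_scale sum_distrib_left mult.left_commute)
  thus ?thesis using u T_scale by (auto simp: W_def)
 qed
qed

lemma R_T: "R x u ==> x \<in> T" "R x u ==> u \<in> T" by (auto simp: R_def)

lemma R_W: "R x u ==> x + fscale t u \<in> W t" by (simp add: R_def)

lemma R_coeffs:
 assumes x: "x \<in> T" and u: "u \<in> T" and z: "!!t. t \<noteq> 0 ==> x + fscale t u \<in> W t" and j: "j < r"
 shows "e 0 j x = 0" "e (m j - 1) j u = 0" "!!i. 1 \<le> i ==> i < m j ==> e i j x + e (i - 1) j u = 0"
proof -
 have "(\<Sum>i<m j. t ^ i * (e i j x + t * e i j u)) = 0" if "t \<noteq> 0" for t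
  using z[OF that] j x u T_scale by (simp add: W_def e_add e_scale)
 from polyfun_shift_zero[OF m_pos[OF j] this]
 show "e 0 j x = 0" "e (m j - 1) j u = 0" "!!i. 1 \<le> i ==> i < m j ==> e i j x + e (i - 1) j u = 0"
  by blast+
qed

lemma R_I:
 assumes x: "x \<in> T" and u: "u \<in> T"
  and "!!j. j < r ==> e 0 j x = 0" "!!j. j < r ==> e (m j - 1) j u = 0"
  and "!!i j. j < r ==> Suc i < m j ==> e (Suc i) j x = - e i j u"
 shows "R x u"
proof -
 have "(\<Sum>i<m j. t ^ i * (e i j x + t * e i j u)) = 0" if j: "j < r" for j t
 proof -
  obtain l where l: "m j = Suc l" using m_pos[OF j] by (cases "m j") auto
  have "(\<Sum>i<m j. t ^ i * (e i j x + t * e i j u))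
    = (\<Sum>i<m j. t ^ i * e i j x) + (\<Sum>i<m j. t ^ Suc i * e i j u)"
   by (simp add: sum.distrib[symmetric] algebra_simps)
  also have "(\<Sum>i<m j. t ^ i * e i j x) = - (\<Sum>i<l. t ^ Suc i * e i j u)"
   unfolding l sum.lessThan_Suc_shift using assms(3,5)[of j] j l by (simp add: sum_negf[symmetric])
  also have "(\<Sum>i<m j. t ^ Suc i * e i j u) = (\<Sum>i<l. t ^ Suc i * e i j u)"
   using assms(4)[OF j] l by simp
  finally show ?thesis by simp
 qed
 thus ?thesis using x u T_add T_scale by (auto simp: R_def W_def e_add e_scale)
qed

lemma R_off_zero:
 assumes x: "x \<in> T" and u: "u \<in> T" and z: "!!t. t \<noteq> 0 ==> x + fscale t u \<in> W t"
 shows "R x u"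
proof (rule R_I[OF x u])
 note c = R_coeffs[OF x u z]
 show "e 0 j x = 0" "e (m j - 1) j u = 0" if "j < r" for j using c(1,2)[OF _ that] by blast+
 show "e (Suc i) j x = - e i j u" if "j < r" "Suc i < m j" for i j
  using c(3)[OF _ that(1), of "Suc i"] that by (simp add: add_eq_0_iff2)
qed

text \<open>In coordinates \<open>ell\<close> is, up to sign, the shift by one place in each block.
  The two end conditions describe w(0) for \<open>x\<close> and w(\<infinity>) for
  \<open>u\<close>.\<close>

lemma R_iff: "x \<in> T ==> u \<in> T ==> R x u \<longleftrightarrow> (ALL j<r. e 0 j x = 0 \<and> e (m j - 1) j u = 0 \<and>
  (ALL i. Suc i < m j --> e (Suc i) j x = - e i j u))"
proof
 assume x: "x \<in> T" "u \<in> T" and R: "R x u"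
 note c = R_coeffs[OF x R_W[OF R]]
 show "ALL j<r. e 0 j x = 0 \<and> e (m j - 1) j u = 0 \<and> (ALL i. Suc i < m j --> e (Suc i) j x = - e i j u)"
  using c(1,2) c(3)[of _ "Suc _"] by (auto simp: add_eq_0_iff2)
qed (auto intro: R_I)

lemma W_zero_iff: "x \<in> W 0 \<longleftrightarrow> x \<in> T \<and> (ALL j<r. e 0 j x = 0)"
proof -
 have "(\<Sum>i<m j. 0 ^ i * e i j x) = e 0 j x" if "j < r" for j
  using m_pos[OF that] by (cases "m j") (simp_all add: sum.lessThan_Suc_shift del: sum.lessThan_Suc)
 thus ?thesis by (auto simp: W_def)
qed

lemma R_right: assumes x: "x \<in> W 0" shows "EX u. R x u"
proof -
 define u where "u = vec (%i j. if Suc i < m j then - e (Suc i) j x else 0)"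
 have xT: "x \<in> T" and x0: "!!j. j < r ==> e 0 j x = 0" using x by (auto simp: W_zero_iff)
 have "R x u"
 proof (rule R_I[OF xT])
  show "u \<in> T" unfolding u_def by (rule vec_T)
  show "e (m j - 1) j u = 0" if "j < r" for j using m_pos[OF that] that by (simp add: u_def e_vec)
  show "e (Suc i) j x = - e i j u" if "j < r" "Suc i < m j" for i j using that by (simp add: u_def e_vec)
 qed (rule x0)
 thus ?thesis by blast
qed

lemma R_left: assumes u: "u \<in> T" "ALL j<r. e (m j - 1) j u = 0" shows "EX x. R x u"
proof -
 define x where "x = vec (%i j. if 1 \<le> i then - e (i - 1) j u else 0)"
 have "R x u"
 proof (rule R_I)
  show "x \<in> T" unfolding x_def by (rule vec_T)
  show "e 0 j x = 0" if "j < r" for j using m_pos[OF that] that by (simp add: x_def e_vec)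
  show "e (Suc i) j x = - e i j u" if "j < r" "Suc i < m j" for i j using that by (simp add: x_def e_vec)
 qed (use u in auto)
 thus ?thesis by blast
qed

lemma R_unique_right: assumes "R x u" "R x u'" shows "u = u'"
proof (rule eqI[OF R_T(2)[OF assms(1)] R_T(2)[OF assms(2)]])
 fix i j assume j: "j < r" and i: "i < m j"
 have *: "e (m j - 1) j v = 0 \<and> (Suc i < m j --> e (Suc i) j x = - e i j v)" if "R x v" for v
  using that R_iff[OF R_T[OF that]] j by blast
 show "e i j u = e i j u'"
 proof (cases "Suc i < m j")
  case False hence "i = m j - 1" using i by simp
  thus ?thesis using *[OF assms(1)] *[OF assms(2)] by simp
 qed (use *[OF assms(1)] *[OF assms(2)] in auto)
qed

lemma R_unique_left: assumes "R x u" "R x' u" shows "x = x'"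
proof (rule eqI[OF R_T(1)[OF assms(1)] R_T(1)[OF assms(2)]])
 fix i j assume j: "j < r" and i: "i < m j"
 have *: "e 0 j v = 0 \<and> (ALL i. Suc i < m j --> e (Suc i) j v = - e i j u)" if "R v u" for v
  using that R_iff[OF R_T[OF that]] j by blast
 show "e i j x = e i j x'" using *[OF assms(1)] *[OF assms(2)] i by (cases i) auto
qed

lemma R_add: assumes "R x u" "R y v" shows "R (x + y) (u + v)"
proof -
 have "x + y + fscale t (u + v) = (x + fscale t u) + (y + fscale t v)" for t
  by (simp add: fv.scale_right_distrib)
 hence "x + y + fscale t (u + v) \<in> W t" for t
  using fv.subspace_add[OF W_subspace R_W[OF assms(1)] R_W[OF assms(2)]] by metis
 thus ?thesis
  unfolding R_def by (intro conjI allI T_add R_T[OF assms(1)] R_T[OF assms(2)])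
qed

lemma R_scale: assumes "R x u" shows "R (fscale c x) (fscale c u)"
proof -
 have "fscale c x + fscale t (fscale c u) = fscale c (x + fscale t u)" for t
  by (simp add: fv.scale_right_distrib mult.commute)
 hence "fscale c x + fscale t (fscale c u) \<in> W t" for t
  using fv.subspace_scale[OF W_subspace R_W[OF assms]] by metis
 thus ?thesis
  unfolding R_def by (intro conjI allI T_scale R_T[OF assms])
qed

lemma R_sum:
 assumes "!!i. i \<in> S ==> R (x i) (u i)"
 shows "R (\<Sum>i\<in>S. fscale (c i) (x i)) (\<Sum>i\<in>S. fscale (c i) (u i))"
proof -
 have *: "(\<Sum>i\<in>S. fscale (c i) (x i)) + fscale t (\<Sum>i\<in>S. fscale (c i) (u i))
  = (\<Sum>i\<in>S. fscale (c i) (x i + fscale t (u i)))" for t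
  by (simp add: fv.scale_right_distrib fv.scale_sum_right sum.distrib mult.commute)
 show ?thesis
  unfolding R_def *
  by (intro conjI allI fv.subspace_sum[OF T] fv.subspace_sum[OF W_subspace]
    fv.subspace_scale[OF W_subspace] R_W T_scale R_T(1)[OF assms] R_T(2)[OF assms] assms)
qed

text \<open>The algebraic core of the affineness of the structure functions. The value at 0 gives
  \<open>u\<close> with \<open>R A u\<close>; subtracting \<open>A + fscale t u\<close> leaves a
  multiple of \<open>t\<close>, and after division a linear pencil remains that is known to lie in
  \<open>W t\<close> for nonzero \<open>t\<close>, which \<open>R_off_zero\<close>
  completes.\<close>

lemma quadratic_pencil:
 assumes BC: "B \<in> T" "C \<in> T" and W: "!!t. A + fscale t B + fscale (t * t) C \<in> W t"
 shows "EX u. R A u \<and> R (B - u) C"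
proof -
 have "A \<in> W 0" using W[of 0] by simp
 then obtain u where u: "R A u" using R_right by blast
 have "R (B - u) C"
 proof (rule R_off_zero[OF _ BC(2)])
  show "B - u \<in> T" by (rule fv.subspace_diff[OF T BC(1) R_T(2)[OF u]])
  fix t :: 'k assume t: "t \<noteq> 0"
  have "(A + fscale t B + fscale (t * t) C) - (A + fscale t u) \<in> W t"
   by (rule fv.subspace_diff[OF W_subspace W R_W[OF u]])
  hence "fscale (inverse t) ((A + fscale t B + fscale (t * t) C) - (A + fscale t u)) \<in> W t"
   by (rule fv.subspace_scale[OF W_subspace])
  also have "fscale (inverse t) ((A + fscale t B + fscale (t * t) C) - (A + fscale t u)) = B - u + fscale t C"
   using t by (simp add: fun_eq_iff field_simps)
  finally show "B - u + fscale t C \<in> W t" .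
 qed
 thus ?thesis using u by blast
qed

text \<open>For fixed \<open>v\<close> the form of block \<open>j\<close> is a polynomial in
  \<open>t\<close> of degree less than \<open>m j\<close>, so at least \<open>m j\<close> distinct
  zeros annihilate its coefficients.\<close>

lemma W_separate:
 assumes v: "v \<in> T" and t: "inj_on t {..<K}" and W: "!!s. s < K ==> v \<in> W (t s)"
  and m: "!!j. j < r ==> m j \<le> K"
 shows "v = 0"
proof (rule eqI[OF v fv.subspace_0[OF T]])
 fix i j assume j: "j < r" and i: "i < m j"
 show "e i j v = e i j 0"
 proof (rule ccontr)
  assume "e i j v \<noteq> e i j 0"
  hence nz: "e i j v \<noteq> 0" using linear_on_zero[OF e_linear[OF j i] T] by simp
  obtain l where l: "m j = Suc l" using i by (cases "m j") auto
  have s: "(\<Sum>i\<le>l. e i j v * x ^ i) = (\<Sum>i<m j. x ^ i * e i j v)" for x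
   by (simp add: l lessThan_Suc_atMost mult.commute)
  have rb: "finite {z. (\<Sum>i\<le>l. e i j v * z ^ i) = 0} \<and> card {z. (\<Sum>i\<le>l. e i j v * z ^ i) = 0} \<le> l"
   by (rule Transcendental.polyfun_rootbound[where k = i]) (use nz i l in auto)
  moreover have "t ` {..<K} \<subseteq> {z. (\<Sum>i\<le>l. e i j v * z ^ i) = 0}"
   using W j by (auto simp: s W_def)
  ultimately have "card (t ` {..<K}) \<le> l" using card_mono le_trans by blast
  thus False using card_image[OF t] m[OF j] l by simp
 qed
qed

lemma W_all_zero: assumes "!!t. v \<in> W t" shows "v = 0"
proof (rule W_separate[where t = "of_nat" and K = "Max (m ` {..<r} \<union> {0})"])
 show "inj_on (of_nat :: nat => 'k) {..<Max (m ` {..<r} \<union> {0})}" by (simp add: inj_on_def)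
 show "m j \<le> Max (m ` {..<r} \<union> {0})" if "j < r" for j using that by (intro Max_ge) auto
qed (use assms W_T in auto)

lemma T_dim: "fv.dim T = (\<Sum>j<r. m j)"
proof -
 have "fv.dim T = card (SIGMA j:{..<r}. {..<m j})"
 proof (rule dim_dual_family[where f = "%(j, i). f i j" and \<theta> = "%(j, i). e i j"])
  show "v = (\<Sum>x\<in>(SIGMA j:{..<r}. {..<m j}). fscale ((case x of (j, i) => e i j) v) (case x of (j, i) => f i j))"
   if "v \<in> T" for v
   using expand[OF that] by (simp add: sum.Sigma split_def)
 qed (use T f_T e_linear e_f in \<open>auto split: if_splits\<close>)
 thus ?thesis by (simp add: card_SigmaI)
qed

lemma W_infinity_dim: "fv.dim {u \<in> T. ALL j<r. e (m j - 1) j u = 0} + r = (\<Sum>j<r. m j)" (is "fv.dim ?V + r = _")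
proof -
 have V: "fv.subspace ?V"
  using T linear_on_zero[OF e_linear T] m_pos
  by (auto simp: fv.subspace_def e_add e_scale Suc_le_eq)
 have "fv.dim ?V = card (SIGMA j:{..<r}. {..<m j - 1})"
 proof (rule dim_dual_family[where f = "%(j, i). f i j" and \<theta> = "%(j, i). e i j"])
  show "v = (\<Sum>x\<in>(SIGMA j:{..<r}. {..<m j - 1}). fscale ((case x of (j, i) => e i j) v) (case x of (j, i) => f i j))"
   if v: "v \<in> ?V" for v
  proof -
   have "(\<Sum>i<m j. fscale (e i j v) (f i j)) = (\<Sum>i<m j - 1. fscale (e i j v) (f i j))" if j: "j < r" for j
   proof -
    obtain l where "m j = Suc l" using m_pos[OF j] by (cases "m j") auto
    thus ?thesis using v j by auto
   qed
   thus ?thesis using expand[of v] v by (simp add: sum.Sigma split_def)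
  qed
  show "linear_on ?V (*) (case x of (j, i) => e i j)" if "x \<in> (SIGMA j:{..<r}. {..<m j - 1})" for x
   using that by (auto simp: linear_on_def e_add e_scale)
 qed (use V f_T e_f m_pos in \<open>auto simp: Suc_le_eq split: if_splits\<close>)
 hence "fv.dim ?V = (\<Sum>j<r. m j - 1)" by (simp add: card_SigmaI)
 moreover have "(\<Sum>j<r. m j) = (\<Sum>j<r. (m j - 1) + 1)"
  using m_pos by (intro sum.cong refl) (auto simp: Suc_le_eq)
 ultimately show ?thesis unfolding sum.distrib by simp
qed

lemma W_infinity_iff: "u \<in> T \<and> (ALL j<r. e (m j - 1) j u = 0) \<longleftrightarrow> (EX x. R x u)"
 using R_left R_T R_iff by blast

end

section \<open>Veronese webs near a point\<close>

lemma span_image_finite: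
 fixes f :: "'i => 'a => 'k::field"
 assumes I: "finite I" and f: "inj_on f I" and x: "x \<in> fv.span (f ` I)"
 shows "EX g. x = (\<Sum>i\<in>I. fscale (g i) (f i))"
proof -
 obtain u where "x = (\<Sum>v\<in>f ` I. fscale (u v) v)"
  using x I by (auto simp: fv.span_finite)
 hence "x = (\<Sum>i\<in>I. fscale ((u \<circ> f) i) (f i))" by (simp add: sum.reindex[OF f])
 thus ?thesis by blast
qed

section \<open>The wedge as a polynomial in t and its leading coefficient\<close>

context web_point
begin

definition wpoly :: "(nat => 'a => 'k) => 'k poly" where
 "wpoly v = (\<Sum>\<sigma> | \<sigma> permutes {..<r}. smult (of_int (sign \<sigma>)) (\<Prod>j<r. \<Sum>i<m j. monom (e i j (v (\<sigma> j))) i))"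

lemma poly_wpoly: "poly (wpoly v) t = wedge r (%j. \<Sum>i<m j. fscale (t ^ i) (e i j)) v"
 by (simp add: wpoly_def wedge_def poly_sum poly_prod poly_monom sum_fun_apply mult.commute)

lemma wpoly_degree_coeff:
 "degree (wpoly v) \<le> (\<Sum>j<r. m j - 1) \<and> coeff (wpoly v) (\<Sum>j<r. m j - 1) = wedge r (%j. e (m j - 1) j) v"
proof -
 have d: "degree (\<Sum>i<m j. monom (a i) i) \<le> m j - 1" for j and a :: "nat => 'k"
  by (rule degree_sum_le) (auto intro: order_trans[OF degree_monom_le])
 have c: "coeff (\<Sum>i<m j. monom (a i) i) (m j - 1) = a (m j - 1)" if "j < r" for j and a :: "nat => 'k"
  using m_pos[OF that] by (simp add: coeff_sum coeff_monom)
 have *: "degree (\<Prod>j<r. \<Sum>i<m j. monom (e i j (v (\<sigma> j))) i) \<le> (\<Sum>j<r. m j - 1) \<and>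
  coeff (\<Prod>j<r. \<Sum>i<m j. monom (e i j (v (\<sigma> j))) i) (\<Sum>j<r. m j - 1)
   = (\<Prod>j<r. coeff (\<Sum>i<m j. monom (e i j (v (\<sigma> j))) i) (m j - 1))" for \<sigma>
  by (rule coeff_prod_sum[OF finite_lessThan d])
 show ?thesis
  unfolding wpoly_def wedge_def coeff_sum
 proof (intro conjI degree_sum_le sum.cong refl)
  show "degree (smult (of_int (sign \<sigma>)) (\<Prod>j<r. \<Sum>i<m j. monom (e i j (v (\<sigma> j))) i)) \<le> (\<Sum>j<r. m j - 1)" for \<sigma>
   using * degree_smult_le order_trans by blast
  show "coeff (smult (of_int (sign \<sigma>)) (\<Prod>j<r. \<Sum>i<m j. monom (e i j (v (\<sigma> j))) i)) (\<Sum>j<r. m j - 1)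
   = of_int (sign \<sigma>) * (\<Prod>j<r. e (m j - 1) j (v (\<sigma> j)))" for \<sigma>
   using * by (simp add: c del: One_nat_def)
 qed (simp add: finite_permutations)
qed

lemma sum_m: "(\<Sum>j<r. m j) = (\<Sum>j<r. m j - 1) + r"
proof -
 have "(\<Sum>j<r. m j) = (\<Sum>j<r. (m j - 1) + 1)"
  using m_pos by (intro sum.cong refl) (auto simp: Suc_le_eq)
 thus ?thesis unfolding sum.distrib by simp
qed

lemma poly_sum_bound:
 fixes p :: "'k poly"
 assumes "degree p \<le> d" shows "poly p t = (\<Sum>i\<le>d. t ^ i * coeff p i)"
 unfolding poly_altdef using assms
 by (intro sum.mono_neutral_cong_left) (auto simp: coeff_eq_0 mult.commute)

text \<open>Coefficients that merely represent the polynomial function are determined, because the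
  field is infinite; so they agree with those of \<open>wpoly\<close>.\<close>

lemma leading_coefficient:
 assumes "!!t. wedge r (%j. \<Sum>i<m j. fscale (t ^ i) (e i j)) v = (\<Sum>i\<le>(\<Sum>j<r. m j - 1). t ^ i * c i)"
 shows "c (\<Sum>j<r. m j - 1) = wedge r (%j. e (m j - 1) j) v"
proof -
 let ?d = "\<Sum>j<r. m j - 1"
 have "(\<Sum>i\<le>?d. c i * t ^ i) = (\<Sum>i\<le>?d. coeff (wpoly v) i * t ^ i)" for t
  using assms[of t] poly_sum_bound[of "wpoly v" ?d t] wpoly_degree_coeff[of v]
  by (simp add: poly_wpoly mult.commute)
 hence "c ?d = coeff (wpoly v) ?d"
  using Transcendental.polyfun_eq_coeffs[of c ?d "coeff (wpoly v)"] by blast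
 thus ?thesis using wpoly_degree_coeff[of v] by simp
qed

lemma wedge_expansion:
 "wedge r (%j. \<Sum>i<m j. fscale (t ^ i) (e i j)) v = (\<Sum>i\<le>(\<Sum>j<r. m j - 1). t ^ i * coeff (wpoly v) i)"
 using poly_sum_bound[of "wpoly v" "\<Sum>j<r. m j - 1" t] wpoly_degree_coeff[of v] by (simp add: poly_wpoly)

text \<open>The leading coefficient is the wedge of the last covectors of the blocks, and their
  common kernel is the set of all \<open>u\<close> to which some \<open>x\<close> is related, that
  is, the domain of \<open>ell\<close>.\<close>

lemma leading_kernel:
 assumes r: "r \<ge> 1" and \<omega>: "!!v. (ALL i<r. v i \<in> T) ==> \<omega> v = wedge r (%j. e (m j - 1) j) v"
 shows "form_kernel r T \<omega> = {u. EX x. R x u}"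
proof -
 have "form_kernel r T \<omega> = {u \<in> T. ALL j<r. e (m j - 1) j u = 0}"
 proof (rule form_kernel_wedge[OF r _ _ \<omega>])
  show "f (m j - 1) j \<in> T" if "j < r" for j using f_T that m_pos[OF that] by simp
  show "e (m i - 1) i (f (m j - 1) j) = (if i = j then 1 else 0)" if "i < r" "j < r" for i j
   using e_f that m_pos[OF that(1)] m_pos[OF that(2)] by auto
 qed
 thus ?thesis using W_infinity_iff by auto
qed

end

context mfold
begin

text \<open>A web supplies only the covectors. The dual vectors are constructed here, and the blocks
  are shown to be nonempty.\<close>

lemma web_form_point:
 assumes wf: "web_form M r w U \<gamma>" and q: "q \<in> U" and r: "r \<ge> 1" and dim: "fv.dim (w 0 q) + r = mdim M"
 shows "EX m e f. web_point (TS q) r m e f \<and>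
  (ALL t. w t q = web_point.W (TS q) r m e t) \<and>
  (ALL t v. (ALL i<r. v i \<in> TS q) -->
   \<gamma> t q v = wedge r (%j. \<Sum>i<m j. fscale (t ^ i) (e i j)) v)"
proof -
 let ?T = "TS q"
 have qM: "q \<in> points M" using wf q openin_sub_points unfolding web_form_def by blast
 note TS = tangent_subspace[OF qM]
 have wk: "w t q = form_kernel r ?T (\<gamma> t q)" for t using wf q unfolding web_form_def by blast
 have "EX (m :: nat => nat) (e :: nat => nat => ('p, 'k) covec). let I = {(i, j). j < r \<and> i < m j} in
     inj_on (%(i, j). e i j) I \<and> fv.independent ((%(i, j). e i j) ` I) \<and>
     fv.span ((%(i, j). e i j) ` I) = dual ?T \<and>
     (ALL t v. (ALL i<r. v i \<in> ?T) --> \<gamma> t q v = wedge r (%j. \<Sum>i<m j. fscale (t ^ i) (e i j)) v)"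
  using wf q unfolding web_form_def by blast
 then obtain m :: "nat => nat" and e :: "nat => nat => ('p, 'k) covec" where
  inj: "inj_on (%(i, j). e i j) {(i, j). j < r \<and> i < m j}" and
  ind: "fv.independent ((%(i, j). e i j) ` {(i, j). j < r \<and> i < m j})" and
  span: "fv.span ((%(i, j). e i j) ` {(i, j). j < r \<and> i < m j}) = dual ?T" and
  \<gamma>: "ALL t v. (ALL i<r. v i \<in> ?T) --> \<gamma> t q v = wedge r (%j. \<Sum>i<m j. fscale (t ^ i) (e i j)) v"
  unfolding Let_def by (elim exE conjE) (rule that)
 define I where "I = {(i, j). j < r \<and> i < m j}"
 define E where "E = (%(i, j). e i j)"
 have IS: "I = prod.swap ` (SIGMA j:{..<r}. {..<m j})" unfolding I_def by force
 have fin: "finite I" unfolding IS by simp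
 have sumI: "(\<Sum>x\<in>I. h x) = (\<Sum>j<r. \<Sum>i<m j. h (i, j))" for h :: "nat \<times> nat => 'v::comm_monoid_add"
  unfolding IS by (simp add: sum.reindex inj_on_def sum.Sigma split_def prod.swap_def)
 note ind = ind[folded I_def E_def] and inj = inj[folded I_def E_def] and span = span[folded I_def E_def]
 have E_dual: "E x \<in> dual ?T" if "x \<in> I" for x unfolding span[symmetric] by (rule fv.span_base[OF imageI[OF that]])
 obtain U0 \<phi> where U0: "(U0, \<phi>) \<in> atlas M" "q \<in> U0" using ex_chart[OF qM] by blast
 have "ALL a. EX g. restr ?T (%v. v (%x. \<phi> x a)) = (\<Sum>x\<in>I. fscale (g x) (E x))"
 proof
  fix a
  have "restr ?T (%v. v (%x. \<phi> x a)) \<in> dual ?T"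
   by (rule dual_restr[OF _ TS]) (simp add: linear_on_def)
  thus "EX g. restr ?T (%v. v (%x. \<phi> x a)) = (\<Sum>x\<in>I. fscale (g x) (E x))"
   using span_image_finite[OF fin inj] span by blast
 qed
 from choice[OF this] obtain g
  where g': "ALL a. restr ?T (%v. v (%x. \<phi> x a)) = (\<Sum>x\<in>I. fscale (g a x) (E x))"
  by (elim exE) (rule that)
 note g = spec[OF g']
 \<comment> \<open>\<open>g a x\<close> is the coefficient of the differential of coordinate
   \<open>a\<close> along the covector \<open>E x\<close>; transposing these coefficients onto the
   coordinate vectors gives the dual basis.\<close>
 define Fv where "Fv x = (\<Sum>a<mdim M. fscale (g a x) (coord_vec M U0 \<phi> a q))" for x
 have Fv_T: "Fv x \<in> ?T" for x unfolding Fv_def by (rule tangent_spaceI[OF U0])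
 have exp: "v = (\<Sum>x\<in>I. fscale (E x v) (Fv x))" if v: "v \<in> ?T" for v
 proof -
  have "v (%x. \<phi> x a) = (\<Sum>x\<in>I. g a x * E x v)" for a
   using fun_cong[OF g[of a], of v] v by (simp add: restr_def sum_fun_apply)
  hence "v = (\<Sum>a<mdim M. fscale (\<Sum>x\<in>I. g a x * E x v) (coord_vec M U0 \<phi> a q))"
   using tangent_expand[OF v U0] by simp
  also have "\<dots> = (\<Sum>x\<in>I. \<Sum>a<mdim M. fscale (g a x * E x v) (coord_vec M U0 \<phi> a q))"
   unfolding fv.scale_sum_left by (rule sum.swap)
  also have "\<dots> = (\<Sum>x\<in>I. fscale (E x v) (Fv x))"
   unfolding Fv_def fv.scale_sum_right by (simp add: mult.commute)
  finally show ?thesis .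
 qed
 have EF: "E y (Fv x) = (if y = x then 1 else 0)" if x: "x \<in> I" and y: "y \<in> I" for x y
 proof -
  have "(\<Sum>x\<in>I. fscale (E y (Fv x) - (if y = x then 1 else 0)) (E x)) v = 0" for v
  proof (cases "v \<in> ?T")
   case True
   have "E y v = E y (\<Sum>x\<in>I. fscale (E x v) (Fv x))" using exp[OF True] by simp
   also have "\<dots> = (\<Sum>x\<in>I. E x v * E y (Fv x))"
    by (rule linear_on_sum[OF dual_linear[OF E_dual[OF y]] TS Fv_T])
   finally have "(\<Sum>x\<in>I. E y (Fv x) * E x v) = E y v" by (simp add: mult.commute)
   moreover have "(\<Sum>x\<in>I. (if y = x then 1 else 0) * E x v) = E y v" using y fin
    by (simp add: if_distrib[where f = "%c. c * d" for d] cong: if_cong)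
   ultimately show ?thesis by (simp add: sum_fun_apply left_diff_distrib sum_subtractf)
  qed (simp add: sum_fun_apply dual_outside[OF E_dual])
  hence "(\<Sum>x\<in>I. fscale (E y (Fv x) - (if y = x then 1 else 0)) (E x)) = 0" by (simp add: fun_eq_iff)
  from independent_image_coeffs[OF fin inj ind this x] show ?thesis by simp
 qed
 \<comment> \<open>An empty block puts a zero factor into the wedge, so w(0) would be the whole
   tangent space, against its codimension \<open>r\<close> being positive.\<close>
 have mpos: "1 \<le> m j" if j: "j < r" for j
 proof (rule ccontr)
  assume "\<not> 1 \<le> m j"
  hence "m j = 0" by simp
  hence "wedge r (%j. \<Sum>i<m j. fscale (0 ^ i) (e i j)) v = 0" for v
   unfolding wedge_def using j
   by (intro sum.neutral ballI) (auto simp: prod_zero_iff intro!: bexI[of _ j])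
  hence "form_kernel r ?T (\<gamma> 0 q) = ?T" using \<gamma> by (auto simp: form_kernel_def)
  thus False using dim r wk[of 0] dim_tangent_space[OF qM] by simp
 qed
 interpret web_point ?T r m e "%i j. Fv (i, j)"
 proof
  show "e i j \<in> dual ?T" if "j < r" "i < m j" for i j
   using E_dual[of "(i, j)"] that by (simp add: I_def E_def)
  show "e i j (Fv (h, l)) = (if i = h \<and> j = l then 1 else 0)" if "j < r" "i < m j" "l < r" "h < m l" for i j h l
   using EF[of "(h, l)" "(i, j)"] that by (auto simp: I_def E_def)
  show "v = (\<Sum>j<r. \<Sum>i<m j. fscale (e i j v) (Fv (i, j)))" if "v \<in> ?T" for v
   using exp[OF that] by (simp add: sumI E_def)
 qed (rule TS Fv_T mpos, assumption?)+
 have "w t q = W t" for t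
 proof -
  have "form_kernel r ?T (\<gamma> t q) = {u \<in> ?T. ALL j<r. (\<Sum>i<m j. fscale (t ^ i) (e i j)) u = 0}"
  proof (rule form_kernel_wedge[OF r])
   show "Fv (0, j) \<in> ?T" for j by (rule Fv_T)
   show "\<gamma> t q v = wedge r (%j. \<Sum>i<m j. fscale (t ^ i) (e i j)) v" if "ALL i<r. v i \<in> ?T" for v
    using \<gamma> that by blast
   show "(\<Sum>h<m i. fscale (t ^ h) (e h i)) (Fv (0, j)) = (if i = j then 1 else 0)" if "i < r" "j < r" for i j
   proof -
    have "(\<Sum>h<m i. t ^ h * e h i (Fv (0, j))) = (\<Sum>h<m i. if h = 0 then (if i = j then 1 else 0) else 0)"
     using that m_pos[OF that(2)] by (intro sum.cong[OF refl]) (simp add: e_f)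
    thus ?thesis using m_pos[OF that(1)] by (simp add: sum_fun_apply)
   qed
  qed
  thus ?thesis unfolding wk[of t] by (simp add: W_def sum_fun_apply)
 qed
 thus ?thesis using web_point_axioms \<gamma> by blast
qed

end

locale web = mfold N for N :: "('p, 'k::ground_field) mfd" +
 fixes r :: nat and w :: "'k => ('p, 'k) distrib"
 assumes web: "veronese_web N r w"
begin

abbreviation "n \<equiv> mdim N"

lemma r_pos: "1 \<le> r" using web by (simp add: veronese_web_def)

lemma web_distribution: "distribution N r (w t)"
 and web_involutive: "involutive N (w t)"
 using web by (auto simp: veronese_web_def foliation_def)

lemma web_dim: "q \<in> points N ==> fv.dim (w t q) + r = n"
 using web_distribution[of t] by (auto simp: distribution_def)

text \<open>The relation \<open>R\<close> written through \<open>w\<close> alone, hence independent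
  of the basis chosen at \<open>q\<close>.\<close>

definition RR :: "'p => ('p, 'k) tvec => ('p, 'k) tvec => bool" where
 "RR q x u \<longleftrightarrow> x \<in> TS q \<and> u \<in> TS q \<and> (ALL t. x + fscale t u \<in> w t q)"

lemma ex_point:
 assumes q: "q \<in> points N"
 shows "EX m e f. web_point (TS q) r m e f \<and> (ALL t. w t q = web_point.W (TS q) r m e t)"
proof -
 obtain U \<gamma> where "q \<in> U" "web_form N r w U \<gamma>" using web q by (auto simp: veronese_web_def)
 thus ?thesis using web_form_point[where w = w and q = q, OF _ _ r_pos web_dim[where t = 0, OF q]] by blast
qed

lemma RR_eq:
 assumes "web_point (TS q) r m e f" "ALL t. w t q = web_point.W (TS q) r m e t"
 shows "RR q = web_point.R (TS q) r m e"
 using assms by (simp add: fun_eq_iff RR_def web_point.R_def)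

text \<open>\<open>web_infinity\<close> collects the kernels obtained from all local forms around
  \<open>q\<close>. Each of these kernels equals the domain of \<open>ell\<close>, so their union
  does.\<close>

lemma web_infinity_eq:
 assumes q: "q \<in> points N"
 shows "web_infinity N r w q = {u. EX x. RR q x u}"
proof -
 let ?T = "TS q"
 have *: "n - r = (\<Sum>j<r. m j - 1)" if "web_point ?T r m e f" for m e f
  using web_point.sum_m[OF that] web_point.T_dim[OF that] dim_tangent_space[OF q] by simp
 have "u \<in> web_infinity N r w q \<longleftrightarrow> (EX x. RR q x u)" for u
 proof
  assume "u \<in> web_infinity N r w q"
  then obtain U \<gamma> c where U: "q \<in> U" "web_form N r w U \<gamma>"
   and c: "ALL t v. (ALL i<r. v i \<in> ?T) --> \<gamma> t q v = (\<Sum>i\<le>n - r. t ^ i * c i v)"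
   and u: "u \<in> form_kernel r ?T (c (n - r))"
   unfolding web_infinity_def by blast
  obtain m e f where P: "web_point ?T r m e f" and W: "ALL t. w t q = web_point.W ?T r m e t"
   and \<gamma>: "ALL t v. (ALL i<r. v i \<in> ?T) --> \<gamma> t q v = wedge r (%j. \<Sum>i<m j. fscale (t ^ i) (e i j)) v"
   using web_form_point[where w = w and q = q, OF U(2,1) r_pos web_dim[where t = 0, OF q]] by (elim exE conjE) (rule that)
  have "form_kernel r ?T (c (n - r)) = {u. EX x. RR q x u}"
   unfolding RR_eq[OF P W]
  proof (rule web_point.leading_kernel[OF P r_pos])
   fix v assume v: "ALL i<r. v i \<in> ?T"
   show "c (n - r) v = wedge r (%j. e (m j - 1) j) v"
    using web_point.leading_coefficient[OF P, of v "%i. c i v"] \<gamma> c v by (simp add: *[OF P])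
  qed
  thus "EX x. RR q x u" using u by blast
 next
  assume u: "EX x. RR q x u"
  obtain U \<gamma> where U: "q \<in> U" "web_form N r w U \<gamma>" using web q by (auto simp: veronese_web_def)
  obtain m e f where P: "web_point ?T r m e f" and W: "ALL t. w t q = web_point.W ?T r m e t"
   and \<gamma>: "ALL t v. (ALL i<r. v i \<in> ?T) --> \<gamma> t q v = wedge r (%j. \<Sum>i<m j. fscale (t ^ i) (e i j)) v"
   using web_form_point[where w = w and q = q, OF U(2,1) r_pos web_dim[where t = 0, OF q]] by (elim exE conjE) (rule that)
  define c where "c i v = coeff (web_point.wpoly r m e v) i" for i and v :: "nat => ('p, 'k) tvec"
  have c: "ALL t v. (ALL i<r. v i \<in> ?T) --> \<gamma> t q v = (\<Sum>i\<le>n - r. t ^ i * c i v)"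
   using \<gamma> web_point.wedge_expansion[OF P] by (simp add: c_def *[OF P])
  have "form_kernel r ?T (c (n - r)) = {u. EX x. RR q x u}"
   unfolding RR_eq[OF P W]
   by (rule web_point.leading_kernel[OF P r_pos]) (simp add: c_def *[OF P] web_point.wpoly_degree_coeff[OF P] del: One_nat_def)
  hence "u \<in> form_kernel r ?T (c (n - r))" using u by blast
  thus "u \<in> web_infinity N r w q" unfolding web_infinity_def using U c by blast
 qed
 thus ?thesis by blast
qed

end

section \<open>Injectivity and range of ell + tI\<close>

context web_point
begin

text \<open>Climbing each block: if component \<open>i\<close> of \<open>x\<close> vanishes, then
  \<open>t = 0\<close> or component \<open>i\<close> of \<open>u\<close> vanishes, and either way so
  does component \<open>Suc i\<close> of \<open>x\<close>.\<close>

lemma pencil_independent: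
 assumes R: "R x u" and z: "x + fscale t u = 0" shows "x = 0"
proof -
 have zz: "e i j x + t * e i j u = 0" if j: "j < r" "i < m j" for i j
  using arg_cong[OF z, of "e i j"] R_T[OF R] T_scale linear_on_zero[OF e_linear[OF j] T]
  by (simp add: e_add[OF j] e_scale[OF j])
 have c: "e 0 j x = 0 \<and> (ALL i. Suc i < m j --> e (Suc i) j x = - e i j u)" if "j < r" for j
  using R R_iff[OF R_T[OF R]] that by blast
 have "e i j x = 0" if j: "j < r" and i: "i < m j" for i j
  using i
 proof (induction i)
  case (Suc i)
  hence "e i j x = 0" by simp
  hence "t = 0 \<or> e i j u = 0" using zz[OF j, of i] Suc by simp
  thus ?case using c[OF j] zz[OF j, of "Suc i"] Suc by auto
 qed (use c[OF j] in blast)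
 thus ?thesis using R_T[OF R] linear_on_zero[OF e_linear T] by (intro eqI fv.subspace_0[OF T]) auto
qed

lemma pencil_spans:
 assumes v: "v \<in> W t" shows "EX x u. R x u \<and> v = x + fscale t u"
proof (cases "t = 0")
 case True
 thus ?thesis using R_right[of v] v by auto
next
 case t: False
 have vT: "v \<in> T" and v0: "!!j. j < r ==> (\<Sum>i<m j. t ^ i * e i j v) = 0" using v by (auto simp: W_def)
 \<comment> \<open>With x = v - tu the shift equations become t u_i = v_i + u_(i-1), and this sum
   solves them. The end condition on the last component is exactly membership of \<open>v\<close> in
   \<open>W t\<close>.\<close>
 define u where "u = vec (%i j. (\<Sum>l\<le>i. t ^ l * e l j v) / t ^ Suc i)"
 have uT: "u \<in> T" unfolding u_def by (rule vec_T)
 have eu: "e i j u = (\<Sum>l\<le>i. t ^ l * e l j v) / t ^ Suc i" if "j < r" "i < m j" for i j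
  using that by (simp add: u_def e_vec)
 have ex: "e i j (v + fscale (- t) u) = e i j v - t * e i j u" if j: "j < r" "i < m j" for i j
  using vT uT T_scale by (simp only: e_add[OF j] e_scale[OF j]) simp
 have "R (v + fscale (- t) u) u"
 proof (rule R_I[OF T_add[OF vT T_scale[OF uT]] uT])
  fix j assume j: "j < r"
  have m0: "0 < m j" using m_pos[OF j] by simp
  show "e 0 j (v + fscale (- t) u) = 0" unfolding ex[OF j m0] eu[OF j m0] using t by simp
  show "e (m j - 1) j u = 0"
  proof -
   obtain l where "m j = Suc l" using m_pos[OF j] by (cases "m j") auto
   thus ?thesis using v0[OF j] eu[OF j, of l] by (simp add: lessThan_Suc_atMost)
  qed
  fix i assume i: "Suc i < m j"
  show "e (Suc i) j (v + fscale (- t) u) = - e i j u"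
   unfolding ex[OF j i] eu[OF j i] eu[OF j Suc_lessD[OF i]] using t by (simp add: field_simps)
 qed
 moreover have "v = v + fscale (- t) u + fscale t u" by (simp add: fun_eq_iff)
 ultimately show ?thesis by blast
qed

lemma annihilated_in_W:
 assumes x: "x \<in> T" and a: "!!\<alpha>. \<alpha> \<in> dual T ==> (ALL v:W t. \<alpha> v = 0) ==> \<alpha> x = 0"
 shows "x \<in> W t"
proof -
 have "(\<Sum>i<m j. t ^ i * e i j x) = 0" if j: "j < r" for j
 proof -
  have "(\<Sum>i<m j. fscale (t ^ i) (e i j)) \<in> dual T"
   using j by (intro fv.subspace_sum[OF dual_subspace] fv.subspace_scale[OF dual_subspace] e_dual) auto
  from a[OF this] show ?thesis using j by (auto simp: sum_fun_apply W_def)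
 qed
 thus ?thesis using x by (simp add: W_def)
qed

lemma m_le: "j < r ==> m j \<le> (\<Sum>j<r. m j)"
 by (rule member_le_sum) auto

end

context mfold
begin

lemma lie_bracket_pencil:
 assumes X: "vector_field M V X" "vector_field M V X'" and Y: "vector_field M V Y" "vector_field M V Y'"
  and p: "p \<in> V"
 shows "lie_bracket M (%p. X p + fscale t (Y p)) (%p. X' p + fscale t (Y' p)) p =
  lie_bracket M X X' p + fscale t (lie_bracket M X Y' p + lie_bracket M Y X' p)
   + fscale (t * t) (lie_bracket M Y Y' p)"
proof (rule ext)
 fix g
 show "lie_bracket M (%p. X p + fscale t (Y p)) (%p. X' p + fscale t (Y' p)) p g =
  (lie_bracket M X X' p + fscale t (lie_bracket M X Y' p + lie_bracket M Y X' p)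
   + fscale (t * t) (lie_bracket M Y Y' p)) g"
 proof (cases "smooth p g")
  case True
  note pM = subsetD[OF openin_sub_points[OF vector_field_open[OF X(1)]] p]
  have *: "v (%x. A x g + t * B x g) = v (%x. A x g) + t * v (%x. B x g)"
   if "v \<in> TS p" "vector_field M V A" "vector_field M V B" for v A B
  proof -
   have A: "smooth p (%x. A x g)" and B: "smooth p (%x. B x g)"
    using vector_field_smooth[OF that(2) p True] vector_field_smooth[OF that(3) p True] by blast+
   have "v (%x. A x g + t * B x g) = v (%x. A x g) + v (%x. t * B x g)"
    by (rule tangent_plus[OF that(1) A smooth_near_mult[OF smooth_near_const[OF pM] B]])
   thus ?thesis using tangent_cmult[OF that(1) B] by simp
  qed
  note t = vector_field_tangent[OF X(1) p] vector_field_tangent[OF X(2) p]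
   vector_field_tangent[OF Y(1) p] vector_field_tangent[OF Y(2) p]
  show ?thesis
   unfolding lie_bracket_apply[OF True] plus_fun_apply fscale_apply
   using *[OF t(1) X(2) Y(2)] *[OF t(2) X(1) Y(1)] *[OF t(3) X(2) Y(2)] *[OF t(4) X(1) Y(1)]
   by (simp add: algebra_simps)
 qed (simp add: lie_bracket_def)
qed

end

section \<open>Transfer to the web and smoothness of ell\<close>

context web
begin

lemma points_tangent: "RR q x u ==> q \<in> points N" using tangent_point by (auto simp: RR_def)

lemma RR_W: "RR q x u ==> x + fscale t u \<in> w t q" by (simp add: RR_def)

text \<open>Pointwise facts freed from the choice of a basis. The one with the \<open>n\<close>
  parameters 1, ..., n prepares the smoothness of \<open>ell\<close>: \<open>n\<close> bounds every
  block length, so these members of the web already separate vectors.\<close>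

lemma RR_facts:
 assumes q: "q \<in> points N"
 shows "RR q x u ==> RR q x u' ==> u = u'"
  and "RR q x u ==> RR q x' u ==> x = x'"
  and "x \<in> w 0 q ==> EX u. RR q x u"
  and "RR q x u ==> x + fscale t u = 0 ==> x = 0"
  and "v \<in> w t q ==> EX x u. RR q x u \<and> v = x + fscale t u"
  and "B \<in> TS q ==> C \<in> TS q ==>
   ALL t. A + fscale t B + fscale (t * t) C \<in> w t q ==> EX u. RR q A u \<and> RR q (B - u) C"
  and "x \<in> TS q ==>
   ALL \<alpha>:cotangent_space N q. (ALL v:w t q. \<alpha> v = 0) --> \<alpha> x = 0 ==> x \<in> w t q"
  and "(ALL t. v \<in> w t q) ==> v = 0"
  and "v \<in> TS q ==> ALL s<n. v \<in> w (of_nat (s + 1)) q ==> v = 0"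
  and "fv.dim {u. EX x. RR q x u} + r = n"
proof -
 let ?T = "TS q"
 obtain m e f where P: "web_point ?T r m e f" and W: "ALL t. w t q = web_point.W ?T r m e t"
  using ex_point[OF q] by blast
 interpret web_point ?T r m e f by (rule P)
 note E = RR_eq[OF P W]
 note W = spec[OF W]
 show "RR q x u ==> RR q x u' ==> u = u'" unfolding E by (rule R_unique_right)
 show "RR q x u ==> RR q x' u ==> x = x'" unfolding E by (rule R_unique_left)
 show "x \<in> w 0 q ==> EX u. RR q x u" unfolding E W by (rule R_right)
 show "RR q x u ==> x + fscale t u = 0 ==> x = 0" unfolding E by (rule pencil_independent)
 show "v \<in> w t q ==> EX x u. RR q x u \<and> v = x + fscale t u" unfolding E W by (rule pencil_spans)
 show "EX u. RR q A u \<and> RR q (B - u) C" if "B \<in> ?T" "C \<in> ?T" "ALL t. A + fscale t B + fscale (t * t) C \<in> w t q"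
  unfolding E using that(3) unfolding W by (intro quadratic_pencil[OF that(1,2)]) blast
 show "x \<in> w t q" if "x \<in> ?T" "ALL \<alpha>:dual ?T. (ALL v:w t q. \<alpha> v = 0) --> \<alpha> x = 0"
  using that(2) unfolding W by (intro annihilated_in_W[OF that(1)]) blast
 show "v = 0" if "ALL t. v \<in> w t q" using that unfolding W by (intro W_all_zero) blast
 have n: "(\<Sum>j<r. m j) = n" using T_dim dim_tangent_space[OF q] by simp
 show "v = 0" if v: "v \<in> ?T" "ALL s<n. v \<in> w (of_nat (s + 1)) q"
 proof (rule W_separate[OF v(1), where t = "%s. of_nat (s + 1)" and K = n])
  show "inj_on (%s. of_nat (s + 1) :: 'k) {..<n}" unfolding inj_on_def of_nat_eq_iff by simp
  show "v \<in> W (of_nat (s + 1))" if "s < n" for s using v(2) that unfolding W by blast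
  show "m j \<le> n" if "j < r" for j using m_le[OF that] n by simp
 qed
 have "{u. EX x. RR q x u} = {u \<in> ?T. ALL j<r. e (m j - 1) j u = 0}" unfolding E using W_infinity_iff by blast
 thus "fv.dim {u. EX x. RR q x u} + r = n" using W_infinity_dim n by simp
qed

lemma RR_sum:
 assumes q: "q \<in> points N" and R: "!!i. i \<in> S ==> RR q (x i) (u i)"
 shows "RR q (\<Sum>i\<in>S. fscale (c i) (x i)) (\<Sum>i\<in>S. fscale (c i) (u i))"
proof -
 obtain m e f where P: "web_point (TS q) r m e f"
  and W: "ALL t. w t q = web_point.W (TS q) r m e t"
  using ex_point[OF q] by blast
 show ?thesis
  using R unfolding RR_eq[OF P W] by (intro web_point.R_sum[OF P])
qed

lemma RR_add: "q \<in> points N ==> RR q x u ==> RR q y v ==> RR q (x + y) (u + v)"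
 and RR_scale: "q \<in> points N ==> RR q x u ==> RR q (fscale c x) (fscale c u)"
proof -
 assume q: "q \<in> points N"
 obtain m e f where P: "web_point (TS q) r m e f"
  and W: "ALL t. w t q = web_point.W (TS q) r m e t"
  using ex_point[OF q] by blast
 show "RR q x u ==> RR q y v ==> RR q (x + y) (u + v)" unfolding RR_eq[OF P W] by (rule web_point.R_add[OF P])
 show "RR q x u ==> RR q (fscale c x) (fscale c u)" unfolding RR_eq[OF P W] by (rule web_point.R_scale[OF P])
qed

lemma RR_zero: "q \<in> points N ==> RR q 0 0"
 using RR_sum[of q "{}"] by simp

lemma annihilator:
 assumes q: "q \<in> points N" and U: "(U, \<phi>) \<in> atlas N" "q \<in> U"
 shows "EX \<theta> :: nat => nat => 'p => 'k. (ALL a<n. ALL b<n. smooth q (\<theta> a b)) \<and>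
  eventually (%x. ALL a<n. ALL v:w t x. (\<Sum>b<n. \<theta> a b x * v (%y. \<phi> y b)) = 0) (near q) \<and>
  (ALL v:TS q. (ALL a<n. (\<Sum>b<n. \<theta> a b q * v (%y. \<phi> y b)) = 0) --> v \<in> w t q)"
proof -
 interpret F: cotangent N r "w t" by unfold_locales (rule web_distribution)
 let ?k = "n - r"
 obtain U' \<phi>' V X where V: "q \<in> V" and X: "local_frame N r (w t) V X"
  using F.ex_local_frame[OF q] by blast
 have vf: "ALL i<?k. vector_field N V (X i)" using F.local_frame_vf[OF X] by blast
 have ind: "ALL c. (\<Sum>i<?k. fscale (c i) (X i q)) = 0 --> (ALL i<?k. c i = 0)"
  using F.local_frame_independent[OF X V] by blast
 obtain B where B: "ALL l<?k. ALL a<n. smooth q (B l a)"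
  and Be: "eventually (%x. ALL l<?k. ALL c. (\<Sum>a<n. B l a x * (\<Sum>i<?k. fscale (c i) (X i x)) (%y. \<phi> y a)) = c l) (near q)"
  using F.frame_coefficients[OF U vf V ind] by (elim exE conjE) (rule that)
 \<comment> \<open>The identity minus the projection of coordinates onto w(t) given by
   \<open>X\<close> and \<open>B\<close>. Near \<open>q\<close> its rows annihilate w(t), and at
   \<open>q\<close> their common kernel lies in w(t).\<close>
 define \<theta> where "\<theta> a b x = (if a = b then 1 else 0) - (\<Sum>l<?k. X l x (%y. \<phi> y a) * B l b x)" for a b x
 have \<theta>: "(\<Sum>b<n. \<theta> a b x * z b) = z a - (\<Sum>l<?k. X l x (%y. \<phi> y a) * (\<Sum>b<n. B l b x * z b))"
  if "a < n" for a x z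
 proof -
  have "(\<Sum>b<n. \<theta> a b x * z b) = (\<Sum>b<n. (if a = b then z b else 0))
   - (\<Sum>b<n. \<Sum>l<?k. X l x (%y. \<phi> y a) * (B l b x * z b))"
   unfolding \<theta>_def left_diff_distrib sum_subtractf sum_distrib_right
   by (intro arg_cong2[where f = "(-)"] sum.cong refl) (auto simp: mult.assoc)
  also have "(\<Sum>b<n. \<Sum>l<?k. X l x (%y. \<phi> y a) * (B l b x * z b))
   = (\<Sum>l<?k. X l x (%y. \<phi> y a) * (\<Sum>b<n. B l b x * z b))"
   unfolding sum_distrib_left by (rule sum.swap)
  finally show ?thesis using that by simp
 qed
 show ?thesis
 proof (intro exI[of _ \<theta>] conjI allI impI ballI)
  fix a b assume ab: "a < n" "b < n"
  show "smooth q (\<theta> a b)"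
   unfolding \<theta>_def
  proof (rule smooth_near_diff[OF smooth_near_const[OF q] smooth_near_sum[OF q]])
   fix l assume l: "l \<in> {..<?k}"
   have "smooth q (%x. X l x (%y. \<phi> y a))"
    using vf l vector_field_smooth[OF _ V smooth_near_chart_coord[OF U ab(1)], where X = "X l"] by blast
   moreover have "smooth q (B l b)" using B l ab by blast
   ultimately show "smooth q (%x. X l x (%y. \<phi> y a) * B l b x)"
    by (rule smooth_near_mult)
  qed
 next
  show "eventually (%x. ALL a<n. ALL v:w t x. (\<Sum>b<n. \<theta> a b x * v (%y. \<phi> y b)) = 0) (near q)"
   using Be eventually_in_open[OF F.local_frame_open[OF X] V]
  proof eventually_elim
   case (elim x)
   show ?case
   proof (intro allI impI ballI)
    fix a v assume a: "a < n" and v: "v \<in> w t x"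
    then obtain c where c: "v = (\<Sum>i<?k. fscale (c i) (X i x))"
     using F.local_frame_range[OF X elim(2)] by blast
    have "(\<Sum>l<?k. X l x (%y. \<phi> y a) * (\<Sum>b<n. B l b x * v (%y. \<phi> y b))) = (\<Sum>l<?k. X l x (%y. \<phi> y a) * c l)"
     using elim(1) unfolding c by (intro sum.cong[OF refl]) simp
    also have "\<dots> = v (%y. \<phi> y a)" unfolding c sum_fun_apply by (simp add: mult.commute)
    finally show "(\<Sum>b<n. \<theta> a b x * v (%y. \<phi> y b)) = 0" using \<theta>[OF a] by simp
   qed
  qed
 next
  fix v assume v: "v \<in> TS q" and z: "ALL a<n. (\<Sum>b<n. \<theta> a b q * v (%y. \<phi> y b)) = 0"
  let ?c = "%l. \<Sum>b<n. B l b q * v (%y. \<phi> y b)"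
  have in_w: "(\<Sum>l<?k. fscale (?c l) (X l q)) \<in> w t q"
   unfolding F.local_frame_range[OF X V] by (rule rangeI[where x = ?c])
  have "v = (\<Sum>l<?k. fscale (?c l) (X l q))"
  proof (rule tangent_eqI[OF v _ U])
   show "(\<Sum>l<?k. fscale (?c l) (X l q)) \<in> TS q" using in_w F.F_tangent[OF q] by blast
   fix a assume a: "a < n"
   have "v (%x. \<phi> x a) = (\<Sum>l<?k. X l q (%x. \<phi> x a) * ?c l)"
    using z \<theta>[OF a, of q "%b. v (%y. \<phi> y b)"] a by simp
   thus "v (%x. \<phi> x a) = (\<Sum>l<?k. fscale (?c l) (X l q)) (%x. \<phi> x a)"
    by (simp add: sum_fun_apply mult.commute)
  qed
  thus "v \<in> w t q" using in_w by simp
 qed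
qed

text \<open>For related x' and u, a covector \<theta> annihilating w(t) satisfies \<theta>(x') = - t
  \<theta>(u). Annihilators at t = 1, ..., n have no common kernel at \<open>q\<close>, so
  \<open>smooth_left_inverse\<close> recovers a vector from their values; thus each of x' and u is a
  smooth matrix applied to the other. The parameters are nonzero so that they can be
  inverted.\<close>

lemma relation_matrices:
 assumes q: "q \<in> points N" and U: "(U, \<phi>) \<in> atlas N" "q \<in> U"
 shows "EX G. (ALL b<n. ALL c<n. smooth q (G b c)) \<and> eventually (%x. ALL x' u. RR x x' u -->
   (ALL b<n. x' (%y. \<phi> y b) = (\<Sum>c<n. G b c x * u (%y. \<phi> y c)))) (near q)" (is ?A)
  and "EX G. (ALL b<n. ALL c<n. smooth q (G b c)) \<and> eventually (%x. ALL x' u. RR x x' u -->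
   (ALL b<n. u (%y. \<phi> y b) = (\<Sum>c<n. G b c x * x' (%y. \<phi> y c)))) (near q)" (is ?B)
proof -
 define tt where "tt s = (of_nat (s + 1) :: 'k)" for s
 have tt: "tt s \<noteq> 0" for s unfolding tt_def by (simp del: of_nat_add of_nat_Suc add: of_nat_eq_0_iff)
 have tt_inv: "inverse (tt s) * (tt s * z) = z" for s z using tt by simp
 define S where "S = {..<n} \<times> {..<n}"
 have "ALL s. EX \<theta> :: nat => nat => 'p => 'k. (ALL a<n. ALL b<n. smooth q (\<theta> a b)) \<and>
  eventually (%x. ALL a<n. ALL v:w (tt s) x. (\<Sum>b<n. \<theta> a b x * v (%y. \<phi> y b)) = 0) (near q) \<and>
  (ALL v:TS q. (ALL a<n. (\<Sum>b<n. \<theta> a b q * v (%y. \<phi> y b)) = 0) --> v \<in> w (tt s) q)"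
  by (intro allI annihilator[OF q U])
 from choice[OF this] obtain \<theta> :: "nat => nat => nat => 'p => 'k" where
  \<theta>: "ALL s. (ALL a<n. ALL b<n. smooth q (\<theta> s a b)) \<and>
  eventually (%x. ALL a<n. ALL v:w (tt s) x. (\<Sum>b<n. \<theta> s a b x * v (%y. \<phi> y b)) = 0) (near q) \<and>
  (ALL v:TS q. (ALL a<n. (\<Sum>b<n. \<theta> s a b q * v (%y. \<phi> y b)) = 0) --> v \<in> w (tt s) q)"
  by (elim exE) (rule that)
 have sm: "smooth q (\<theta> s a b)" if "a < n" "b < n" for s a b using \<theta> that by blast
 have "EX B. (ALL l<n. ALL a:S. smooth q (B l a)) \<and>
  eventually (%x. ALL l<n. ALL i<n. (\<Sum>a\<in>S. B l a x * \<theta> (fst a) (snd a) i x) = (if l = i then 1 else 0)) (near q)"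
 proof (rule smooth_left_inverse[OF q])
  show "finite S" by (simp add: S_def)
  show "smooth q (\<theta> (fst a) (snd a) i)" if "i < n" "a \<in> S" for i a
   using sm that by (auto simp: S_def)
  fix c assume z: "!!a. a \<in> S ==> (\<Sum>i<n. c i * \<theta> (fst a) (snd a) i q) = 0"
  define v where "v = (\<Sum>i<n. fscale (c i) (coord_vec N U \<phi> i q))"
  have v: "v \<in> TS q" unfolding v_def by (rule tangent_spaceI[OF U])
  have vc: "v (%y. \<phi> y b) = c b" if "b < n" for b unfolding v_def by (rule coord_vec_sum_coord[OF U that])
  have "v \<in> w (tt s) q" if s: "s < n" for s
  proof -
   have "(\<Sum>b<n. \<theta> s a b q * v (%y. \<phi> y b)) = 0" if "a < n" for a
    using z[of "(s, a)"] s that by (simp add: S_def vc mult.commute)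
   thus ?thesis using \<theta> v by blast
  qed
  hence "v = 0" using RR_facts(9)[OF q v] by (simp add: tt_def)
  thus "ALL i<n. c i = 0" using vc by simp
 qed
 then obtain B where B: "ALL l<n. ALL a:S. smooth q (B l a)"
  and Be: "eventually (%x. ALL l<n. ALL i<n. (\<Sum>a\<in>S. B l a x * \<theta> (fst a) (snd a) i x) = (if l = i then 1 else 0)) (near q)"
  by (elim exE conjE) (rule that)
 \<comment> \<open>The left inverse \<open>B\<close>, a diagonal scaling \<open>d\<close> over the
   parameters, and the annihilators \<theta>, multiplied together. The scaling by - t_s expresses x'
   through u, and the one by - 1/t_s expresses u through x'.\<close>
 define mat where "mat d b c x = (\<Sum>a\<in>S. B b a x * (d (fst a) * \<theta> (fst a) (snd a) c x))"
  for d :: "nat => 'k" and b c x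
 have mat_smooth: "smooth q (mat d b c)" if "b < n" "c < n" for d b c
  unfolding mat_def
 proof (rule smooth_near_sum[OF q])
  fix a assume a: "a \<in> S"
  have "smooth q (\<theta> (fst a) (snd a) c)"
   using a that by (intro sm) (auto simp: S_def)
  note d = smooth_near_mult[OF smooth_near_const[OF q, of "d (fst a)"] this]
  have "smooth q (B b a)" using B that(1) a by blast
  from smooth_near_mult[OF this d]
  show "smooth q (%x. B b a x * (d (fst a) * \<theta> (fst a) (snd a) c x))" .
 qed
 have mat: "(\<Sum>c<n. mat d b c x * z c) = (\<Sum>a\<in>S. B b a x * (d (fst a) * (\<Sum>c<n. \<theta> (fst a) (snd a) c x * z c)))"
  for d b x z
 proof -
  have "(\<Sum>c<n. mat d b c x * z c) = (\<Sum>c<n. \<Sum>a\<in>S. B b a x * (d (fst a) * (\<theta> (fst a) (snd a) c x * z c)))"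
   by (simp add: mat_def sum_distrib_right mult.assoc)
  also have "\<dots> = (\<Sum>a\<in>S. \<Sum>c<n. B b a x * (d (fst a) * (\<theta> (fst a) (snd a) c x * z c)))" by (rule sum.swap)
  finally show ?thesis by (simp add: sum_distrib_left)
 qed
 have "eventually (%x. ALL s:{..<n}. ALL a<n. ALL v:w (tt s) x. (\<Sum>b<n. \<theta> s a b x * v (%y. \<phi> y b)) = 0) (near q)"
  by (rule eventually_ball_finite) (use \<theta> in auto)
 hence ev: "eventually (%x. ALL x' u. RR x x' u --> (ALL b<n.
   x' (%y. \<phi> y b) = (\<Sum>c<n. mat (%s. - tt s) b c x * u (%y. \<phi> y c)) \<and>
   u (%y. \<phi> y b) = (\<Sum>c<n. mat (%s. - inverse (tt s)) b c x * x' (%y. \<phi> y c)))) (near q)"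
  using Be
 proof eventually_elim
  case (elim x)
  show ?case
  proof (intro allI impI)
   fix x' u b assume R: "RR x x' u" and b: "b < n"
   have id: "(\<Sum>a\<in>S. B b a x * (\<Sum>c<n. \<theta> (fst a) (snd a) c x * z c)) = z b" for z
   proof -
    have "(\<Sum>a\<in>S. B b a x * (\<Sum>c<n. \<theta> (fst a) (snd a) c x * z c))
     = (\<Sum>c<n. (\<Sum>a\<in>S. B b a x * \<theta> (fst a) (snd a) c x) * z c)"
     unfolding sum_distrib_left sum_distrib_right mult.assoc by (rule sum.swap)
    also have "\<dots> = (\<Sum>c<n. if b = c then z c else 0)"
     using elim(2) b by (intro sum.cong[OF refl]) simp
    finally show ?thesis using b by simp
   qed
   have k: "(\<Sum>c<n. \<theta> s a c x * x' (%y. \<phi> y c)) = - (tt s * (\<Sum>c<n. \<theta> s a c x * u (%y. \<phi> y c)))"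
    if "(s, a) \<in> S" for s a
   proof -
    have "(\<Sum>c<n. \<theta> s a c x * (x' + fscale (tt s) u) (%y. \<phi> y c)) = 0"
     using elim(1) RR_W[OF R, of "tt s"] that unfolding S_def by blast
    thus ?thesis
     by (simp add: ring_distribs sum.distrib sum_distrib_left mult.left_commute eq_neg_iff_add_eq_0)
   qed
   show "x' (%y. \<phi> y b) = (\<Sum>c<n. mat (%s. - tt s) b c x * u (%y. \<phi> y c)) \<and>
    u (%y. \<phi> y b) = (\<Sum>c<n. mat (%s. - inverse (tt s)) b c x * x' (%y. \<phi> y c))"
    unfolding mat
    using id[of "%c. x' (%y. \<phi> y c)"] id[of "%c. u (%y. \<phi> y c)"]
    by (simp add: k tt_inv cong: sum.cong)
  qed
 qed
 show ?A
  by (rule exI[of _ "mat (%s. - tt s)"], rule conjI, intro allI impI mat_smooth, assumption+)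
   (rule eventually_mono[OF ev], intro allI impI, drule spec, drule spec, drule (1) mp, drule spec, drule (1) mp, erule conjunct1)
 show ?B
  by (rule exI[of _ "mat (%s. - inverse (tt s))"], rule conjI, intro allI impI mat_smooth, assumption+)
   (rule eventually_mono[OF ev], intro allI impI, drule spec, drule spec, drule (1) mp, drule spec, drule (1) mp, erule conjunct2)
qed

lemma vector_field_matrix:
 assumes V: "opn V" and Z: "vector_field N V Z" and T: "!!p. p \<in> V ==> Z' p \<in> TS p"
  and G: "!!p U \<phi>. p \<in> V ==> (U, \<phi>) \<in> atlas N ==> p \<in> U ==>
   EX G. (ALL b<n. ALL c<n. smooth p (G b c)) \<and> eventually (%x. x \<in> V -->
    (ALL b<n. Z' x (%y. \<phi> y b) = (\<Sum>c<n. G b c x * Z x (%y. \<phi> y c)))) (near p)"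
 shows "vector_field N V Z'"
proof (rule vector_fieldI[OF V T])
 fix p assume p: "p \<in> V"
 have pN: "p \<in> points N" using openin_sub_points[OF V] p by blast
 obtain U \<phi> where U: "(U, \<phi>) \<in> atlas N" "p \<in> U" using ex_chart[OF pN] by blast
 obtain G where G: "ALL b<n. ALL c<n. smooth p (G b c)" and e: "eventually (%x. x \<in> V -->
   (ALL b<n. Z' x (%y. \<phi> y b) = (\<Sum>c<n. G b c x * Z x (%y. \<phi> y c)))) (near p)"
  using G[OF p U] by (elim exE conjE) (rule that)
 have "smooth p (%x. Z' x (%y. \<phi> y b))" if b: "b < n" for b
 proof (rule smooth_near_cong[where f = "%x. \<Sum>c<n. G b c x * Z x (%y. \<phi> y c)"])
  show "smooth p (%x. \<Sum>c<n. G b c x * Z x (%y. \<phi> y c))"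
  proof (rule smooth_near_sum[OF pN])
   fix c assume "c \<in> {..<n}"
   hence c: "c < n" by simp
   have "smooth p (G b c)" using G b c by blast
   from smooth_near_mult[OF this vector_field_smooth[OF Z p smooth_near_chart_coord[OF U c]]]
   show "smooth p (%x. G b c x * Z x (%y. \<phi> y c))" .
  qed
  show "eventually (%x. (\<Sum>c<n. G b c x * Z x (%y. \<phi> y c)) = Z' x (%y. \<phi> y b)) (near p)"
   using e eventually_in_open[OF V p] by eventually_elim (use b in simp)
 qed
 thus "EX V \<psi>. (V, \<psi>) \<in> atlas N \<and> p \<in> V \<and> (ALL i<n. smooth p (%x. Z' x (%y. \<psi> y i)))"
  using U by (intro exI conjI allI impI)
qed

lemma relation_vector_field:
 assumes V: "opn V" and R: "!!p. p \<in> V ==> RR p (X p) (Y p)"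
 shows "vector_field N V X \<longleftrightarrow> vector_field N V Y"
proof
 have T: "X p \<in> TS p" "Y p \<in> TS p" "p \<in> points N" if "p \<in> V" for p
  using R[OF that] points_tangent[OF R[OF that]] by (simp_all add: RR_def)
 show "vector_field N V Y" if "vector_field N V X"
 proof (rule vector_field_matrix[OF V that T(2)])
  fix p U \<phi> assume p: "p \<in> V" and U: "(U, \<phi>) \<in> atlas N" "p \<in> U"
  obtain G where "ALL b<n. ALL c<n. smooth p (G b c)" and "eventually (%x. ALL x' u. RR x x' u -->
    (ALL b<n. u (%y. \<phi> y b) = (\<Sum>c<n. G b c x * x' (%y. \<phi> y c)))) (near p)"
   using relation_matrices(2)[OF T(3)[OF p] U] by (elim exE conjE) (rule that)
  thus "EX G. (ALL b<n. ALL c<n. smooth p (G b c)) \<and> eventually (%x. x \<in> V -->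
    (ALL b<n. Y x (%y. \<phi> y b) = (\<Sum>c<n. G b c x * X x (%y. \<phi> y c)))) (near p)"
   by (intro exI[of _ G] conjI) (auto elim!: eventually_mono dest: R)
 qed
 show "vector_field N V X" if "vector_field N V Y"
 proof (rule vector_field_matrix[OF V that T(1)])
  fix p U \<phi> assume p: "p \<in> V" and U: "(U, \<phi>) \<in> atlas N" "p \<in> U"
  obtain G where "ALL b<n. ALL c<n. smooth p (G b c)" and "eventually (%x. ALL x' u. RR x x' u -->
    (ALL b<n. x' (%y. \<phi> y b) = (\<Sum>c<n. G b c x * u (%y. \<phi> y c)))) (near p)"
   using relation_matrices(1)[OF T(3)[OF p] U] by (elim exE conjE) (rule that)
  thus "EX G. (ALL b<n. ALL c<n. smooth p (G b c)) \<and> eventually (%x. x \<in> V -->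
    (ALL b<n. X x (%y. \<phi> y b) = (\<Sum>c<n. G b c x * Y x (%y. \<phi> y c)))) (near p)"
   by (intro exI[of _ G] conjI) (auto elim!: eventually_mono dest: R)
 qed
qed

end

section \<open>The canonical isomorphism and adapted frames\<close>

context web
begin

abbreviation "winf \<equiv> web_infinity N r w"

definition ell :: "'p => ('p, 'k) tvec => ('p, 'k) tvec"
 where "ell q u = (if EX x. RR q x u then THE x. RR q x u else 0)"

lemma ell_eq: assumes "RR q x u" shows "ell q u = x"
proof -
 have "(THE x. RR q x u) = x"
  using assms RR_facts(2)[OF points_tangent[OF assms] _ assms] by (intro the_equality) blast+
 thus ?thesis using assms by (auto simp: ell_def)
qed

lemma winf_iff: "q \<in> points N ==> u \<in> winf q \<longleftrightarrow> (EX x. RR q x u)"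
 by (simp add: web_infinity_eq)

lemma winfI: "RR q x u ==> u \<in> winf q"
 using winf_iff[OF points_tangent] by blast

lemma winf_ell: "q \<in> points N ==> u \<in> winf q ==> RR q (ell q u) u"
 using ell_eq by (auto simp: winf_iff)

lemma RR_w0: "RR q x u ==> x \<in> w 0 q"
 using RR_W[of q x u 0] by simp

lemma web_cotangent: "cotangent N r (w t)"
 by unfold_locales (rule web_distribution)

text \<open>\<open>ell\<close> maps w(\<infinity>) bijectively onto w(0), and smoothness passes
  between related fields, so fields related to a frame of w(0) frame w(\<infinity>).\<close>

lemma relation_frame:
 assumes X: "local_frame N r (w 0) V X"
  and Y: "ALL i<n - r. ALL p:V. RR p (X i p) (Y i p)"
 shows "local_frame N r winf V Y"
proof -
 interpret F: cotangent N r "w 0" by (rule web_cotangent)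
 have V: "opn V" by (rule F.local_frame_open[OF X])
 have "vector_field N V (Y i)" if i: "i < n - r" for i
  using relation_vector_field[OF V, of "X i" "Y i"] Y i F.local_frame_vf[OF X i] by blast
 moreover have "fv.span ((%i. Y i q) ` {..<n - r}) = winf q" if q: "q \<in> V" for q
 proof -
  have qN: "q \<in> points N" using F.local_frame_points[OF X q] .
  have R: "RR q (\<Sum>i<n - r. fscale (c i) (X i q)) (\<Sum>i<n - r. fscale (c i) (Y i q))" for c
   using Y q by (intro RR_sum[OF qN]) blast
  show ?thesis
   unfolding span_image_lessThan
  proof (intro equalityI subsetI)
   fix u assume "u \<in> range (%c. \<Sum>i<n - r. fscale (c i) (Y i q))"
   thus "u \<in> winf q" using R by (auto simp: winf_iff[OF qN])
  next
   fix u assume "u \<in> winf q"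
   then obtain x where x: "RR q x u" using winf_iff[OF qN] by blast
   then obtain c where c: "x = (\<Sum>i<n - r. fscale (c i) (X i q))"
    using F.local_frame_range[OF X q] RR_w0[OF x] by blast
   have "u = (\<Sum>i<n - r. fscale (c i) (Y i q))"
    by (rule RR_facts(1)[OF qN x]) (unfold c, rule R)
   thus "u \<in> range (%c. \<Sum>i<n - r. fscale (c i) (Y i q))" by (intro range_eqI)
  qed
 qed
 ultimately show ?thesis using V by (simp add: local_frame_def)
qed

lemma ex_related:
 assumes X: "local_frame N r (w 0) V X"
 shows "EX Y. ALL i<n - r. ALL p:V. RR p (X i p) (Y i p)"
proof -
 interpret F: cotangent N r "w 0" by (rule web_cotangent)
 define Y where "Y i p = (SOME u. RR p (X i p) u)" for i p
 have "RR p (X i p) (Y i p)" if "i < n - r" "p \<in> V" for i p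
 proof -
  have "EX u. RR p (X i p) u"
   using RR_facts(3)[OF F.local_frame_points[OF X that(2)]] F.local_frame_in[OF X that(2,1)] by blast
  thus ?thesis unfolding Y_def by (rule someI_ex)
 qed
 thus ?thesis by blast
qed

lemma infinity_distribution: "distribution N r winf"
 unfolding distribution_def
proof (intro conjI ballI)
 fix q assume q: "q \<in> points N"
 show "fv.subspace (winf q)"
  unfolding fv.subspace_def
 proof (intro conjI ballI allI)
  show "0 \<in> winf q" by (rule winfI[OF RR_zero[OF q]])
  show "u + v \<in> winf q" if "u \<in> winf q" "v \<in> winf q" for u v
   by (rule winfI[OF RR_add[OF q winf_ell[OF q that(1)] winf_ell[OF q that(2)]]])
  show "fscale c u \<in> winf q" if "u \<in> winf q" for u c
   by (rule winfI[OF RR_scale[OF q winf_ell[OF q that]]])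
 qed
 show "winf q \<subseteq> TS q" by (auto simp: winf_iff[OF q] RR_def)
 show "fv.dim (winf q) + r = n" unfolding web_infinity_eq[OF q] by (rule RR_facts(10)[OF q])
 interpret F: cotangent N r "w 0" by (rule web_cotangent)
 obtain U \<phi> V X where V: "q \<in> V" and X: "local_frame N r (w 0) V X"
  using F.ex_local_frame[OF q] by blast
 obtain Y where "ALL i<n - r. ALL p:V. RR p (X i p) (Y i p)" using ex_related[OF X] by blast
 from relation_frame[OF X this] V
 show "EX U X. q \<in> U \<and> (ALL i<n - r. vector_field N U (X i)) \<and> opn U \<and>
  (ALL x:U. fv.span ((%i. X i x) ` {..<n - r}) = winf x)"
  unfolding local_frame_def by blast
qed

text \<open>Uniqueness: w(t) is cut out by its annihilators, so the required identities force
  \<open>L q v + fscale t v\<close> into \<open>w t q\<close> for every \<open>t\<close>. Hence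
  \<open>L q v\<close> and \<open>v\<close> are related, and \<open>ell q v\<close> is the only such
  vector; outside the bundle both sides are 0 by convention.\<close>

lemma canonical_iso_eq: "canonical_iso N r w = (%q v. if q \<in> points N \<and> v \<in> winf q then ell q v else 0)"
 unfolding canonical_iso_def
proof (rule the_equality)
 let ?L = "%q v. if q \<in> points N \<and> v \<in> winf q then ell q v else 0"
 show "bundle_morphism_TN N winf ?L \<and> (ALL q:points N. ALL t. ALL \<alpha>:cotangent_space N q.
  (ALL v:w t q. \<alpha> v = 0) --> (ALL v:winf q. \<alpha> (?L q v) = - t * \<alpha> v))"
 proof (intro conjI ballI allI impI)
  show "bundle_morphism_TN N winf ?L"
   unfolding bundle_morphism_TN_def
  proof (intro conjI ballI allI impI)
   fix q assume q: "q \<in> points N"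
   have "ell q (u + v) = ell q u + ell q v \<and> u + v \<in> winf q" if "u \<in> winf q" "v \<in> winf q" for u v
    using ell_eq[OF RR_add[OF q winf_ell[OF q that(1)] winf_ell[OF q that(2)]]]
     winfI[OF RR_add[OF q winf_ell[OF q that(1)] winf_ell[OF q that(2)]]] by blast
   moreover have "ell q (fscale c u) = fscale c (ell q u) \<and> fscale c u \<in> winf q" if "u \<in> winf q" for u c
    using ell_eq[OF RR_scale[OF q winf_ell[OF q that]]] winfI[OF RR_scale[OF q winf_ell[OF q that]]]
     by blast
   ultimately show "linear_on (winf q) fscale (?L q)" using q by (simp add: linear_on_def)
   show "?L q ` winf q \<subseteq> TS q" using q winf_ell[OF q] by (auto simp: RR_def)
  next
   show "?L q v = 0" if "q \<notin> points N \<or> v \<notin> winf q" for q v using that by auto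
  next
   fix U X assume X: "vector_field N U X \<and> (ALL q:U. X q \<in> winf q)"
   note U = vector_field_open[OF conjunct1[OF X]]
   show "vector_field N U (%q. ?L q (X q))"
    using relation_vector_field[OF U, of "%q. ?L q (X q)" X] X openin_sub_points[OF U] winf_ell
    by (simp add: subset_iff)
  qed
 next
  fix q t \<alpha> v assume q: "q \<in> points N" and \<alpha>: "\<alpha> \<in> cotangent_space N q" "ALL v:w t q. \<alpha> v = 0"
   and v: "v \<in> winf q"
  note R = winf_ell[OF q v]
  have T: "ell q v \<in> TS q" "v \<in> TS q" using R by (auto simp: RR_def)
  have "0 = \<alpha> (ell q v + fscale t v)" using \<alpha>(2) RR_W[OF R] by simp
  also have "\<dots> = \<alpha> (ell q v) + t * \<alpha> v"
   using linear_on_add[OF dual_linear[OF \<alpha>(1)] T(1) tangent_scale[OF T(2)]]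
    linear_on_scale[OF dual_linear[OF \<alpha>(1)] T(2)] by simp
  finally show "\<alpha> (?L q v) = - t * \<alpha> v" using q v by (simp add: eq_neg_iff_add_eq_0)
 qed
next
 fix L assume L: "bundle_morphism_TN N winf L \<and> (ALL q:points N. ALL t. ALL \<alpha>:cotangent_space N q.
  (ALL v:w t q. \<alpha> v = 0) --> (ALL v:winf q. \<alpha> (L q v) = - t * \<alpha> v))"
 have "L q v = ell q v" if q: "q \<in> points N" and v: "v \<in> winf q" for q v
 proof -
  have T: "L q v \<in> TS q" "v \<in> TS q"
   using L q v winf_ell[OF q v] by (auto simp: bundle_morphism_TN_def RR_def)
  have "L q v + fscale t v \<in> w t q" for t
  proof (rule RR_facts(7)[OF q], intro tangent_add T tangent_scale, intro ballI impI)
   fix \<alpha> assume \<alpha>: "\<alpha> \<in> cotangent_space N q" "ALL v:w t q. \<alpha> v = 0"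
   hence "\<alpha> (L q v) = - t * \<alpha> v" using L q v by blast
   thus "\<alpha> (L q v + fscale t v) = 0"
    using linear_on_add[OF dual_linear[OF \<alpha>(1)] T(1) tangent_scale[OF T(2)]]
     linear_on_scale[OF dual_linear[OF \<alpha>(1)] T(2)] by simp
  qed
  hence "RR q (L q v) v" using T by (simp add: RR_def)
  thus ?thesis by (simp add: ell_eq)
 qed
 moreover have "L q v = 0" if "q \<notin> points N \<or> v \<notin> winf q" for q v
  using L that unfolding bundle_morphism_TN_def by blast
 ultimately show "L = (%q v. if q \<in> points N \<and> v \<in> winf q then ell q v else 0)"
  by (auto simp: fun_eq_iff)
qed

end

text \<open>Frames of w(0) and w(\<infinity>) over the same \<open>V\<close> and the same base
  chart, linked by X_i = ell(Y_i). They yield charts of both total spaces with the same image, and X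
  + tY frames w(t).\<close>

locale web_frame = cot_frame N r "w 0" U \<phi> V X + Web: web N r w
 for N :: "('p, 'k::ground_field) mfd" and r and w :: "'k => ('p, 'k) distrib" and U \<phi> V X +
 fixes Y
 assumes XY: "i < mdim N - r ==> q \<in> V ==> Web.RR q (X i q) (Y i q)"

sublocale web_frame \<subseteq> I: cot_frame N r "web_infinity N r w" U \<phi> V Y
proof unfold_locales
 show "distribution N r Web.winf" by (rule Web.infinity_distribution)
 show "local_frame N r Web.winf V Y" using XY by (intro Web.relation_frame[OF X]) blast
qed (rule U)+

section \<open>Brackets of the frames X + tY\<close>

context web_frame
begin

lemma V_points: "q \<in> V ==> q \<in> points N" by (rule local_frame_points[OF X])

lemma XY_sum: "q \<in> V ==> Web.RR q (\<Sum>i<k. fscale (a i) (X i q)) (\<Sum>i<k. fscale (a i) (Y i q))"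
 by (rule Web.RR_sum[OF V_points]) (simp_all add: XY)

lemma pencil_vector_field: "i < k ==> vector_field N V (%q. X i q + fscale t (Y i q))"
 using N.vector_field_lincomb[of V "{..<2::nat}" "%a. if a = 0 then X i else Y i" "%a q. if a = 0 then 1 else t"]
  local_frame_vf[OF X] I.local_frame_vf[OF I.X] local_frame_open[OF X] N.smooth_near_const[OF V_points]
 by (simp add: numeral_2_eq_2)

lemma pencil_sum:
 "(\<Sum>i<k. fscale (a i) (X i q + fscale t (Y i q)))
  = (\<Sum>i<k. fscale (a i) (X i q)) + fscale t (\<Sum>i<k. fscale (a i) (Y i q))"
 by (simp add: fv.scale_right_distrib fv.scale_sum_right sum.distrib mult.commute)

lemma pencil_range:
 assumes q: "q \<in> V"
 shows "range (%\<xi>. \<Sum>i<k. fscale (\<xi> i) (X i q + fscale t (Y i q))) = w t q"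
proof (intro equalityI subsetI)
 fix v assume "v \<in> range (%\<xi>. \<Sum>i<k. fscale (\<xi> i) (X i q + fscale t (Y i q)))"
 then obtain \<xi> where "v = (\<Sum>i<k. fscale (\<xi> i) (X i q)) + fscale t (\<Sum>i<k. fscale (\<xi> i) (Y i q))"
  unfolding pencil_sum by blast
 thus "v \<in> w t q" using Web.RR_W[OF XY_sum[OF q]] by simp
next
 fix v assume "v \<in> w t q"
 then obtain x u where R: "Web.RR q x u" and v: "v = x + fscale t u" using Web.RR_facts(5)[OF V_points[OF q]] by blast
 obtain \<xi> where x: "x = (\<Sum>i<k. fscale (\<xi> i) (X i q))"
  using local_frame_range[OF X q] Web.RR_w0[OF R] by blast
 have u: "u = (\<Sum>i<k. fscale (\<xi> i) (Y i q))"
  using Web.RR_facts(1)[OF V_points[OF q] R] XY_sum[OF q, of \<xi>] unfolding x by blast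
 have "v = (\<Sum>i<k. fscale (\<xi> i) (X i q + fscale t (Y i q)))"
  unfolding pencil_sum v x u by (rule refl)
 thus "v \<in> range (%\<xi>. \<Sum>i<k. fscale (\<xi> i) (X i q + fscale t (Y i q)))" by (intro range_eqI)
qed

lemma pencil_bracket:
 assumes q: "q \<in> V" and ij: "i < k" "j < k"
 shows "lie_bracket N (%q. X i q + fscale t (Y i q)) (%q. X j q + fscale t (Y j q)) q =
  lie_bracket N (X i) (X j) q + fscale t (lie_bracket N (X i) (Y j) q + lie_bracket N (Y i) (X j) q)
   + fscale (t * t) (lie_bracket N (Y i) (Y j) q)"
 by (rule N.lie_bracket_pencil[OF local_frame_vf[OF X ij(1)] local_frame_vf[OF X ij(2)]
  I.local_frame_vf[OF I.X ij(1)] I.local_frame_vf[OF I.X ij(2)] q])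

text \<open>The bracket of two members of the frame X + tY is a quadratic pencil, and involutivity
  of all w(t) puts it under \<open>quadratic_pencil\<close>. Since X = ell(Y), the outcome is the
  vanishing of the Nijenhuis torsion of \<open>ell\<close> on Y_i and Y_j.\<close>

lemma torsion:
 assumes q: "q \<in> V" and ij: "i < k" "j < k"
 shows "EX u. Web.RR q (lie_bracket N (X i) (X j) q) u \<and>
  Web.RR q (lie_bracket N (X i) (Y j) q + lie_bracket N (Y i) (X j) q - u) (lie_bracket N (Y i) (Y j) q)"
proof (rule Web.RR_facts(6)[OF V_points[OF q]])
 note vf = local_frame_vf[OF X ij(1)] local_frame_vf[OF X ij(2)]
  I.local_frame_vf[OF I.X ij(1)] I.local_frame_vf[OF I.X ij(2)]
 show "lie_bracket N (X i) (Y j) q + lie_bracket N (Y i) (X j) q \<in> N.TS q"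
  by (intro N.tangent_add N.lie_bracket_tangent[OF vf(1,4) q] N.lie_bracket_tangent[OF vf(3,2) q])
 show "lie_bracket N (Y i) (Y j) q \<in> N.TS q" by (rule N.lie_bracket_tangent[OF vf(3,4) q])
 show "ALL t. lie_bracket N (X i) (X j) q + fscale t (lie_bracket N (X i) (Y j) q + lie_bracket N (Y i) (X j) q)
   + fscale (t * t) (lie_bracket N (Y i) (Y j) q) \<in> w t q"
 proof
  fix t
  have "ALL p:V. X i p + fscale t (Y i p) \<in> w t p \<and> X j p + fscale t (Y j p) \<in> w t p"
   using Web.RR_W[OF XY] ij by blast
  hence "lie_bracket N (%q. X i q + fscale t (Y i q)) (%q. X j q + fscale t (Y j q)) q \<in> w t q"
   using Web.web_involutive[of t] pencil_vector_field ij q unfolding involutive_def by blast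
  thus "lie_bracket N (X i) (X j) q + fscale t (lie_bracket N (X i) (Y j) q + lie_bracket N (Y i) (X j) q)
   + fscale (t * t) (lie_bracket N (Y i) (Y j) q) \<in> w t q"
   unfolding pencil_bracket[OF q ij] .
 qed
qed

text \<open>Let A, B, C be the coefficients of 1, t and t^2 in the bracket. If A is the sum of c_l
  X_l and C that of c'_l Y_l, then \<open>torsion\<close> makes B the sum of c_l Y_l + c'_l X_l, and
  the pencil factors as the sum of (c_l + t c'_l)(X_l + t Y_l). That A and C have this form is part
  of the result of \<open>torsion\<close>, so the span of \<open>Y\<close> is closed under brackets
  too.\<close>

lemma ex_structure_functions:
 "EX c c'. frame_data X c \<and> frame_data Y c' \<and>
  (ALL t. frame_data (%i q. X i q + fscale t (Y i q)) (%i j l q. c i j l q + t * c' i j l q))"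
proof -
 have indX: "ALL q:V. ALL a. (\<Sum>i<k. fscale (a i) (X i q)) = 0 --> (ALL i<k. a i = 0)"
  using local_frame_independent[OF X] by blast
 have indY: "ALL q:V. ALL a. (\<Sum>i<k. fscale (a i) (Y i q)) = 0 --> (ALL i<k. a i = 0)"
  using I.local_frame_independent[OF I.X] by blast
 have vfX: "ALL i<k. vector_field N V (X i)" and vfY: "ALL i<k. vector_field N V (Y i)"
  using local_frame_vf[OF X] I.local_frame_vf[OF I.X] by blast+
 have brX: "ALL q:V. ALL i<k. ALL j<k. lie_bracket N (X i) (X j) q \<in> range (%\<xi>. \<Sum>l<k. fscale (\<xi> l) (X l q))"
  using torsion Web.RR_w0 local_frame_range[OF X] by blast
 obtain c where c: "frame_data X c" using ex_frame_data[OF vfX indX brX] by blast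
 have brY: "ALL q:V. ALL i<k. ALL j<k. lie_bracket N (Y i) (Y j) q \<in> range (%\<xi>. \<Sum>l<k. fscale (\<xi> l) (Y l q))"
  using torsion Web.winf_iff[OF V_points] I.local_frame_range[OF I.X] by blast
 obtain c' where c': "frame_data Y c'" using ex_frame_data[OF vfY indY brY] by blast
 have "frame_data (%i q. X i q + fscale t (Y i q)) (%i j l q. c i j l q + t * c' i j l q)" for t
  unfolding frame_data_def
 proof (intro conjI ballI allI impI)
  show "vector_field N V (%q. X i q + fscale t (Y i q))" if "i < k" for i by (rule pencil_vector_field[OF that])
 next
  fix q a i assume q: "q \<in> V" and z: "(\<Sum>i<k. fscale (a i) (X i q + fscale t (Y i q))) = 0" and i: "i < k"
  have "(\<Sum>i<k. fscale (a i) (X i q)) = 0"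
   by (rule Web.RR_facts(4)[OF V_points[OF q] XY_sum[OF q]]) (use z in \<open>unfold pencil_sum\<close>)
  thus "a i = 0" using indX q i by blast
 next
  fix q i j l assume q: "q \<in> V" and ijl: "i < k" "j < k" "l < k"
  from N.smooth_near_add[OF frame_data_smooth[OF c q ijl]
   N.smooth_near_mult[OF N.smooth_near_const[OF V_points[OF q]] frame_data_smooth[OF c' q ijl]]]
  show "N.smooth q (%x. c i j l x + t * c' i j l x)" .
 next
  fix q i j assume q: "q \<in> V" and ij: "i < k" "j < k"
  note A = frame_data_bracket[OF c q ij] and C = frame_data_bracket[OF c' q ij]
  let ?A = "\<Sum>l<k. fscale (c i j l q) (X l q)" and ?JA = "\<Sum>l<k. fscale (c i j l q) (Y l q)"
   and ?C = "\<Sum>l<k. fscale (c' i j l q) (Y l q)" and ?LC = "\<Sum>l<k. fscale (c' i j l q) (X l q)"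
  let ?B = "lie_bracket N (X i) (Y j) q + lie_bracket N (Y i) (X j) q"
  obtain u where u: "Web.RR q ?A u" "Web.RR q (?B - u) ?C"
   using torsion[OF q ij] unfolding A C by blast
  have "u = ?JA" by (rule Web.RR_facts(1)[OF V_points[OF q] u(1) XY_sum[OF q]])
  moreover have "?B - u = ?LC" by (rule Web.RR_facts(2)[OF V_points[OF q] u(2) XY_sum[OF q]])
  ultimately have B: "?B = ?LC + ?JA" by (metis diff_add_cancel)
  show "lie_bracket N (%q. X i q + fscale t (Y i q)) (%q. X j q + fscale t (Y j q)) q =
   (\<Sum>l<k. fscale (c i j l q + t * c' i j l q) (X l q + fscale t (Y l q)))"
   unfolding pencil_bracket[OF q ij] A B C
   by (simp add: fun_eq_iff sum_fun_apply sum_distrib_left sum.distrib ring_distribs mult_ac)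
 qed
 thus ?thesis using c c' by blast
qed

end

context web
begin

lemma ex_web_frame:
 assumes q: "q \<in> points N"
 shows "EX U \<phi> V X Y. web_frame N r w U \<phi> V X Y \<and> q \<in> V"
proof -
 interpret F: cotangent N r "w 0" by (rule web_cotangent)
 obtain U \<phi> V X where U: "(U, \<phi>) \<in> atlas N" "V \<subseteq> U" "q \<in> V" and X: "local_frame N r (w 0) V X"
  using F.ex_local_frame[OF q] by blast
 obtain Y where Y: "ALL i<n - r. ALL p:V. RR p (X i p) (Y i p)" using ex_related[OF X] by blast
 have "web_frame N r w U \<phi> V X Y"
 proof unfold_locales
  show "local_frame N r (w 0) V X" by (rule X)
  show "RR q (X i q) (Y i q)" if "i < n - r" "q \<in> V" for i q using Y that by blast
 qed (rule U)+
 thus ?thesis using U(3) by blast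
qed

end

section \<open>Kronecker pairs in normal form\<close>

text \<open>
 Interpolation at the points \<open>-b s\<close>: \<open>a s\<close> lists the coefficients of the Lagrange polynomial
 vanishing at the other points and with constant term 1.
\<close>

lemma lagrange_matrices:
 "EX (b :: nat => 'k::ground_field) a v. inj_on b {..<m} \<and> (ALL s<m. b s \<noteq> 0) \<and> (ALL s<m. a s 0 = 1) \<and>
  (ALL s<m. ALL t<m. (\<Sum>i<m. a s i * v i t) = (if s = t then 1 else 0)) \<and>
  (ALL i<m. ALL l<m. (\<Sum>s<m. v i s * a s l) = (if i = l then 1 else 0)) \<and>
  (ALL i. ALL s. v (Suc i) s = - b s * v i s)"
proof -
 define b where "b s = (of_nat (s + 1) :: 'k)" for s
 have b0: "b s \<noteq> 0" for s unfolding b_def of_nat_eq_0_iff by simp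
 have b_eq: "b s = b t \<longleftrightarrow> s = t" for s t unfolding b_def of_nat_eq_iff by simp
 define P where "P s = (\<Prod>t\<in>{..<m} - {s}. [:1, inverse (b t):])" for s
 define d where "d s = poly (P s) (- b s)" for s
 have Pt: "poly (P s) (- b t) = (if s = t then d s else 0)" if "t < m" for s t
 proof (cases "s = t")
  case False
  hence "t \<in> {..<m} - {s}" using that by simp
  thus ?thesis using False b0 unfolding P_def poly_prod by (auto simp: prod_zero_iff intro!: bexI[of _ t])
 qed (simp add: d_def)
 have d0: "d s \<noteq> 0" for s
  unfolding d_def P_def poly_prod using b0 b_eq by (auto simp: prod_zero_iff field_simps)
 have deg: "degree (P s) < m" if "s < m" for s
 proof -
  have "degree (P s) \<le> sum (degree \<circ> (%t. [:1, inverse (b t):])) ({..<m} - {s})"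
   unfolding P_def by (rule degree_prod_sum_le) simp
  also have "\<dots> \<le> (\<Sum>t\<in>{..<m} - {s}. 1)" by (rule sum_mono) simp
  also have "\<dots> < m" using that by simp
  finally show ?thesis .
 qed
 \<comment> \<open>Columns of a Vandermonde matrix divided by the values \<open>d s\<close>, which
   makes \<open>v\<close> inverse to the coefficient matrix of the \<open>P s\<close>:
   \<open>AV\<close> evaluates \<open>P s\<close> at the nodes, and \<open>VA\<close> expands the
   monomial of degree \<open>i\<close> in the \<open>P s\<close>.\<close>
 define v where "v i s = (- b s) ^ i / d s" for i s
 have AV: "(\<Sum>i<m. coeff (P s) i * v i t) = (if s = t then 1 else 0)" if "s < m" "t < m" for s t
 proof -
  have "(\<Sum>i<m. coeff (P s) i * v i t) = (\<Sum>i<m. coeff (P s) i * (- b t) ^ i) / d t"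
   by (simp add: v_def sum_divide_distrib)
  also have "(\<Sum>i<m. coeff (P s) i * (- b t) ^ i) = poly (P s) (- b t)"
   unfolding poly_altdef using deg[OF that(1)]
   by (intro sum.mono_neutral_right) (auto simp: coeff_eq_0)
  finally show ?thesis using Pt[OF that(2), of s] d0 by simp
 qed
 have VA: "(\<Sum>s<m. v i s * coeff (P s) l) = (if i = l then 1 else 0)" if i: "i < m" for i l
 proof -
  have "(\<Sum>s<m. smult (v i s) (P s)) = monom 1 i"
  proof (rule poly_eqI_degree)
   have c: "card ((%s. - b s) ` {..<m}) = m" by (subst card_image) (auto simp: inj_on_def b_eq)
   show "poly (\<Sum>s<m. smult (v i s) (P s)) x = poly (monom 1 i) x" if x: "x \<in> (%s. - b s) ` {..<m}" for x
   proof -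
    obtain t where t: "t < m" "x = - b t" using x by blast
    have "poly (\<Sum>s<m. smult (v i s) (P s)) x = (\<Sum>s<m. if s = t then v i t * d t else 0)"
     unfolding poly_sum t(2) by (intro sum.cong[OF refl]) (simp add: Pt[OF t(1)])
    thus ?thesis using t d0 by (simp add: poly_monom v_def)
   qed
   show "degree (\<Sum>s<m. smult (v i s) (P s)) < card ((%s. - b s) ` {..<m})"
    unfolding c using deg i by (intro degree_sum_less) (auto intro: le_less_trans[OF degree_smult_le])
   show "degree (monom (1::'k) i) < card ((%s. - b s) ` {..<m})" unfolding c using i by (simp add: degree_monom_eq)
  qed
  hence "coeff (\<Sum>s<m. smult (v i s) (P s)) l = coeff (monom 1 i) l" by simp
  thus ?thesis by (simp add: coeff_sum coeff_monom)
 qed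
 have P0: "coeff (P s) 0 = 1" for s
  unfolding poly_0_coeff_0[symmetric] P_def poly_prod by simp
 show ?thesis
 proof (rule exI[of _ b], rule exI[of _ "%s. coeff (P s)"], rule exI[of _ v], intro conjI allI impI)
  show "inj_on b {..<m}" by (simp add: inj_on_def b_eq)
  show "v (Suc i) s = - b s * v i s" for i s by (simp add: v_def)
 qed (rule b0 P0, rule P0, rule AV, assumption+, rule VA, assumption)
qed

lemma sum_lessThan_split: "(\<Sum>u<i + k. h u) = (\<Sum>u<i. h u) + (\<Sum>u<k. h (i + u :: nat) :: 'a::comm_monoid_add)"
 by (induction k) (simp_all add: add.assoc)

text \<open>
 Removes the terms in \<open>G\<close> alone from both bivectors at once: \<open>H\<close> is the shift of \<open>F\<close> along \<open>G\<close>.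
\<close>

lemma vertical_shift:
 fixes C C' :: "nat => nat => nat => nat => 'k::ground_field"
 assumes C: "!!i j h l. C i j h l = - C h l i j" and C': "!!i j h l. C' i j h l = - C' h l i j"
 shows "EX H. ALL i j h l. H (Suc i) j h l - H (Suc h) l i j = C i j h l \<and> H h l i j - H i j h l = C' i j h l"
proof -
 \<comment> \<open>Put s for the sum of the two level indices of \<open>H\<close>. Eliminating the
   transposed entries from the two equations gives a recursion along constant s: the step from level
   u to level Suc u adds \<open>A s j l u + A' s j l u\<close>. The recursion leaves the starting
   value free, and antisymmetry fixes it to minus one half of the total \<open>t\<close>.\<close>
 define A where "A s j l u = C u j (s - Suc u) l" for s j l u
 define A' where "A' s j l u = C' u j (s - u) l" for s j l u
 define t where "t s j l = (\<Sum>u<s. A s j l u) + (\<Sum>u<Suc s. A' s j l u)" for s j l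
 define H where "H i j h l = (\<Sum>u<i. A (i + h) j l u) + (\<Sum>u<i. A' (i + h) j l u) - t (i + h) j l / 2" for i j h l
 have a: "(\<Sum>u<h. A (i + h) l j u) = - (\<Sum>u<h. A (i + h) j l (i + u))" for i h j l
 proof -
  have "(\<Sum>u<h. A (i + h) l j u) = (\<Sum>u<h. - A (i + h) j l (i + (h - Suc u)))"
  proof (rule sum.cong[OF refl])
   fix u assume "u \<in> {..<h}"
   hence *: "i + (h - Suc u) = i + h - Suc u" "i + h - Suc (i + h - Suc u) = u" by auto
   show "A (i + h) l j u = - A (i + h) j l (i + (h - Suc u))" unfolding A_def * by (rule C)
  qed
  also have "\<dots> = - (\<Sum>u<h. A (i + h) j l (i + u))"
   unfolding sum_negf by (rule arg_cong[where f = uminus], rule sum.nat_diff_reindex)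
  finally show ?thesis .
 qed
 have a': "(\<Sum>u<h. A' (i + h) l j u) = - (\<Sum>u<h. A' (i + h) j l (Suc i + u))" for i h j l
 proof -
  have "(\<Sum>u<h. A' (i + h) l j u) = (\<Sum>u<h. - A' (i + h) j l (Suc i + (h - Suc u)))"
  proof (rule sum.cong[OF refl])
   fix u assume "u \<in> {..<h}"
   hence *: "Suc i + (h - Suc u) = i + h - u" "i + h - (i + h - u) = u" by auto
   show "A' (i + h) l j u = - A' (i + h) j l (Suc i + (h - Suc u))" unfolding A'_def * by (rule C')
  qed
  also have "\<dots> = - (\<Sum>u<h. A' (i + h) j l (Suc i + u))"
   unfolding sum_negf by (rule arg_cong[where f = uminus], rule sum.nat_diff_reindex)
  finally show ?thesis .
 qed
 have ts: "t s l j = - t s j l" for s j l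
 proof -
  have "(\<Sum>u<Suc s. A' s l j u) = (\<Sum>u<Suc s. - A' s j l (Suc s - Suc u))"
  proof (rule sum.cong[OF refl])
   fix u assume "u \<in> {..<Suc s}"
   hence *: "Suc s - Suc u = s - u" "s - (s - u) = u" by auto
   show "A' s l j u = - A' s j l (Suc s - Suc u)" unfolding A'_def * by (rule C')
  qed
  also have "\<dots> = - (\<Sum>u<Suc s. A' s j l u)"
   unfolding sum_negf by (rule arg_cong[where f = uminus], rule sum.nat_diff_reindex)
  finally show ?thesis using a[of 0 s l j] unfolding t_def by simp
 qed
 have half: "y' - y = c + d + a + b - t" if "y = - a - b + t / 2" "y' = c + d - t / 2" for y y' a b c d t :: 'k
  unfolding that by (simp add: field_simps)
 have "H (Suc i) j h l - H (Suc h) l i j = C i j h l \<and> H h l i j - H i j h l = C' i j h l" for i j h l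
 proof
  let ?s = "i + Suc h"
  have *: "(\<Sum>u<?s. A ?s j l u) = (\<Sum>u<i. A ?s j l u) + (\<Sum>u<Suc h. A ?s j l (i + u))"
   "(\<Sum>u<Suc ?s. A' ?s j l u) = (\<Sum>u<Suc i. A' ?s j l u) + (\<Sum>u<Suc h. A' ?s j l (Suc i + u))"
   using sum_lessThan_split[of "A ?s j l" i "Suc h"] sum_lessThan_split[of "A' ?s j l" "Suc i" "Suc h"] by simp_all
  have "H (Suc h) l i j = - (\<Sum>u<Suc h. A ?s j l (i + u)) - (\<Sum>u<Suc h. A' ?s j l (Suc i + u)) + t ?s j l / 2"
   unfolding H_def using a[where i = i and h = "Suc h" and l = l and j = j]
    a'[where i = i and h = "Suc h" and l = l and j = j] ts[of ?s l j] by (simp add: add.commute[of h])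
  moreover have "H (Suc i) j h l = (\<Sum>u<Suc i. A ?s j l u) + (\<Sum>u<Suc i. A' ?s j l u) - t ?s j l / 2"
   unfolding H_def by simp
  ultimately have "H (Suc i) j h l - H (Suc h) l i j = (\<Sum>u<Suc i. A ?s j l u) + (\<Sum>u<Suc i. A' ?s j l u)
    + (\<Sum>u<Suc h. A ?s j l (i + u)) + (\<Sum>u<Suc h. A' ?s j l (Suc i + u)) - t ?s j l"
   by (rule half)
  hence "H (Suc i) j h l - H (Suc h) l i j = A ?s j l i"
   unfolding t_def * by simp
  thus "H (Suc i) j h l - H (Suc h) l i j = C i j h l" by (simp add: A_def)
 next
  let ?s = "i + h"
  have *: "(\<Sum>u<?s. A ?s j l u) = (\<Sum>u<i. A ?s j l u) + (\<Sum>u<h. A ?s j l (i + u))"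
   "(\<Sum>u<Suc ?s. A' ?s j l u) = (\<Sum>u<i. A' ?s j l u) + A' ?s j l i + (\<Sum>u<h. A' ?s j l (Suc i + u))"
   using sum_lessThan_split[of "A ?s j l" i h] sum_lessThan_split[of "A' ?s j l" "Suc i" h] by simp_all
  have "H h l i j = - (\<Sum>u<h. A ?s j l (i + u)) - (\<Sum>u<h. A' ?s j l (Suc i + u)) + t ?s j l / 2"
   unfolding H_def using a[where i = i and h = h and l = l and j = j]
    a'[where i = i and h = h and l = l and j = j] ts[of ?s l j] by (simp add: add.commute[of h])
  from half[OF this H_def]
  have "H i j h l - H h l i j = - A' ?s j l i"
   unfolding t_def * by simp
  hence "H h l i j - H i j h l = A' ?s j l i" by (simp add: algebra_simps)
  thus "H h l i j - H i j h l = C' i j h l" by (simp add: A'_def)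
 qed
 thus ?thesis by blast
qed

definition ladder ::
  "nat => ('a => 'k) set => (nat => 'a => 'k) => (nat => 'a => 'k) => ('a, 'k::field) bivector"
 where "ladder l V f g \<alpha> \<beta> = (if \<alpha> \<in> dual V \<and> \<beta> \<in> dual V
  then \<Sum>i<l. \<alpha> (f i) * \<beta> (g i) - \<alpha> (g i) * \<beta> (f i) else 0)"

lemma ladder_bivector: "bivector_on V (ladder l V f g)"
 using fv.subspace_add[OF dual_subspace[of V]] fv.subspace_scale[OF dual_subspace[of V]]
 by (auto simp: bivector_on_def linear_on_def ladder_def ring_distribs sum.distrib sum_subtractf sum_distrib_left
   algebra_simps)

text \<open>The shift form of a Kronecker block of dimension \<open>2 * l + 1\<close>. Lagrange
  interpolation diagonalises both ladders at once, into sums of \<open>P s\<close> \<and>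
  \<open>G s\<close> with coefficients 1 and \<open>inverse (b s)\<close>. The \<open>Suc l\<close>
  vectors \<open>G s\<close> lie in a space of dimension \<open>l\<close>, and their single
  relation, that their sum is 0, is the line divided out in the definition of an elementary
  pair.\<close>

lemma kronecker_elementary_ladder:
 fixes f g :: "nat => 'a => 'k::ground_field"
 assumes V: "fv.subspace V" "!!i. i < Suc l ==> f i \<in> V" "!!i. i < l ==> g i \<in> V"
  and span: "!!v. v \<in> V ==> EX x z. v = (\<Sum>i<Suc l. fscale (x i) (f i)) + (\<Sum>i<l. fscale (z i) (g i))"
  and ind: "!!x z. (\<Sum>i<Suc l. fscale (x i) (f i)) + (\<Sum>i<l. fscale (z i) (g i)) = 0 ==>
   (ALL i<Suc l. x i = 0) \<and> (ALL i<l. z i = 0)"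
 shows "kronecker_elementary (Suc l) V (ladder l V (%i. f (Suc i)) g) (ladder l V (%i. - f i) g)"
proof -
 note [simp del] = sum.lessThan_Suc
 obtain b :: "nat => 'k" and a v where b: "inj_on b {..<Suc l}" "ALL s<Suc l. b s \<noteq> 0"
  and a0: "ALL s<Suc l. a s 0 = 1"
  and AV: "ALL s<Suc l. ALL t<Suc l. (\<Sum>i<Suc l. a s i * v i t) = (if s = t then 1 else 0)"
  and VA: "ALL i<Suc l. ALL j<Suc l. (\<Sum>s<Suc l. v i s * a s j) = (if i = j then 1 else 0)"
  and vS: "ALL i. ALL s. v (Suc i) s = - b s * v i s"
  using lagrange_matrices[of "Suc l"] by (elim exE conjE) (rule that)
 \<comment> \<open>\<open>P\<close> combines the \<open>f i\<close> by the Lagrange coefficients,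
   while \<open>G\<close> uses the inverse matrix without its row 0; the missing row is the source
   of the relation among the \<open>G s\<close>.\<close>
 define P where "P s = (\<Sum>i<Suc l. fscale (a s i) (f i))" for s
 define G where "G s = (\<Sum>i<l. fscale (v (Suc i) s) (g i))" for s
 define Q where "Q x = (\<Sum>s<Suc l. fscale (x (2 * s)) (P s) + fscale (x (2 * s + 1)) (G s))" for x
 have PV: "P s \<in> V" and GV: "G s \<in> V" for s
  unfolding P_def G_def using V by (auto intro!: fv.subspace_sum fv.subspace_scale)
 have lin: "linear_on (coord_space (2 * Suc l)) fscale Q"
  unfolding linear_on_def Q_def
  by (simp add: fun_eq_iff sum_fun_apply ring_distribs sum.distrib sum_distrib_left mult.assoc)
 have QV: "Q x \<in> V" for x
  unfolding Q_def using PV GV V(1) by (intro fv.subspace_sum fv.subspace_add fv.subspace_scale) auto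
 have QP: "Q (unit_vec (2 * s)) = P s" and QG: "Q (unit_vec (2 * s + 1)) = G s" if "s < Suc l" for s
 proof -
  have ne: "2 * s \<noteq> Suc (2 * t)" "Suc (2 * t) \<noteq> 2 * s" for s t :: nat by presburger+
  have "Q (unit_vec (2 * s)) = (\<Sum>t<Suc l. if t = s then P s else 0)"
   "Q (unit_vec (2 * s + 1)) = (\<Sum>t<Suc l. if t = s then G s else 0)"
   unfolding Q_def by (rule sum.cong[OF refl]; simp add: unit_vec_def ne)+
  thus "Q (unit_vec (2 * s)) = P s" "Q (unit_vec (2 * s + 1)) = G s" using that by simp_all
 qed
 have Q_expand: "Q x = (\<Sum>i<Suc l. fscale (\<Sum>s<Suc l. x (2 * s) * a s i) (f i))
   + (\<Sum>i<l. fscale (\<Sum>s<Suc l. x (2 * s + 1) * v (Suc i) s) (g i))" for x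
 proof -
  have "Q x = (\<Sum>s<Suc l. \<Sum>i<Suc l. fscale (x (2 * s) * a s i) (f i))
   + (\<Sum>s<Suc l. \<Sum>i<l. fscale (x (2 * s + 1) * v (Suc i) s) (g i))"
   unfolding Q_def sum.distrib P_def G_def fv.scale_sum_right by simp
  also have "\<dots> = (\<Sum>i<Suc l. \<Sum>s<Suc l. fscale (x (2 * s) * a s i) (f i))
   + (\<Sum>i<l. \<Sum>s<Suc l. fscale (x (2 * s + 1) * v (Suc i) s) (g i))"
   by (rule arg_cong2[where f = "(+)"]; rule sum.swap)
  finally show ?thesis unfolding fv.scale_sum_left .
 qed
 \<comment> \<open>Inverting \<open>a\<close> recovers the even entries. For the odd ones only row 0
   of \<open>v\<close> survives, and since \<open>a t 0 = 1\<close> its contribution is the same for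
   every \<open>t\<close>.\<close>
 have ker: "x (2 * t) = 0 \<and> x (2 * t + 1) = (\<Sum>s<Suc l. x (2 * s + 1) * v 0 s)" if x: "Q x = 0" and t: "t < Suc l" for x t
 proof -
  have z: "ALL i<Suc l. (\<Sum>s<Suc l. x (2 * s) * a s i) = 0" "ALL i<l. (\<Sum>s<Suc l. x (2 * s + 1) * v (Suc i) s) = 0"
   using ind[OF x[unfolded Q_expand]] by blast+
  have "(\<Sum>i<Suc l. (\<Sum>s<Suc l. x (2 * s) * a s i) * v i t) = (\<Sum>s<Suc l. x (2 * s) * (\<Sum>i<Suc l. a s i * v i t))"
   unfolding sum_distrib_left sum_distrib_right mult.assoc by (rule sum.swap)
  also have "\<dots> = (\<Sum>s<Suc l. if s = t then x (2 * s) else 0)"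
   using AV t by (intro sum.cong[OF refl]) simp
  also have "\<dots> = x (2 * t)" using t by (simp)
  finally have 1: "x (2 * t) = 0" using z by (simp)
  have "(\<Sum>i<Suc l. a t i * (\<Sum>s<Suc l. x (2 * s + 1) * v i s)) = (\<Sum>s<Suc l. (\<Sum>i<Suc l. a t i * v i s) * x (2 * s + 1))"
   unfolding sum_distrib_left sum_distrib_right mult.assoc mult.commute[of "x _"] by (rule sum.swap)
  also have "\<dots> = (\<Sum>s<Suc l. if s = t then x (2 * s + 1) else 0)"
   using AV t by (intro sum.cong[OF refl]) simp
  also have "\<dots> = x (2 * t + 1)" using t by (simp)
  finally have "x (2 * t + 1) = (\<Sum>i<Suc l. a t i * (\<Sum>s<Suc l. x (2 * s + 1) * v i s))" by simp
  also have "\<dots> = (\<Sum>s<Suc l. x (2 * s + 1) * v 0 s)"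
   unfolding sum.lessThan_Suc_shift[of _ l] using z(2) a0 t
   by (simp add: sum.lessThan_Suc_shift)
  finally show ?thesis using 1 by blast
 qed
 \<comment> \<open>Because \<open>a s 0 = 1\<close>, the sum is an off-diagonal entry of the product
   of \<open>v\<close> and \<open>a\<close>, which is the identity.\<close>
 have sumG: "(\<Sum>s<Suc l. v (Suc i) s) = 0" if "i < l" for i
 proof -
  have "(\<Sum>s<Suc l. v (Suc i) s) = (\<Sum>s<Suc l. v (Suc i) s * a s 0)" using a0 by simp
  thus ?thesis using VA that by simp
 qed
 let ?e = "\<Sum>s<Suc l. unit_vec (2 * s + 1) :: nat => 'k"
 have e: "?e i = (if odd i \<and> i < 2 * Suc l then 1 else 0)" for i
 proof (cases "odd i")
  case True
  then obtain t where t: "i = 2 * t + 1" by (rule oddE)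
  have "?e i = (\<Sum>s<Suc l. if s = t then 1 else 0)"
   unfolding sum_fun_apply t by (intro sum.cong[OF refl]) (auto simp: unit_vec_def)
  thus ?thesis using t by (simp)
 next
  case False
  hence "unit_vec (2 * s + 1) i = (0::'k)" for s by (auto simp: unit_vec_def)
  thus ?thesis using False unfolding sum_fun_apply by simp
 qed
 have kernel: "{x \<in> coord_space (2 * Suc l). Q x = 0} = fv.span {?e}"
 proof (intro equalityI subsetI)
  fix x assume x: "x \<in> {x \<in> coord_space (2 * Suc l). Q x = 0}"
  have "x i = (fscale (\<Sum>s<Suc l. x (2 * s + 1) * v 0 s) ?e) i" for i
  proof (cases "i < 2 * Suc l")
   case True
   hence t: "i div 2 < Suc l" by simp
   note k = ker[OF _ t, of x]
   show ?thesis
   proof (cases "odd i")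
    case True
    thus ?thesis using k x \<open>i < 2 * Suc l\<close> e[of i] by (simp)
   next
    case False
    thus ?thesis using k x e[of i] by (simp)
   qed
  next
   case False
   thus ?thesis using x e[of i] by (simp add: coord_space_def)
  qed
  hence "x = fscale (\<Sum>s<Suc l. x (2 * s + 1) * v 0 s) ?e" by (rule ext)
  thus "x \<in> fv.span {?e}" unfolding fv.span_singleton by (rule range_eqI)
 next
  fix x assume "x \<in> fv.span {?e}"
  then obtain c where c: "x = fscale c ?e" unfolding fv.span_singleton by blast
  have x: "x i = (if odd i \<and> i < 2 * Suc l then c else 0)" for i
   unfolding c fscale_apply e by simp
  have xo: "(\<Sum>s<Suc l. x (2 * s + 1) * h s) = (\<Sum>s<Suc l. c * h s)" for h
   by (rule sum.cong[OF refl]) (simp add: x)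
  have "Q x = (\<Sum>i<l. fscale (\<Sum>s<Suc l. c * v (Suc i) s) (g i))"
   unfolding Q_expand xo by (simp add: x)
  also have "\<dots> = 0" using sumG by (intro sum.neutral) (simp add: sum_distrib_left[symmetric])
  finally show "x \<in> {x \<in> coord_space (2 * Suc l). Q x = 0}" using x by (simp add: coord_space_def)
 qed
 have image: "Q ` coord_space (2 * Suc l) = V"
 proof (intro equalityI subsetI)
  fix u assume "u \<in> V"
  then obtain x z where u: "u = (\<Sum>i<Suc l. fscale (x i) (f i)) + (\<Sum>i<l. fscale (z i) (g i))" using span by blast
  define X where "X h = (if h < 2 * Suc l then if even h then (\<Sum>i<Suc l. x i * v i (h div 2))
   else (\<Sum>i<l. z i * a (h div 2) (Suc i)) else 0)" for h
  have "(\<Sum>s<Suc l. X (2 * s) * a s i) = x i" if i: "i < Suc l" for i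
  proof -
   have "(\<Sum>s<Suc l. X (2 * s) * a s i) = (\<Sum>s<Suc l. \<Sum>j<Suc l. x j * (v j s * a s i))"
    by (intro sum.cong[OF refl]) (simp add: X_def sum_distrib_right mult.assoc)
   also have "\<dots> = (\<Sum>j<Suc l. x j * (\<Sum>s<Suc l. v j s * a s i))"
    unfolding sum_distrib_left by (rule sum.swap)
   also have "\<dots> = (\<Sum>j<Suc l. if j = i then x j else 0)" using VA i by (intro sum.cong[OF refl]) simp
   finally show ?thesis using i by (simp)
  qed
  moreover have "(\<Sum>s<Suc l. X (2 * s + 1) * v (Suc i) s) = z i" if i: "i < l" for i
  proof -
   have "(\<Sum>s<Suc l. X (2 * s + 1) * v (Suc i) s) = (\<Sum>s<Suc l. \<Sum>j<l. z j * (v (Suc i) s * a s (Suc j)))"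
    by (intro sum.cong[OF refl]) (simp add: X_def sum_distrib_right mult.assoc mult.commute[of "v _ _"])
   also have "\<dots> = (\<Sum>j<l. z j * (\<Sum>s<Suc l. v (Suc i) s * a s (Suc j)))"
    unfolding sum_distrib_left by (rule sum.swap)
   also have "\<dots> = (\<Sum>j<l. if j = i then z j else 0)" using VA i by (intro sum.cong[OF refl]) simp
   finally show ?thesis using i by simp
  qed
  ultimately have "Q X = u" unfolding Q_expand u by (intro arg_cong2[where f = "(+)"] sum.cong[OF refl]; simp)
  moreover have "X \<in> coord_space (2 * Suc l)" by (simp add: coord_space_def X_def)
  ultimately show "u \<in> Q ` coord_space (2 * Suc l)" by blast
 qed (use QV in blast)
 \<comment> \<open>Used with weights 1 and \<open>inverse (b s)\<close>. By \<open>vS\<close> the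
   second weight lowers the row of \<open>v\<close> by one and changes the sign, which is the shift
   \<sigma> that distinguishes the two ladders.\<close>
 have key: "(\<Sum>s<Suc l. h s * (\<alpha> (P s) * \<beta> (G s))) = (\<Sum>i<l. c * (\<alpha> (f (\<sigma> i)) * \<beta> (g i)))"
  if d: "\<alpha> \<in> dual V" "\<beta> \<in> dual V" and \<sigma>: "!!i. i < l ==> \<sigma> i < Suc l"
   and h: "!!i j. i < l ==> j < Suc l ==> (\<Sum>s<Suc l. h s * v (Suc i) s * a s j) = (if \<sigma> i = j then c else 0)"
  for \<alpha> \<beta> h c \<sigma>
 proof -
  have "\<alpha> (P s) = (\<Sum>j<Suc l. a s j * \<alpha> (f j))" "\<beta> (G s) = (\<Sum>i<l. v (Suc i) s * \<beta> (g i))" for s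
   unfolding P_def G_def using V(2,3) d by (intro linear_on_sum[OF dual_linear V(1)]; simp)+
  hence "(\<Sum>s<Suc l. h s * (\<alpha> (P s) * \<beta> (G s)))
   = (\<Sum>s<Suc l. \<Sum>i<l. \<Sum>j<Suc l. h s * v (Suc i) s * a s j * (\<alpha> (f j) * \<beta> (g i)))"
   by (simp add: sum_product sum_distrib_left mult_ac sum.swap[of _ "{..<l}"])
  also have "\<dots> = (\<Sum>i<l. \<Sum>s<Suc l. \<Sum>j<Suc l. h s * v (Suc i) s * a s j * (\<alpha> (f j) * \<beta> (g i)))"
   by (rule sum.swap)
  also have "\<dots> = (\<Sum>i<l. \<Sum>j<Suc l. (\<Sum>s<Suc l. h s * v (Suc i) s * a s j) * (\<alpha> (f j) * \<beta> (g i)))"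
   unfolding sum_distrib_right by (rule sum.cong[OF refl], rule sum.swap)
  also have "\<dots> = (\<Sum>i<l. \<Sum>j<Suc l. if \<sigma> i = j then c * (\<alpha> (f j) * \<beta> (g i)) else 0)"
   by (intro sum.cong[OF refl]) (simp add: h)
  also have "\<dots> = (\<Sum>i<l. c * (\<alpha> (f (\<sigma> i)) * \<beta> (g i)))"
   by (intro sum.cong[OF refl]) (simp add: \<sigma>)
  finally show ?thesis .
 qed
 have B: "ladder l V (%i. f (Suc i)) g \<alpha> \<beta> = (\<Sum>s<Suc l. \<alpha> (P s) * \<beta> (G s) - \<alpha> (G s) * \<beta> (P s))"
  and B1: "ladder l V (%i. - f i) g \<alpha> \<beta> = (\<Sum>s<Suc l. inverse (b s) * (\<alpha> (P s) * \<beta> (G s) - \<alpha> (G s) * \<beta> (P s)))"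
  if d: "\<alpha> \<in> dual V" "\<beta> \<in> dual V" for \<alpha> \<beta>
 proof -
  have 1: "(\<Sum>s<Suc l. 1 * (\<alpha> (P s) * \<beta> (G s))) = (\<Sum>i<l. 1 * (\<alpha> (f (Suc i)) * \<beta> (g i)))"
   if "\<alpha> \<in> dual V" "\<beta> \<in> dual V" for \<alpha> \<beta>
   by (rule key[OF that]) (use VA in simp_all)
  show "ladder l V (%i. f (Suc i)) g \<alpha> \<beta> = (\<Sum>s<Suc l. \<alpha> (P s) * \<beta> (G s) - \<alpha> (G s) * \<beta> (P s))"
   using 1[OF d] 1[OF d(2,1)] d by (simp add: ladder_def sum_subtractf mult.commute[of "\<alpha> _"])
  have m: "\<gamma> (- f i) = - \<gamma> (f i)" if "\<gamma> \<in> dual V" "i < l" for \<gamma> i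
   using linear_on_scale[OF dual_linear[OF that(1)] V(2)[of i], of "-1"] that(2) by simp
  have "inverse (b s) * v (Suc i) s = - v i s" if "s < Suc l" for i s using b(2) vS that by simp
  hence "(\<Sum>s<Suc l. inverse (b s) * v (Suc i) s * a s j) = - (\<Sum>s<Suc l. v i s * a s j)" for i j
   unfolding sum_negf[symmetric] by (intro sum.cong[OF refl]) simp
  hence 2: "(\<Sum>s<Suc l. inverse (b s) * (\<alpha> (P s) * \<beta> (G s))) = (\<Sum>i<l. - 1 * (\<alpha> (f (id i)) * \<beta> (g i)))"
   if "\<alpha> \<in> dual V" "\<beta> \<in> dual V" for \<alpha> \<beta>
   by (intro key[OF that]) (use VA in simp_all)
  show "ladder l V (%i. - f i) g \<alpha> \<beta> = (\<Sum>s<Suc l. inverse (b s) * (\<alpha> (P s) * \<beta> (G s) - \<alpha> (G s) * \<beta> (P s)))"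
   using 2[OF d] 2[OF d(2,1)] d
   by (simp add: ladder_def m sum_subtractf sum_negf right_diff_distrib mult.commute[of "\<alpha> _"])
 qed
 show ?thesis
  unfolding kronecker_elementary_def
 proof (intro conjI exI[of _ b] exI[of _ Q] ballI)
  show "ladder l V (%i. f (Suc i)) g \<alpha> \<beta> = (\<Sum>j<Suc l.
      \<alpha> (Q (unit_vec (2 * j))) * \<beta> (Q (unit_vec (2 * j + 1)))
      - \<alpha> (Q (unit_vec (2 * j + 1))) * \<beta> (Q (unit_vec (2 * j))))"
   "ladder l V (%i. - f i) g \<alpha> \<beta> = (\<Sum>j<Suc l. inverse (b j) *
      (\<alpha> (Q (unit_vec (2 * j))) * \<beta> (Q (unit_vec (2 * j + 1)))
      - \<alpha> (Q (unit_vec (2 * j + 1))) * \<beta> (Q (unit_vec (2 * j)))))"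
   if "\<alpha> \<in> dual V" "\<beta> \<in> dual V" for \<alpha> \<beta>
   unfolding B[OF that] B1[OF that] by (intro sum.cong[OF refl], simp only: QP QG lessThan_iff)+
 qed (use b lin image kernel in \<open>auto simp: ladder_bivector\<close>)
qed

definition block :: "nat => (nat => 'a => 'k) => (nat => 'a => 'k) => (nat => 'k) => (nat => 'k) => 'a => 'k::field"
 where "block l f g x z = (\<Sum>i<Suc l. fscale (x i) (f i)) + (\<Sum>i<l. fscale (z i) (g i))"

lemma block_diff: "block l f g x z - block l f g x' z' = block l f g (%i. x i - x' i) (%i. z i - z' i)"
 by (simp add: block_def fv.scale_left_diff_distrib sum_subtractf algebra_simps)

text \<open>Joint independence of all blocks makes the sum of the spans \<open>V j\<close> direct:
  two decompositions of a vector differ by a vanishing combination of blocks, to which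
  \<open>ind\<close> applies.\<close>

lemma kronecker_product_ladder:
 fixes F G :: "nat => nat => 'a => 'k::ground_field"
 assumes T: "fv.subspace T" "!!i j. j < r ==> i < Suc (l j) ==> F j i \<in> T" "!!i j. j < r ==> i < l j ==> G j i \<in> T"
  and span: "!!v. v \<in> T ==> EX x z. v = (\<Sum>j<r. block (l j) (F j) (G j) (x j) (z j))"
  and ind: "!!x z. (\<Sum>j<r. block (l j) (F j) (G j) (x j) (z j)) = 0 ==>
   ALL j<r. (ALL i<Suc (l j). x j i = 0) \<and> (ALL i<l j. z j i = 0)"
  and B: "!!\<alpha> \<beta>. \<alpha> \<in> dual T ==> \<beta> \<in> dual T ==>
   B \<alpha> \<beta> = (\<Sum>j<r. \<Sum>i<l j. \<alpha> (F j (Suc i)) * \<beta> (G j i) - \<alpha> (G j i) * \<beta> (F j (Suc i)))"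
  and B1: "!!\<alpha> \<beta>. \<alpha> \<in> dual T ==> \<beta> \<in> dual T ==>
   B1 \<alpha> \<beta> = (\<Sum>j<r. \<Sum>i<l j. \<alpha> (- F j i) * \<beta> (G j i) - \<alpha> (G j i) * \<beta> (- F j i))"
 shows "kronecker_product r T B B1"
proof -
 define V where "V j = fv.span (F j ` {..<Suc (l j)} \<union> G j ` {..<l j})" for j
 have V: "u \<in> V j \<longleftrightarrow> (EX x z. u = block (l j) (F j) (G j) x z)" for u j
  unfolding V_def fv.span_Un span_image_lessThan block_def by auto
 have VT: "V j \<subseteq> T" if j: "j < r" for j
  unfolding V_def using T(2,3)[OF j] by (intro fv.span_minimal[OF _ T(1)]) (auto simp del: sum.lessThan_Suc)
 have Vsub: "fv.subspace (V j)" for j unfolding V_def by (rule fv.subspace_span)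
 have FV: "F j i \<in> V j" if i: "i < Suc (l j)" for i j unfolding V_def using i by (intro fv.span_base) auto
 have GV: "G j i \<in> V j" if i: "i < l j" for i j unfolding V_def using i by (intro fv.span_base) auto
 have elem: "kronecker_elementary (Suc (l j)) (V j) (ladder (l j) (V j) (%i. F j (Suc i)) (G j))
   (ladder (l j) (V j) (%i. - F j i) (G j))" if j: "j < r" for j
 proof (rule kronecker_elementary_ladder[OF Vsub FV GV], assumption, assumption)
  show "EX x z. v = (\<Sum>i<Suc (l j). fscale (x i) (F j i)) + (\<Sum>i<l j. fscale (z i) (G j i))" if "v \<in> V j" for v
   using that unfolding V block_def .
  fix x z assume z: "(\<Sum>i<Suc (l j). fscale (x i) (F j i)) + (\<Sum>i<l j. fscale (z i) (G j i)) = 0"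
  have "block (l h) (F h) (G h) (%i. if h = j then x i else 0) (%i. if h = j then z i else 0) = 0" for h
   using z by (cases "h = j") (simp_all add: block_def)
  hence "(\<Sum>h<r. block (l h) (F h) (G h) ((%h i. if h = j then x i else 0) h) ((%h i. if h = j then z i else 0) h)) = 0"
   by simp
  from ind[OF this] have "ALL h<r. (ALL i<Suc (l h). (if h = j then x i else 0) = 0) \<and> (ALL i<l h. (if h = j then z i else 0) = 0)" .
  from mp[OF spec[OF this, of j] j] show "(ALL i<Suc (l j). x i = 0) \<and> (ALL i<l j. z i = 0)"
   unfolding simp_thms if_True .
 qed
 have uniq: "EX!x. (ALL j<r. x j \<in> V j) \<and> (ALL j>=r. x j = 0) \<and> v = (\<Sum>j<r. x j)" if v: "v \<in> T" for v
 proof -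
  obtain x z where xz: "v = (\<Sum>j<r. block (l j) (F j) (G j) (x j) (z j))" using span[OF v] by blast
  define X where "X j = (if j < r then block (l j) (F j) (G j) (x j) (z j) else 0)" for j
  show ?thesis
  proof (rule ex1I[of _ X])
   show "(ALL j<r. X j \<in> V j) \<and> (ALL j>=r. X j = 0) \<and> v = (\<Sum>j<r. X j)"
    unfolding xz X_def V by auto
   fix Y assume Y: "(ALL j<r. Y j \<in> V j) \<and> (ALL j>=r. Y j = 0) \<and> v = (\<Sum>j<r. Y j)"
   have "ALL j. EX x' z'. j < r --> Y j = block (l j) (F j) (G j) x' z'" using Y unfolding V by blast
   then obtain x' z' where Y': "ALL j. j < r --> Y j = block (l j) (F j) (G j) (x' j) (z' j)" by metis
   have "(\<Sum>j<r. block (l j) (F j) (G j) (%i. x' j i - x j i) (%i. z' j i - z j i)) = (\<Sum>j<r. Y j) - v"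
    unfolding xz sum_subtractf[symmetric] block_diff[symmetric] using Y' by (intro sum.cong[OF refl]) simp
   also have "\<dots> = 0" using Y by simp
   finally have "ALL j<r. (ALL i<Suc (l j). x' j i - x j i = 0) \<and> (ALL i<l j. z' j i - z j i = 0)" by (rule ind)
   hence "block (l j) (F j) (G j) (x' j) (z' j) = block (l j) (F j) (G j) (x j) (z j)" if "j < r" for j
    using that by (simp add: block_def del: sum.lessThan_Suc)
   thus "Y = X" using Y Y' by (auto simp: X_def fun_eq_iff not_less)
  qed
 qed
 have restr: "restr (V j) \<alpha> \<in> dual (V j)" if "\<alpha> \<in> dual T" "j < r" for \<alpha> j
  using dual_linear[OF that(1)] subsetD[OF VT[OF that(2)]]
  by (intro dual_restr[OF _ Vsub]) (simp add: linear_on_def)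
 have neg: "- u \<in> V j" if "u \<in> V j" for u j using fv.subspace_neg[OF Vsub that] .
 show ?thesis
  unfolding kronecker_product_def
 proof (rule exI[of _ "%j. Suc (l j)"], rule exI[of _ V],
   rule exI[of _ "%j. ladder (l j) (V j) (%i. F j (Suc i)) (G j)"],
   rule exI[of _ "%j. ladder (l j) (V j) (%i. - F j i) (G j)"], intro conjI)
  show "ALL j<r. fv.subspace (V j) \<and> V j \<subseteq> T \<and> kronecker_elementary (Suc (l j)) (V j)
   (ladder (l j) (V j) (%i. F j (Suc i)) (G j)) (ladder (l j) (V j) (%i. - F j i) (G j))"
   by (intro allI impI conjI Vsub VT elem)
  show "ALL v:T. EX!x. (ALL j<r. x j \<in> V j) \<and> (ALL j>=r. x j = 0) \<and> v = (\<Sum>j<r. x j)" by (intro ballI uniq)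
  show "ALL \<alpha>:dual T. ALL \<beta>:dual T.
   B \<alpha> \<beta> = (\<Sum>j<r. ladder (l j) (V j) (%i. F j (Suc i)) (G j) (restr (V j) \<alpha>) (restr (V j) \<beta>)) \<and>
   B1 \<alpha> \<beta> = (\<Sum>j<r. ladder (l j) (V j) (%i. - F j i) (G j) (restr (V j) \<alpha>) (restr (V j) \<beta>))"
   using restr FV GV neg by (auto simp: B B1 ladder_def restr_def intro!: sum.cong)
 qed
qed

lemma sum_swap_pairs:
 fixes l :: "nat => nat"
 shows "(\<Sum>j<r. \<Sum>i<l j. \<Sum>s<r. \<Sum>h<l s. g j i s h :: 'b::comm_monoid_add)
  = (\<Sum>j<r. \<Sum>i<l j. \<Sum>s<r. \<Sum>h<l s. g s h j i)"
proof -
 have *: "(\<Sum>j<r. \<Sum>i<l j. k j i) = (\<Sum>x\<in>(SIGMA j:{..<r}. {..<l j}). k (fst x) (snd x))" for k :: "nat => nat => 'b"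
  by (simp add: sum.Sigma split_def)
 show ?thesis unfolding * by (rule sum.swap)
qed

text \<open>Adding to each \<open>F j i\<close> a combination \<open>E j i\<close> of the
  \<open>G s h\<close> changes both ladder sums only by terms quadratic in the \<open>G\<close>, and
  \<open>vertical_shift\<close> provides coefficients that remove the given quadratic terms from
  both. The change of basis is triangular, so spanning and independence persist.\<close>

lemma kronecker_product_shifted:
 fixes F G :: "nat => nat => 'a => 'k::ground_field"
 assumes T: "fv.subspace T" "!!i j. j < r ==> i < Suc (l j) ==> F j i \<in> T" "!!i j. j < r ==> i < l j ==> G j i \<in> T"
  and span: "!!v. v \<in> T ==> EX x z. v = (\<Sum>j<r. block (l j) (F j) (G j) (x j) (z j))"
  and ind: "!!x z. (\<Sum>j<r. block (l j) (F j) (G j) (x j) (z j)) = 0 ==>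
   ALL j<r. (ALL i<Suc (l j). x j i = 0) \<and> (ALL i<l j. z j i = 0)"
  and C: "!!i j h s. C i j h s = - C h s i j" and C': "!!i j h s. C' i j h s = - C' h s i j"
  and B: "!!\<alpha> \<beta>. \<alpha> \<in> dual T ==> \<beta> \<in> dual T ==>
   B \<alpha> \<beta> = (\<Sum>j<r. \<Sum>i<l j. \<alpha> (F j (Suc i)) * \<beta> (G j i) - \<alpha> (G j i) * \<beta> (F j (Suc i)))
    - (\<Sum>j<r. \<Sum>i<l j. \<Sum>s<r. \<Sum>h<l s. C i j h s * \<alpha> (G j i) * \<beta> (G s h))"
  and B1: "!!\<alpha> \<beta>. \<alpha> \<in> dual T ==> \<beta> \<in> dual T ==>
   B1 \<alpha> \<beta> = - (\<Sum>j<r. \<Sum>i<l j. \<alpha> (F j i) * \<beta> (G j i) - \<alpha> (G j i) * \<beta> (F j i))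
    - (\<Sum>j<r. \<Sum>i<l j. \<Sum>s<r. \<Sum>h<l s. C' i j h s * \<alpha> (G j i) * \<beta> (G s h))"
 shows "kronecker_product r T B B1"
proof -
 obtain H where H: "ALL i j h s. H (Suc i) j h s - H (Suc h) s i j = C i j h s \<and> H h s i j - H i j h s = C' i j h s"
  using vertical_shift[of C C', OF C C'] by (elim exE) (rule that)
 define E where "E j i = (\<Sum>s<r. \<Sum>h<l s. fscale (H i j h s) (G s h))" for j i
 have ET: "E j i \<in> T" for j i
  unfolding E_def using T(3) by (intro fv.subspace_sum[OF T(1)] fv.subspace_scale[OF T(1)]) auto
 have \<gamma>E: "\<gamma> (E j i) = (\<Sum>s<r. \<Sum>h<l s. H i j h s * \<gamma> (G s h))" if "\<gamma> \<in> dual T" for \<gamma> j i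
 proof -
  have "\<gamma> (\<Sum>s<r. fscale 1 (\<Sum>h<l s. fscale (H i j h s) (G s h)))
   = (\<Sum>s<r. 1 * \<gamma> (\<Sum>h<l s. fscale (H i j h s) (G s h)))"
   using T(3) by (intro linear_on_sum[OF dual_linear[OF that] T(1)] fv.subspace_sum[OF T(1)] fv.subspace_scale[OF T(1)]) auto
  also have "\<dots> = (\<Sum>s<r. \<Sum>h<l s. H i j h s * \<gamma> (G s h))"
   using T(3) by (intro sum.cong refl) (simp, intro linear_on_sum[OF dual_linear[OF that] T(1)], auto)
  finally show ?thesis by (simp add: E_def)
 qed
 have \<gamma>F: "\<gamma> (F j i + E j i) = \<gamma> (F j i) + \<gamma> (E j i)" if "\<gamma> \<in> dual T" "j < r" "i < Suc (l j)" for \<gamma> j i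
  by (rule linear_on_add[OF dual_linear[OF that(1)] T(2)[OF that(2,3)] ET])
 have shift: "(\<Sum>j<r. block (l j) (%i. F j i + E j i) (G j) (x j) (z j))
   = (\<Sum>s<r. block (l s) (F s) (G s) (x s) (%h. (\<Sum>j<r. \<Sum>i<Suc (l j). x j i * H i j h s) + z s h))" for x z
 proof -
  have "(\<Sum>j<r. \<Sum>i<Suc (l j). fscale (x j i) (E j i))
   = (\<Sum>j<r. \<Sum>i<Suc (l j). \<Sum>s<r. \<Sum>h<l s. fscale (x j i * H i j h s) (G s h))"
   by (simp add: E_def fv.scale_sum_right del: sum.lessThan_Suc)
  also have "\<dots> = (\<Sum>j<r. \<Sum>s<r. \<Sum>i<Suc (l j). \<Sum>h<l s. fscale (x j i * H i j h s) (G s h))"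
   by (rule sum.cong[OF refl], rule sum.swap)
  also have "\<dots> = (\<Sum>s<r. \<Sum>j<r. \<Sum>i<Suc (l j). \<Sum>h<l s. fscale (x j i * H i j h s) (G s h))"
   by (rule sum.swap)
  also have "\<dots> = (\<Sum>s<r. \<Sum>j<r. \<Sum>h<l s. \<Sum>i<Suc (l j). fscale (x j i * H i j h s) (G s h))"
   by (rule sum.cong[OF refl], rule sum.cong[OF refl], rule sum.swap)
  also have "\<dots> = (\<Sum>s<r. \<Sum>h<l s. \<Sum>j<r. \<Sum>i<Suc (l j). fscale (x j i * H i j h s) (G s h))"
   by (rule sum.cong[OF refl], rule sum.swap)
  finally have e: "(\<Sum>j<r. \<Sum>i<Suc (l j). fscale (x j i) (E j i))
   = (\<Sum>s<r. \<Sum>h<l s. fscale (\<Sum>j<r. \<Sum>i<Suc (l j). x j i * H i j h s) (G s h))"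
   unfolding fv.scale_sum_left .
  show ?thesis
   unfolding block_def fv.scale_right_distrib fv.scale_left_distrib sum.distrib e by (simp only: add_ac)
 qed
 have quad: "(\<Sum>j<r. \<Sum>i<l j. \<alpha> (E j (\<sigma> i)) * \<beta> (G j i) - \<alpha> (G j i) * \<beta> (E j (\<sigma> i)))
   = - (\<Sum>j<r. \<Sum>i<l j. \<Sum>s<r. \<Sum>h<l s. (H (\<sigma> i) j h s - H (\<sigma> h) s i j) * \<alpha> (G j i) * \<beta> (G s h))"
  if d: "\<alpha> \<in> dual T" "\<beta> \<in> dual T" for \<alpha> \<beta> \<sigma>
 proof -
  have "(\<Sum>j<r. \<Sum>i<l j. \<alpha> (E j (\<sigma> i)) * \<beta> (G j i))
   = (\<Sum>j<r. \<Sum>i<l j. \<Sum>s<r. \<Sum>h<l s. H (\<sigma> i) j h s * \<alpha> (G s h) * \<beta> (G j i))"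
   by (simp add: \<gamma>E[OF d(1)] sum_distrib_right)
  also have "\<dots> = (\<Sum>j<r. \<Sum>i<l j. \<Sum>s<r. \<Sum>h<l s. H (\<sigma> h) s i j * \<alpha> (G j i) * \<beta> (G s h))"
   by (rule sum_swap_pairs)
  finally have 1: "(\<Sum>j<r. \<Sum>i<l j. \<alpha> (E j (\<sigma> i)) * \<beta> (G j i))
   = (\<Sum>j<r. \<Sum>i<l j. \<Sum>s<r. \<Sum>h<l s. H (\<sigma> h) s i j * \<alpha> (G j i) * \<beta> (G s h))" .
  have 2: "(\<Sum>j<r. \<Sum>i<l j. \<alpha> (G j i) * \<beta> (E j (\<sigma> i)))
   = (\<Sum>j<r. \<Sum>i<l j. \<Sum>s<r. \<Sum>h<l s. H (\<sigma> i) j h s * \<alpha> (G j i) * \<beta> (G s h))"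
   by (simp add: \<gamma>E[OF d(2)] sum_distrib_left mult_ac)
  show ?thesis
   unfolding sum_subtractf 1 2 left_diff_distrib by simp
 qed
 show ?thesis
 proof (rule kronecker_product_ladder[where F = "%j i. F j i + E j i" and G = G and l = l])
  show "F j i + E j i \<in> T" if "j < r" "i < Suc (l j)" for i j
   by (rule fv.subspace_add[OF T(1) T(2)[OF that] ET])
  show "EX x z. v = (\<Sum>j<r. block (l j) (%i. F j i + E j i) (G j) (x j) (z j))" if v: "v \<in> T" for v
  proof -
   obtain x z where "v = (\<Sum>j<r. block (l j) (F j) (G j) (x j) (z j))" using span[OF v] by blast
   hence "v = (\<Sum>j<r. block (l j) (%i. F j i + E j i) (G j) (x j)
     ((%s h. z s h - (\<Sum>j<r. \<Sum>i<Suc (l j). x j i * H i j h s)) j))"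
    unfolding shift by simp
   thus ?thesis
    by - (rule exI[of _ x], rule exI[of _ "%s h. z s h - (\<Sum>j<r. \<Sum>i<Suc (l j). x j i * H i j h s)"])
  qed
  show "ALL j<r. (ALL i<Suc (l j). x j i = 0) \<and> (ALL i<l j. z j i = 0)"
   if z: "(\<Sum>j<r. block (l j) (%i. F j i + E j i) (G j) (x j) (z j)) = 0" for x z
  proof -
   have *: "ALL j<r. (ALL i<Suc (l j). x j i = 0) \<and> (ALL h<l j. (\<Sum>s<r. \<Sum>i<Suc (l s). x s i * H i s h j) + z j h = 0)"
    by (rule ind[where z = "%s h. (\<Sum>j<r. \<Sum>i<Suc (l j). x j i * H i j h s) + z s h", OF z[unfolded shift]])
   hence z0: "(\<Sum>s<r. \<Sum>i<Suc (l s). x s i * H i s h j) = 0" for h j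
    by (intro sum.neutral ballI) auto
   show ?thesis using * unfolding z0 by simp
  qed
  fix \<alpha> \<beta> assume d: "\<alpha> \<in> dual T" "\<beta> \<in> dual T"
  show "B \<alpha> \<beta> = (\<Sum>j<r. \<Sum>i<l j. \<alpha> (F j (Suc i) + E j (Suc i)) * \<beta> (G j i) - \<alpha> (G j i) * \<beta> (F j (Suc i) + E j (Suc i)))"
  proof -
   have "(\<Sum>j<r. \<Sum>i<l j. \<alpha> (F j (Suc i) + E j (Suc i)) * \<beta> (G j i) - \<alpha> (G j i) * \<beta> (F j (Suc i) + E j (Suc i)))
    = (\<Sum>j<r. \<Sum>i<l j. (\<alpha> (F j (Suc i)) * \<beta> (G j i) - \<alpha> (G j i) * \<beta> (F j (Suc i)))
     + (\<alpha> (E j (Suc i)) * \<beta> (G j i) - \<alpha> (G j i) * \<beta> (E j (Suc i))))"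
   proof (intro sum.cong[OF refl])
    fix j i assume "j \<in> {..<r}" "i \<in> {..<l j}"
    hence i: "j < r" "Suc i < Suc (l j)" by auto
    show "\<alpha> (F j (Suc i) + E j (Suc i)) * \<beta> (G j i) - \<alpha> (G j i) * \<beta> (F j (Suc i) + E j (Suc i)) =
     (\<alpha> (F j (Suc i)) * \<beta> (G j i) - \<alpha> (G j i) * \<beta> (F j (Suc i)))
     + (\<alpha> (E j (Suc i)) * \<beta> (G j i) - \<alpha> (G j i) * \<beta> (E j (Suc i)))"
     unfolding \<gamma>F[OF d(1) i] \<gamma>F[OF d(2) i] by (simp add: algebra_simps)
   qed
   also have "\<dots> = B \<alpha> \<beta>"
    unfolding sum.distrib quad[OF d] B[OF d] using H by simp
   finally show ?thesis by simp
  qed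
  have neg: "\<gamma> (- (F j i + E j i)) = - (\<gamma> (F j i) + \<gamma> (E j i))" if "\<gamma> \<in> dual T" "j < r" "i < Suc (l j)" for \<gamma> j i
   using linear_on_scale[OF dual_linear[OF that(1)] fv.subspace_add[OF T(1) T(2)[OF that(2,3)] ET], of "-1"]
    \<gamma>F[OF that] by simp
  show "B1 \<alpha> \<beta> = (\<Sum>j<r. \<Sum>i<l j. \<alpha> (- (F j i + E j i)) * \<beta> (G j i) - \<alpha> (G j i) * \<beta> (- (F j i + E j i)))"
  proof -
   have "(\<Sum>j<r. \<Sum>i<l j. \<alpha> (- (F j i + E j i)) * \<beta> (G j i) - \<alpha> (G j i) * \<beta> (- (F j i + E j i)))
    = (\<Sum>j<r. \<Sum>i<l j. - ((\<alpha> (F j i) * \<beta> (G j i) - \<alpha> (G j i) * \<beta> (F j i))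
     + (\<alpha> (E j (id i)) * \<beta> (G j i) - \<alpha> (G j i) * \<beta> (E j (id i)))))"
   proof (intro sum.cong[OF refl])
    fix j i assume "j \<in> {..<r}" "i \<in> {..<l j}"
    hence i: "j < r" "i < Suc (l j)" by auto
    show "\<alpha> (- (F j i + E j i)) * \<beta> (G j i) - \<alpha> (G j i) * \<beta> (- (F j i + E j i)) =
     - ((\<alpha> (F j i) * \<beta> (G j i) - \<alpha> (G j i) * \<beta> (F j i))
     + (\<alpha> (E j (id i)) * \<beta> (G j i) - \<alpha> (G j i) * \<beta> (E j (id i))))"
     unfolding neg[OF d(1) i] neg[OF d(2) i] by (simp add: algebra_simps)
   qed
   also have "\<dots> = B1 \<alpha> \<beta>"
   proof -
    have "H (id i) j h s - H (id h) s i j = - C' i j h s" for i j h s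
     using H by (simp add: minus_equation_iff[of _ "C' i j h s"]) (metis minus_diff_eq)
    thus ?thesis unfolding sum_negf sum.distrib quad[OF d] B1[OF d] by (simp add: sum_negf)
   qed
   finally show ?thesis by simp
  qed
 qed (use T in auto)
qed

section \<open>The Kronecker property\<close>

text \<open>Related vectors have the same coefficients, but along the basis vectors moved down by
  one place and with opposite sign. This turns the lifts of \<open>X\<close> and of \<open>Y\<close>
  into the two ladders of a Kronecker block.\<close>

lemma (in web_point) R_dual:
 assumes R: "R x u" and L: "linear_on T (*) L"
 shows "L x = (\<Sum>j<r. \<Sum>i<m j - 1. e (Suc i) j x * L (f (Suc i) j))"
  "L u = - (\<Sum>j<r. \<Sum>i<m j - 1. e (Suc i) j x * L (f i j))"
proof -
 have *: "L v = (\<Sum>j<r. \<Sum>i<m j. e i j v * L (f i j))" if "v \<in> T" for v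
  using dual_vec[OF L, of "%i j. e i j v"] expand[OF that] by (simp add: vec_def)
 have c: "e 0 j x = 0" "e (m j - 1) j u = 0" "!!i. Suc i < m j ==> e (Suc i) j x = - e i j u" if "j < r" for j
  using R R_iff[OF R_T[OF R]] that by blast+
 have m: "m j = Suc (m j - 1)" if "j < r" for j using m_pos[OF that] by simp
 have "(\<Sum>i<m j. e i j x * L (f i j)) = (\<Sum>i<m j - 1. e (Suc i) j x * L (f (Suc i) j))" if "j < r" for j
  by (subst m[OF that], subst sum.lessThan_Suc_shift) (simp add: c(1)[OF that])
 thus "L x = (\<Sum>j<r. \<Sum>i<m j - 1. e (Suc i) j x * L (f (Suc i) j))"
  using *[OF R_T(1)[OF R]] by simp
 have "(\<Sum>i<m j. e i j u * L (f i j)) = - (\<Sum>i<m j - 1. e (Suc i) j x * L (f i j))" if "j < r" for j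
  using c[OF that] m_pos[OF that] by (cases "m j") (simp_all add: sum_negf[symmetric])
 thus "L u = - (\<Sum>j<r. \<Sum>i<m j - 1. e (Suc i) j x * L (f i j))"
  using *[OF R_T(2)[OF R]] by (simp add: sum_negf)
qed

lemma sum_rotate:
 fixes l :: "nat => nat" and E :: "nat => nat => nat => 'k::field"
 shows "(\<Sum>a<k. (\<Sum>j<r. \<Sum>i<l j. E a j i * u j i) * v a) = (\<Sum>j<r. \<Sum>i<l j. u j i * (\<Sum>a<k. E a j i * v a))"
proof -
 have "(\<Sum>a<k. (\<Sum>j<r. \<Sum>i<l j. E a j i * u j i) * v a) = (\<Sum>a<k. \<Sum>j<r. \<Sum>i<l j. u j i * (E a j i * v a))"
  unfolding sum_distrib_right by (simp only: mult_ac)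
 also have "\<dots> = (\<Sum>j<r. \<Sum>a<k. \<Sum>i<l j. u j i * (E a j i * v a))" by (rule sum.swap)
 also have "\<dots> = (\<Sum>j<r. \<Sum>i<l j. \<Sum>a<k. u j i * (E a j i * v a))" by (rule sum.cong[OF refl], rule sum.swap)
 finally show ?thesis by (simp add: sum_distrib_left)
qed

lemma quadratic_change:
 fixes l :: "nat => nat" and g :: "nat => nat => nat => 'k::field"
 shows "(\<Sum>a<k. \<Sum>b<k. K a b * (\<Sum>j<r. \<Sum>i<l j. g a j i * u j i) * (\<Sum>s<r. \<Sum>h<l s. g b s h * v s h))
  = (\<Sum>j<r. \<Sum>i<l j. \<Sum>s<r. \<Sum>h<l s. (\<Sum>a<k. \<Sum>b<k. K a b * g a j i * g b s h) * u j i * v s h)"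
proof -
 let ?V = "%b. \<Sum>s<r. \<Sum>h<l s. g b s h * v s h"
 have i: "(\<Sum>a<k. g a j i * (\<Sum>b<k. K a b * ?V b))
   = (\<Sum>s<r. \<Sum>h<l s. v s h * (\<Sum>a<k. \<Sum>b<k. K a b * g a j i * g b s h))" for j i
 proof -
  have inner: "(\<Sum>b<k. g b s h * (\<Sum>a<k. g a j i * K a b)) = (\<Sum>a<k. \<Sum>b<k. K a b * g a j i * g b s h)" for s h
   unfolding sum_distrib_left by (subst sum.swap) (simp only: mult_ac)
  have "(\<Sum>a<k. g a j i * (\<Sum>b<k. K a b * ?V b)) = (\<Sum>b<k. ?V b * (\<Sum>a<k. g a j i * K a b))"
   unfolding sum_distrib_left[of "g _ _ _"] sum_distrib_left[of "?V _"]
   by (subst sum.swap) (simp only: mult_ac)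
  also have "\<dots> = (\<Sum>s<r. \<Sum>h<l s. v s h * (\<Sum>b<k. g b s h * (\<Sum>a<k. g a j i * K a b)))" by (rule sum_rotate)
  finally show ?thesis unfolding inner .
 qed
 have "(\<Sum>a<k. \<Sum>b<k. K a b * (\<Sum>j<r. \<Sum>i<l j. g a j i * u j i) * ?V b)
  = (\<Sum>a<k. (\<Sum>j<r. \<Sum>i<l j. g a j i * u j i) * (\<Sum>b<k. K a b * ?V b))"
  unfolding sum_distrib_left[of "\<Sum>j<r. \<Sum>i<l j. g _ j i * u j i"] by (simp only: mult_ac)
 also have "\<dots> = (\<Sum>j<r. \<Sum>i<l j. u j i * (\<Sum>a<k. g a j i * (\<Sum>b<k. K a b * ?V b)))" by (rule sum_rotate)
 finally show ?thesis unfolding i by (simp add: sum_distrib_left mult_ac)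
qed

context cot_frame
begin

lemma PB_expand:
 assumes "\<alpha> \<in> cotangent_space M p" "\<beta> \<in> cotangent_space M p"
 shows "PB Z c p \<alpha> \<beta> = (\<Sum>a<k. \<alpha> (hlift p (Z a (fst p))) * \<beta> (dy a p)) - (\<Sum>a<k. \<beta> (hlift p (Z a (fst p))) * \<alpha> (dy a p))
  - (\<Sum>a<k. \<Sum>b<k. C c a b p * \<alpha> (dy a p) * \<beta> (dy b p))"
 unfolding PB_def using assms
 by (simp add: left_diff_distrib sum_subtractf sum_distrib_right mult.commute[of "\<alpha> (dy _ p)" "\<beta> (hlift _ _)"])
  (subst sum.swap, rule refl)

end

context web_frame
begin

text \<open>Each block of length \<open>m j\<close> of the web at \<open>fst p\<close> yields an
  elementary pair with \<open>m j\<close> horizontal vectors \<open>F\<close> and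
  \<open>m j - 1\<close> vertical vectors \<open>G\<close>. The structure functions contribute only
  terms quadratic in the vertical vectors, as \<open>kronecker_product_shifted\<close>
  allows.\<close>

lemma kronecker_at:
 assumes c: "frame_data X c" and c': "frame_data Y c'" and p: "p \<in> D"
 shows "kronecker_product r (M.TS p) (PB X c p) (PB Y c' p)"
proof -
 note [simp del] = sum.lessThan_Suc
 define q where "q = fst p"
 have q: "q \<in> V" "q \<in> points N" unfolding q_def using D_base[OF p] by blast+
 let ?T = "M.TS p" and ?N = "N.TS q"
 have T: "fv.subspace ?T" by (rule M.tangent_subspace[OF D_base(4)[OF p]])
 obtain m e f where P: "web_point ?N r m e f" and W: "ALL t. w t q = web_point.W ?N r m e t"
  using Web.ex_point[OF q(2)] by blast
 interpret A: web_point ?N r m e f by (rule P)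
 define l where "l j = m j - 1" for j
 have m: "m j = Suc (l j)" if "j < r" for j using A.m_pos[OF that] by (simp add: l_def)
 define E where "E a j i = e (Suc i) j (X a q)" for a j i
 define F where "F j i = hlift p (f i j)" for j i
 \<comment> \<open>The coefficients of \<open>X a\<close> are moved onto the vertical vectors: the
   sum of the lifts of \<open>X a\<close> paired with \<open>dy a\<close> becomes the sum of
   \<open>F j (Suc i)\<close> paired with \<open>G j i\<close>, and for \<open>Y\<close> the same
   \<open>G j i\<close> are paired with \<open>- F j i\<close>.\<close>
 define G where "G j i = (\<Sum>a<k. fscale (E a j i) (dy a p))" for j i
 have R: "A.R (X a q) (Y a q)" if "a < k" for a
  using XY[OF that q(1)] Web.RR_eq[OF P W] by simp
 have FT: "F j i \<in> ?T" and GT: "G j i \<in> ?T" for j i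
  unfolding F_def G_def using hlift_tangent[OF p] dy_tangent[OF p]
  by (auto intro!: fv.subspace_sum[OF T] fv.subspace_scale[OF T])
 have lin: "linear_on ?N (*) (%u. \<gamma> (hlift p u))" if "linear_on ?T (*) \<gamma>" for \<gamma>
  using that hlift_tangent[OF p] by (simp add: linear_on_def hlift_add hlift_scale)
 have hX: "\<gamma> (hlift p (X a q)) = (\<Sum>j<r. \<Sum>i<l j. E a j i * \<gamma> (F j (Suc i)))"
  and hY: "\<gamma> (hlift p (Y a q)) = - (\<Sum>j<r. \<Sum>i<l j. E a j i * \<gamma> (F j i))"
  if "linear_on ?T (*) \<gamma>" "a < k" for \<gamma> a
  using A.R_dual[OF R[OF that(2)] lin[OF that(1)]] unfolding E_def F_def l_def by blast+
 have \<gamma>G: "\<gamma> (G j i) = (\<Sum>a<k. E a j i * \<gamma> (dy a p))" if "linear_on ?T (*) \<gamma>" for \<gamma> j i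
  unfolding G_def by (rule linear_on_sum[OF that T]) (simp add: dy_tangent[OF p])
 \<comment> \<open>The vectors \<open>f (Suc i) j\<close> lie in w(0), so they expand in the frame
   \<open>X\<close>; the resulting coefficients invert \<open>E\<close>. Hence the
   \<open>G j i\<close> form another basis of the vertical vectors.\<close>
 have "ALL j. ALL i. EX g. j < r \<and> i < l j --> f (Suc i) j = (\<Sum>a<k. fscale (g a) (X a q))"
 proof (intro allI)
  fix j i
  show "EX g. j < r \<and> i < l j --> f (Suc i) j = (\<Sum>a<k. fscale (g a) (X a q))"
  proof (cases "j < r \<and> i < l j")
   case True
   hence "f (Suc i) j \<in> w 0 q"
    unfolding spec[OF W] A.W_zero_iff using A.f_T A.e_f m by auto
   thus ?thesis using local_frame_range[OF X q(1)] by blast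
  qed blast
 qed
 then obtain g' where g': "ALL j i. j < r \<and> i < l j --> f (Suc i) j = (\<Sum>a<k. fscale (g' j i a) (X a q))"
  unfolding choice_iff by (elim exE) (rule that)
 define g where "g a j i = g' j i a" for a j i
 have g: "f (Suc i) j = (\<Sum>a<k. fscale (g a j i) (X a q))" if "j < r" "i < l j" for j i
  using g' that by (simp add: g_def)
 have gE: "(\<Sum>a<k. g a s h * E a j i) = (if j = s \<and> i = h then 1 else 0)"
  if "j < r" "i < l j" "s < r" "h < l s" for j i s h
 proof -
  have i: "Suc i < m j" "Suc h < m s" using that m by auto
  have "e (Suc i) j (f (Suc h) s) = (\<Sum>a<k. g a s h * E a j i)"
   unfolding g[OF that(3,4)] E_def
   by (rule linear_on_sum[OF A.e_linear[OF that(1) i(1)] A.T]) (simp add: A.R_T(1)[OF R])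
  thus ?thesis using A.e_f[OF that(1) i(1) that(3) i(2)] by auto
 qed
 have Eg: "(\<Sum>j<r. \<Sum>i<l j. g b j i * E a j i) = (if a = b then 1 else 0)" if a: "a < k" and b: "b < k" for a b
 proof (rule frame_data_coeff_eq[OF c q(1) _ b])
  show "(\<Sum>b<k. fscale (\<Sum>j<r. \<Sum>i<l j. g b j i * E a j i) (X b q)) = (\<Sum>b<k. fscale (if a = b then 1 else 0) (X b q))"
  proof (rule ext)
   fix z
   have "(\<Sum>b<k. (if a = b then 1 else 0) * X b q z) = (\<Sum>b<k. if b = a then X b q z else 0)"
    by (rule sum.cong) auto
   also have "\<dots> = X a q z" using a by simp
   also have "\<dots> = (\<Sum>j<r. \<Sum>i<l j. E a j i * f (Suc i) j z)"
    using A.R_dual(1)[OF R[OF a], of "%v. v z"] unfolding E_def l_def by (simp add: linear_on_def)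
   also have "\<dots> = (\<Sum>j<r. \<Sum>i<l j. E a j i * (\<Sum>b<k. g b j i * X b q z))"
    using g by (simp add: sum_fun_apply)
   also have "\<dots> = (\<Sum>b<k. (\<Sum>j<r. \<Sum>i<l j. g b j i * E a j i) * X b q z)"
    by (rule sum_rotate[symmetric])
   finally show "(\<Sum>b<k. fscale (\<Sum>j<r. \<Sum>i<l j. g b j i * E a j i) (X b q)) z
     = (\<Sum>b<k. fscale (if a = b then 1 else 0) (X b q)) z" by (simp add: sum_fun_apply)
  qed
 qed
 have dyG: "\<gamma> (dy b p) = (\<Sum>j<r. \<Sum>i<l j. g b j i * \<gamma> (G j i))" if L: "linear_on ?T (*) \<gamma>" and b: "b < k" for \<gamma> b
 proof -
  have "(\<Sum>j<r. \<Sum>i<l j. g b j i * \<gamma> (G j i)) = (\<Sum>a<k. (\<Sum>j<r. \<Sum>i<l j. E a j i * g b j i) * \<gamma> (dy a p))"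
   unfolding \<gamma>G[OF L] by (rule sum_rotate[symmetric])
  also have "\<dots> = (\<Sum>a<k. if a = b then \<gamma> (dy a p) else 0)"
   using Eg b by (intro sum.cong[OF refl]) (simp add: mult.commute)
  finally show ?thesis using b by simp
 qed
 define Ct where "Ct d i j h s = (\<Sum>a<k. \<Sum>b<k. C d a b p * g a j i * g b s h)" for d i j h s
 have Ct: "Ct d i j h s = - Ct d h s i j" if "frame_data Z d" for Z d i j h s
 proof -
  have "Ct d h s i j = (\<Sum>a<k. \<Sum>b<k. C d b a p * g b s h * g a j i)" unfolding Ct_def by (rule sum.swap)
  also have "\<dots> = (\<Sum>a<k. \<Sum>b<k. - (C d a b p * g a j i * g b s h))"
  proof (intro sum.cong[OF refl])
   fix a b assume "a \<in> {..<k}" "b \<in> {..<k}"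
   thus "C d b a p * g b s h * g a j i = - (C d a b p * g a j i * g b s h)"
    using C_antisym[OF that p, of b a] by simp
  qed
  finally show ?thesis by (simp add: Ct_def sum_negf)
 qed
 have lind: "linear_on ?T (*) \<gamma>" if "\<gamma> \<in> dual ?T" for \<gamma> by (rule dual_linear[OF that])
 have quad: "(\<Sum>a<k. \<Sum>b<k. C d a b p * \<alpha> (dy a p) * \<beta> (dy b p))
   = (\<Sum>j<r. \<Sum>i<l j. \<Sum>s<r. \<Sum>h<l s. Ct d i j h s * \<alpha> (G j i) * \<beta> (G s h))"
  if "\<alpha> \<in> dual ?T" "\<beta> \<in> dual ?T" for d \<alpha> \<beta>
  using quadratic_change[where K = "%a b. C d a b p" and g = g and u = "%j i. \<alpha> (G j i)"
   and v = "%s h. \<beta> (G s h)" and r = r and l = l and k = k]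
  by (simp add: Ct_def dyG[OF lind[OF that(1)]] dyG[OF lind[OF that(2)]])
 have rot: "(\<Sum>a<k. (\<Sum>j<r. \<Sum>i<l j. E a j i * u j i) * \<beta> (dy a p)) = (\<Sum>j<r. \<Sum>i<l j. u j i * \<beta> (G j i))"
  if "\<beta> \<in> dual ?T" for u \<beta>
  unfolding \<gamma>G[OF lind[OF that]] by (rule sum_rotate)
 show ?thesis
 proof (rule kronecker_product_shifted[where F = F and G = G and l = l, OF T FT GT _ _ Ct[OF c] Ct[OF c']])
  fix \<alpha> \<beta> assume d: "\<alpha> \<in> dual ?T" "\<beta> \<in> dual ?T"
  have "(\<Sum>a<k. \<alpha> (hlift p (X a q)) * \<beta> (dy a p)) = (\<Sum>j<r. \<Sum>i<l j. \<alpha> (F j (Suc i)) * \<beta> (G j i))"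
   "(\<Sum>a<k. \<alpha> (hlift p (Y a q)) * \<beta> (dy a p)) = - (\<Sum>j<r. \<Sum>i<l j. \<alpha> (F j i) * \<beta> (G j i))"
   if d: "\<alpha> \<in> dual ?T" "\<beta> \<in> dual ?T" for \<alpha> \<beta>
   unfolding rot[OF d(2), symmetric]
   by (rule sum.cong[OF refl], simp add: hX[OF lind[OF d(1)]])
    (subst sum_negf[symmetric], rule sum.cong[OF refl], simp add: hY[OF lind[OF d(1)]])
  note s = this[OF d] this[OF d(2,1)]
  show "PB X c p \<alpha> \<beta> = (\<Sum>j<r. \<Sum>i<l j. \<alpha> (F j (Suc i)) * \<beta> (G j i) - \<alpha> (G j i) * \<beta> (F j (Suc i)))
    - (\<Sum>j<r. \<Sum>i<l j. \<Sum>s<r. \<Sum>h<l s. Ct c i j h s * \<alpha> (G j i) * \<beta> (G s h))"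
   unfolding PB_expand[OF d] quad[OF d] q_def[symmetric] s sum_subtractf by (simp only: mult.commute[of "\<beta> _"])
  show "PB Y c' p \<alpha> \<beta> = - (\<Sum>j<r. \<Sum>i<l j. \<alpha> (F j i) * \<beta> (G j i) - \<alpha> (G j i) * \<beta> (F j i))
    - (\<Sum>j<r. \<Sum>i<l j. \<Sum>s<r. \<Sum>h<l s. Ct c' i j h s * \<alpha> (G j i) * \<beta> (G s h))"
   unfolding PB_expand[OF d] quad[OF d] q_def[symmetric] s sum_subtractf by (simp add: mult.commute[of "\<beta> _"])
 next
  fix v assume v: "v \<in> ?T"
  let ?u = "push N fst p v"
  have u: "?u \<in> ?N" using push_tangent[OF v] by (simp add: q_def)
  show "EX x z. v = (\<Sum>j<r. block (l j) (F j) (G j) (x j) (z j))"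
  proof (rule exI[of _ "%j i. e i j ?u"], rule exI[of _ "%j i. \<Sum>a<k. g a j i * v (y a)"], rule ext)
   fix t
   have L: "linear_on ?T (*) (%x. x t)" by (simp add: linear_on_def)
   have "v t = hlift p ?u t + (\<Sum>a<k. v (y a) * dy a p t)"
    using fun_cong[OF tangent_split[OF v p], of t] by (simp add: sum_fun_apply)
   also have "hlift p ?u t = (\<Sum>j<r. \<Sum>i<Suc (l j). e i j ?u * F j i t)"
   proof -
    have "hlift p ?u t = (\<Sum>j<r. \<Sum>i<m j. e i j ?u * hlift p (f i j) t)"
     using A.dual_vec[OF lin[OF L], of "%i j. e i j ?u"] A.expand[OF u] by (simp add: A.vec_def)
    thus ?thesis using m by (simp add: F_def)
   qed
   also have "(\<Sum>a<k. v (y a) * dy a p t) = (\<Sum>a<k. (\<Sum>j<r. \<Sum>i<l j. g a j i * G j i t) * v (y a))"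
    using dyG[OF L] by (simp add: mult.commute)
   also have "\<dots> = (\<Sum>j<r. \<Sum>i<l j. G j i t * (\<Sum>a<k. g a j i * v (y a)))" by (rule sum_rotate)
   finally show "v t = (\<Sum>j<r. block (l j) (F j) (G j) (%i. e i j ?u) (%i. \<Sum>a<k. g a j i * v (y a))) t"
    by (simp add: block_def sum_fun_apply sum.distrib mult.commute)
  qed
 next
  fix x z assume z: "(\<Sum>j<r. block (l j) (F j) (G j) (x j) (z j)) = 0"
  have "0 = push N fst p (\<Sum>j<r. block (l j) (F j) (G j) (x j) (z j))" unfolding z push_zero ..
  also have "\<dots> = A.vec (%i j. x j i)"
   unfolding A.vec_def push_sum block_def push_add push_scale F_def G_def
   using push_hlift[OF p] A.f_T m by (simp add: push_dy[OF p] q_def)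
  finally have vec: "A.vec (%i j. x j i) = 0" by simp
  have x: "x j i = 0" if "j < r" "i < Suc (l j)" for j i
   using A.e_vec[of j i "%i j. x j i"] that m linear_on_zero[OF A.e_linear A.T, of j i] unfolding vec by simp
  have "(\<Sum>j<r. \<Sum>i<l j. E a j i * z j i) = 0" if a: "a < k" for a
  proof -
   have "G j i (y a) = E a j i" for j i
   proof -
    have "G j i (y a) = (\<Sum>b<k. if b = a then E a j i else 0)"
     unfolding G_def sum_fun_apply using a by (intro sum.cong[OF refl]) (auto simp: dy_y[OF p])
    thus ?thesis using a by simp
   qed
   thus ?thesis using fun_cong[OF z, of "y a"] x
    by (simp add: block_def sum_fun_apply mult.commute)
  qed
  hence "(\<Sum>j<r. \<Sum>i<l j. z j i * (\<Sum>a<k. E a j i * g a s h)) = 0" for s h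
   unfolding sum_rotate[symmetric] by (intro sum.neutral) simp
  moreover have "(\<Sum>j<r. \<Sum>i<l j. z j i * (\<Sum>a<k. E a j i * g a s h)) = z s h" if s: "s < r" "h < l s" for s h
  proof -
   have "(\<Sum>j<r. \<Sum>i<l j. z j i * (\<Sum>a<k. E a j i * g a s h))
    = (\<Sum>j<r. if j = s then (\<Sum>i<l s. if i = h then z s h else 0) else 0)"
    using gE[OF _ _ s] by (intro sum.cong[OF refl]) (auto simp: mult.commute[of "E _ _ _"]
     if_distrib[where f = "(*) d" for d] cong: if_cong intro!: sum.neutral)
   thus ?thesis using s by simp
  qed
  ultimately show "ALL j<r. (ALL i<Suc (l j). x j i = 0) \<and> (ALL i<l j. z j i = 0)" using x by simp
 qed
qed

end

section \<open>The pull-back by the dual isomorphism\<close>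

context web_frame
begin

abbreviation "M' \<equiv> leaf_cotangent N r (web_infinity N r w)"
abbreviation "\<psi> \<equiv> dual_iso N r w"
abbreviation "push' p \<equiv> push M' \<psi> p"

lemma fst_psi: "fst (\<psi> p) = fst p" by (simp add: dual_iso_def)

lemma psi_D: assumes p: "p \<in> D" shows "\<psi> p \<in> cot_dom (web_infinity N r w) V"
proof -
 let ?q = "fst p"
 have q: "?q \<in> V" "?q \<in> points N" using D_base[OF p] by blast+
 have sn: "snd p \<in> dual (w 0 ?q)" using p by (simp add: cot_dom_def)
 have e: "Web.RR ?q (canonical_iso N r w ?q v) v" if "v \<in> Web.winf ?q" for v
  using Web.winf_ell[OF q(2) that] that q by (simp add: Web.canonical_iso_eq)
 have s: "u + v \<in> Web.winf ?q" "fscale c u \<in> Web.winf ?q" if "u \<in> Web.winf ?q" "v \<in> Web.winf ?q" for u v c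
  using fv.subspace_add[OF I.F_subspace[OF q(2)] that] fv.subspace_scale[OF I.F_subspace[OF q(2)] that(1)] by auto
 have "canonical_iso N r w ?q (u + v) = canonical_iso N r w ?q u + canonical_iso N r w ?q v"
  if "u \<in> Web.winf ?q" "v \<in> Web.winf ?q" for u v
  using Web.RR_facts(2)[OF q(2) e[OF s(1)[OF that]] Web.RR_add[OF q(2) e[OF that(1)] e[OF that(2)]]] .
 moreover have "canonical_iso N r w ?q (fscale c u) = fscale c (canonical_iso N r w ?q u)"
  if "u \<in> Web.winf ?q" for u c
  using Web.RR_facts(2)[OF q(2) e[OF s(2)[OF that that]] Web.RR_scale[OF q(2) e[OF that]]] .
 ultimately have "linear_on (Web.winf ?q) (*) (snd p \<circ> canonical_iso N r w ?q)"
  using linear_on_add[OF dual_linear[OF sn]] linear_on_scale[OF dual_linear[OF sn]] Web.RR_w0[OF e]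
  by (simp add: linear_on_def)
 thus ?thesis
  using q dual_restr[OF _ I.F_subspace[OF q(2)]] by (simp add: cot_dom_def dual_iso_def)
qed

lemma psi_y: assumes p: "p \<in> D" and i: "i < k" shows "I.y i (\<psi> p) = y i p"
proof -
 have q: "fst p \<in> V" "fst p \<in> points N" using D_base[OF p] by blast+
 note R = XY[OF i q(1)]
 have "canonical_iso N r w (fst p) (Y i (fst p)) = X i (fst p)"
  using Web.ell_eq[OF R] Web.winfI[OF R] q by (simp add: Web.canonical_iso_eq)
 thus ?thesis
  using Web.winfI[OF R] by (simp add: I.y_def y_def dual_iso_def restr_def)
qed

text \<open>Since X_i = ell(Y_i), a functional composed with \<open>ell\<close> takes on Y_i the
  value that the functional takes on X_i. In adapted charts the dual isomorphism is therefore the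
  identity, and the remaining lemmas on it transfer coordinate formulas.\<close>

lemma psi_coord: assumes p: "p \<in> D" shows "I.\<Phi> (\<psi> p) = \<Phi> p"
 using psi_y[OF p] by (auto simp: cot_map_def fun_eq_iff fst_psi I.y_def y_def)

lemma image_eq: "W \<subseteq> V ==> \<Phi> ` cot_dom (w 0) W = I.\<Phi> ` cot_dom (web_infinity N r w) W"
 using cot_map_image[OF U X] I.cot_map_image[OF U I.X] by simp

lemma psi_inv:
 assumes z: "z \<in> \<Phi> ` D" shows "\<psi> (inv_into D \<Phi> z) = inv_into I.D I.\<Phi> z"
proof -
 have d: "inv_into D \<Phi> z \<in> D" "\<Phi> (inv_into D \<Phi> z) = z"
  using z by (auto intro: inv_into_into f_inv_into_f)
 from I.M.chart_inv[OF I.chart psi_D[OF d(1)]] show ?thesis unfolding psi_coord[OF d(1)] d(2) by simp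
qed

lemma smooth_psi:
 assumes p: "p \<in> D" and g: "smooth_near M' (\<psi> p) g" shows "M.smooth p (g \<circ> \<psi>)"
proof -
 obtain W' where "openin (mtop M') W'" and W': "\<psi> p \<in> W'" "W' \<subseteq> I.D" "open_coord (mdim M') (I.\<Phi> ` W')"
  and s: "smooth_coord (mdim M') (I.\<Phi> ` W') (g \<circ> inv_into I.D I.\<Phi>)"
  by (rule I.M.smooth_near_chartE[OF g I.chart psi_D[OF p]]) (rule that)
 define W where "W = {x \<in> D. \<psi> x \<in> W'}"
 have im: "\<Phi> ` W = I.\<Phi> ` W'"
 proof (intro equalityI subsetI)
  fix z assume "z \<in> \<Phi> ` W"
  thus "z \<in> I.\<Phi> ` W'" using psi_coord by (force simp: W_def)
 next
  fix z assume z: "z \<in> I.\<Phi> ` W'"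
  hence zD: "z \<in> \<Phi> ` D" using W'(2) image_eq[OF order_refl] by blast
  obtain x where x: "x \<in> W'" "z = I.\<Phi> x" using z by blast
  have "\<psi> (inv_into D \<Phi> z) = x"
   unfolding psi_inv[OF zD] unfolding x(2) using x(1) W'(2) by (intro I.M.chart_inv[OF I.chart]) blast
  hence "inv_into D \<Phi> z \<in> W" using inv_into_into[OF zD] x by (simp add: W_def)
  thus "z \<in> \<Phi> ` W" using f_inv_into_f[OF zD] by force
 qed
 have WD: "W \<subseteq> D" by (auto simp: W_def)
 have "smooth_coord (mdim M) (\<Phi> ` W) ((g \<circ> \<psi>) \<circ> inv_into D \<Phi>)"
  unfolding im mdim_M I.mdim_M[symmetric]
 proof (rule smooth_coord_cong[OF W'(3) _ s])
  fix z assume "z \<in> I.\<Phi> ` W'"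
  hence "z \<in> \<Phi> ` D" using WD unfolding im[symmetric] by blast
  thus "(g \<circ> inv_into I.D I.\<Phi>) z = ((g \<circ> \<psi>) \<circ> inv_into D \<Phi>) z" by (simp add: psi_inv)
 qed
 thus ?thesis
  unfolding M.smooth_near_iff[OF chart p]
  using M.openin_chart[OF chart WD] W' p im WD by (intro exI[of _ W]) (simp add: W_def)
qed

lemma push_coord:
 assumes p: "p \<in> D" and i: "i < n + k"
 shows "push' p (coord_vec M D \<Phi> i p) = coord_vec M' I.D I.\<Phi> i (\<psi> p)"
proof (rule ext)
 fix g
 show "push' p (coord_vec M D \<Phi> i p) g = coord_vec M' I.D I.\<Phi> i (\<psi> p) g"
 proof (cases "smooth_near M' (\<psi> p) g")
  case True
  have "pderivative i ((g \<circ> \<psi>) \<circ> inv_into D \<Phi>) (\<Phi> p) = pderivative i (g \<circ> inv_into I.D I.\<Phi>) (\<Phi> p)"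
   using M.chart_image_open[OF chart] p i
   by (intro pderivative_cong[where V = "\<Phi> ` D" and n = "n + k"]) (auto simp: psi_inv)
  thus ?thesis
   using True smooth_psi[OF p True] by (simp add: push_def coord_vec_def psi_coord[OF p])
 qed (simp add: push_def coord_vec_def)
qed

lemma push_expand':
 assumes p: "p \<in> D" and v: "v \<in> M.TS p"
 shows "push' p v = (\<Sum>i<mdim M'. fscale (v (%x. \<Phi> x i)) (coord_vec M' I.D I.\<Phi> i (\<psi> p)))"
proof -
 have "push' p v = push' p (\<Sum>i<n + k. fscale (v (%x. \<Phi> x i)) (coord_vec M D \<Phi> i p))"
  using M.tangent_expand[OF v chart p] by simp
 thus ?thesis using push_coord[OF p] by (simp add: push_sum push_scale)
qed

lemma push_inj: assumes p: "p \<in> D" shows "inj_on (push' p) (M.TS p)"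
proof (rule inj_onI)
 fix u v assume u: "u \<in> M.TS p" and v: "v \<in> M.TS p" and e: "push' p u = push' p v"
 show "u = v"
 proof (rule M.tangent_eqI[OF u v chart p])
  fix i assume "i < mdim M"
  hence i: "i < mdim M'" by simp
  show "u (%x. \<Phi> x i) = v (%x. \<Phi> x i)"
   using fun_cong[OF e, of "%x. I.\<Phi> x i"]
   unfolding push_expand'[OF p u] push_expand'[OF p v] I.M.coord_vec_sum_coord[OF I.chart psi_D[OF p] i] .
 qed
qed

lemma push_image: assumes p: "p \<in> D" shows "push' p ` M.TS p = tangent_space M' (\<psi> p)"
proof (intro equalityI subsetI)
 fix u assume "u \<in> push' p ` M.TS p"
 thus "u \<in> tangent_space M' (\<psi> p)"
  using push_expand'[OF p] I.M.tangent_spaceI[OF I.chart psi_D[OF p]] by force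
next
 fix u assume u: "u \<in> tangent_space M' (\<psi> p)"
 define v where "v = (\<Sum>i<mdim M. fscale (u (%x. I.\<Phi> x i)) (coord_vec M D \<Phi> i p))"
 have v: "v \<in> M.TS p" unfolding v_def by (rule M.tangent_spaceI[OF chart p])
 have "push' p v = u"
  using push_coord[OF p] I.M.tangent_expand[OF u I.chart psi_D[OF p]]
  by (simp add: v_def push_sum push_scale)
 thus "u \<in> push' p ` M.TS p" using v by blast
qed

lemma push_hlift': "p \<in> D ==> push' p (hlift p u) = I.hlift (\<psi> p) u"
 by (simp add: hlift_def I.hlift_def push_sum push_scale push_coord)

lemma push_dy': "p \<in> D ==> i < k ==> push' p (dy i p) = I.dy i (\<psi> p)"
 by (simp add: dy_def I.dy_def push_coord)

text \<open>\<open>PB\<close> involves only lifts, vertical coordinate vectors and the functions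
  \<open>C\<close>, and all of these correspond under the identity of coordinates. So the
  Liouville-Poisson structure of T*w(\<infinity>) becomes the bivector of the frame \<open>Y\<close>
  on the dual bundle framed by \<open>X\<close>.\<close>

lemma pullback_PB:
 assumes c': "frame_data Y c'" and p: "p \<in> D"
 shows "pullback_bivector M M' \<psi> (liouville_poisson N r (web_infinity N r w)) p = PB Y c' p"
proof (intro ext)
 fix \<alpha> \<beta>
 let ?T = "M.TS p" and ?T' = "tangent_space M' (\<psi> p)"
 define tr where "tr \<gamma> = restr ?T' (\<gamma> \<circ> inv_into ?T (push' p))" for \<gamma> :: "(('p, 'k) cot, 'k) covec"
 have tr: "tr \<gamma> (push' p v) = \<gamma> v" if "v \<in> ?T" for \<gamma> v
  using that push_image[OF p] inv_into_f_f[OF push_inj[OF p] that] by (auto simp: tr_def restr_def)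
 have trd: "tr \<gamma> \<in> dual ?T'" if g: "\<gamma> \<in> dual ?T" for \<gamma>
 proof (rule dualI)
  have "tr \<gamma> (push' p u + push' p v) = tr \<gamma> (push' p u) + tr \<gamma> (push' p v)" if "u \<in> ?T" "v \<in> ?T" for u v
   unfolding push_add[symmetric] tr[OF M.tangent_add[OF that]] tr[OF that(1)] tr[OF that(2)]
   by (rule linear_on_add[OF dual_linear[OF g] that])
  moreover have "tr \<gamma> (fscale c (push' p u)) = c * tr \<gamma> (push' p u)" if "u \<in> ?T" for u c
   unfolding push_scale[symmetric] tr[OF M.tangent_scale[OF that]] tr[OF that]
   by (rule linear_on_scale[OF dual_linear[OF g] that])
  ultimately show "linear_on ?T' (*) (tr \<gamma>)" unfolding linear_on_def push_image[OF p, symmetric] by auto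
 qed (simp add: tr_def restr_def)
 have h: "tr \<gamma> (I.hlift (\<psi> p) u) = \<gamma> (hlift p u)" for \<gamma> u
  unfolding push_hlift'[OF p, symmetric] by (rule tr[OF hlift_tangent[OF p]])
 have d: "tr \<gamma> (I.dy i (\<psi> p)) = \<gamma> (dy i p)" if "i < k" for \<gamma> i
  unfolding push_dy'[OF p that, symmetric] by (rule tr[OF dy_tangent[OF p that]])
 have C: "I.C c' i j (\<psi> p) = C c' i j p" for i j
  unfolding I.C_def C_def using psi_y[OF p] by (simp add: fst_psi)
 show "pullback_bivector M M' \<psi> (liouville_poisson N r (web_infinity N r w)) p \<alpha> \<beta> = PB Y c' p \<alpha> \<beta>"
 proof (cases "\<alpha> \<in> dual ?T \<and> \<beta> \<in> dual ?T")
  case True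
  hence t: "tr \<alpha> \<in> dual ?T'" "tr \<beta> \<in> dual ?T'" using trd by blast+
  have "pullback_bivector M M' \<psi> (liouville_poisson N r (web_infinity N r w)) p \<alpha> \<beta> = I.PB Y c' (\<psi> p) (tr \<alpha>) (tr \<beta>)"
   using True by (simp add: pullback_bivector_def tr_def I.liouville_poisson_PB[OF c' psi_D[OF p]])
  also have "\<dots> = PB Y c' p \<alpha> \<beta>"
   unfolding I.PB_expand[OF t] PB_expand[OF conjunct1[OF True] conjunct2[OF True]] fst_psi h C
   by (simp add: d)
  finally show ?thesis .
 qed (auto simp: pullback_bivector_def PB_def)
qed

text \<open>\<open>PB\<close> depends linearly on the frame and on the structure functions taken
  together, and the structure functions of X + tY are those of \<open>X\<close> plus
  \<open>t\<close> times those of \<open>Y\<close>.\<close>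

lemma pencil_PB:
 assumes p: "p \<in> D"
 shows "PB X c p \<alpha> \<beta> + t * PB Y c' p \<alpha> \<beta> =
  PB (%i q. X i q + fscale t (Y i q)) (%i j l q. c i j l q + t * c' i j l q) p \<alpha> \<beta>"
proof (cases "\<alpha> \<in> cotangent_space M p \<and> \<beta> \<in> cotangent_space M p")
 case True
 have h: "\<gamma> (hlift p (u + fscale t v)) = \<gamma> (hlift p u) + t * \<gamma> (hlift p v)" if "\<gamma> \<in> cotangent_space M p" for \<gamma> u v
  unfolding hlift_add hlift_scale
  using linear_on_add[OF dual_linear[OF that] hlift_tangent[OF p] M.tangent_scale[OF hlift_tangent[OF p]]]
   linear_on_scale[OF dual_linear[OF that] hlift_tangent[OF p]] by simp
 have C: "C (%i j l q. c i j l q + t * c' i j l q) i j p = C c i j p + t * C c' i j p" for i j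
  by (simp add: C_def ring_distribs sum.distrib sum_distrib_left mult.assoc)
 show ?thesis
  using True by (simp add: PB_expand h C ring_distribs sum.distrib sum_distrib_left mult.assoc)
qed (auto simp: PB_def)

end

section \<open>Leaves of the vertical foliation\<close>

context cot_frame
begin

text \<open>An affine line inside one fibre, with the whole ground field as parameter set: in the
  chart the base coordinates are constant and the fibre coordinates affine.\<close>

lemma vertical_line:
 assumes Dd: "!!p. p \<in> points M ==> Dd p = {v \<in> M.TS p. push N fst p v = 0}"
  and p: "p \<in> D" and x: "x \<in> D" and px: "fst x = fst p"
 shows "tangent_curve M Dd UNIV (%u. (fst p, snd p + fscale u (snd x - snd p)))"
  (is "tangent_curve _ _ _ ?c")
proof -
 have d: "snd p \<in> dual (F (fst p))" "snd x \<in> dual (F (fst p))" using p x px by (auto simp: cot_dom_def)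
 have cD: "?c u \<in> D" for u
  using p fv.subspace_add[OF dual_subspace d(1) fv.subspace_scale[OF dual_subspace fv.subspace_diff[OF dual_subspace d(2,1)]]]
  by (simp add: cot_dom_def)
 have co: "\<Phi> (?c u) i = (if i < n then \<phi> (fst p) i else if i < n + k
   then y (i - n) p + u * (y (i - n) x - y (i - n) p) else 0)" for u i
  unfolding cot_map_def y_def by (simp only: px fst_conv snd_conv plus_fun_apply fscale_apply minus_apply)
 have dc: "((%u. \<Phi> (?c u) i) has_field_derivative (if i < n then 0 else y (i - n) x - y (i - n) p)) (at u)"
  if "i < n + k" for i u
 proof (cases "i < n")
  case False
  have "((%u. y (i - n) p + u * (y (i - n) x - y (i - n) p)) has_field_derivative (y (i - n) x - y (i - n) p)) (at u)"
   by (auto intro!: derivative_eq_intros)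
  thus ?thesis unfolding co using False that by (simp only: if_False if_True)
 qed (simp add: co)
 have cs: "\<Phi> (?c u) \<in> coord_space (n + k)" for u using M.chart_coord[OF chart cD] by simp
 have cont: "continuous_on UNIV (%u. \<Phi> (?c u))"
  by (rule continuous_on_coords[OF cs])
   (intro continuous_at_imp_continuous_on ballI DERIV_isCont[OF dc])
 show ?thesis
  unfolding tangent_curve_def
 proof (intro conjI ballI)
  show "connected (UNIV :: 'k set)" by (rule convex_connected[OF convex_UNIV])
  show "continuous_map (top_of_set UNIV) (mtop M) ?c"
   unfolding continuous_map_def
  proof (intro conjI allI impI)
   show "?c \<in> topspace (top_of_set UNIV) \<rightarrow> topspace (mtop M)"
    using cD D_base(4) by (auto simp: M.topspace_mtop)
   fix W assume W: "M.opn W"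
   have "open_coord (n + k) (\<Phi> ` (W \<inter> D))"
    using W chart unfolding M.openin_mtop mdim_M by blast
   then obtain A where A: "open A" "\<Phi> ` (W \<inter> D) = coord_space (n + k) \<inter> A"
    by (auto simp: openin_open)
   have "?c u \<in> W \<longleftrightarrow> \<Phi> (?c u) \<in> A" for u
   proof
    show "\<Phi> (?c u) \<in> A" if "?c u \<in> W" using that cD A(2) by blast
    assume "\<Phi> (?c u) \<in> A"
    hence "\<Phi> (?c u) \<in> \<Phi> ` (W \<inter> D)" unfolding A(2) using cs by blast
    then obtain z where z: "\<Phi> (?c u) = \<Phi> z" "z \<in> W \<inter> D" by (elim imageE) (rule that)
    thus "?c u \<in> W" using inj_onD[OF M.chart_inj[OF chart] z(1) cD] by blast
   qed
   hence "{u \<in> topspace (top_of_set UNIV). ?c u \<in> W} = (%u. \<Phi> (?c u)) -` A" by auto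
   thus "openin (top_of_set UNIV) {u \<in> topspace (top_of_set UNIV). ?c u \<in> W}"
    using continuous_on_open_vimage[OF open_UNIV, of "%u. \<Phi> (?c u)"] cont A(1) by simp
  qed
  fix u :: 'k
  let ?v = "\<Sum>i<k. fscale (y i x - y i p) (dy i (?c u))"
  have "?v \<in> Dd (?c u)"
   unfolding Dd[OF D_base(4)[OF cD]]
  proof (intro CollectI conjI)
   note T = M.tangent_subspace[OF D_base(4)[OF cD]]
   show "?v \<in> M.TS (?c u)"
    using dy_tangent[OF cD] by (intro fv.subspace_sum[OF T] fv.subspace_scale[OF T]) simp
   show "push N fst (?c u) ?v = 0" unfolding push_sum push_scale using push_dy[OF cD] by simp
  qed
  moreover have "((g \<circ> ?c) has_field_derivative ?v g) (at u)" if g: "M.smooth (?c u) g" for g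
  proof -
   obtain W where "M.opn W" and W: "?c u \<in> W" "W \<subseteq> D" "open_coord (mdim M) (\<Phi> ` W)"
    "smooth_coord (mdim M) (\<Phi> ` W) (g \<circ> inv_into D \<Phi>)"
    by (rule M.smooth_near_chartE[OF g chart cD]) (rule that)
   let ?h = "g \<circ> inv_into D \<Phi>"
   have "((%t. ?h (\<Phi> (?c t))) has_field_derivative
     (\<Sum>i<n + k. pderivative i ?h (\<Phi> (?c u)) * (if i < n then 0 else y (i - n) x - y (i - n) p))) (at u)"
   proof (rule chain_rule_curve[where c = "%t. \<Phi> (?c t)"])
    show "open_coord (n + k) (\<Phi> ` W)" "Ck_coord (n + k) (Suc 0) (\<Phi> ` W) ?h" "\<Phi> (?c u) \<in> \<Phi> ` W"
     using W unfolding smooth_coord_def by auto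
   qed (use cs dc in auto)
   moreover have "?h (\<Phi> (?c t)) = (g \<circ> ?c) t" for t using M.chart_inv[OF chart cD] by simp
   moreover have "(\<Sum>i<n + k. pderivative i ?h (\<Phi> (?c u)) * (if i < n then 0 else y (i - n) x - y (i - n) p)) = ?v g"
    unfolding sum_lessThan_split sum_fun_apply using g by (simp add: dy_def coord_vec_def mult.commute)
   ultimately show ?thesis by (simp add: comp_def)
  qed
  ultimately show "EX v:Dd (?c u). ALL f. M.smooth (?c u) f --> ((f \<circ> ?c) has_field_derivative v f) (at u)"
   by blast
 qed simp
qed

text \<open>On a ball around the parameter the curve stays in one chart and its base coordinates
  have derivative 0; a ball is convex, so they are constant there.\<close>

lemma vertical_curve_local:
 assumes Dd: "!!p. p \<in> points M ==> Dd p = {v \<in> M.TS p. push N fst p v = 0}"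
  and c: "tangent_curve M Dd J c" and s: "u \<in> J" "c u \<in> D"
 shows "eventually (%t. fst (c u) = fst (c t)) (at u within J)"
proof -
 have J: "open J" and cm: "continuous_map (top_of_set J) (mtop M) c"
  using c by (auto simp: tangent_curve_def)
 have "openin (top_of_set J) {t \<in> J. c t \<in> D}"
  using openin_continuous_map_preimage[OF cm D_open] by simp
 hence "open {t \<in> J. c t \<in> D}" using J by (simp add: openin_open_eq)
 then obtain e where e: "e > 0" "ball u e \<subseteq> {t \<in> J. c t \<in> D}"
  using s by (auto simp: open_contains_ball)
 have der: "((%t. \<phi> (fst (c t)) a) has_field_derivative 0) (at t within ball u e)"
  if t: "t \<in> ball u e" and a: "a < n" for t a
 proof -
  have tJ: "t \<in> J" and tD: "c t \<in> D" using e t by blast+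
  obtain v where v: "v \<in> Dd (c t)"
   and dv: "ALL g. M.smooth (c t) g --> ((g \<circ> c) has_field_derivative v g) (at t)"
   using c tJ unfolding tangent_curve_def by blast
  have "v (%x. \<phi> (fst x) a) = push N fst (c t) v (%x. \<phi> x a)"
   by (rule push_fst_apply[symmetric], rule N.smooth_near_chart_coord[OF U(1) D_base(2)[OF tD] a])
  also have "\<dots> = 0" using v unfolding Dd[OF D_base(4)[OF tD]] by simp
  finally have "((%t. \<phi> (fst (c t)) a) has_field_derivative 0) (at t)"
   using mp[OF spec[OF dv, of "%x. \<phi> (fst x) a"] smooth_base[OF tD a]] by (simp add: comp_def)
  thus ?thesis by (rule has_field_derivative_at_within)
 qed
 have "fst (c t) = fst (c u)" if t: "t \<in> ball u e" for t
 proof -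
  have tD: "c t \<in> D" using e t by blast
  have "\<phi> (fst (c t)) a = \<phi> (fst (c u)) a" for a
  proof (cases "a < n")
   case True
   obtain d where "ALL t:ball u e. \<phi> (fst (c t)) a = d"
    using has_field_derivative_zero_constant[OF convex_ball der[OF _ True]] by blast
   thus ?thesis using t e(1) by simp
  next
   case False
   thus ?thesis
    using N.chart_coord[OF U(1) D_base(2)[OF tD]] N.chart_coord[OF U(1) D_base(2)[OF s(2)]]
    by (simp add: coord_space_def)
  qed
  hence "\<phi> (fst (c t)) = \<phi> (fst (c u))" by (rule ext)
  thus ?thesis using inj_onD[OF N.chart_inj[OF U(1)] _ D_base(2)[OF tD] D_base(2)[OF s(2)]] by blast
 qed
 note const = this
 show ?thesis
  unfolding eventually_at
 proof (intro exI[of _ e] conjI ballI impI e(1))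
  fix t assume "t \<noteq> u \<and> dist t u < e"
  hence "t \<in> ball u e" by (simp add: dist_commute)
  thus "fst (c u) = fst (c t)" by (rule const[symmetric])
 qed
qed

end

context cotangent
begin

lemma ex_cot_frame:
 assumes p: "p \<in> points M" shows "EX U \<phi> V X. cot_frame N s F U \<phi> V X \<and> p \<in> cot_dom F V"
proof -
 have q: "fst p \<in> points N" "snd p \<in> dual (F (fst p))" using p unfolding points_M by auto
 obtain U \<phi> V X where U: "(U, \<phi>) \<in> atlas N" "V \<subseteq> U" "fst p \<in> V" and X: "local_frame N s F V X"
  using ex_local_frame[OF q(1)] by blast
 have "cot_frame N s F U \<phi> V X" by unfold_locales (fact U X)+
 thus ?thesis using q U(3) by (auto simp: cot_dom_def)
qed

text \<open>The base point is locally constant along a tangent curve, hence constant on the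
  connected parameter set and along chains of curves. Conversely, one affine line joins any two
  points of a fibre.\<close>

lemma leaf_vertical:
 assumes Dd: "!!p. p \<in> points M ==> Dd p = {v \<in> M.TS p. push N fst p v = 0}"
  and p: "p \<in> points M"
 shows "leaf M Dd p = {x \<in> points M. fst x = fst p}"
proof (intro equalityI subsetI)
 fix x assume "x \<in> leaf M Dd p"
 hence "(p, x) \<in> {(y, z). EX J c. tangent_curve M Dd J c \<and> y \<in> c ` J \<and> z \<in> c ` J}\<^sup>*" by (simp add: leaf_def)
 thus "x \<in> {x \<in> points M. fst x = fst p}"
 proof (induction rule: rtrancl_induct)
  case (step y z)
  then obtain J c a b where c: "tangent_curve M Dd J c" and ab: "a \<in> J" "y = c a" "b \<in> J" "z = c b" by blast
  have cJ: "c u \<in> points M" if "u \<in> J" for u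
   using c continuous_map_image_subset_topspace[of "top_of_set J" "mtop M" c] that
   by (auto simp: tangent_curve_def M.topspace_mtop)
  have "fst (c a) = fst (c b)"
  proof (rule connected_local_const[where A = J and f = "%u. fst (c u)"])
   show "connected J" using c by (simp add: tangent_curve_def)
   show "ALL u:J. eventually (%t. fst (c u) = fst (c t)) (at u within J)"
   proof
    fix u assume u: "u \<in> J"
    obtain U \<phi> V X where A: "cot_frame N s F U \<phi> V X" and sD: "c u \<in> cot_dom F V"
     using ex_cot_frame[OF cJ[OF u]] by blast
    interpret A: cot_frame N s F U \<phi> V X by (rule A)
    show "eventually (%t. fst (c u) = fst (c t)) (at u within J)"
     by (rule A.vertical_curve_local[OF Dd c u sD])
   qed
  qed (use ab in auto)
  thus ?case using step.IH cJ[OF ab(3)] ab by simp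
 qed (use p in simp)
next
 fix x assume x: "x \<in> {x \<in> points M. fst x = fst p}"
 obtain U \<phi> V X where A: "cot_frame N s F U \<phi> V X" and pD: "p \<in> cot_dom F V" using ex_cot_frame[OF p] by blast
 interpret A: cot_frame N s F U \<phi> V X by (rule A)
 have xD: "x \<in> cot_dom F V" using x pD unfolding points_M by (auto simp: cot_dom_def)
 let ?c = "%u. (fst p, snd p + fscale u (snd x - snd p))"
 have "?c 0 = p" "?c 1 = x" using x by (auto simp: prod_eq_iff)
 hence "p \<in> range ?c" "x \<in> range ?c" by (metis rangeI)+
 moreover have "tangent_curve M Dd UNIV ?c" using A.vertical_line[OF Dd pD xD] x by simp
 ultimately show "x \<in> leaf M Dd p" unfolding leaf_def by (intro CollectI r_into_rtrancl) blast
qed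

lemma quotient_fst:
 assumes Dd: "!!p. p \<in> points M ==> Dd p = {v \<in> M.TS p. push N fst p v = 0}"
 shows "quotient_manifold M Dd N fst"
 unfolding quotient_manifold_def
proof (intro conjI ballI leaf_vertical[OF Dd] smooth_map_fst)
 show "fst ` points M = points N"
 proof -
  have "q \<in> fst ` points M" if "q \<in> points N" for q
   using that dual_zero unfolding points_M by (intro image_eqI[of _ fst "(q, 0)"]) auto
  thus ?thesis by (auto simp: points_M)
 qed
 fix p assume p: "p \<in> points M"
 obtain U \<phi> V X where A: "cot_frame N s F U \<phi> V X" and pD: "p \<in> cot_dom F V" using ex_cot_frame[OF p] by blast
 interpret A: cot_frame N s F U \<phi> V X by (rule A)
 show "push N fst p ` M.TS p = N.TS (fst p)"
 proof (intro equalityI subsetI)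
  fix u assume "u \<in> N.TS (fst p)"
  thus "u \<in> push N fst p ` M.TS p"
   by (intro image_eqI[of _ _ "A.hlift p u"] A.push_hlift[OF pD, symmetric] A.hlift_tangent[OF pD])
 qed (use push_tangent in blast)
qed

end

text \<open>A pointwise form of \<open>poisson_structure\<close>, so that each point can be treated
  in an adapted frame of its own. Asking for the Jacobi identity on the coordinates of one chart is
  enough by \<open>poisson_structureI\<close>.\<close>

definition (in mfold) poisson_at :: "('p, 'k) bivector_field => 'p => bool"
 where "poisson_at \<Lambda> p \<longleftrightarrow> bivector_on (TS p) (\<Lambda> p) \<and>
  (ALL f g. smooth p f --> smooth p g --> smooth p (br \<Lambda> f g)) \<and>
  (EX U \<phi>. (U, \<phi>) \<in> atlas M \<and> p \<in> U \<and> (ALL i<mdim M. ALL j<mdim M. ALL l<mdim M.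
   jacobiator \<Lambda> (%x. \<phi> x i) (%x. \<phi> x j) (%x. \<phi> x l) p = 0))"

lemma (in mfold) poisson_structure_local:
 assumes M: "manifold M" and \<Lambda>: "ALL p:points M. poisson_at \<Lambda> p"
 shows "poisson_structure M \<Lambda>"
proof (rule poisson_structureI[OF M])
 show "bivector_on (TS p) (\<Lambda> p)" if "p \<in> points M" for p
  using \<Lambda> that unfolding poisson_at_def by blast
 show "smooth p (br \<Lambda> f g)" if "smooth p f" "smooth p g" for p f g
  using \<Lambda> smooth_near_points[OF that(1)] that unfolding poisson_at_def by blast
 show "EX U \<phi>. (U, \<phi>) \<in> atlas M \<and> p \<in> U \<and> (ALL i<mdim M. ALL j<mdim M. ALL l<mdim M.
   jacobiator \<Lambda> (%x. \<phi> x i) (%x. \<phi> x j) (%x. \<phi> x l) p = 0)" if "p \<in> points M" for p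
  using \<Lambda> that unfolding poisson_at_def by blast
qed

lemma (in cot_frame) poisson_at_PB:
 assumes Z: "frame_data Z c" and \<Lambda>: "!!x. x \<in> D ==> \<Lambda> x = PB Z c x" and p: "p \<in> D"
 shows "M.poisson_at \<Lambda> p"
 unfolding M.poisson_at_def
proof (intro conjI allI impI)
 show "bivector_on (M.TS p) (\<Lambda> p)" unfolding \<Lambda>[OF p] by (rule PB_bivector[OF Z p])
 show "M.smooth p (M.br \<Lambda> f g)" if "M.smooth p f" "M.smooth p g" for f g
  by (rule bracket_PB_smooth[OF Z \<Lambda> p that])
 show "EX U \<phi>. (U, \<phi>) \<in> atlas M \<and> p \<in> U \<and> (ALL i<mdim M. ALL j<mdim M. ALL l<mdim M.
   M.jacobiator \<Lambda> (%x. \<phi> x i) (%x. \<phi> x j) (%x. \<phi> x l) p = 0)"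
  using chart p PB_jacobi[OF Z \<Lambda> p] by (intro exI[of _ D] exI[of _ \<Phi>]) blast
qed

context web
begin

abbreviation "Mw \<equiv> leaf_cotangent N r (w 0)"
abbreviation "Pi0 \<equiv> liouville_poisson N r (w 0)"
abbreviation "Pi1 \<equiv> pullback_bivector Mw (leaf_cotangent N r winf) (dual_iso N r w) (liouville_poisson N r winf)"

text \<open>Around \<open>p\<close> the bivectors \<open>Pi0\<close>, \<open>Pi1\<close> and their
  pencil are those of the frames \<open>X\<close>, \<open>Y\<close> and X + tY, so the results on
  \<open>PB\<close> apply to all of them.\<close>

lemma pencil_local:
 assumes p: "p \<in> points Mw"
 shows "mfold.poisson_at Mw Pi0 p" "mfold.poisson_at Mw Pi1 p" "mfold.poisson_at Mw (pencil Pi0 Pi1 t) p"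
  "kronecker_product r (tangent_space Mw p) (Pi0 p) (Pi1 p)"
  "bivector_image (tangent_space Mw p) (pencil Pi0 Pi1 t p)
   = {v \<in> tangent_space Mw p. push N fst p v \<in> w t (fst p)}"
proof -
 interpret F: cotangent N r "w 0" by (rule web_cotangent)
 have q: "fst p \<in> points N" "snd p \<in> dual (w 0 (fst p))" using p unfolding F.points_M by auto
 obtain U \<phi> V X Y where A: "web_frame N r w U \<phi> V X Y" and "fst p \<in> V" using ex_web_frame[OF q(1)] by blast
 hence pD: "p \<in> cot_dom (w 0) V" using q by (simp add: cot_dom_def)
 interpret A: web_frame N r w U \<phi> V X Y by (rule A)
 obtain c c' where c: "A.frame_data X c" and c': "A.frame_data Y c'"
  and ct: "ALL t. A.frame_data (%i q. X i q + fscale t (Y i q)) (%i j l q. c i j l q + t * c' i j l q)"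
  using A.ex_structure_functions by (elim exE conjE) (rule that)
 have L: "Pi0 x = A.PB X c x" if "x \<in> A.D" for x by (rule A.liouville_poisson_PB[OF c that])
 have L': "Pi1 x = A.PB Y c' x" if "x \<in> A.D" for x by (rule A.pullback_PB[OF c' that])
 have Lt: "pencil Pi0 Pi1 t x = A.PB (%i q. X i q + fscale t (Y i q)) (%i j l q. c i j l q + t * c' i j l q) x"
  if "x \<in> A.D" for x
  by (intro ext) (simp only: pencil_def L[OF that] L'[OF that] A.pencil_PB[OF that])
 show "mfold.poisson_at Mw Pi0 p" by (rule A.poisson_at_PB[OF c L pD])
 show "mfold.poisson_at Mw Pi1 p" by (rule A.poisson_at_PB[OF c' L' pD])
 show "mfold.poisson_at Mw (pencil Pi0 Pi1 t) p" by (rule A.poisson_at_PB[OF spec[OF ct] Lt pD])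
 show "kronecker_product r (tangent_space Mw p) (Pi0 p) (Pi1 p)"
  unfolding L[OF pD] L'[OF pD] by (rule A.kronecker_at[OF c c' pD])
 show "bivector_image (tangent_space Mw p) (pencil Pi0 Pi1 t p)
   = {v \<in> tangent_space Mw p. push N fst p v \<in> w t (fst p)}"
  unfolding Lt[OF pD] A.image_PB[OF spec[OF ct] pD] A.pencil_range[OF \<open>fst p \<in> V\<close>] by (rule refl)
qed

text \<open>The images in the intersection are the preimages of the w(t), and the w(t) have only 0
  in common.\<close>

lemma soul_vertical:
 assumes p: "p \<in> points Mw"
 shows "soul Mw Pi0 Pi1 p = {v \<in> tangent_space Mw p. push N fst p v = 0}"
proof -
 interpret F: cotangent N r "w 0" by (rule web_cotangent)
 have q: "fst p \<in> points N" using p unfolding F.points_M by auto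
 have z: "u = 0 \<longleftrightarrow> (ALL t. u \<in> w t (fst p))" for u
  using RR_facts(8)[OF q] fv.subspace_0[OF cotangent.F_subspace[OF web_cotangent q]] by blast
 show ?thesis unfolding soul_def pencil_local(5)[OF p] z by blast
qed

lemma main:
 assumes N: "manifold N"
 shows "kronecker_bihamiltonian Mw r Pi0 Pi1 \<and> quotient_manifold Mw (soul Mw Pi0 Pi1) N fst \<and>
  induced_web Mw Pi0 Pi1 N fst w"
proof -
 interpret F: cotangent N r "w 0" by (rule web_cotangent)
 note P = F.M.poisson_structure_local[OF F.manifold_M[OF N]]
 have "kronecker_bihamiltonian Mw r Pi0 Pi1"
  unfolding kronecker_bihamiltonian_def bihamiltonian_def
  by (intro conjI P ballI pencil_local)
 moreover have Q: "quotient_manifold Mw (soul Mw Pi0 Pi1) N fst"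
  by (rule F.quotient_fst[OF soul_vertical])
 moreover have "w t (fst p) = push N fst p ` bivector_image (tangent_space Mw p) (pencil Pi0 Pi1 t p)"
  if p: "p \<in> points Mw" for t p
 proof -
  have "fst p \<in> points N" using p unfolding F.points_M by auto
  hence "w t (fst p) \<subseteq> push N fst p ` tangent_space Mw p"
   using Q p cotangent.F_tangent[OF web_cotangent] unfolding quotient_manifold_def by blast
  thus ?thesis unfolding pencil_local(5)[OF p] by blast
 qed
 ultimately show ?thesis unfolding induced_web_def by blast
qed

end

theorem proposition3p2:
  fixes N :: "('p, 'k::ground_field) mfd"
    and w :: "'k \<Rightarrow> ('p, 'k) distrib"
    and r :: nat
  assumes "manifold N"
    and "veronese_web N r w"
    and M: "M = leaf_cotangent N r (w 0)"
    and M': "M' = leaf_cotangent N r (web_infinity N r w)"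
    and \<Lambda>: "\<Lambda> = liouville_poisson N r (w 0)"
    and \<Lambda>': "\<Lambda>' = liouville_poisson N r (web_infinity N r w)"
    and \<Lambda>\<^sub>1: "\<Lambda>\<^sub>1 = pullback_bivector M M' (dual_iso N r w) \<Lambda>'"
  shows "kronecker_bihamiltonian M r \<Lambda> \<Lambda>\<^sub>1 \<and>
    (\<forall>p\<in>points M. soul M \<Lambda> \<Lambda>\<^sub>1 p = {v \<in> tangent_space M p. push N fst p v = 0}) \<and>
    quotient_manifold M (soul M \<Lambda> \<Lambda>\<^sub>1) N fst \<and>
    induced_web M \<Lambda> \<Lambda>\<^sub>1 N fst w"
proof -
  interpret web N r w
    using assms(1,2) by unfold_locales (simp_all add: manifold_iff)
  show ?thesis unfolding \<Lambda>\<^sub>1 \<Lambda> \<Lambda>' M M' using main[OF assms(1)] soul_vertical by blast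
qed

end
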